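(* Let $(E;L)$ be a Courant--Jacobi algebroid over $M$ and let $A\subset E$ be a Dirac--Jacobi structure. For each almost Dirac--Jacobi structure $B\subset E$ complementary to $A$ (i.e. $E=A\oplus B$), the graded $\Omega^\bullet(A)$-module $\Omega^\bullet(A;L)[2]$ is endowed with an $LR_\infty[1]$-algebra structure $\{\mathfrak m_k^B\}$ whose only non-trivial brackets are $\mathfrak m_1^B,\mathfrak m_2^B,\mathfrak m_3^B$, given, under the identification $B\simeq A^\dagger$ of the context, by: (1) $\mathfrak m_1^B=\mathrm d_{A,L}$, the de Rham differential of the Jacobi algebroid $(A;L)$; (2) $\mathfrak m_2^B(\alpha,\beta)=(-1)^{|\alpha|}[\alpha,\beta]_{A^\dagger,L}$ for all homogeneous $\alpha,\beta\in\Omega^\bullet(A;L)$; (3) $\mathfrak m_3^B(\alpha,\beta,\gamma)=-(-1)^{|\beta|}(\alpha^\sharp\wedge\beta^\sharp\wedge\gamma^\sharp\otimes\mathrm{id}_L)\Upsilon_{A^\dagger}$ for all homogeneous $\alpha,\beta,\gamma\in\Omega^\bullet(A;L)$. Moreover, $(\Omega^\bullet(A;L)[2],\{\mathfrak m_k^B\})$ reduces to a dgL[1]a, i.e. $\mathfrak m_3^B=0$, if and only if $B$ is involutive.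
   Context: **Courant--Jacobi algebroids.** For a line bundle $L\to M$, $DL\to M$ is the gauge (Atiyah) algebroid: its sections are the derivations of $L$, i.e. $\mathbb R$-linear maps $\Delta:\Gamma(L)\to\Gamma(L)$ with $\Delta(f\lambda)=\sigma(\Delta)(f)\lambda+f\Delta\lambda$ for a (unique) vector field $\sigma(\Delta)$. A *Courant--Jacobi algebroid* $(E;L)$ over $M$ is a vector bundle $E\to M$ and a line bundle $L\to M$ with: a non-degenerate symmetric $C^\infty(M)$-bilinear product $\langle\!\langle-,-\rangle\!\rangle:E\otimes E\to L$; an $\mathbb R$-bilinear bracket $[\![-,-]\!]$ on $\Gamma(E)$ with $[\![e_1,[\![e_2,e_3]\!]]\!]=[\![[\![e_1,e_2]\!],e_3]\!]+[\![e_2,[\![e_1,e_3]\!]]\!]$; a vector bundle morphism $\nabla:E\to DL$ over $\mathrm{id}_M$; such that $\langle\!\langle[\![e_1,e_2]\!],e_2\rangle\!\rangle=\langle\!\langle e_1,[\![e_2,e_2]\!]\rangle\!\rangle$ and $\nabla_{e_1}\langle\!\langle e_2,e_2\rangle\!\rangle=2\langle\!\langle[\![e_1,e_2]\!],e_2\rangle\!\rangle$. A subbundle $A\subset E$ is an *almost Dirac--Jacobi structure* if it is Lagrangian ($A=A^\perp$), and a *Dirac--Jacobi structure* if moreover it is involutive: $[\![\Gamma(A),\Gamma(A)]\!]\subset\Gamma(A)$. **Identification.** Put $A^\dagger:=A^\ast\otimes L$. With $E=A\oplus B$, both Lagrangian, $B\to A^\dagger$, $v\mapsto\langle\!\langle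 v,-\rangle\!\rangle|_A$, is an isomorphism; the induced isomorphism $\varphi_B:E=A\oplus B\to A\oplus A^\dagger$ transfers the Courant--Jacobi structure of $(E;L)$ to $(A\oplus A^\dagger;L)$, with product $\langle\!\langle\xi+\alpha,\zeta+\beta\rangle\!\rangle=\alpha(\zeta)+\beta(\xi)$. **Almost Jacobi algebroids.** An almost Jacobi algebroid $(A;L)$ is a vector bundle $A$ with a skew-symmetric $\mathbb R$-bilinear bracket $[-,-]$ on $\Gamma(A)$ and a vector bundle morphism $\nabla:A\to DL$ with $[u,fv]=(\sigma(\nabla_u)f)v+f[u,v]$ (a Jacobi algebroid if moreover the Jacobi identity holds and $\nabla$ is flat). Put $\Omega^\bullet(A)=\Gamma(\wedge^\bullet A^\ast)$, $\Omega^\bullet(A;L)=\Gamma(\wedge^\bullet A^\ast\otimes L)$. Its operator $\mathrm d_{A,L}$ is $$(\mathrm d_{A,L}\alpha)(X_0,\dots,X_k)=\sum_i(-1)^i\nabla_{X_i}(\alpha(\dots,\widehat{X_i},\dots))+\sum_{i<j}(-1)^{i+j}\alpha([X_i,X_j],\dots,\widehat{X_i},\dots,\widehat{X_j},\dots).$$ Its almost Gerstenhaber--Jacobi bracket $[-,-]_{A,L}$ is the unique degree $0$ graded skew-symmetric bracket on $\Omega^\bullet(A^\dagger;L)[1]$ which is a graded derivation of the $\Omega^\bullet(A^\dagger)$-module $\Omega^\bullet(A^\dagger;L)[1]$ in each entry and satisfies $[u,v]_{A,L}=[u,v]$, $[u,\lambda]_{A,L}=\nabla_u\lambda$ for $u,v\in\Gamma(A)=\Omega^1(A^\dagger;L)$,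 $\lambda\in\Gamma(L)=\Omega^0(A^\dagger;L)$. (A graded derivation $X$ of a graded module is a graded linear map for which there is a graded derivation $\underline X$ of the algebra with $X(\omega\alpha)=\underline X(\omega)\alpha+(-1)^{|X||\omega|}\omega X(\alpha)$.) Here $(A;L)$ is the Jacobi algebroid with $[\xi,\zeta]_A=[\![\xi,\zeta]\!]$, $\nabla^A=\nabla|_A$, and $(A^\dagger;L)$ the almost Jacobi algebroid (depending on $B$) with $[\alpha,\beta]_{A^\dagger}=\mathrm{pr}_{A^\dagger}[\![\alpha,\beta]\!]$, $\nabla^{A^\dagger}=\nabla|_{A^\dagger}$, computed in the transferred structure. Since $(A^\dagger)^\dagger=A$, the bracket $[-,-]_{A^\dagger,L}$ of $(A^\dagger;L)$ lives on $\Omega^\bullet(A;L)[1]$. $\Upsilon_{A^\dagger}\in\Omega^3(A^\dagger;L)=\Gamma(\wedge^3(A\otimes L^\ast)\otimes L)$ is $\Upsilon_{A^\dagger}(\alpha_1,\alpha_2,\alpha_3)=\langle\!\langle[\![\alpha_1,\alpha_2]\!],\alpha_3\rangle\!\rangle$ (determinant convention for wedges). **Sharp notation.** For $\alpha\in\Omega^{k+1}(A;L)$, $\alpha^\sharp:A\otimes L^\ast\to\wedge^kA^\ast$ is $\alpha^\sharp(u_0\otimes\nu)(u_1,\dots,u_k)=\nu(\alpha(u_0,\dots,u_k))$ ($\alpha^\sharp=0$ if $k=-1$), and $(\alpha_1^\sharp\wedge\dots\wedge\alpha_n^\sharp)(\tilde u_1\wedge\dots\wedge\tilde u_n)=\sum_{\sigma\in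 S_n}(-1)^\sigma\alpha_1^\sharp(\tilde u_{\sigma(1)})\wedge\dots\wedge\alpha_n^\sharp(\tilde u_{\sigma(n)})$. **$L_\infty[1]$ conventions.** An $L_\infty[1]$-algebra is a graded vector space $V$ with degree $1$ graded symmetric maps $\mathfrak m_k:\mathsf S^kV\to V$, $k\ge1$, satisfying $\sum_{i+j=n}\sum_{\sigma\in S_{i,j}}\epsilon(\sigma;v)\,\mathfrak m_{j+1}(\mathfrak m_i(v_{\sigma(1)},\dots,v_{\sigma(i)}),v_{\sigma(i+1)},\dots,v_{\sigma(n)})=0$ for all $n\ge 1$ (unshuffles, Koszul sign). An $LR_\infty[1]$-algebra structure on a graded module here means an $L_\infty[1]$-algebra structure whose brackets are graded derivations of the module in each entry separately. A dgL[1]a is an $L_\infty[1]$-algebra with only $\mathfrak m_1,\mathfrak m_2$ non-trivial. $|\alpha|$ is the form degree. *)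

theory Defs
  imports
    "HOL-Analysis.Analysis"
    "HOL-Library.Function_Algebras"
    "HOL-Combinatorics.Permutations"
begin

section \<open>Functions into a vector space\<close>

instantiation "fun" :: (type, real_vector) real_vector
begin

definition scaleR_fun :: "real \<Rightarrow> ('a \<Rightarrow> 'b) \<Rightarrow> 'a \<Rightarrow> 'b"
  where "scaleR_fun c f = (\<lambda>x. c *\<^sub>R f x)"

instance
  by standard (auto simp: scaleR_fun_def fun_eq_iff scaleR_add_right scaleR_add_left)

end


section \<open>Smooth manifolds\<close>

primrec Ck_on :: "nat \<Rightarrow> 'a::euclidean_space set \<Rightarrow> ('a \<Rightarrow> 'b::real_normed_vector) \<Rightarrow> bool" where
  "Ck_on 0 W f \<longleftrightarrow> continuous_on W f"
| "Ck_on (Suc k) W f \<longleftrightarrow>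
     (\<forall>x\<in>W. f differentiable (at x)) \<and> (\<forall>v. Ck_on k W (\<lambda>x. frechet_derivative f (at x) v))"

text \<open>Smoothness on a not necessarily open set means local extendability to a smooth function on an
  open set. It is used for relatively open subsets of a linear subspace.\<close>

definition smooth_on :: "'a::euclidean_space set \<Rightarrow> ('a \<Rightarrow> 'b::real_normed_vector) \<Rightarrow> bool" where
  "smooth_on S f \<longleftrightarrow>
     (\<forall>x\<in>S. \<exists>W g. open W \<and> x \<in> W \<and> (\<forall>k. Ck_on k W g) \<and> (\<forall>y\<in>W \<inter> S. g y = f y))"

text \<open>Charts take values in a linear subspace \<open>model\<close> of a Euclidean space; this way all dimensions,
  including \<open>0\<close>, occur. The underlying set of the manifold is the whole type \<open>'m\<close>.\<close>

record ('m, 'b) manifold =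
  model :: "'b set"
  charts :: "('m set \<times> ('m \<Rightarrow> 'b)) set"

definition smooth_manifold ::
  "('m::{t2_space,second_countable_topology}, 'b::euclidean_space) manifold \<Rightarrow> bool" where
  "smooth_manifold M \<longleftrightarrow>
     subspace (model M) \<and>
     (\<Union>(U, \<phi>)\<in>charts M. U) = UNIV \<and>
     (\<forall>(U, \<phi>)\<in>charts M. open U \<and> openin (top_of_set (model M)) (\<phi> ` U) \<and>
        homeomorphism U (\<phi> ` U) \<phi> (inv_into U \<phi>)) \<and>
     (\<forall>(U, \<phi>)\<in>charts M. \<forall>(W, \<psi>)\<in>charts M. smooth_on (\<phi> ` (U \<inter> W)) (\<psi> \<circ> inv_into U \<phi>))"

definition smooth_fun_on :: "('m, 'b::euclidean_space) manifold \<Rightarrow> 'm set \<Rightarrow> ('m \<Rightarrow> real) \<Rightarrow> bool" where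
  "smooth_fun_on M W f \<longleftrightarrow> (\<forall>(U, \<phi>)\<in>charts M. smooth_on (\<phi> ` (U \<inter> W)) (f \<circ> inv_into U \<phi>))"

definition Cinf :: "('m, 'b::euclidean_space) manifold \<Rightarrow> ('m \<Rightarrow> real) set" where
  "Cinf M = {f. smooth_fun_on M UNIV f}"

definition tangent_space :: "('m, 'b::euclidean_space) manifold \<Rightarrow> 'm \<Rightarrow> (('m \<Rightarrow> real) \<Rightarrow> real) set" where
  "tangent_space M x = {v. \<forall>f\<in>Cinf M. \<forall>g\<in>Cinf M. \<forall>c.
     v (\<lambda>y. c * f y + g y) = c * v f + v g \<and> v (\<lambda>y. f y * g y) = v f * g x + f x * v g}"


section \<open>Vector bundles\<close>

text \<open>The fibres are subspaces of an ambient vector space \<open>'e\<close>. Local triviality is expressed by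
  local frames: a pair of an open set and a list of local sections over it. The rank is locally
  constant.\<close>

record ('m, 'e) vbundle =
  fib :: "'m \<Rightarrow> 'e set"
  frames :: "('m set \<times> ('m \<Rightarrow> 'e) list) set"

definition smooth_section_on ::
  "('m, 'b::euclidean_space) manifold \<Rightarrow> ('m, 'e::real_vector) vbundle \<Rightarrow> 'm set \<Rightarrow> ('m \<Rightarrow> 'e) \<Rightarrow> bool" where
  "smooth_section_on M E U s \<longleftrightarrow>
     (\<forall>x\<in>U. s x \<in> fib E x) \<and>
     (\<forall>(W, ts)\<in>frames E. \<exists>c. (\<forall>j<length ts. smooth_fun_on M (U \<inter> W) (c j)) \<and>
        (\<forall>x\<in>U \<inter> W. s x = (\<Sum>j<length ts. c j x *\<^sub>R (ts ! j) x)))"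

definition vector_bundle ::
  "('m::topological_space, 'b::euclidean_space) manifold \<Rightarrow> ('m, 'e::real_vector) vbundle \<Rightarrow> bool" where
  "vector_bundle M E \<longleftrightarrow>
     (\<Union>(U, ts)\<in>frames E. U) = UNIV \<and>
     (\<forall>(U, ts)\<in>frames E. open U \<and>
        (\<forall>x\<in>U. distinct (map (\<lambda>t. t x) ts) \<and> independent (set (map (\<lambda>t. t x) ts)) \<and>
               span (set (map (\<lambda>t. t x) ts)) = fib E x) \<and>
        (\<forall>t\<in>set ts. smooth_section_on M E U t))"

definition line_bundle ::
  "('m::topological_space, 'b::euclidean_space) manifold \<Rightarrow> ('m, 'l::real_vector) vbundle \<Rightarrow> bool" where
  "line_bundle M L \<longleftrightarrow> vector_bundle M L \<and> (\<forall>x. dim (fib L x) = 1)"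

definition trivial_line :: "('m, real) vbundle" where
  "trivial_line = \<lparr>fib = (\<lambda>_. UNIV), frames = {(UNIV, [\<lambda>_. 1])}\<rparr>"

definition sections ::
  "('m, 'b::euclidean_space) manifold \<Rightarrow> ('m, 'e::real_vector) vbundle \<Rightarrow> ('m \<Rightarrow> 'e) set" where
  "sections M E = {s. smooth_section_on M E UNIV s}"

definition subbundle ::
  "('m::topological_space, 'b::euclidean_space) manifold \<Rightarrow> ('m, 'e::real_vector) vbundle
     \<Rightarrow> ('m, 'e) vbundle \<Rightarrow> bool" where
  "subbundle M A E \<longleftrightarrow> vector_bundle M A \<and> (\<forall>x. fib A x \<subseteq> fib E x) \<and>
     (\<forall>(U, ts)\<in>frames A. \<forall>t\<in>set ts. smooth_section_on M E U t)"

definition complementary :: "('m, 'e::real_vector) vbundle \<Rightarrow> ('m, 'e) vbundle \<Rightarrow> ('m, 'e) vbundle \<Rightarrow> bool" where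
  "complementary E A B \<longleftrightarrow>
     (\<forall>x. fib A x \<inter> fib B x = {0} \<and> fib E x = {a + b | a b. a \<in> fib A x \<and> b \<in> fib B x})"

text \<open>The fibre at \<open>x\<close> of the gauge algebroid \<open>DL\<close>: restricted to \<open>sections M L\<close>, its elements are the
  values at \<open>x\<close> of derivations of \<open>L\<close>.\<close>

definition gauge_fib ::
  "('m, 'b::euclidean_space) manifold \<Rightarrow> ('m, 'l::real_vector) vbundle \<Rightarrow> 'm \<Rightarrow> (('m \<Rightarrow> 'l) \<Rightarrow> 'l) set" where
  "gauge_fib M L x = {D.
     (\<forall>s\<in>sections M L. D s \<in> fib L x) \<and>
     (\<forall>s\<in>sections M L. \<forall>t\<in>sections M L. \<forall>c. D (\<lambda>y. c *\<^sub>R s y + t y) = c *\<^sub>R D s + D t) \<and>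
     (\<exists>v\<in>tangent_space M x. \<forall>f\<in>Cinf M. \<forall>s\<in>sections M L.
        D (\<lambda>y. f y *\<^sub>R s y) = v f *\<^sub>R s x + f x *\<^sub>R D s)}"

text \<open>Vector bundle morphisms \<open>E \<rightarrow> DL\<close> over the identity. The smooth sections of \<open>DL\<close> are the
  derivations of \<open>L\<close>, i.e. the fibrewise families that map smooth sections of \<open>L\<close> to smooth ones.\<close>

definition gauge_morphism ::
  "('m, 'b::euclidean_space) manifold \<Rightarrow> ('m, 'e::real_vector) vbundle \<Rightarrow> ('m, 'l::real_vector) vbundle
     \<Rightarrow> ('m \<Rightarrow> 'e \<Rightarrow> ('m \<Rightarrow> 'l) \<Rightarrow> 'l) \<Rightarrow> bool" where
  "gauge_morphism M E L N \<longleftrightarrow>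
     (\<forall>x. \<forall>v\<in>fib E x. N x v \<in> gauge_fib M L x) \<and>
     (\<forall>x. \<forall>v\<in>fib E x. \<forall>w\<in>fib E x. \<forall>c. \<forall>s\<in>sections M L.
        N x (c *\<^sub>R v + w) s = c *\<^sub>R N x v s + N x w s) \<and>
     (\<forall>e\<in>sections M E. \<forall>s\<in>sections M L. (\<lambda>x. N x (e x) s) \<in> sections M L)"


section \<open>Courant--Jacobi algebroids and Dirac--Jacobi structures\<close>

record ('m, 'e, 'l) cj_data =
  bdl :: "('m, 'e) vbundle"
  lin :: "('m, 'l) vbundle"
  pairing :: "'m \<Rightarrow> 'e \<Rightarrow> 'e \<Rightarrow> 'l"
  bracket :: "('m \<Rightarrow> 'e) \<Rightarrow> ('m \<Rightarrow> 'e) \<Rightarrow> ('m \<Rightarrow> 'e)"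
  nabla :: "'m \<Rightarrow> 'e \<Rightarrow> ('m \<Rightarrow> 'l) \<Rightarrow> 'l"

definition spair :: "('m, 'e, 'l) cj_data \<Rightarrow> ('m \<Rightarrow> 'e) \<Rightarrow> ('m \<Rightarrow> 'e) \<Rightarrow> 'm \<Rightarrow> 'l" where
  "spair C s t = (\<lambda>x. pairing C x (s x) (t x))"

definition courant_jacobi ::
  "('m::topological_space, 'b::euclidean_space) manifold \<Rightarrow> ('m, 'e::real_vector, 'l::real_vector) cj_data
     \<Rightarrow> bool" where
  "courant_jacobi M C \<longleftrightarrow>
     vector_bundle M (bdl C) \<and> line_bundle M (lin C) \<and>
     \<comment> \<open>the product\<close>
     (\<forall>x. \<forall>u\<in>fib (bdl C) x. \<forall>v\<in>fib (bdl C) x.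
        pairing C x u v \<in> fib (lin C) x \<and> pairing C x u v = pairing C x v u \<and>
        (\<forall>w\<in>fib (bdl C) x. \<forall>c.
           pairing C x (c *\<^sub>R u + v) w = c *\<^sub>R pairing C x u w + pairing C x v w)) \<and>
     (\<forall>x. \<forall>u\<in>fib (bdl C) x. (\<forall>v\<in>fib (bdl C) x. pairing C x u v = 0) \<longrightarrow> u = 0) \<and>
     (\<forall>s\<in>sections M (bdl C). \<forall>t\<in>sections M (bdl C). spair C s t \<in> sections M (lin C)) \<and>
     \<comment> \<open>the bracket\<close>
     (\<forall>s\<in>sections M (bdl C). \<forall>t\<in>sections M (bdl C). bracket C s t \<in> sections M (bdl C)) \<and>
     (\<forall>s\<in>sections M (bdl C). \<forall>t\<in>sections M (bdl C). \<forall>r\<in>sections M (bdl C). \<forall>c.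
        bracket C (c *\<^sub>R s + t) r = c *\<^sub>R bracket C s r + bracket C t r \<and>
        bracket C r (c *\<^sub>R s + t) = c *\<^sub>R bracket C r s + bracket C r t) \<and>
     (\<forall>s\<in>sections M (bdl C). \<forall>t\<in>sections M (bdl C). \<forall>r\<in>sections M (bdl C).
        bracket C s (bracket C t r) = bracket C (bracket C s t) r + bracket C t (bracket C s r)) \<and>
     \<comment> \<open>the morphism to the gauge algebroid\<close>
     gauge_morphism M (bdl C) (lin C) (nabla C) \<and>
     (\<forall>s\<in>sections M (bdl C). \<forall>t\<in>sections M (bdl C).
        spair C (bracket C s t) t = spair C s (bracket C t t) \<and>
        (\<lambda>x. nabla C x (s x) (spair C t t)) = 2 *\<^sub>R spair C (bracket C s t) t)"

definition almost_dirac_jacobi ::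
  "('m::topological_space, 'b::euclidean_space) manifold \<Rightarrow> ('m, 'e::real_vector, 'l::real_vector) cj_data
     \<Rightarrow> ('m, 'e) vbundle \<Rightarrow> bool" where
  "almost_dirac_jacobi M C A \<longleftrightarrow> subbundle M A (bdl C) \<and>
     (\<forall>x. fib A x = {v \<in> fib (bdl C) x. \<forall>a\<in>fib A x. pairing C x v a = 0})"

definition involutive ::
  "('m, 'b::euclidean_space) manifold \<Rightarrow> ('m, 'e::real_vector, 'l) cj_data \<Rightarrow> ('m, 'e) vbundle \<Rightarrow> bool" where
  "involutive M C A \<longleftrightarrow> (\<forall>s\<in>sections M A. \<forall>t\<in>sections M A. bracket C s t \<in> sections M A)"

definition dirac_jacobi ::
  "('m::topological_space, 'b::euclidean_space) manifold \<Rightarrow> ('m, 'e::real_vector, 'l::real_vector) cj_data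
     \<Rightarrow> ('m, 'e) vbundle \<Rightarrow> bool" where
  "dirac_jacobi M C A \<longleftrightarrow> almost_dirac_jacobi M C A \<and> involutive M C A"


section \<open>Graded algebra\<close>

text \<open>A graded vector space is given by its homogeneous components, subspaces of one ambient vector
  space indexed by the degree.\<close>

definition psign :: "int \<Rightarrow> real" where
  "psign k = (if even k then 1 else - 1)"

definition graded_linear ::
  "(int \<Rightarrow> 'v::real_vector set) \<Rightarrow> (int \<Rightarrow> 'w::real_vector set) \<Rightarrow> int \<Rightarrow> ('v \<Rightarrow> 'w) \<Rightarrow> bool" where
  "graded_linear V W d X \<longleftrightarrow> (\<forall>k. \<forall>v\<in>V k. X v \<in> W (k + d) \<and>
     (\<forall>w\<in>V k. \<forall>c. X (c *\<^sub>R v + w) = c *\<^sub>R X v + X w))"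

definition algebra_derivation ::
  "(int \<Rightarrow> 'r::real_vector set) \<Rightarrow> ('r \<Rightarrow> 'r \<Rightarrow> 'r) \<Rightarrow> int \<Rightarrow> ('r \<Rightarrow> 'r) \<Rightarrow> bool" where
  "algebra_derivation R mul d Y \<longleftrightarrow> graded_linear R R d Y \<and>
     (\<forall>p q. \<forall>a\<in>R p. \<forall>b\<in>R q. Y (mul a b) = mul (Y a) b + psign (d * p) *\<^sub>R mul a (Y b))"

definition module_derivation ::
  "(int \<Rightarrow> 'r::real_vector set) \<Rightarrow> ('r \<Rightarrow> 'r \<Rightarrow> 'r) \<Rightarrow> (int \<Rightarrow> 'v::real_vector set) \<Rightarrow> ('r \<Rightarrow> 'v \<Rightarrow> 'v)
     \<Rightarrow> int \<Rightarrow> ('v \<Rightarrow> 'v) \<Rightarrow> bool" where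
  "module_derivation R mul V act d X \<longleftrightarrow> graded_linear V V d X \<and>
     (\<exists>Y. algebra_derivation R mul d Y \<and>
        (\<forall>p k. \<forall>a\<in>R p. \<forall>v\<in>V k. X (act a v) = act (Y a) v + psign (d * p) *\<^sub>R act a (X v)))"

definition homogeneous :: "(int \<Rightarrow> 'v set) \<Rightarrow> int list \<Rightarrow> 'v list \<Rightarrow> bool" where
  "homogeneous V ds vs \<longleftrightarrow> list_all2 (\<lambda>d v. v \<in> V d) ds vs"

definition unshuffles :: "nat \<Rightarrow> nat \<Rightarrow> (nat \<Rightarrow> nat) set" where
  "unshuffles i n =
     {\<sigma>. \<sigma> permutes {..<n} \<and> strict_mono_on {..<i} \<sigma> \<and> strict_mono_on {i..<n} \<sigma>}"

definition koszul_sign :: "int list \<Rightarrow> (nat \<Rightarrow> nat) \<Rightarrow> real" where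
  "koszul_sign ds \<sigma> =
     psign (\<Sum>(p, q)\<in>{(p, q). p < q \<and> q < length ds \<and> \<sigma> q < \<sigma> p}. ds ! \<sigma> p * ds ! \<sigma> q)"

text \<open>A single function on lists encodes all brackets: \<open>m\<close> on lists of length \<open>k \<ge> 1\<close> is the \<open>k\<close>-ary
  bracket. Only its values on homogeneous elements matter.\<close>

definition L_infinity_1 :: "(int \<Rightarrow> 'v::real_vector set) \<Rightarrow> ('v list \<Rightarrow> 'v) \<Rightarrow> bool" where
  "L_infinity_1 V m \<longleftrightarrow>
     (\<forall>k. subspace (V k)) \<and>
     (\<forall>ds vs. vs \<noteq> [] \<and> homogeneous V ds vs \<longrightarrow> m vs \<in> V (sum_list ds + 1)) \<and>
     (\<forall>ds xs v w ys c. homogeneous V ds (xs @ v # ys) \<and> homogeneous V ds (xs @ w # ys) \<longrightarrow>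
        m (xs @ (c *\<^sub>R v + w) # ys) = c *\<^sub>R m (xs @ v # ys) + m (xs @ w # ys)) \<and>
     (\<forall>ds xs v w ys. homogeneous V ds (xs @ v # w # ys) \<longrightarrow>
        m (xs @ v # w # ys) =
          psign (ds ! length xs * ds ! Suc (length xs)) *\<^sub>R m (xs @ w # v # ys)) \<and>
     (\<forall>ds vs. vs \<noteq> [] \<and> homogeneous V ds vs \<longrightarrow>
        (\<Sum>i = 1..length vs. \<Sum>\<sigma>\<in>unshuffles i (length vs).
           koszul_sign ds \<sigma> *\<^sub>R
             m (m (map (\<lambda>p. vs ! \<sigma> p) [0..<i]) # map (\<lambda>p. vs ! \<sigma> p) [i..<length vs])) = 0)"

text \<open>By graded symmetry it suffices to formulate the derivation property in the last entry, where
  no additional Koszul signs occur.\<close>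

definition LR_infinity_1 ::
  "(int \<Rightarrow> 'r::real_vector set) \<Rightarrow> ('r \<Rightarrow> 'r \<Rightarrow> 'r) \<Rightarrow> (int \<Rightarrow> 'v::real_vector set) \<Rightarrow> ('r \<Rightarrow> 'v \<Rightarrow> 'v)
     \<Rightarrow> ('v list \<Rightarrow> 'v) \<Rightarrow> bool" where
  "LR_infinity_1 R mul V act m \<longleftrightarrow> L_infinity_1 V m \<and>
     (\<forall>ds vs. homogeneous V ds vs \<longrightarrow>
        module_derivation R mul V act (sum_list ds + 1) (\<lambda>v. m (vs @ [v])))"

definition dgL1a :: "(int \<Rightarrow> 'v::real_vector set) \<Rightarrow> ('v list \<Rightarrow> 'v) \<Rightarrow> bool" where
  "dgL1a V m \<longleftrightarrow> L_infinity_1 V m \<and>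
     (\<forall>ds vs. homogeneous V ds vs \<and> length vs > 2 \<longrightarrow> m vs = 0)"


section \<open>Forms\<close>

text \<open>The fibre of \<open>\<And>\<^sup>k A\<^sup>* \<otimes> L\<close>: alternating maps on lists of length \<open>k\<close>, extended by \<open>0\<close> to all other
  lists.\<close>

definition alt_forms :: "'e::real_vector set \<Rightarrow> 'l::real_vector set \<Rightarrow> nat \<Rightarrow> ('e list \<Rightarrow> 'l) set" where
  "alt_forms V W k = {f.
     (\<forall>vs. length vs = k \<and> set vs \<subseteq> V \<longrightarrow> f vs \<in> W) \<and>
     (\<forall>vs. \<not> (length vs = k \<and> set vs \<subseteq> V) \<longrightarrow> f vs = 0) \<and>
     (\<forall>xs v w ys c. set xs \<subseteq> V \<and> v \<in> V \<and> w \<in> V \<and> set ys \<subseteq> V \<longrightarrow>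
        f (xs @ (c *\<^sub>R v + w) # ys) = c *\<^sub>R f (xs @ v # ys) + f (xs @ w # ys)) \<and>
     (\<forall>vs. \<not> distinct vs \<longrightarrow> f vs = 0)}"

text \<open>\<open>Omega M A L k\<close> is \<open>\<Gamma>(\<And>\<^sup>k A\<^sup>* \<otimes> L)\<close>, and \<open>{0}\<close> for negative \<open>k\<close>. Smoothness of a family of
  alternating maps means smoothness of its values on smooth sections.\<close>

definition Omega ::
  "('m, 'b::euclidean_space) manifold \<Rightarrow> ('m, 'e::real_vector) vbundle \<Rightarrow> ('m, 'l::real_vector) vbundle
     \<Rightarrow> int \<Rightarrow> ('m \<Rightarrow> 'e list \<Rightarrow> 'l) set" where
  "Omega M A L k = (if k < 0 then {0} else {\<alpha>.
     (\<forall>x. \<alpha> x \<in> alt_forms (fib A x) (fib L x) (nat k)) \<and>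
     (\<forall>ss. length ss = nat k \<and> set ss \<subseteq> sections M A \<longrightarrow>
        (\<lambda>x. \<alpha> x (map (\<lambda>s. s x) ss)) \<in> sections M L)})"

abbreviation Omega_fun ::
  "('m, 'b::euclidean_space) manifold \<Rightarrow> ('m, 'e::real_vector) vbundle \<Rightarrow> int \<Rightarrow> ('m \<Rightarrow> 'e list \<Rightarrow> real) set"
  where "Omega_fun M A \<equiv> Omega M A trivial_line"

definition form0 :: "('m \<Rightarrow> 'l::zero) \<Rightarrow> 'm \<Rightarrow> 'e list \<Rightarrow> 'l" where
  "form0 s = (\<lambda>x vs. if vs = [] then s x else 0)"

text \<open>Wedge product in the determinant convention: the sum over all shuffles, encoded by the set \<open>I\<close>
  of the positions whose entries go into the first factor.\<close>

definition shuffle_sign :: "nat \<Rightarrow> nat set \<Rightarrow> real" where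
  "shuffle_sign n I = (- 1) ^ card {(i, j). i \<in> I \<and> j \<in> {..<n} - I \<and> j < i}"

definition alt_wedge :: "('e list \<Rightarrow> real) \<Rightarrow> ('e list \<Rightarrow> 'l::real_vector) \<Rightarrow> 'e list \<Rightarrow> 'l" where
  "alt_wedge f g = (\<lambda>vs. \<Sum>I\<in>Pow {..<length vs}.
     (shuffle_sign (length vs) I * f (nths vs I)) *\<^sub>R g (nths vs (- I)))"

definition wedge ::
  "('m \<Rightarrow> 'e list \<Rightarrow> real) \<Rightarrow> ('m \<Rightarrow> 'e list \<Rightarrow> 'l::real_vector) \<Rightarrow> 'm \<Rightarrow> 'e list \<Rightarrow> 'l" where
  "wedge \<omega> \<alpha> = (\<lambda>x. alt_wedge (\<omega> x) (\<alpha> x))"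

text \<open>The operator \<open>d\<^sub>A\<^sub>,\<^sub>L\<close> on forms of degree \<open>k\<close>, for a bracket \<open>br\<close> on the sections of \<open>A\<close> and a
  morphism \<open>N\<close> from \<open>A\<close> to the gauge algebroid of \<open>L\<close>.\<close>

definition dAL ::
  "('m, 'b::euclidean_space) manifold \<Rightarrow> ('m, 'e::real_vector) vbundle \<Rightarrow> ('m, 'l::real_vector) vbundle
     \<Rightarrow> (('m \<Rightarrow> 'e) \<Rightarrow> ('m \<Rightarrow> 'e) \<Rightarrow> 'm \<Rightarrow> 'e) \<Rightarrow> ('m \<Rightarrow> 'e \<Rightarrow> ('m \<Rightarrow> 'l) \<Rightarrow> 'l)
     \<Rightarrow> nat \<Rightarrow> ('m \<Rightarrow> 'e list \<Rightarrow> 'l) \<Rightarrow> 'm \<Rightarrow> 'e list \<Rightarrow> 'l" where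
  "dAL M A L br N k \<alpha> = (THE \<eta>. \<eta> \<in> Omega M A L (int k + 1) \<and>
     (\<forall>Xs x. length Xs = Suc k \<and> set Xs \<subseteq> sections M A \<longrightarrow>
        \<eta> x (map (\<lambda>X. X x) Xs) =
          (\<Sum>i\<le>k. (- 1) ^ i *\<^sub>R
             N x ((Xs ! i) x) (\<lambda>y. \<alpha> y (map (\<lambda>X. X y) (nths Xs (- {i}))))) +
          (\<Sum>(i, j)\<in>{(i, j). i < j \<and> j \<le> k}. (- 1) ^ (i + j) *\<^sub>R
             \<alpha> x (br (Xs ! i) (Xs ! j) x # map (\<lambda>X. X x) (nths Xs (- {i, j}))))))"

text \<open>The almost Gerstenhaber--Jacobi bracket of an almost Jacobi algebroid on \<open>A\<^sup>\<dagger> = A\<^sup>* \<otimes> L\<close>. Sections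
  of \<open>A\<^sup>\<dagger>\<close> are the elements of \<open>Omega M A L 1\<close>; \<open>br\<close> and \<open>N\<close> are the bracket and the covariant
  derivative on sections. Because of \<open>(A\<^sup>\<dagger>)\<^sup>\<dagger> = A\<close> the bracket is defined on \<open>\<Omega>(A;L)[1]\<close>, so that a form
  of degree \<open>a\<close> has degree \<open>a - 1\<close>. By graded skew-symmetry the derivation property (and
  linearity) is needed in the second entry only.\<close>

definition GJ_bracket_axioms ::
  "('m, 'b::euclidean_space) manifold \<Rightarrow> ('m, 'e::real_vector) vbundle \<Rightarrow> ('m, 'l::real_vector) vbundle
     \<Rightarrow> (('m \<Rightarrow> 'e list \<Rightarrow> 'l) \<Rightarrow> ('m \<Rightarrow> 'e list \<Rightarrow> 'l) \<Rightarrow> 'm \<Rightarrow> 'e list \<Rightarrow> 'l)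
     \<Rightarrow> (('m \<Rightarrow> 'e list \<Rightarrow> 'l) \<Rightarrow> ('m \<Rightarrow> 'l) \<Rightarrow> 'm \<Rightarrow> 'l)
     \<Rightarrow> (('m \<Rightarrow> 'e list \<Rightarrow> 'l) \<Rightarrow> ('m \<Rightarrow> 'e list \<Rightarrow> 'l) \<Rightarrow> 'm \<Rightarrow> 'e list \<Rightarrow> 'l) \<Rightarrow> bool" where
  "GJ_bracket_axioms M A L br N G \<longleftrightarrow>
     (\<forall>a b. \<forall>\<alpha>\<in>Omega M A L a. \<forall>\<beta>\<in>Omega M A L b.
        G \<alpha> \<beta> \<in> Omega M A L (a + b - 1) \<and>
        G \<alpha> \<beta> = - (psign ((a - 1) * (b - 1)) *\<^sub>R G \<beta> \<alpha>)) \<and>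
     (\<forall>a. \<forall>\<alpha>\<in>Omega M A L a.
        module_derivation (Omega_fun M A) wedge (\<lambda>k. Omega M A L (k + 1)) wedge (a - 1) (G \<alpha>)) \<and>
     (\<forall>\<alpha>\<in>Omega M A L 1. \<forall>\<beta>\<in>Omega M A L 1. G \<alpha> \<beta> = br \<alpha> \<beta>) \<and>
     (\<forall>\<alpha>\<in>Omega M A L 1. \<forall>s\<in>sections M L. G \<alpha> (form0 s) = form0 (N \<alpha> s))"

text \<open>Off homogeneous elements the value is fixed to be \<open>0\<close>, to make the function unique.\<close>

definition GJ_bracket ::
  "('m, 'b::euclidean_space) manifold \<Rightarrow> ('m, 'e::real_vector) vbundle \<Rightarrow> ('m, 'l::real_vector) vbundle
     \<Rightarrow> (('m \<Rightarrow> 'e list \<Rightarrow> 'l) \<Rightarrow> ('m \<Rightarrow> 'e list \<Rightarrow> 'l) \<Rightarrow> 'm \<Rightarrow> 'e list \<Rightarrow> 'l)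
     \<Rightarrow> (('m \<Rightarrow> 'e list \<Rightarrow> 'l) \<Rightarrow> ('m \<Rightarrow> 'l) \<Rightarrow> 'm \<Rightarrow> 'l)
     \<Rightarrow> ('m \<Rightarrow> 'e list \<Rightarrow> 'l) \<Rightarrow> ('m \<Rightarrow> 'e list \<Rightarrow> 'l) \<Rightarrow> 'm \<Rightarrow> 'e list \<Rightarrow> 'l" where
  "GJ_bracket M A L br N = (THE G. GJ_bracket_axioms M A L br N G \<and>
     (\<forall>\<alpha> \<beta>. \<alpha> \<notin> (\<Union>a. Omega M A L a) \<or> \<beta> \<notin> (\<Union>b. Omega M A L b) \<longrightarrow> G \<alpha> \<beta> = 0))"


section \<open>The identification of \<open>B\<close> with \<open>A\<^sup>\<dagger>\<close>\<close>

definition to_dual ::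
  "('m, 'e, 'l::zero) cj_data \<Rightarrow> ('m, 'e) vbundle \<Rightarrow> ('m \<Rightarrow> 'e) \<Rightarrow> 'm \<Rightarrow> 'e list \<Rightarrow> 'l" where
  "to_dual C A b = (\<lambda>x vs. case vs of [u] \<Rightarrow> if u \<in> fib A x then pairing C x (b x) u else 0 | _ \<Rightarrow> 0)"

definition of_dual ::
  "('m, 'e, 'l) cj_data \<Rightarrow> ('m, 'e) vbundle \<Rightarrow> ('m, 'e) vbundle \<Rightarrow> ('m \<Rightarrow> 'e list \<Rightarrow> 'l) \<Rightarrow> 'm \<Rightarrow> 'e" where
  "of_dual C A B \<alpha> = (\<lambda>x. THE b. b \<in> fib B x \<and> (\<forall>u\<in>fib A x. pairing C x b u = \<alpha> x [u]))"

text \<open>The projection onto \<open>B\<close> along \<open>A\<close>.\<close>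

definition proj :: "('m, 'e::plus) vbundle \<Rightarrow> ('m, 'e) vbundle \<Rightarrow> ('m \<Rightarrow> 'e) \<Rightarrow> 'm \<Rightarrow> 'e" where
  "proj A B e = (\<lambda>x. THE b. b \<in> fib B x \<and> (\<exists>a\<in>fib A x. e x = a + b))"

definition dual_bracket ::
  "('m, 'e::plus, 'l::zero) cj_data \<Rightarrow> ('m, 'e) vbundle \<Rightarrow> ('m, 'e) vbundle
     \<Rightarrow> ('m \<Rightarrow> 'e list \<Rightarrow> 'l) \<Rightarrow> ('m \<Rightarrow> 'e list \<Rightarrow> 'l) \<Rightarrow> 'm \<Rightarrow> 'e list \<Rightarrow> 'l" where
  "dual_bracket C A B \<alpha> \<beta> =
     to_dual C A (proj A B (bracket C (of_dual C A B \<alpha>) (of_dual C A B \<beta>)))"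

definition dual_nabla ::
  "('m, 'e, 'l) cj_data \<Rightarrow> ('m, 'e) vbundle \<Rightarrow> ('m, 'e) vbundle
     \<Rightarrow> ('m \<Rightarrow> 'e list \<Rightarrow> 'l) \<Rightarrow> ('m \<Rightarrow> 'l) \<Rightarrow> 'm \<Rightarrow> 'l" where
  "dual_nabla C A B \<alpha> s = (\<lambda>x. nabla C x (of_dual C A B \<alpha> x) s)"

definition Upsilon ::
  "('m, 'e, 'l) cj_data \<Rightarrow> ('m, 'e) vbundle \<Rightarrow> ('m, 'e) vbundle
     \<Rightarrow> ('m \<Rightarrow> 'e list \<Rightarrow> 'l) \<Rightarrow> ('m \<Rightarrow> 'e list \<Rightarrow> 'l) \<Rightarrow> ('m \<Rightarrow> 'e list \<Rightarrow> 'l) \<Rightarrow> 'm \<Rightarrow> 'l" where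
  "Upsilon C A B \<alpha>1 \<alpha>2 \<alpha>3 =
     spair C (bracket C (of_dual C A B \<alpha>1) (of_dual C A B \<alpha>2)) (of_dual C A B \<alpha>3)"


section \<open>Sharp notation\<close>

text \<open>A pair \<open>(u, \<nu>)\<close> stands for the simple tensor \<open>u \<otimes> \<nu>\<close> in \<open>A \<otimes> L\<^sup>*\<close> at the point \<open>x\<close>.\<close>

definition simple_tensors ::
  "('m, 'e) vbundle \<Rightarrow> ('m, 'l::real_vector) vbundle \<Rightarrow> 'm \<Rightarrow> ('e \<times> ('l \<Rightarrow> real)) set" where
  "simple_tensors A L x = {(u, \<nu>). u \<in> fib A x \<and>
     (\<forall>s\<in>fib L x. \<forall>t\<in>fib L x. \<forall>c. \<nu> (c *\<^sub>R s + t) = c * \<nu> s + \<nu> t)}"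

definition sharp :: "('m \<Rightarrow> 'e list \<Rightarrow> 'l) \<Rightarrow> 'm \<Rightarrow> 'e \<times> ('l \<Rightarrow> real) \<Rightarrow> 'e list \<Rightarrow> real" where
  "sharp \<alpha> x t = (\<lambda>us. snd t (\<alpha> x (fst t # us)))"

definition sharp_wedge3 ::
  "('m \<Rightarrow> 'e list \<Rightarrow> 'l) \<Rightarrow> ('m \<Rightarrow> 'e list \<Rightarrow> 'l) \<Rightarrow> ('m \<Rightarrow> 'e list \<Rightarrow> 'l) \<Rightarrow> 'm
     \<Rightarrow> (nat \<Rightarrow> 'e \<times> ('l \<Rightarrow> real)) \<Rightarrow> 'e list \<Rightarrow> real" where
  "sharp_wedge3 \<alpha> \<beta> \<gamma> x t = (\<lambda>us. \<Sum>\<sigma> | \<sigma> permutes {..<3}. of_int (sign \<sigma>) *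
     alt_wedge (sharp \<alpha> x (t (\<sigma> 0)))
       (alt_wedge (sharp \<beta> x (t (\<sigma> 1))) (sharp \<gamma> x (t (\<sigma> 2)))) us)"

text \<open>The list \<open>[(t\<^sub>1, l\<^sub>1), (t\<^sub>2, l\<^sub>2), \<dots>]\<close> represents the element
  \<open>t\<^sub>1 0 \<and> t\<^sub>1 1 \<and> t\<^sub>1 2 \<otimes> l\<^sub>1 + t\<^sub>2 0 \<and> t\<^sub>2 1 \<and> t\<^sub>2 2 \<otimes> l\<^sub>2 + \<dots>\<close> of \<open>\<And>\<^sup>3(A \<otimes> L\<^sup>*) \<otimes> L\<close> at \<open>x\<close>; the predicate says that
  this element equals the value at \<open>x\<close> of \<open>T\<close>, a trilinear map on sections of \<open>A\<^sup>\<dagger>\<close>. The wedge of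
  three elements acts on sections of \<open>A\<^sup>\<dagger>\<close> by the determinant.\<close>

definition represents ::
  "('m, 'b::euclidean_space) manifold \<Rightarrow> ('m, 'e::real_vector) vbundle \<Rightarrow> ('m, 'l::real_vector) vbundle
     \<Rightarrow> (('m \<Rightarrow> 'e list \<Rightarrow> 'l) \<Rightarrow> ('m \<Rightarrow> 'e list \<Rightarrow> 'l) \<Rightarrow> ('m \<Rightarrow> 'e list \<Rightarrow> 'l) \<Rightarrow> 'm \<Rightarrow> 'l)
     \<Rightarrow> 'm \<Rightarrow> ((nat \<Rightarrow> 'e \<times> ('l \<Rightarrow> real)) \<times> 'l) list \<Rightarrow> bool" where
  "represents M A L T x ts \<longleftrightarrow>
     (\<forall>(t, l)\<in>set ts. (\<forall>i<3. t i \<in> simple_tensors A L x) \<and> l \<in> fib L x) \<and>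
     (\<forall>\<alpha>. (\<forall>j<3. \<alpha> j \<in> Omega M A L 1) \<longrightarrow>
        T (\<alpha> 0) (\<alpha> 1) (\<alpha> 2) x =
          (\<Sum>(t, l)\<leftarrow>ts. (\<Sum>\<sigma> | \<sigma> permutes {..<3::nat}. of_int (sign \<sigma>) *
             (\<Prod>i<3. snd (t i) (\<alpha> (\<sigma> i) x [fst (t i)]))) *\<^sub>R l))"

text \<open>\<open>(\<alpha>\<^sup>\<sharp> \<and> \<beta>\<^sup>\<sharp> \<and> \<gamma>\<^sup>\<sharp> \<otimes> id\<^sub>L) T\<close>; the value does not depend on the chosen representation of \<open>T\<close> at \<open>x\<close>.\<close>

definition sharp_apply ::
  "('m, 'b::euclidean_space) manifold \<Rightarrow> ('m, 'e::real_vector) vbundle \<Rightarrow> ('m, 'l::real_vector) vbundle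
     \<Rightarrow> ('m \<Rightarrow> 'e list \<Rightarrow> 'l) \<Rightarrow> ('m \<Rightarrow> 'e list \<Rightarrow> 'l) \<Rightarrow> ('m \<Rightarrow> 'e list \<Rightarrow> 'l)
     \<Rightarrow> (('m \<Rightarrow> 'e list \<Rightarrow> 'l) \<Rightarrow> ('m \<Rightarrow> 'e list \<Rightarrow> 'l) \<Rightarrow> ('m \<Rightarrow> 'e list \<Rightarrow> 'l) \<Rightarrow> 'm \<Rightarrow> 'l)
     \<Rightarrow> 'm \<Rightarrow> 'e list \<Rightarrow> 'l" where
  "sharp_apply M A L \<alpha> \<beta> \<gamma> T = (\<lambda>x us.
     \<Sum>(t, l)\<leftarrow>(SOME ts. represents M A L T x ts). sharp_wedge3 \<alpha> \<beta> \<gamma> x t us *\<^sub>R l)"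

end

theory Submission
  imports Defs "HOL-Analysis.Analysis"
begin

text \<open>All three brackets are graded derivations in each entry, so every identity between them has to be checked
  only on the generators of the module of forms: the sections of \<open>L\<close> and, through the pairing, the sections of \<open>B\<close>.
  In a local frame dual to one of \<open>B\<close> the binary bracket is an explicit combination of Lie derivatives
  and contractions; its values on generators do not depend on the frame, hence the local formulas glue. The \<open>n\<close>-th
  higher Jacobi expression is a sum of graded commutators of derivations and is graded symmetric, hence vanishes as soon
  as it does on generators. There the relations unravel to the Courant--Jacobi axioms, and for \<open>n \<ge> 4\<close>
  only the case of four sections of \<open>B\<close> survives for degree reasons. The obstruction to involutivity
  of \<open>B\<close> is exactly the ternary bracket on three sections of \<open>B\<close>.\<close>

section \<open>Smooth functions on open sets\<close>

text \<open>The differential, the Gerstenhaber--Jacobi bracket and the contraction with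
  \<open>Upsilon\<close> enter the statement through descriptions and choices, so existence and
  uniqueness must be shown on a manifold known only through its charts. Cut-offs from charts turn
  every germ of a section into a global section; gluing derivations that agree on generators
  replaces partitions of unity. Two \<open>L\<close>-valued forms have no product: local formulas
  trivialise one factor by a functional \<open>nu\<close>, and the factors may be exchanged because
  \<open>L\<close> has rank one. The derivation property in the last entry suffices, because each
  Jacobi expression is invariant under rotation of its entries up to sign; an identity known for
  generators in front is rotated and one more place becomes free. The Leibniz rule of the bracket
  and the flatness of \<open>nabla\<close> are consequences of the axioms: the first by
  non-degeneracy, the second because sections of \<open>L\<close> are locally pairings of sections
  of \<open>E\<close>. The latter fails where the fibre of \<open>E\<close> is zero, and such points
  are treated apart.\<close>

lemma Ck_on_cong:
 assumes "open W" "!!x. x : W ==> f x = g x"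
 shows "Ck_on k W f = Ck_on k W g"
proof -
 have "Ck_on k W g" if "open W" "!!x. x : W ==> f x = g x" "Ck_on k W f"
  for f g :: "'a => 'b" and k
  using that
 proof (induction k arbitrary: f g)
  case 0
  then show ?case using continuous_on_cong[of W W f g] by simp
 next
  case (Suc k)
  have d: "(g has_derivative frechet_derivative f (at x)) (at x)" if "x : W" for x
   using has_derivative_transform_within_open[of f _ x UNIV W g] Suc.prems that
   by (auto simp: frechet_derivative_works)
  have "frechet_derivative g (at x) = frechet_derivative f (at x)" if "x : W" for x
   using frechet_derivative_at[OF d[OF that]] by simp
  then have e: "frechet_derivative f (at x) v = frechet_derivative g (at x) v" if "x : W" for x v
   using that by simp
  have c: "Ck_on k W (%x. frechet_derivative f (at x) v)" for v
   using Suc.prems(3) by simp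
  have "Ck_on k W (%x. frechet_derivative g (at x) v)" for v
   by (rule Suc.IH[OF Suc.prems(1) e c])
  then show ?case using d by (auto simp: differentiable_def)
 qed
 from this[of f g] this[of g f] show ?thesis using assms by metis
qed

text \<open>\<open>Ck_on\<close> refers to the chosen \<open>frechet_derivative\<close>. Derivatives
  are unique, so any explicit formula may take its place, and the closure properties below reduce to
  rules of calculus.\<close>

lemma Ck_on_Suc_intro:
 assumes "open W" "!!x. x : W ==> (f has_derivative f' x) (at x)" "!!v. Ck_on k W (%x. f' x v)"
 shows "Ck_on (Suc k) W f"
proof -
 have "frechet_derivative f (at x) = f' x" if "x : W" for x
  using frechet_derivative_at[OF assms(2)[OF that]] by simp
 then have "Ck_on k W (%x. frechet_derivative f (at x) v)" for v
  using assms(3)[of v] Ck_on_cong[OF assms(1), of "%x. frechet_derivative f (at x) v" "%x. f' x v"] by simp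
 then show ?thesis using assms(2) by (auto simp: differentiable_def)
qed

lemma Ck_on_derivative:
 "Ck_on (Suc k) W f ==> x : W ==> (f has_derivative frechet_derivative f (at x)) (at x)"
 by (simp add: frechet_derivative_works)

lemma Ck_on_SucD: "Ck_on (Suc k) W f ==> Ck_on k W f"
proof (induction k arbitrary: f)
 case 0
 then show ?case
  by (auto intro!: continuous_at_imp_continuous_on differentiable_imp_continuous_within)
next
 case (Suc k)
 have "Ck_on (Suc k) W (%x. frechet_derivative f (at x) v)" for v
  using Suc.prems by simp
 then show ?case using Suc by auto
qed

lemma Ck_on_subset: "Ck_on k W f ==> V <= W ==> Ck_on k V f"
 by (induction k arbitrary: f) (auto intro: continuous_on_subset)

lemma Ck_on_const: "open W ==> Ck_on k W (%x. c)"
 by (induction k arbitrary: c) (auto intro!: Ck_on_Suc_intro[where f'="%_ _. 0"] continuous_intros simp del: Ck_on.simps(2))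

lemma Ck_on_add:
 "open W ==> Ck_on k W f ==> Ck_on k W g ==> Ck_on k W (%x. f x + g x)"
proof (induction k arbitrary: f g)
 case (Suc k)
 show ?case
  by (rule Ck_on_Suc_intro[OF Suc.prems(1)
     has_derivative_add[OF Ck_on_derivative[OF Suc.prems(2)] Ck_on_derivative[OF Suc.prems(3)]]])
    (use Suc in auto)
qed (auto intro: continuous_on_add)

lemma Ck_on_bilinear:
 assumes "bounded_bilinear bil"
 shows "open W ==> Ck_on k W f ==> Ck_on k W g ==> Ck_on k W (%x. bil (f x) (g x))"
proof (induction k arbitrary: f g)
 case 0
 then show ?case using bounded_bilinear.continuous_on[OF assms] by auto
next
 case (Suc k)
 note fg = Ck_on_SucD[OF Suc.prems(2)] Ck_on_SucD[OF Suc.prems(3)]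
 have d: "Ck_on k W (%x. frechet_derivative f (at x) v)" "Ck_on k W (%x. frechet_derivative g (at x) v)" for v
  using Suc.prems by auto
 show ?case
  by (rule Ck_on_Suc_intro[OF Suc.prems(1) bounded_bilinear.FDERIV[OF assms
      Ck_on_derivative[OF Suc.prems(2)] Ck_on_derivative[OF Suc.prems(3)]]])
    (auto intro!: Ck_on_add Suc fg d)
qed

lemmas Ck_on_mult = Ck_on_bilinear[OF bounded_bilinear_mult]
lemmas Ck_on_inner = Ck_on_bilinear[OF bounded_bilinear_inner]

lemma Ck_on_inverse:
 fixes f :: "'a::euclidean_space => real"
 shows "open W ==> Ck_on k W f ==> (!!x. x : W ==> f x ~= 0) ==> Ck_on k W (%x. inverse (f x))"
proof (induction k)
 case 0
 then show ?case by (auto intro: continuous_on_inverse)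
next
 case (Suc k)
 have *: "Ck_on k W (%x. inverse (f x))"
  using Suc Ck_on_SucD by blast
 have **: "Ck_on k W (%x. frechet_derivative f (at x) v)" for v
  using Suc.prems by simp
 have "Ck_on k W (%x. - 1 * (inverse (f x) * frechet_derivative f (at x) v * inverse (f x)))" for v
  by (intro Ck_on_mult Ck_on_const Suc.prems * **)
 then show ?case
  by (intro Ck_on_Suc_intro[OF Suc.prems(1) Deriv.has_derivative_inverse[OF Suc.prems(3) Ck_on_derivative[OF Suc.prems(2)]]])
    (auto simp del: Ck_on.simps)
qed

text \<open>The functions \<open>exp (- 1 / t) / t ^ n\<close>, extended by \<open>0\<close>, are closed under differentiation
 up to linear combinations.\<close>

definition flat :: "nat => real => real" where
 "flat n t = (if t > 0 then exp (- 1 / t) / t ^ n else 0)"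

text \<open>From \<open>exp s \<ge> (1 + s / m) ^ m\<close> with \<open>s = 1 / t\<close>. The
  choice \<open>m = n + 2\<close> leaves two powers of \<open>t\<close> after division by
  \<open>t ^ n\<close>, enough to make the difference quotient at 0 tend to 0.\<close>

lemma flat_le: "\<bar>flat n t\<bar> <= real (n + 2) ^ (n + 2) * t\<^sup>2"
proof (cases "t > 0")
 case True
 define m where "m = n + 2"
 have m: "m > 0" by (simp add: m_def)
 have "(1 / t / m) ^ m <= (1 + 1 / t / m) ^ m"
  using True by (intro power_mono) auto
 also have "\<dots> <= exp (1 / t)"
  using True m by (intro exp_ge_one_plus_x_over_n_power_n) (auto intro: order.trans[of _ 0])
 finally have "1 / (t ^ m * real m ^ m) <= exp (1 / t)"
  by (simp add: power_divide field_simps)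
 then have "1 <= exp (1 / t) * (t ^ m * real m ^ m)"
  using True m by (simp add: field_simps)
 then have "exp (- 1 / t) <= t ^ m * real m ^ m"
  by (simp add: exp_minus field_simps)
 then have "exp (- 1 / t) / t ^ n <= t ^ m * real m ^ m / t ^ n"
  using True by (intro divide_right_mono) auto
 also have "\<dots> = real m ^ m * t\<^sup>2"
 proof -
  have "t ^ m = t ^ n * t\<^sup>2" by (simp only: m_def power_add)
  then show ?thesis using True by simp
 qed
 finally show ?thesis using True by (simp add: flat_def m_def)
qed (simp add: flat_def)

lemma flat_derivative:
 "(flat n has_real_derivative flat (n + 2) t - real n * flat (n + 1) t) (at t)"
proof -
 consider "t > 0" | "t < 0" | "t = 0" by linarith
 then show ?thesis
 proof cases
  case 1
  have "((%t. exp (- 1 / t) / t ^ n) has_real_derivative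
    exp (- 1 / t) / t ^ (n + 2) - real n * (exp (- 1 / t) / t ^ (n + 1))) (at t)"
  proof -
   have 2: "real n * t ^ (n - 1) / (t ^ n * t ^ n) = real n / t ^ (n + 1)"
    using 1 by (cases n) (auto simp: field_simps)
   have "((%t. exp (- 1 / t) / t ^ n) has_real_derivative
     (exp (- 1 / t) * (1 / t ^ 2) * t ^ n - exp (- 1 / t) * (real n * t ^ (n - 1))) / (t ^ n * t ^ n)) (at t)"
    using 1 by (auto intro!: derivative_eq_intros simp: power2_eq_square)
   also have "(exp (- 1 / t) * (1 / t ^ 2) * t ^ n - exp (- 1 / t) * (real n * t ^ (n - 1))) / (t ^ n * t ^ n)
     = exp (- 1 / t) / t ^ (n + 2) - exp (- 1 / t) * (real n * t ^ (n - 1) / (t ^ n * t ^ n))"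
    using 1 by (simp add: diff_divide_distrib power_add power2_eq_square)
   finally show ?thesis unfolding 2 by (simp add: mult.commute)
  qed
  then show ?thesis using 1
   by (intro DERIV_cong_ev[THEN iffD1, OF refl _ _ \<open>(_ has_real_derivative _) _\<close>])
     (auto simp: flat_def eventually_nhds intro!: exI[of _ "{0<..}"])
 next
  case 2
  have "((%t. 0) has_real_derivative 0) (at t)" by simp
  then show ?thesis using 2
   by (intro DERIV_cong_ev[THEN iffD1, OF refl _ _ \<open>(_ has_real_derivative _) _\<close>])
     (auto simp: flat_def eventually_nhds intro!: exI[of _ "{..<0}"])
 next
  case 3
  \<comment> \<open>At 0 the claimed derivative is 0, and the quadratic bound \<open>flat_le\<close>
    squeezes the difference quotient.\<close>
  have "((%h. flat n h / h) \<longlongrightarrow> 0) (at 0)"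
  proof (rule Lim_null_comparison)
   have "norm (flat n h / h) <= real (n + 2) ^ (n + 2) * \<bar>h\<bar>" for h
    using flat_le[of n h] by (cases "h = 0") (auto simp: field_simps power2_eq_square abs_mult)
   then show "\<forall>\<^sub>F h in at 0. norm (flat n h / h) <= real (n + 2) ^ (n + 2) * \<bar>h\<bar>"
    by simp
   have "((%h. real (n + 2) ^ (n + 2) * \<bar>h\<bar>) \<longlongrightarrow> real (n + 2) ^ (n + 2) * \<bar>0\<bar>) (at 0)"
    by (intro tendsto_intros)
   then show "((%h. real (n + 2) ^ (n + 2) * \<bar>h\<bar>) \<longlongrightarrow> 0) (at 0)" by simp
  qed
  then show ?thesis using 3 by (simp add: DERIV_def flat_def)
 qed
qed

text \<open>The induction over \<open>k\<close> keeps \<open>n\<close> arbitrary, because one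
  differentiation raises the index to \<open>n + 1\<close> and \<open>n + 2\<close>.\<close>

lemma Ck_on_flat:
 fixes g :: "'a::euclidean_space => real"
 shows "open W ==> Ck_on k W g ==> Ck_on k W (%x. flat n (g x))"
proof (induction k arbitrary: n)
 case 0
 have "continuous_on UNIV (flat n)"
  using flat_derivative DERIV_isCont by (metis continuous_at_imp_continuous_on)
 from continuous_on_compose2[OF this, of W g] show ?case using 0 by simp
next
 case (Suc k)
 have *: "Ck_on k W (%x. flat n (g x))" for n
  using Suc Ck_on_SucD by blast
 have **: "Ck_on k W (%x. frechet_derivative g (at x) v)" for v
  using Suc.prems by simp
 have ***: "((%x. flat n (g x)) has_derivative
   (%v. frechet_derivative g (at x) v * (flat (n + 2) (g x) + (- real n) * flat (n + 1) (g x)))) (at x)"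
  if "x : W" for x
  using has_derivative_compose[OF Ck_on_derivative[OF Suc.prems(2) that]
    flat_derivative[of n "g x", unfolded has_field_derivative_def]]
  by (simp add: mult.commute)
 show ?case
  by (rule Ck_on_Suc_intro[OF Suc.prems(1) ***], assumption)
    (intro Ck_on_mult Ck_on_add Ck_on_const * ** Suc.prems)
qed

text \<open>The classical quotient of flat functions. The half-lines on which the two summands of
  the denominator are positive, \<open>t < 1\<close> and \<open>t > 1 / 2\<close>, cover the line,
  so it never vanishes.\<close>

definition cutoff :: "real => real" where
 "cutoff t = flat 0 (1 - t) * inverse (flat 0 (1 - t) + flat 0 (t - 1 / 2))"

lemma flat_0_pos: "flat 0 t > 0 \<longleftrightarrow> t > 0" "flat 0 t >= 0"
 by (auto simp: flat_def)

lemma cutoff_denominator: "flat 0 (1 - t) + flat 0 (t - 1 / 2) ~= 0"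
 using flat_0_pos[of "1 - t"] flat_0_pos[of "t - 1 / 2"] by (cases "t < 1") auto

lemma cutoff_eq: "t <= 1 / 2 ==> cutoff t = 1" "t >= 1 ==> cutoff t = 0"
 using cutoff_denominator[of t] by (auto simp: cutoff_def flat_def)

lemma Ck_on_cutoff:
 assumes "open W" "Ck_on k W g"
 shows "Ck_on k W (%x. cutoff (g x))"
proof -
 have "Ck_on k W (%x. flat 0 (1 + - 1 * g x) * inverse (flat 0 (1 + - 1 * g x) + flat 0 (g x + - 1 / 2)))"
  by (intro Ck_on_mult Ck_on_inverse Ck_on_add Ck_on_flat Ck_on_const assms)
    (use cutoff_denominator in auto)
 then show ?thesis by (simp add: cutoff_def)
qed

section \<open>Smooth functions on arbitrary sets\<close>

lemma smooth_onE:
 assumes "smooth_on S f" "x : S"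
 obtains W g where "open W" "x : W" "!!k. Ck_on k W g" "!!y. y : W ==> y : S ==> g y = f y"
 using bspec[OF assms(1)[unfolded smooth_on_def] assms(2)] by (elim exE conjE) (rule that, assumption+, blast, blast)

text \<open>Smoothness on a general set is local extendability, so the operation is applied to both
  extensions on the intersection of their domains. Leaving the operation abstract serves sums,
  products and the cut-off of a squared distance alike.\<close>

lemma smooth_on_combine:
 fixes S :: "'a::euclidean_space set"
 assumes "smooth_on S f" "smooth_on S g"
  and "!!k (W :: 'a set) g h. open W ==> Ck_on k W g ==> Ck_on k W h ==> Ck_on k W (%x. opr (g x) (h x))"
 shows "smooth_on S (%x. opr (f x) (g x))"
 unfolding smooth_on_def
proof
 fix x assume "x : S"
 from smooth_onE[OF assms(1) this] obtain W f' where
  W: "open W" "x : W" "!!k. Ck_on k W f'" "!!y. y : W ==> y : S ==> f' y = f y" by blast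
 from smooth_onE[OF assms(2) \<open>x : S\<close>] obtain V g' where
  V: "open V" "x : V" "!!k. Ck_on k V g'" "!!y. y : V ==> y : S ==> g' y = g y" by blast
 have "Ck_on k (W \<inter> V) (%x. opr (f' x) (g' x))" for k
  by (rule assms(3)[OF open_Int[OF W(1) V(1)] Ck_on_subset[OF W(3)] Ck_on_subset[OF V(3)]]) auto
 then show "\<exists>W h. open W & x : W & (\<forall>k. Ck_on k W h) & (ALL y:W \<inter> S. h y = opr (f y) (g y))"
  using W(1,2) V(1,2) W(4) V(4) by (intro exI[of _ "W \<inter> V"] exI[of _ "%x. opr (f' x) (g' x)"]) auto
qed

lemma smooth_on_const: "smooth_on S (%x. c)"
 unfolding smooth_on_def by (auto intro!: exI[of _ UNIV] exI[of _ "%_. c"] Ck_on_const)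

lemmas smooth_on_add = smooth_on_combine[OF _ _ Ck_on_add]
lemmas smooth_on_mult = smooth_on_combine[OF _ _ Ck_on_mult]

lemma smooth_on_inverse:
 assumes "smooth_on S f" "!!x. x : S ==> f x ~= (0::real)"
 shows "smooth_on S (%x. inverse (f x))"
 unfolding smooth_on_def
proof
 fix x assume x: "x : S"
 from smooth_onE[OF assms(1) this] obtain W f' where
  W: "open W" "x : W" "!!k. Ck_on k W f'" "!!y. y : W ==> y : S ==> f' y = f y" by blast
 \<comment> \<open>Outside \<open>S\<close> the local extension may have zeros; its domain is shrunk
   to the open set where it has none.\<close>
 have "continuous_on W f'" using W(3)[of 0] by simp
 then have o: "open (W \<inter> f' -` (- {0}))"
  using W(1) by (intro continuous_open_preimage) auto
 show "\<exists>W h. open W & x : W & (\<forall>k. Ck_on k W h) & (ALL y:W \<inter> S. h y = inverse (f y))"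
  using W x assms(2)[of x] o
  by (intro exI[of _ "W \<inter> f' -` (- {0})"] exI[of _ "%x. inverse (f' x)"])
    (auto intro!: Ck_on_inverse Ck_on_subset[OF W(3)])
qed

lemma smooth_on_cong: "(!!x. x : S ==> f x = g x) ==> smooth_on S f = smooth_on S g"
 by (auto simp: smooth_on_def)

lemma smooth_on_subset: "smooth_on S f ==> T <= S ==> smooth_on T f"
 unfolding smooth_on_def by (meson IntD1 IntD2 IntI subsetD)

lemma smooth_on_local:
 assumes "!!x. x : S ==> \<exists>V. open V & x : V & smooth_on (V \<inter> S) f"
 shows "smooth_on S f"
 unfolding smooth_on_def
proof
 fix x assume x: "x : S"
 then obtain V where V: "open V" "x : V" "smooth_on (V \<inter> S) f"
  using assms by blast
 from smooth_onE[OF V(3), of x] x V(2) obtain W g where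
  W: "open W" "x : W" "!!k. Ck_on k W g" "!!y. y : W ==> y : V \<inter> S ==> g y = f y" by blast
 then show "\<exists>W g. open W & x : W & (\<forall>k. Ck_on k W g) & (ALL y:W \<inter> S. g y = f y)"
  using V by (intro exI[of _ "W \<inter> V"] exI[of _ g]) (auto intro: Ck_on_subset[OF W(3)])
qed

section \<open>Smooth functions on a manifold\<close>

lemma smooth_fun_on_subset: "smooth_fun_on M W f ==> V <= W ==> smooth_fun_on M V f"
 unfolding smooth_fun_on_def by (fast intro: smooth_on_subset)

lemma smooth_fun_on_const: "smooth_fun_on M W (%x. c)"
 by (auto simp: smooth_fun_on_def o_def smooth_on_const)

lemma smooth_fun_on_add:
 "smooth_fun_on M W f ==> smooth_fun_on M W g ==> smooth_fun_on M W (%x. f x + g x)"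
 unfolding smooth_fun_on_def o_def using smooth_on_add by fast

lemma smooth_fun_on_mult:
 "smooth_fun_on M W f ==> smooth_fun_on M W g ==> smooth_fun_on M W (%x. f x * g x)"
 unfolding smooth_fun_on_def o_def using smooth_on_mult by fast

lemma Cinf_smooth: "f : Cinf M ==> smooth_fun_on M W f"
 by (auto simp: Cinf_def intro: smooth_fun_on_subset)

locale mfd =
 fixes M :: "('m::{t2_space,second_countable_topology}, 'b::euclidean_space) manifold"
 assumes M: "smooth_manifold M"
begin

lemma subspace_model: "subspace (model M)"
 using M by (simp add: smooth_manifold_def)

lemma chart_at: obtains U \<phi> where "(U, \<phi>) : charts M" "x : U"
proof -
 have "(\<Union>(U, \<phi>)\<in>charts M. U) = UNIV" using M by (simp add: smooth_manifold_def)
 then have "x : (\<Union>(U, \<phi>)\<in>charts M. U)" by simp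
 then show ?thesis using that by auto
qed

lemma chartD:
 assumes "(U, \<phi>) : charts M"
 shows "open U" "openin (top_of_set (model M)) (\<phi> ` U)" "homeomorphism U (\<phi> ` U) \<phi> (inv_into U \<phi>)"
  "inj_on \<phi> U" "!!x. x : U ==> inv_into U \<phi> (\<phi> x) = x"
proof -
 show *: "open U" "openin (top_of_set (model M)) (\<phi> ` U)" "homeomorphism U (\<phi> ` U) \<phi> (inv_into U \<phi>)"
  using M assms unfolding smooth_manifold_def by auto
 then show "!!x. x : U ==> inv_into U \<phi> (\<phi> x) = x" by (simp add: homeomorphism_def)
 then show "inj_on \<phi> U" by (metis inj_on_inverseI)
qed

lemma transition_smooth:
 "(U, \<phi>) : charts M ==> (W, \<psi>) : charts M ==> smooth_on (\<phi> ` (U \<inter> W)) (\<psi> \<circ> inv_into U \<phi>)"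
 using M unfolding smooth_manifold_def by fast

text \<open>A chart image is open only inside the subspace \<open>model M\<close>, so openness
  downstairs appears as the trace of an ambient open set on that image.\<close>

lemma chart_open:
 assumes "(U, \<phi>) : charts M" "open W"
 obtains V where "open V" "\<phi> ` (U \<inter> W) = V \<inter> \<phi> ` U"
proof -
 have "openin (top_of_set (\<phi> ` U)) (\<phi> ` (U \<inter> W))"
  using homeomorphism_imp_open_map[OF chartD(3)[OF assms(1)]] assms(2)
  by (simp add: openin_open_Int)
 then show ?thesis using that by (auto simp: openin_open)
qed

lemma smooth_fun_on_cong:
 assumes "!!x. x : W ==> f x = g x"
 shows "smooth_fun_on M W f = smooth_fun_on M W g"
proof -
 have "smooth_on (\<phi> ` (U \<inter> W)) (f \<circ> inv_into U \<phi>) = smooth_on (\<phi> ` (U \<inter> W)) (g \<circ> inv_into U \<phi>)"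
  if "(U, \<phi>) : charts M" for U \<phi>
  by (rule smooth_on_cong) (use assms chartD(5)[OF that] in auto)
 then show ?thesis by (auto simp: smooth_fun_on_def)
qed

lemma smooth_fun_on_local:
 assumes "!!x. x : W ==> \<exists>V. open V & x : V & smooth_fun_on M (V \<inter> W) f"
 shows "smooth_fun_on M W f"
 unfolding smooth_fun_on_def
proof clarify
 fix U \<phi> assume c: "(U, \<phi>) : charts M"
 show "smooth_on (\<phi> ` (U \<inter> W)) (f \<circ> inv_into U \<phi>)"
 proof (rule smooth_on_local)
  fix z assume "z : \<phi> ` (U \<inter> W)"
  then obtain x where x: "x : U" "x : W" "z = \<phi> x" by auto
  from assms[OF x(2)] obtain V where V: "open V" "x : V" "smooth_fun_on M (V \<inter> W) f" by auto
  from chart_open[OF c V(1)] obtain V' where V': "open V'" "\<phi> ` (U \<inter> V) = V' \<inter> \<phi> ` U" .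
  have "V' \<inter> \<phi> ` (U \<inter> W) <= \<phi> ` (U \<inter> (V \<inter> W))"
  proof
   fix y assume "y : V' \<inter> \<phi> ` (U \<inter> W)"
   then obtain u where u: "u : U" "u : W" "y = \<phi> u" "y : V'" by auto
   then have "y : \<phi> ` (U \<inter> V)" using V'(2) by blast
   then have "u : V" using u chartD(4)[OF c] by (auto dest: inj_onD)
   then show "y : \<phi> ` (U \<inter> (V \<inter> W))" using u by auto
  qed
  moreover have "smooth_on (\<phi> ` (U \<inter> (V \<inter> W))) (f \<circ> inv_into U \<phi>)"
   using V(3) c by (auto simp: smooth_fun_on_def)
  moreover have "z : V'" using V' x V(2) by blast
  ultimately show "\<exists>V. open V & z : V & smooth_on (V \<inter> \<phi> ` (U \<inter> W)) (f \<circ> inv_into U \<phi>)"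
   using V'(1) smooth_on_subset by blast
 qed
qed

lemma smooth_fun_on_inverse:
 assumes "smooth_fun_on M W f" "!!x. x : W ==> f x ~= 0"
 shows "smooth_fun_on M W (%x. inverse (f x))"
 unfolding smooth_fun_on_def
proof clarify
 fix U \<phi> assume c: "(U, \<phi>) : charts M"
 have "smooth_on (\<phi> ` (U \<inter> W)) (f \<circ> inv_into U \<phi>)"
  using assms(1) c by (auto simp: smooth_fun_on_def)
 moreover have "(f \<circ> inv_into U \<phi>) z ~= 0" if "z : \<phi> ` (U \<inter> W)" for z
  using that assms(2) chartD(5)[OF c] by auto
 ultimately have "smooth_on (\<phi> ` (U \<inter> W)) (%x. inverse ((f \<circ> inv_into U \<phi>) x))"
  by (rule smooth_on_inverse)
 then show "smooth_on (\<phi> ` (U \<inter> W)) ((%x. inverse (f x)) \<circ> inv_into U \<phi>)"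
  by (simp add: o_def)
qed

lemma CinfI_local:
 assumes "!!x. \<exists>V. open V & x : V & smooth_fun_on M V f"
 shows "f : Cinf M"
 unfolding Cinf_def using smooth_fun_on_local[of UNIV f] assms by auto

lemma Cinf_const: "(%x. c) : Cinf M"
 by (simp add: Cinf_def smooth_fun_on_const)

lemma Cinf_add: "f : Cinf M ==> g : Cinf M ==> f + g : Cinf M"
 unfolding plus_fun_def Cinf_def using smooth_fun_on_add by blast

lemma Cinf_mult: "f : Cinf M ==> g : Cinf M ==> f * g : Cinf M"
 unfolding times_fun_def Cinf_def using smooth_fun_on_mult by blast

text \<open>\<open>K\<close> comes from a compact piece of a chart and is closed because the
  manifold is Hausdorff. Hence the domain of a local object and the complement of \<open>K\<close>
  form an open cover, on which \<open>chi\<close> times that object, extended by zero, is visibly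
  smooth.\<close>

lemma bump:
 assumes "open U" "x : U"
 obtains chi V K where "chi : Cinf M" "open V" "x : V" "V <= K" "!!y. y : V ==> chi y = 1" "closed K" "K <= U"
  "!!y. y \<notin> K ==> chi y = 0"
proof -
 obtain U0 \<phi> where c: "(U0, \<phi>) : charts M" "x : U0" using chart_at .
 obtain O' where O': "open O'" "\<phi> ` (U0 \<inter> U) = O' \<inter> \<phi> ` U0"
  using chart_open[OF c(1) assms(1)] .
 obtain O'' where O'': "open O''" "\<phi> ` U0 = model M \<inter> O''"
  using chartD(2)[OF c(1)] by (auto simp: openin_open)
 have "\<phi> x : O' \<inter> O''" using O' O'' c assms by blast
 then obtain r where r: "r > 0" "cball (\<phi> x) r <= O' \<inter> O''"
  using open_contains_cball[of "O' \<inter> O''"] O'(1) O''(1) by blast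
 \<comment> \<open>The squared distance in units of \<open>r\<close> is smooth at the centre as
   well. It is at most 1/4 on the half ball, where the cut-off is 1, and at least 1 outside the
   ball, where the cut-off is 0.\<close>
 define q where "q z = ((z - \<phi> x) \<bullet> (z - \<phi> x)) * inverse (r\<^sup>2)" for z
 define chi where "chi y = (if y : U0 then cutoff (q (\<phi> y)) else 0)" for y
 define N where "N = cball (\<phi> x) r \<inter> model M"
 define K where "K = inv_into U0 \<phi> ` N"
 have N: "N <= \<phi> ` (U0 \<inter> U)" "N <= \<phi> ` U0"
  using r O' O'' by (auto simp: N_def)
 have "compact N" unfolding N_def
  by (intro compact_Int_closed compact_cball closed_subspace subspace_model)
 moreover have "continuous_on N (inv_into U0 \<phi>)"
  using chartD(3)[OF c(1)] N(2) by (auto simp: homeomorphism_def intro: continuous_on_subset)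
 ultimately have "compact K" unfolding K_def by (rule compact_continuous_image[rotated])
 then have closedK: "closed K" by (rule compact_imp_closed)
 have K: "K <= U0 \<inter> U" using N(1) chartD(5)[OF c(1)] by (auto simp: K_def)
 have Kiff: "y : K \<longleftrightarrow> y : U0 & dist (\<phi> x) (\<phi> y) <= r" for y
 proof
  assume "y : K"
  then show "y : U0 & dist (\<phi> x) (\<phi> y) <= r"
   using N chartD(5)[OF c(1)] by (auto simp: K_def N_def)
 next
  assume y: "y : U0 & dist (\<phi> x) (\<phi> y) <= r"
  then have "\<phi> y : N" using O'' by (auto simp: N_def)
  then show "y : K" using y chartD(5)[OF c(1), of y] by (auto simp: K_def image_iff intro!: bexI[of _ "\<phi> y"])
 qed
 have q: "q z = (dist (\<phi> x) z / r)\<^sup>2" for z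
  by (simp add: q_def dist_norm power2_norm_eq_inner[symmetric] power_divide norm_minus_commute field_simps)
 have q1: "q z >= 1" if "dist (\<phi> x) z >= r" for z
  using that r(1) by (simp add: q one_le_power)
 have zero: "chi y = 0" if "y \<notin> K" for y
  using that q1[of "\<phi> y"] by (auto simp: chi_def Kiff cutoff_eq)
 obtain V where V: "open V" "\<phi> ` (U0 \<inter> V) = ball (\<phi> x) (r / 2) \<inter> \<phi> ` U0" "V <= U0"
 proof -
  have "openin (top_of_set U0) (U0 \<inter> \<phi> -` ball (\<phi> x) (r / 2))"
   using chartD(3)[OF c(1)] by (intro continuous_openin_preimage_gen) (auto simp: homeomorphism_def)
  then have "open (U0 \<inter> \<phi> -` ball (\<phi> x) (r / 2))"
   using chartD(1)[OF c(1)] openin_open_trans by blast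
  then show ?thesis using that[of "U0 \<inter> \<phi> -` ball (\<phi> x) (r / 2)"] by auto
 qed
 have Vd: "dist (\<phi> x) (\<phi> y) < r / 2" if "y : V" for y
  using V(2,3) that by (auto simp: set_eq_iff image_iff)
 have one: "chi y = 1" if "y : V" for y
 proof -
  have "(dist (\<phi> x) (\<phi> y) / r)\<^sup>2 <= (1 / 2)\<^sup>2"
   using Vd[OF that] r(1) by (intro power_mono) (auto simp: field_simps)
  also have "\<dots> <= (1 / 2 :: real)" by (simp add: power2_eq_square)
  finally have "q (\<phi> y) <= 1 / 2" by (simp add: q)
  then show ?thesis using V(3) that by (auto simp: chi_def cutoff_eq)
 qed
 have "x : V"
 proof -
  have "\<phi> x : \<phi> ` (U0 \<inter> V)" using V(2) r(1) c(2) by auto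
  then show ?thesis using chartD(4)[OF c(1)] c(2) V(3) by (auto dest: inj_onD)
 qed
 have VK: "V <= K"
  using Vd V(3) r(1) by (force simp: Kiff)
 have "smooth_fun_on M U0 chi"
  unfolding smooth_fun_on_def
 proof clarify
  fix W \<psi> assume d: "(W, \<psi>) : charts M"
  have "smooth_on (\<psi> ` (W \<inter> U0)) (\<phi> \<circ> inv_into W \<psi>)" using transition_smooth[OF d c(1)] .
  \<comment> \<open>A binary combination with a constant second argument does duty as composition
    with the transition map.\<close>
  then have "smooth_on (\<psi> ` (W \<inter> U0)) (%z. cutoff (q ((\<phi> \<circ> inv_into W \<psi>) z)))"
   unfolding q_def diff_conv_add_uminus
   by (rule smooth_on_combine[OF _ smooth_on_const, of _ _ "%u _. cutoff (((u + - \<phi> x) \<bullet> (u + - \<phi> x)) * inverse (r\<^sup>2))"])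
     (intro Ck_on_cutoff Ck_on_mult Ck_on_inner Ck_on_add Ck_on_const)
  then show "smooth_on (\<psi> ` (W \<inter> U0)) (chi \<circ> inv_into W \<psi>)"
   by (rule smooth_on_cong[THEN iffD1, rotated]) (use chartD(5)[OF d] in \<open>auto simp: chi_def\<close>)
 qed
 moreover have "smooth_fun_on M (- K) chi"
  using smooth_fun_on_const[of M "- K" 0] smooth_fun_on_cong[of "- K" chi "%_. 0"] zero by auto
 ultimately have "chi : Cinf M"
  using chartD(1)[OF c(1)] closedK K by (intro CinfI_local) (metis ComplI IntD1 open_Compl subsetD)
 then show ?thesis
  by (rule that[OF _ V(1) \<open>x : V\<close> VK _ closedK]) (use one zero K in auto)
qed

lemma extend_fun:
 assumes "open U" "x : U" "smooth_fun_on M U f"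
 obtains g V where "g : Cinf M" "open V" "x : V" "V <= U" "!!y. y : V ==> g y = f y"
proof -
 obtain chi V K where b: "chi : Cinf M" "open V" "x : V" "V <= K" "!!y. y : V ==> chi y = 1" "closed K" "K <= U"
  "!!y. y \<notin> K ==> chi y = 0"
  using bump[OF assms(1,2)] by blast
 define g where "g y = chi y * f y" for y
 have "smooth_fun_on M U g" unfolding g_def
  by (intro smooth_fun_on_mult assms Cinf_smooth b)
 moreover have "smooth_fun_on M (- K) g"
  using smooth_fun_on_const[of M "- K" 0] smooth_fun_on_cong[of "- K" g "%_. 0"] b(8) by (auto simp: g_def)
 ultimately have "g : Cinf M"
  using assms(1) b by (intro CinfI_local) (metis ComplI open_Compl subsetD)
 then show ?thesis using that[of g V] b by (auto simp: g_def)
qed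

end

section \<open>Sections of vector bundles\<close>

text \<open>A form has values in the real vector space of functions on lists, so this single
  operation multiplies functions, sections and forms by functions.\<close>

definition sc :: "('m => real) => ('m => 'v::real_vector) => 'm => 'v" where
 "sc f s = (%x. f x *\<^sub>R s x)"

lemma sc_apply: "sc f s x = f x *\<^sub>R s x"
 by (simp add: sc_def)

lemma sc_real: "sc f g = f * g"
 by (simp add: sc_def fun_eq_iff)

lemma scaleR_fun_apply: "(c *\<^sub>R s) x = c *\<^sub>R s x"
 by (simp add: scaleR_fun_def)

lemma scaleR_conv_sc: "c *\<^sub>R s = sc (%_. c) s"
 by (simp add: sc_def scaleR_fun_def)

lemma sum_fun_apply: "(\<Sum>i\<in>I. s i) x = (\<Sum>i\<in>I. s i x :: 'v::ab_group_add)"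
 by (induction I rule: infinite_finite_induct) auto

lemma independent_nth:
 assumes "distinct vs" "independent (set vs)" "(\<Sum>j<length vs. c j *\<^sub>R vs ! j) = 0" "j < length vs"
 shows "c j = 0"
proof -
 define u where "u v = c (inv_into {..<length vs} ((!) vs) v)" for v
 have b: "bij_betw ((!) vs) {..<length vs} (set vs)" using assms(1) by (intro bij_betw_nth) auto
 have u: "u (vs ! i) = c i" if "i < length vs" for i
  using b that by (simp add: u_def bij_betw_def inv_into_f_f)
 have "(\<Sum>v\<in>set vs. u v *\<^sub>R v) = 0"
  using assms(3) by (simp add: sum.reindex_bij_betw[OF b, symmetric] u)
 from independentD[OF assms(2) _ _ this] show ?thesis using u[OF assms(4)] assms(4) by auto
qed

lemma span_nth:
 assumes "v : span (set vs)" "distinct vs"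
 obtains c where "v = (\<Sum>j<length vs. c j *\<^sub>R vs ! j)"
proof -
 from assms(1) obtain u where u: "v = (\<Sum>w\<in>set vs. u w *\<^sub>R w)" by (auto simp: span_finite)
 have b: "bij_betw ((!) vs) {..<length vs} (set vs)" using assms(2) by (intro bij_betw_nth) auto
 have "v = (\<Sum>j<length vs. u (vs ! j) *\<^sub>R vs ! j)"
  unfolding u by (simp add: sum.reindex_bij_betw[OF b, symmetric])
 then show ?thesis by (rule that)
qed

lemma smooth_section_on_subset: "smooth_section_on M E U s ==> V <= U ==> smooth_section_on M E V s"
proof -
 assume s: "smooth_section_on M E U s" and V: "V <= U"
 have "\<exists>c. (\<forall>j<length ts. smooth_fun_on M (V \<inter> W) (c j)) &
    (ALL x:V \<inter> W. s x = (\<Sum>j<length ts. c j x *\<^sub>R (ts ! j) x))" if f: "(W, ts) : frames E" for W ts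
 proof -
  from s f obtain c where "\<forall>j<length ts. smooth_fun_on M (U \<inter> W) (c j)"
    "ALL x:U \<inter> W. s x = (\<Sum>j<length ts. c j x *\<^sub>R (ts ! j) x)"
   unfolding smooth_section_on_def by auto
  with V show ?thesis by (intro exI[of _ c]) (auto intro: smooth_fun_on_subset[of _ "U \<inter> W"])
 qed
 then show ?thesis using s V unfolding smooth_section_on_def by auto
qed

context mfd
begin

context
 fixes E :: "('m, 'e::real_vector) vbundle"
 assumes E: "vector_bundle M E"
begin

lemma frame_at: obtains U ts where "(U, ts) : frames E" "x : U"
proof -
 have "(\<Union>(U, ts)\<in>frames E. U) = UNIV" using E by (simp add: vector_bundle_def)
 then have "x : (\<Union>(U, ts)\<in>frames E. U)" by simp
 then show ?thesis using that by auto
qed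

lemma frameD:
 assumes "(U, ts) : frames E"
 shows "open U" "!!x. x : U ==> distinct (map (%t. t x) ts)"
  "!!x. x : U ==> independent (set (map (%t. t x) ts))"
  "!!x. x : U ==> span (set (map (%t. t x) ts)) = fib E x"
  "!!t. t : set ts ==> smooth_section_on M E U t"
proof -
 have *: "open U & (ALL x:U. distinct (map (%t. t x) ts) & independent (set (map (%t. t x) ts)) &
        span (set (map (%t. t x) ts)) = fib E x) & (ALL t:set ts. smooth_section_on M E U t)"
  using bspec[OF conjunct2[OF E[unfolded vector_bundle_def]] assms] by simp
 show "open U" "!!x. x : U ==> distinct (map (%t. t x) ts)"
  "!!x. x : U ==> independent (set (map (%t. t x) ts))"
  "!!x. x : U ==> span (set (map (%t. t x) ts)) = fib E x"
  "!!t. t : set ts ==> smooth_section_on M E U t"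
  using * by blast+
qed

lemma subspace_fib: "subspace (fib E x)"
proof -
 obtain U ts where "(U, ts) : frames E" "x : U" using frame_at .
 then show ?thesis using frameD(4) subspace_span by metis
qed

lemma frame_unique:
 assumes "(U, ts) : frames E" "x : U" "j < length ts"
  "(\<Sum>j<length ts. c j *\<^sub>R (ts ! j) x) = (\<Sum>j<length ts. d j *\<^sub>R (ts ! j) x)"
 shows "c j = d j"
proof -
 have "(\<Sum>j<length (map (%t. t x) ts). (c j - d j) *\<^sub>R (map (%t. t x) ts) ! j) = 0"
  using assms(4) by (simp add: scaleR_diff_left sum_subtractf)
 from independent_nth[OF frameD(2)[OF assms(1,2)] frameD(3)[OF assms(1,2)] this, of j]
 show ?thesis using assms(3) by auto
qed

lemma frame_span:
 assumes "(U, ts) : frames E" "x : U" "v : fib E x"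
 obtains c where "v = (\<Sum>j<length ts. c j *\<^sub>R (ts ! j) x)"
proof -
 have "v : span (set (map (%t. t x) ts))" using frameD(4)[OF assms(1,2)] assms(3) by simp
 from span_nth[OF this frameD(2)[OF assms(1,2)]] obtain c
  where "v = (\<Sum>j<length (map (%t. t x) ts). c j *\<^sub>R map (%t. t x) ts ! j)" .
 then show ?thesis using that[of c] by simp
qed

lemma sec_fib: "smooth_section_on M E U s ==> x : U ==> s x : fib E x"
 by (simp add: smooth_section_on_def)

lemma sec_coeff:
 assumes "smooth_section_on M E U s" "(W, ts) : frames E"
 obtains c where "!!j. j < length ts ==> smooth_fun_on M (U \<inter> W) (c j)"
  "!!x. x : U ==> x : W ==> s x = (\<Sum>j<length ts. c j x *\<^sub>R (ts ! j) x)"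
proof -
 have "\<exists>c. (\<forall>j<length ts. smooth_fun_on M (U \<inter> W) (c j)) &
    (ALL x:U \<inter> W. s x = (\<Sum>j<length ts. c j x *\<^sub>R (ts ! j) x))"
  using assms unfolding smooth_section_on_def by fast
 then show ?thesis using that by blast
qed

lemma secI:
 assumes "!!x. x : U ==> s x : fib E x"
  "!!W ts. (W, ts) : frames E ==> \<exists>c. (\<forall>j<length ts. smooth_fun_on M (U \<inter> W) (c j)) &
    (ALL x:U \<inter> W. s x = (\<Sum>j<length ts. c j x *\<^sub>R (ts ! j) x))"
 shows "smooth_section_on M E U s"
 using assms unfolding smooth_section_on_def by auto

lemma sec_cong: "smooth_section_on M E U s ==> (!!x. x : U ==> s x = t x) ==> smooth_section_on M E U t"
proof -
 assume s: "smooth_section_on M E U s" and e: "!!x. x : U ==> s x = t x"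
 show ?thesis
 proof (rule secI)
  show "t x : fib E x" if "x : U" for x using e[OF that] sec_fib[OF s that] by simp
  fix W ts assume f: "(W, ts) : frames E"
  from sec_coeff[OF s f] obtain c where "!!j. j < length ts ==> smooth_fun_on M (U \<inter> W) (c j)"
   "!!x. x : U ==> x : W ==> s x = (\<Sum>j<length ts. c j x *\<^sub>R (ts ! j) x)" by blast
  then show "\<exists>c. (\<forall>j<length ts. smooth_fun_on M (U \<inter> W) (c j)) &
    (ALL x:U \<inter> W. t x = (\<Sum>j<length ts. c j x *\<^sub>R (ts ! j) x))"
   using e by (intro exI[of _ c]) auto
 qed
qed

lemma sec_add:
 assumes "smooth_section_on M E U s" "smooth_section_on M E U t"
 shows "smooth_section_on M E U (s + t)"
proof (rule secI)
 fix W ts assume f: "(W, ts) : frames E"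
 from sec_coeff[OF assms(1) f] obtain c where c: "!!j. j < length ts ==> smooth_fun_on M (U \<inter> W) (c j)"
  "!!x. x : U ==> x : W ==> s x = (\<Sum>j<length ts. c j x *\<^sub>R (ts ! j) x)" by blast
 from sec_coeff[OF assms(2) f] obtain d where d: "!!j. j < length ts ==> smooth_fun_on M (U \<inter> W) (d j)"
  "!!x. x : U ==> x : W ==> t x = (\<Sum>j<length ts. d j x *\<^sub>R (ts ! j) x)" by blast
 show "\<exists>c. (\<forall>j<length ts. smooth_fun_on M (U \<inter> W) (c j)) &
    (ALL x:U \<inter> W. (s + t) x = (\<Sum>j<length ts. c j x *\<^sub>R (ts ! j) x))"
  by (rule exI[of _ "%j x. c j x + d j x"])
    (auto simp: c d scaleR_add_left sum.distrib intro: smooth_fun_on_add)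
qed (use assms sec_fib subspace_add[OF subspace_fib] in auto)

lemma sec_sc:
 assumes "smooth_fun_on M U f" "smooth_section_on M E U s"
 shows "smooth_section_on M E U (sc f s)"
proof (rule secI)
 fix W ts assume f: "(W, ts) : frames E"
 from sec_coeff[OF assms(2) f] obtain c where c: "!!j. j < length ts ==> smooth_fun_on M (U \<inter> W) (c j)"
  "!!x. x : U ==> x : W ==> s x = (\<Sum>j<length ts. c j x *\<^sub>R (ts ! j) x)" by blast
 show "\<exists>c. (\<forall>j<length ts. smooth_fun_on M (U \<inter> W) (c j)) &
    (ALL x:U \<inter> W. sc f s x = (\<Sum>j<length ts. c j x *\<^sub>R (ts ! j) x))"
  by (rule exI[of _ "%j x. f x * c j x"])
    (auto simp: sc_def c scaleR_sum_right intro!: smooth_fun_on_mult intro: smooth_fun_on_subset[OF assms(1)])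
qed (use assms sec_fib subspace_scale[OF subspace_fib] in \<open>auto simp: sc_def\<close>)

lemma sec_zero: "smooth_section_on M E U 0"
 by (rule secI) (auto intro: subspace_0[OF subspace_fib] exI[of _ "%_ _. 0"] smooth_fun_on_const)

lemma sec_sum: "(!!i. i : I ==> smooth_section_on M E U (s i)) ==> smooth_section_on M E U (\<Sum>i\<in>I. s i)"
 by (induction I rule: infinite_finite_induct) (auto intro: sec_zero sec_add)

lemma sec_local:
 assumes "!!x. x : U ==> \<exists>V. open V & x : V & smooth_section_on M E (V \<inter> U) s"
 shows "smooth_section_on M E U s"
proof (rule secI)
 show "s x : fib E x" if "x : U" for x
  using assms[OF that] that by (auto dest: sec_fib)
 fix W ts assume f: "(W, ts) : frames E"
 \<comment> \<open>The coefficients are chosen pointwise. By uniqueness they agree with any smooth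
   local coefficients, so their smoothness can be read off locally.\<close>
 define c where "c j x = (SOME c. s x = (\<Sum>j<length ts. c j *\<^sub>R (ts ! j) x)) j" for j x
 have c: "s x = (\<Sum>j<length ts. c j x *\<^sub>R (ts ! j) x)" if xU: "x : U" and xW: "x : W" for x
 proof -
  obtain d where "s x = (\<Sum>j<length ts. d j *\<^sub>R (ts ! j) x)"
   using frame_span[OF f xW \<open>!!x. x : U ==> s x : fib E x\<close>[OF xU]] .
  then show ?thesis unfolding c_def by (rule someI[of "%c. s x = (\<Sum>j<length ts. c j *\<^sub>R (ts ! j) x)"])
 qed
 have "smooth_fun_on M (U \<inter> W) (c j)" if j: "j < length ts" for j
 proof (rule smooth_fun_on_local)
  fix x assume x: "x : U \<inter> W"
  with assms obtain V where V: "open V" "x : V" "smooth_section_on M E (V \<inter> U) s" by blast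
  from sec_coeff[OF V(3) f] obtain d where d: "!!j. j < length ts ==> smooth_fun_on M (V \<inter> U \<inter> W) (d j)"
   "!!x. x : V \<inter> U ==> x : W ==> s x = (\<Sum>j<length ts. d j x *\<^sub>R (ts ! j) x)" by blast
  have "d j y = c j y" if "y : V \<inter> U \<inter> W" for y
   by (rule frame_unique[OF f _ j]) (use c[of y] d(2)[of y] that in auto)
  then have "smooth_fun_on M (V \<inter> (U \<inter> W)) (c j)"
   using d(1)[OF j] smooth_fun_on_cong[of "V \<inter> U \<inter> W" "d j" "c j"] by (simp add: Int_assoc)
  then show "\<exists>V. open V & x : V & smooth_fun_on M (V \<inter> (U \<inter> W)) (c j)" using V by blast
 qed
 then show "\<exists>c. (\<forall>j<length ts. smooth_fun_on M (U \<inter> W) (c j)) &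
    (ALL x:U \<inter> W. s x = (\<Sum>j<length ts. c j x *\<^sub>R (ts ! j) x))"
  using c by (intro exI[of _ c]) auto
qed

lemma sections_on: "s : sections M E ==> smooth_section_on M E U s"
 by (auto simp: sections_def intro: smooth_section_on_subset)

lemma sectionsI_local:
 assumes "!!x. \<exists>V. open V & x : V & smooth_section_on M E V s"
 shows "s : sections M E"
 unfolding sections_def using sec_local[of UNIV s] assms by auto

lemma sections_eq_local:
 assumes "!!x. \<exists>V t. open V & x : V & t : sections M E & (ALL y:V. s y = t y)"
 shows "s : sections M E"
proof (rule sectionsI_local)
 fix x
 from assms obtain V t where *: "open V" "x : V" "t : sections M E" "!!y. y : V ==> s y = t y" by metis
 have "smooth_section_on M E V s" by (rule sec_cong[OF sections_on[OF *(3)]]) (simp add: *)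
 then show "\<exists>V. open V & x : V & smooth_section_on M E V s" using * by blast
qed

lemma sections_fib: "s : sections M E ==> s x : fib E x"
 by (auto simp: sections_def intro: sec_fib)

lemma sections_add: "s : sections M E ==> t : sections M E ==> s + t : sections M E"
 by (auto simp: sections_def intro: sec_add)

lemma sections_zero: "0 : sections M E"
 by (auto simp: sections_def intro: sec_zero)

lemma sections_sc: "f : Cinf M ==> s : sections M E ==> sc f s : sections M E"
 by (auto simp: sections_def intro: sec_sc Cinf_smooth)

lemma sections_scaleR: "s : sections M E ==> c *\<^sub>R s : sections M E"
 unfolding scaleR_conv_sc by (intro sections_sc Cinf_const)

lemma sections_uminus: "s : sections M E ==> - s : sections M E"
 using sections_scaleR[of s "- 1"] by simp

lemma sections_diff: "s : sections M E ==> t : sections M E ==> s - t : sections M E"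
 using sections_add[of s "- t"] sections_uminus[of t] by simp

lemma sections_sum: "(!!i. i : I ==> s i : sections M E) ==> (\<Sum>i\<in>I. s i) : sections M E"
 by (auto simp: sections_def intro: sec_sum)

lemma extend_section:
 assumes "open U" "x : U" "smooth_section_on M E U s"
 obtains t V where "t : sections M E" "open V" "x : V" "V <= U" "ALL y:V. t y = s y"
proof -
 obtain chi V K where b: "chi : Cinf M" "open V" "x : V" "V <= K" "!!y. y : V ==> chi y = 1" "closed K" "K <= U"
  "!!y. y \<notin> K ==> chi y = 0"
  using bump[OF assms(1,2)] by blast
 have "smooth_section_on M E U (sc chi s)"
  by (intro sec_sc assms Cinf_smooth b)
 moreover have "smooth_section_on M E (- K) (sc chi s)"
  by (rule sec_cong[OF sec_zero]) (use b(8) in \<open>auto simp: sc_def\<close>)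
 ultimately have "sc chi s : sections M E"
  using assms(1) b by (intro sectionsI_local) (metis ComplI open_Compl subsetD)
 then show ?thesis using that[of "sc chi s" V] b by (auto simp: sc_def)
qed

lemma section_through:
 assumes "v : fib E x"
 obtains s where "s : sections M E" "s x = v"
proof -
 obtain U ts where f: "(U, ts) : frames E" "x : U" using frame_at .
 obtain c where c: "v = (\<Sum>j<length ts. c j *\<^sub>R (ts ! j) x)" using frame_span[OF f assms] .
 have "smooth_section_on M E U (\<Sum>j<length ts. sc (%_. c j) (ts ! j))"
  by (intro sec_sum sec_sc smooth_fun_on_const frameD(5)[OF f(1)]) auto
 from extend_section[OF frameD(1)[OF f(1)] f(2) this] obtain t V where
  "t : sections M E" "open V" "x : V" "V <= U" "ALL y:V. t y = (\<Sum>j<length ts. sc (%_. c j) (ts ! j)) y" .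
 then show ?thesis using that[of t] c by (simp add: sum_fun_apply sc_def)
qed

text \<open>Frames of a bundle are local, whereas forms, brackets and derivations act on global
  sections. Each member is extended from a smaller neighbourhood; spanning is kept around
  \<open>x\<close>, while independence is recorded at \<open>x\<close> only, which is what
  Gram--Schmidt below consumes.\<close>

lemma global_frame_at:
 obtains ts V where "set ts <= sections M E" "open V" "x : V"
  "!!y. y : V ==> fib E y = span ((%t. t y) ` set ts)"
  "distinct (map (%t. t x) ts)" "independent ((%t. t x) ` set ts)"
proof -
 obtain U ts where f: "(U, ts) : frames E" "x : U" using frame_at .
 have "\<exists>t' V. t' : sections M E & open V & x : V & V <= U & (ALL y:V. t' y = t y)" if "t : set ts" for t
 proof -
  from extend_section[OF frameD(1)[OF f(1)] f(2) frameD(5)[OF f(1) that]] obtain t' V where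
   "t' : sections M E" "open V" "x : V" "V <= U" "ALL y:V. t' y = t y" .
  then show ?thesis by blast
 qed
 then obtain g V where g: "!!t. t : set ts ==> g t : sections M E & open (V t) & x : V t & V t <= U & (ALL y:V t. g t y = t y)"
  by metis
 define W where "W = U \<inter> (\<Inter>t\<in>set ts. V t)"
 have W: "open W" "x : W" using g f(2) frameD(1)[OF f(1)] by (auto simp: W_def)
 have gy: "map (%t. t y) (map g ts) = map (%t. t y) ts" if "y : W" for y
  using g that by (auto simp: W_def)
 have gy': "(%t. t y) ` set (map g ts) = set (map (%t. t y) ts)" if "y : W" for y
  using gy[OF that] by (metis set_map)
 show ?thesis
 proof (rule that[of "map g ts" W])
  show "set (map g ts) <= sections M E" using g by auto
  show "distinct (map (%t. t x) (map g ts))" unfolding gy[OF W(2)] using frameD(2)[OF f] .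
  show "independent ((%t. t x) ` set (map g ts))" unfolding gy'[OF W(2)] using frameD(3)[OF f] .
  show "fib E y = span ((%t. t y) ` set (map g ts))" if "y : W" for y
   unfolding gy'[OF that] using frameD(4)[OF f(1)] that by (auto simp: W_def)
 qed (use W in auto)
qed

end

lemma trivial_line_bundle: "vector_bundle M trivial_line"
 by (auto simp: vector_bundle_def trivial_line_def smooth_section_on_def span_singleton
   intro!: exI[of _ "%_ _. 1"] smooth_fun_on_const)

lemma sections_trivial_line: "sections M trivial_line = Cinf M"
proof
 show "sections M trivial_line <= Cinf M"
 proof
  fix s assume "s : sections M trivial_line"
  then obtain c where "smooth_fun_on M UNIV (c (0::nat))" "!!x. s x = c 0 x"
   by (auto simp: sections_def smooth_section_on_def trivial_line_def)
  then show "s : Cinf M" using smooth_fun_on_cong[of UNIV s "c 0"] by (simp add: Cinf_def)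
 qed
 show "Cinf M <= sections M trivial_line"
 proof
  fix s assume "s : Cinf M"
  then show "s : sections M trivial_line"
   by (auto simp: sections_def smooth_section_on_def trivial_line_def Cinf_def intro!: exI[of _ "%_. s"])
 qed
qed

text \<open>The coordinate functional of a local generator, multiplied by a bump function. It is
  thus defined and smooth on the whole manifold, is linear on every fibre, and inverts
  \<open>lam\<close> near \<open>x\<close> only.\<close>

lemma line_frame:
 fixes L :: "('m, 'l::real_vector) vbundle"
 assumes "line_bundle M L"
 obtains lam nu V where "lam : sections M L" "open V" "x : V"
  "!!y. y : V ==> nu y (lam y) = 1" "!!y l. y : V ==> l : fib L y ==> nu y l *\<^sub>R lam y = l"
  "!!s. s : sections M L ==> (%y. nu y (s y)) : Cinf M"
  "!!y l l' c. l : fib L y ==> l' : fib L y ==> nu y (c *\<^sub>R l + l') = (c * nu y l + nu y l' :: real)"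
proof -
 have L: "vector_bundle M L" "!!x. dim (fib L x) = 1" using assms by (auto simp: line_bundle_def)
 obtain U ts where f: "(U, ts) : frames L" "x : U" using frame_at[OF L(1)] .
 have "dim (fib L x) = card (set (map (%t. t x) ts))"
  using frameD(3,4)[OF L(1) f] by (metis dim_span dim_eq_card_independent)
 also have "\<dots> = length ts" using frameD(2)[OF L(1) f] distinct_card by fastforce
 finally have "length ts = Suc 0" using L(2) by simp
 then obtain t where ts: "ts = [t]" by (auto simp: length_Suc_conv)
 note f = f[unfolded ts]
 have t0: "t y ~= 0" if "y : U" for y using frameD(3)[OF L(1) f(1) that] dependent_zero by auto
 have ex: "\<exists>r. l = r *\<^sub>R t y" if "y : U" "l : fib L y" for y l
  using frame_span[OF L(1) f(1) that] by auto
 obtain chi V K where b: "chi : Cinf M" "open V" "x : V" "V <= K" "!!y. y : V ==> chi y = 1" "closed K" "K <= U"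
  "!!y. y \<notin> K ==> chi y = 0"
  using bump[OF frameD(1)[OF L(1) f(1)] f(2)] by blast
 have "t : set [t]" by simp
 from extend_section[OF L(1) frameD(1)[OF L(1) f(1)] f(2) frameD(5)[OF L(1) f(1) this]]
 obtain lam V' where lam: "lam : sections M L" "open V'" "x : V'" "V' <= U" "ALL y:V'. lam y = t y" .
 define co where "co y l = (SOME r. l = r *\<^sub>R t y)" for y l
 have co: "l = co y l *\<^sub>R t y" if "y : U" "l : fib L y" for y l
  unfolding co_def using ex[OF that] by (rule someI_ex)
 have co_eq: "co y l = r" if "y : U" "l = r *\<^sub>R t y" for y l r
  unfolding co_def using t0[OF that(1)] that(2) by (intro some_equality) auto
 define nu where "nu y l = (if y : U then chi y * co y l else 0)" for y l
 show ?thesis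
 proof (rule that[of lam "V \<inter> V'" nu])
  fix y assume y: "y : V \<inter> V'"
  then have yU: "y : U" using lam by auto
  show "nu y (lam y) = 1" using co_eq[OF yU, of "lam y" 1] y lam b yU by (simp add: nu_def)
  show "nu y l *\<^sub>R lam y = l" if "l : fib L y" for l
   using co[OF yU that] y lam b yU by (simp add: nu_def)
 next
  fix y l l' c assume l: "l : fib L y" "l' : fib L y"
  show "nu y (c *\<^sub>R l + l') = (c * nu y l + nu y l' :: real)"
  proof (cases "y : U")
   case True
   have "co y (c *\<^sub>R l + l') = c * co y l + co y l'"
    by (rule co_eq[OF True]) (metis co[OF True l(1)] co[OF True l(2)] scaleR_left_distrib scaleR_scaleR)
   then show ?thesis by (simp add: nu_def algebra_simps)
  qed (simp add: nu_def)
 next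
  fix s assume s: "s : sections M L"
  from sec_coeff[OF L(1) sections_on[OF L(1) s, of U] f(1)] obtain c where
   c: "smooth_fun_on M U (c (0::nat))" "!!y. y : U ==> s y = c 0 y *\<^sub>R t y" by auto
  have "smooth_fun_on M U (%y. chi y * c 0 y)" by (intro smooth_fun_on_mult c Cinf_smooth b)
  then have "smooth_fun_on M U (%y. nu y (s y))"
   by (rule smooth_fun_on_cong[THEN iffD1, rotated]) (use c co_eq[OF _ c(2)] in \<open>simp add: nu_def\<close>)
  moreover have "smooth_fun_on M (- K) (%y. nu y (s y))"
   using smooth_fun_on_const[of M "- K" 0] smooth_fun_on_cong[of "- K" "%y. nu y (s y)" "%_. 0"] b(8) by (auto simp: nu_def)
  ultimately show "(%y. nu y (s y)) : Cinf M"
   using frameD(1)[OF L(1) f(1)] b by (intro CinfI_local) (metis ComplI open_Compl subsetD)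
 qed (use b lam in auto)
qed

end

section \<open>The wedge product of functions on lists\<close>

text \<open>Identities of wedge products are proved by induction along the contraction with the first
 entry, under which the wedge product satisfies a Leibniz rule. No alternation is needed for this.\<close>

definition ins :: "'e => ('e list => 'v) => 'e list => 'v" where
 "ins v f = (%us. f (v # us))"

text \<open>The parity operator. It supplies the sign of the graded Leibniz rule without a degree
  having to be fixed.\<close>

definition sgl :: "('e list => 'v::real_vector) => 'e list => 'v" where
 "sgl f = (%us. (- 1) ^ length us *\<^sub>R f us)"

lemma alt_wedge_Nil: "alt_wedge f g [] = f [] *\<^sub>R g []"
 by (simp add: alt_wedge_def shuffle_sign_def)

text \<open>Position 0 in the first factor has nothing to its left and causes no inversion; shifting
  by one is a bijection of the remaining inversions.\<close>

lemma shuffle_sign_insert: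
 assumes "I <= {..<n}"
 shows "shuffle_sign (Suc n) (insert 0 (Suc ` I)) = shuffle_sign n I"
proof -
 have "{(i, j). i : insert 0 (Suc ` I) & j : {..<Suc n} - insert 0 (Suc ` I) & j < i}
  = map_prod Suc Suc ` {(i, j). i : I & j : {..<n} - I & j < i}"
 proof (rule set_eqI)
  fix p :: "nat \<times> nat"
  obtain i j where p: "p = (i, j)" by (cases p)
  show "p : {(i, j). i : insert 0 (Suc ` I) & j : {..<Suc n} - insert 0 (Suc ` I) & j < i}
   \<longleftrightarrow> p : map_prod Suc Suc ` {(i, j). i : I & j : {..<n} - I & j < i}"
   unfolding p by (cases i; cases j) (auto simp: image_iff)
 qed
 moreover have "inj_on (map_prod Suc Suc) X" for X by (auto simp: inj_on_def)
 ultimately show ?thesis by (simp add: shuffle_sign_def card_image)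
qed

text \<open>If position 0 goes to the second factor, every element of \<open>I\<close> gains exactly
  one inversion with it, whence the power \<open>card I\<close>.\<close>

lemma shuffle_sign_Suc:
 assumes "I <= {..<n}"
 shows "shuffle_sign (Suc n) (Suc ` I) = (- 1) ^ card I * shuffle_sign n I"
proof -
 let ?X = "{(i, j). i : I & j : {..<n} - I & j < i}"
 have "{(i, j). i : Suc ` I & j : {..<Suc n} - Suc ` I & j < i}
  = map_prod Suc Suc ` ?X \<union> (%i. (Suc i, 0)) ` I"
 proof (rule set_eqI)
  fix p :: "nat \<times> nat"
  obtain i j where p: "p = (i, j)" by (cases p)
  show "p : {(i, j). i : Suc ` I & j : {..<Suc n} - Suc ` I & j < i}
   \<longleftrightarrow> p : map_prod Suc Suc ` ?X \<union> (%i. (Suc i, 0)) ` I"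
   unfolding p by (cases i; cases j) (auto simp: image_iff)
 qed
 moreover have "inj_on (map_prod Suc Suc) ?X" "inj_on (%i. (Suc i, 0::nat)) I" by (auto simp: inj_on_def)
 moreover have fin: "finite ?X" "finite I"
  by (rule finite_subset[of _ "{..<n} \<times> {..<n}"]) (use assms finite_subset in auto)
 moreover have "map_prod Suc Suc ` ?X \<inter> (%i. (Suc i, 0)) ` I = {}" by auto
 ultimately show ?thesis
  by (simp add: shuffle_sign_def card_Un_disjoint card_image power_add mult.commute)
qed

lemma Pow_lessThan_Suc:
 "Pow {..<Suc n} = (%I. insert 0 (Suc ` I)) ` Pow {..<n} \<union> (%I. Suc ` I) ` Pow {..<n}"
proof -
 have "Pow (Suc ` {..<n}) = (%I. Suc ` I) ` Pow {..<n}"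
  using image_Pow_surj[of Suc "{..<n}", OF refl] by simp
 then show ?thesis by (simp only: lessThan_Suc_eq_insert_0 Pow_insert image_image Un_commute)
qed

text \<open>The sets of positions split according to whether they contain the first position. This
  is the Leibniz rule of contraction, for arbitrary functions on lists.\<close>

lemma alt_wedge_Cons:
 "alt_wedge f g (v # vs) = alt_wedge (ins v f) g vs + alt_wedge (sgl f) (ins v g) vs"
proof -
 let ?n = "length vs"
 let ?t = "%I. (shuffle_sign (Suc ?n) I * f (nths (v # vs) I)) *\<^sub>R g (nths (v # vs) (- I))"
 have c: "{j. Suc j : - I} = - {j. Suc j : I}" "{j. Suc j : insert 0 (Suc ` J)} = J"
  "{j. Suc j : Suc ` J} = J" for I J by auto
 have "alt_wedge f g (v # vs) = (\<Sum>I\<in>Pow {..<Suc ?n}. ?t I)"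
  by (simp add: alt_wedge_def)
 also have "\<dots> = (\<Sum>I\<in>(%I. insert 0 (Suc ` I)) ` Pow {..<?n}. ?t I) + (\<Sum>I\<in>(%I. Suc ` I) ` Pow {..<?n}. ?t I)"
  unfolding Pow_lessThan_Suc by (rule sum.union_disjoint) auto
 also have "(\<Sum>I\<in>(%I. insert 0 (Suc ` I)) ` Pow {..<?n}. ?t I) = (\<Sum>I\<in>Pow {..<?n}. ?t (insert 0 (Suc ` I)))"
  by (rule sum.reindex[unfolded o_def]) (auto simp: inj_on_def)
 also have "\<dots> = alt_wedge (ins v f) g vs"
  unfolding alt_wedge_def
 proof (rule sum.cong)
  fix I assume I: "I : Pow {..<?n}"
  show "?t (insert 0 (Suc ` I)) = (shuffle_sign ?n I * ins v f (nths vs I)) *\<^sub>R g (nths vs (- I))"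
   using I by (simp only: nths_Cons c shuffle_sign_insert Pow_iff ins_def) simp
 qed simp
 also have "(\<Sum>I\<in>(%I. Suc ` I) ` Pow {..<?n}. ?t I) = (\<Sum>I\<in>Pow {..<?n}. ?t (Suc ` I))"
  by (rule sum.reindex[unfolded o_def]) (auto simp: inj_on_def)
 also have "\<dots> = alt_wedge (sgl f) (ins v g) vs"
  unfolding alt_wedge_def
 proof (rule sum.cong)
  fix I assume I: "I : Pow {..<?n}"
  then have "{i. i < ?n & i : I} = I" by auto
  then have l: "length (nths vs I) = card I" by (simp add: length_nths)
  have "0 \<notin> Suc ` I" by auto
  then show "?t (Suc ` I) = (shuffle_sign ?n I * sgl f (nths vs I)) *\<^sub>R ins v g (nths vs (- I))"
   using I by (simp only: nths_Cons c shuffle_sign_Suc Pow_iff ins_def sgl_def l) simp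
 qed simp
 finally show ?thesis .
qed

lemma alt_wedge_add_left: "alt_wedge (f + g) h = alt_wedge f h + alt_wedge g h"
 by (auto simp: alt_wedge_def fun_eq_iff distrib_left scaleR_add_left sum.distrib)

lemma alt_wedge_add_right: "alt_wedge f (g + h) = alt_wedge f g + alt_wedge f h"
 by (auto simp: alt_wedge_def fun_eq_iff scaleR_add_right sum.distrib)

lemma alt_wedge_scale_left: "alt_wedge (c *\<^sub>R f) h = c *\<^sub>R alt_wedge f h"
 by (auto simp: alt_wedge_def fun_eq_iff scaleR_fun_def scaleR_sum_right intro!: sum.cong)

lemma alt_wedge_scale_right: "alt_wedge f (c *\<^sub>R h) = c *\<^sub>R alt_wedge f h"
 by (auto simp: alt_wedge_def fun_eq_iff scaleR_fun_def scaleR_sum_right intro!: sum.cong)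

lemma alt_wedge_zero: "alt_wedge 0 h = 0" "alt_wedge f 0 = 0" "alt_wedge (%_. 0) h = 0" "alt_wedge f (%_. 0) = 0"
 by (auto simp: alt_wedge_def fun_eq_iff)

lemma ins_add: "ins v (f + g) = ins v f + ins v g"
 and ins_scale: "ins v (c *\<^sub>R f) = c *\<^sub>R ins v f"
 and sgl_add: "sgl (f + g) = sgl f + sgl g"
 and sgl_scale: "sgl (c *\<^sub>R f) = c *\<^sub>R sgl f"
 and ins_zero: "ins v 0 = 0" and sgl_zero: "sgl 0 = 0"
 by (auto simp: ins_def sgl_def fun_eq_iff scaleR_fun_def scaleR_add_right)

lemma ins_sgl: "ins v (sgl f) = - sgl (ins v f)"
 by (auto simp: ins_def sgl_def fun_eq_iff)

lemma alt_wedge_uminus_left: "alt_wedge (- f) h = - alt_wedge f h"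
 using alt_wedge_scale_left[of "- 1"] by simp

lemma alt_wedge_uminus_right: "alt_wedge f (- h) = - alt_wedge f h"
 using alt_wedge_scale_right[of f "- 1"] by simp

lemma ins_alt_wedge: "ins v (alt_wedge f g) = alt_wedge (ins v f) g + alt_wedge (sgl f) (ins v g)"
 by (auto simp: ins_def[of v "alt_wedge f g"] alt_wedge_Cons)

lemma sgl_alt_wedge: "sgl (alt_wedge f g) = alt_wedge (sgl f) (sgl g)"
proof
 show "sgl (alt_wedge f g) vs = alt_wedge (sgl f) (sgl g) vs" for vs
 proof (induction vs arbitrary: f g)
  case (Cons v vs)
  have "sgl (alt_wedge f g) (v # vs) = - sgl (ins v (alt_wedge f g)) vs"
   by (simp add: sgl_def ins_def)
  also have "\<dots> = - alt_wedge (sgl (ins v f)) (sgl g) vs - alt_wedge (sgl (sgl f)) (sgl (ins v g)) vs"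
   unfolding ins_alt_wedge sgl_add by (simp add: Cons.IH)
  finally show ?case
   by (simp add: alt_wedge_Cons ins_sgl alt_wedge_uminus_left alt_wedge_uminus_right)
 qed (simp add: alt_wedge_Nil sgl_def)
qed

lemma alt_wedge_assoc: "alt_wedge (alt_wedge f g) h = alt_wedge f (alt_wedge g h)"
proof
 show "alt_wedge (alt_wedge f g) h vs = alt_wedge f (alt_wedge g h) vs" for vs
 proof (induction vs arbitrary: f g h)
  case (Cons v vs)
  then show ?case
   by (simp add: alt_wedge_Cons ins_alt_wedge sgl_alt_wedge alt_wedge_add_left alt_wedge_add_right)
 qed (simp add: alt_wedge_Nil)
qed

definition of_degree :: "nat => ('e list => 'v::zero) => bool" where
 "of_degree p f \<longleftrightarrow> (\<forall>vs. length vs ~= p --> f vs = 0)"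

lemma of_degree_ins: "of_degree (Suc p) f ==> of_degree p (ins v f)" "of_degree 0 f ==> ins v f = 0"
 by (auto simp: of_degree_def ins_def fun_eq_iff)

lemma sgl_of_degree: "of_degree p f ==> sgl f = (- 1) ^ p *\<^sub>R f"
 by (auto simp: of_degree_def sgl_def fun_eq_iff scaleR_fun_def)

text \<open>Induction over the argument list: the two Leibniz summands change places, and each pays
  the sign for moving past the factor that is not contracted.\<close>

lemma alt_wedge_comm:
 assumes "of_degree p f" "of_degree q g"
 shows "alt_wedge f g = (- 1) ^ (p * q) *\<^sub>R alt_wedge g f"
proof
 show "alt_wedge f g vs = ((- 1) ^ (p * q) *\<^sub>R alt_wedge g f) vs" for vs
  using assms
 proof (induction vs arbitrary: f g p q)
  case Nil
  then show ?case by (cases p; cases q) (auto simp: alt_wedge_Nil scaleR_fun_def of_degree_def)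
 next
  case (Cons v vs)
  have 1: "alt_wedge (ins v f) g vs = (- 1) ^ (p * q) *\<^sub>R alt_wedge (sgl g) (ins v f) vs"
  proof (cases p)
   case 0
   then show ?thesis using Cons.prems(1) by (simp add: of_degree_ins alt_wedge_zero)
  next
   case (Suc p')
   have "alt_wedge (ins v f) g vs = ((- 1) ^ (p' * q) *\<^sub>R alt_wedge g (ins v f)) vs"
    using Cons.prems Suc by (intro Cons.IH of_degree_ins) auto
   then show ?thesis unfolding sgl_of_degree[OF Cons.prems(2)] alt_wedge_scale_left
    by (auto simp: Suc scaleR_fun_def power_add simp flip: power_mult_distrib mult.assoc)
  qed
  have 2: "alt_wedge (sgl f) (ins v g) vs = (- 1) ^ (p * q) *\<^sub>R alt_wedge (ins v g) f vs"
  proof (cases q)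
   case 0
   then show ?thesis using Cons.prems(2) by (simp add: of_degree_ins alt_wedge_zero)
  next
   case (Suc q')
   have "alt_wedge f (ins v g) vs = ((- 1) ^ (p * q') *\<^sub>R alt_wedge (ins v g) f) vs"
    using Cons.prems Suc by (intro Cons.IH of_degree_ins) auto
   then show ?thesis unfolding sgl_of_degree[OF Cons.prems(1)] alt_wedge_scale_left
    by (auto simp: Suc scaleR_fun_def power_add)
  qed
  show ?case by (simp add: alt_wedge_Cons scaleR_fun_def distrib_left 1 2)
 qed
qed

lemma alt_wedge_degree_0:
 assumes "of_degree 0 f"
 shows "alt_wedge f g = f [] *\<^sub>R g"
proof
 show "alt_wedge f g vs = (f [] *\<^sub>R g) vs" for vs
 proof (induction vs arbitrary: g)
  case (Cons v vs)
  have "alt_wedge f g (v # vs) = alt_wedge f (ins v g) vs"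
   using sgl_of_degree[OF assms] by (simp add: alt_wedge_Cons of_degree_ins(2)[OF assms] alt_wedge_zero)
  then show ?case using Cons.IH[of "ins v g"] by (simp add: scaleR_fun_def ins_def)
 qed (simp add: alt_wedge_Nil scaleR_fun_def)
qed

section \<open>Alternating forms\<close>

lemma alt_formsD:
 assumes "f : alt_forms V W k"
 shows "!!vs. length vs = k ==> set vs <= V ==> f vs : W" "!!vs. \<not> (length vs = k & set vs <= V) ==> f vs = 0"
  "!!v w us c. v : V ==> w : V ==> set us <= V ==> f ((c *\<^sub>R v + w) # us) = c *\<^sub>R f (v # us) + f (w # us)"
  "!!vs. \<not> distinct vs ==> f vs = 0"
  "!!xs v w ys c. set xs <= V ==> v : V ==> w : V ==> set ys <= V ==>
   f (xs @ (c *\<^sub>R v + w) # ys) = c *\<^sub>R f (xs @ v # ys) + f (xs @ w # ys)"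
proof -
 note A = assms[unfolded alt_forms_def mem_Collect_eq]
 note A1 = A[THEN conjunct1, rule_format] and A2 = A[THEN conjunct2, THEN conjunct1, rule_format]
  and A3 = A[THEN conjunct2, THEN conjunct2, THEN conjunct1, rule_format]
  and A4 = A[THEN conjunct2, THEN conjunct2, THEN conjunct2, rule_format]
 show "f vs : W" if "length vs = k" "set vs <= V" for vs using A1 that by simp
 show "f vs = 0" if "\<not> (length vs = k & set vs <= V)" for vs using A2 that by simp
 show "f vs = 0" if "\<not> distinct vs" for vs using A4 that by simp
 show "f (xs @ (c *\<^sub>R v + w) # ys) = c *\<^sub>R f (xs @ v # ys) + f (xs @ w # ys)"
  if "set xs <= V" "v : V" "w : V" "set ys <= V" for xs v w ys c using A3 that by simp
 from this[of "[]"] show "f ((c *\<^sub>R v + w) # us) = c *\<^sub>R f (v # us) + f (w # us)"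
  if "v : V" "w : V" "set us <= V" for v w us c using that by simp
qed

lemma alt_formsI:
 assumes "!!vs. length vs = k ==> set vs <= V ==> f vs : W" "!!vs. \<not> (length vs = k & set vs <= V) ==> f vs = 0"
  "!!vs. \<not> distinct vs ==> f vs = 0"
  "!!xs v w ys c. set xs <= V ==> v : V ==> w : V ==> set ys <= V ==>
   f (xs @ (c *\<^sub>R v + w) # ys) = c *\<^sub>R f (xs @ v # ys) + f (xs @ w # ys)"
 shows "f : alt_forms V W k"
 unfolding alt_forms_def mem_Collect_eq using assms by (intro conjI allI impI) simp_all

lemma alt_forms_degree: "f : alt_forms V W k ==> of_degree k f"
 by (auto simp: of_degree_def dest: alt_formsD(2))

lemma alt_forms_0I:
 assumes "f [] : W" "!!v us. f (v # us) = 0"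
 shows "f : alt_forms V W 0"
proof -
 have "f us = 0" if "us ~= []" for us using that assms(2) by (cases us) auto
 moreover have "f vs = 0" if "\<not> distinct vs" for vs
  using that \<open>!!us. us ~= [] ==> f us = 0\<close>[of vs] by (cases vs) auto
 ultimately show ?thesis using assms(1) by (intro alt_formsI) simp_all
qed

lemma alt_forms_ins:
 assumes "f : alt_forms V W (Suc k)" "v : V"
 shows "ins v f : alt_forms V W k"
proof (rule alt_formsI)
 note D = alt_formsD[OF assms(1)]
 show "ins v f vs : W" if "length vs = k" "set vs <= V" for vs
  using D(1) that assms(2) by (simp add: ins_def)
 show "ins v f vs = 0" if "\<not> (length vs = k & set vs <= V)" for vs
  unfolding ins_def by (rule D(2)) (use that in auto)
 show "ins v f vs = 0" if "\<not> distinct vs" for vs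
  unfolding ins_def by (rule D(4)) (use that in auto)
 show "ins v f (xs @ (c *\<^sub>R u + w) # ys) = c *\<^sub>R ins v f (xs @ u # ys) + ins v f (xs @ w # ys)"
  if "set xs <= V" "u : V" "w : V" "set ys <= V" for xs u w ys c
  using D(5)[of "v # xs" u w ys c] that assms(2) by (simp add: ins_def)
qed

text \<open>Contractions are already alternating, so a repetition is new only if it involves the
  first entry. Skew-symmetry in the first two slots moves the first entry inside, where the
  contraction sees the repetition.\<close>

lemma alt_forms_SucI:
 assumes "subspace V" "!!v. v : V ==> ins v f : alt_forms V W k"
  and "f [] = 0" "!!v us. v \<notin> V ==> f (v # us) = 0"
  and lin: "!!v w us c. v : V ==> w : V ==> set us <= V ==> f ((c *\<^sub>R v + w) # us) = c *\<^sub>R f (v # us) + f (w # us)"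
  and alt: "!!v us. v : V ==> set us <= V ==> f (v # v # us) = 0"
 shows "f : alt_forms V W (Suc k)"
proof -
 note D = alt_formsD[OF assms(2), unfolded ins_def]
 have z: "f vs = 0" if "\<not> set vs <= V" for vs
  using that D(2) assms(3,4) by (cases vs) auto
 have skew: "f (v # w # us) = - f (w # v # us)" if "v : V" "w : V" "set us <= V" for v w us
 proof -
  have vw: "v + w : V" using that assms(1) by (simp add: subspace_add)
  \<comment> \<open>Polarisation: the value on \<open>v + w\<close> taken twice vanishes and expands
    into the two mixed terms.\<close>
  have "0 = f ((1 *\<^sub>R v + w) # (v + w) # us)" using alt[OF vw that(3)] by simp
  also have "\<dots> = f (v # (1 *\<^sub>R v + w) # us) + f (w # (1 *\<^sub>R v + w) # us)"
   using lin[OF that(1,2), of "(v + w) # us" 1] vw that by simp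
  also have "\<dots> = f (v # w # us) + f (w # v # us)"
   unfolding D(3)[OF that(1) that(1,2,3)] D(3)[OF that(2) that(1,2,3)] using alt that by simp
  finally show ?thesis by (simp add: eq_neg_iff_add_eq_0)
 qed
 have dist: "f vs = 0" if nd: "\<not> distinct vs" for vs
 proof (cases "set vs <= V")
  case True
  obtain v us where vs: "vs = v # us" using nd by (cases vs) auto
  show ?thesis
  proof (cases "distinct us")
   case False
   then show ?thesis using D(4) True vs by auto
  next
   case dus: True
   then have "v : set us" using nd vs by auto
   then obtain xs ys where us: "us = xs @ v # ys" by (auto simp: in_set_conv_decomp)
   show ?thesis
   proof (cases xs)
    case Nil
    then show ?thesis using alt vs us True by auto
   next
    case (Cons x xs')
    have "f vs = - f (x # v # xs' @ v # ys)"
     using skew[of v x "xs' @ v # ys"] True vs us Cons by auto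
    also have "f (x # v # xs' @ v # ys) = 0"
     by (rule D(4)) (use True vs us Cons in auto)
    finally show ?thesis by simp
   qed
  qed
 qed (use z in auto)
 have "f (xs @ (c *\<^sub>R v + w) # ys) = c *\<^sub>R f (xs @ v # ys) + f (xs @ w # ys)"
  if "set xs <= V & v : V & w : V & set ys <= V" for xs v w ys c
  using that lin D(5) by (cases xs) auto
 moreover have "f vs : W" if "length vs = Suc k" "set vs <= V" for vs
  using that D(1) by (cases vs) auto
 moreover have "f vs = 0" if "length vs ~= Suc k" for vs
 proof (cases vs)
  case (Cons v us)
  then show ?thesis using that D(2)[of v us] assms(4)[of v us] by (cases "v : V") auto
 qed (simp add: assms(3))
 ultimately show ?thesis using dist z by (intro alt_formsI) (simp_all, blast)
qed

lemma alt_forms_zero: "subspace W ==> 0 : alt_forms V W k"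
 by (auto intro!: alt_formsI simp: subspace_0)

lemma alt_forms_add:
 "subspace W ==> f : alt_forms V W k ==> g : alt_forms V W k ==> f + g : alt_forms V W k"
 by (rule alt_formsI) (simp_all add: subspace_add alt_formsD(1,4,5) scaleR_add_right alt_formsD(2)[of _ V W k])

lemma alt_forms_scale:
 "subspace W ==> f : alt_forms V W k ==> c *\<^sub>R f : alt_forms V W k"
 by (rule alt_formsI) (simp_all add: subspace_scale alt_formsD(1,4,5) scaleR_add_right scaleR_fun_def alt_formsD(2)[of _ V W k])

lemma alt_wedge_linear_head:
 assumes "ins (c *\<^sub>R v + w) f = c *\<^sub>R ins v f + ins w f" "ins (c *\<^sub>R v + w) g = c *\<^sub>R ins v g + ins w g"
 shows "ins (c *\<^sub>R v + w) (alt_wedge f g) = c *\<^sub>R ins v (alt_wedge f g) + ins w (alt_wedge f g)"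
 unfolding ins_alt_wedge assms
 by (simp add: alt_wedge_add_left alt_wedge_add_right alt_wedge_scale_left alt_wedge_scale_right scaleR_add_right)

lemma alt_forms_ins_linear:
 assumes "f : alt_forms V W k" "v : V" "w : V" "subspace V"
 shows "ins (c *\<^sub>R v + w) f = c *\<^sub>R ins v f + ins w f"
proof
 fix us
 show "ins (c *\<^sub>R v + w) f us = (c *\<^sub>R ins v f + ins w f) us"
 proof (cases "set us <= V")
  case True
  then show ?thesis using alt_formsD(3)[OF assms(1-3)] by (simp add: ins_def scaleR_fun_def)
 next
  case False
  then show ?thesis using alt_formsD(2)[OF assms(1)] by (simp add: ins_def scaleR_fun_def)
 qed
qed

lemma alt_forms_ins_ins: "f : alt_forms V W k ==> ins v (ins v f) = 0"
 by (auto simp: ins_def fun_eq_iff intro!: alt_formsD(4))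

lemma alt_forms_ins_outside: "f : alt_forms V W k ==> v \<notin> V ==> ins v f = 0"
 by (auto simp: ins_def fun_eq_iff intro!: alt_formsD(2))

lemma alt_forms_ins_0: "f : alt_forms V W 0 ==> ins v f = 0"
 by (auto simp: ins_def fun_eq_iff intro!: alt_formsD(2))

lemma sgl_alt_forms: "subspace W ==> f : alt_forms V W k ==> sgl f : alt_forms V W k"
 by (subst sgl_of_degree[OF alt_forms_degree]) (auto intro: alt_forms_scale)

lemma alt_wedge_alt_forms:
 assumes "subspace V" "subspace W" "f : alt_forms V UNIV p" "g : alt_forms V W q"
 shows "alt_wedge f g : alt_forms V W (p + q)"
 using assms(3,4)
proof (induction "p + q" arbitrary: p q f g)
 case 0
 then have pq: "p = 0" "q = 0" by auto
 with 0 have fg: "f : alt_forms V UNIV 0" "g : alt_forms V W 0" by auto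
 have "alt_wedge f g : alt_forms V W 0"
 proof (rule alt_forms_0I)
  show "alt_wedge f g [] : W"
   using alt_formsD(1)[OF fg(2), of "[]"] assms(2) by (simp add: alt_wedge_Nil subspace_scale)
  show "alt_wedge f g (v # us) = 0" for v us
   by (simp add: alt_wedge_Cons alt_forms_ins_0[OF fg(1)] alt_forms_ins_0[OF fg(2)] alt_wedge_zero)
 qed
 then show ?case using pq by simp
next
 case (Suc n)
 note f = Suc.prems(1) and g = Suc.prems(2)
 have sf: "sgl f : alt_forms V UNIV p" by (rule sgl_alt_forms[OF subspace_UNIV f])
 show ?case unfolding Suc.hyps(2)[symmetric]
 proof (rule alt_forms_SucI[OF assms(1)])
  show "ins v (alt_wedge f g) : alt_forms V W n" if v: "v : V" for v
  proof -
   have "alt_wedge (ins v f) g : alt_forms V W n"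
   proof (cases p)
    case 0
    then show ?thesis using f by (simp add: alt_forms_ins_0 alt_wedge_zero alt_forms_zero assms(2))
   next
    case (Suc p')
    then show ?thesis using Suc.hyps(1)[of p' q "ins v f" g] Suc.hyps(2) alt_forms_ins[of f V UNIV p' v] f g v by auto
   qed
   moreover have "alt_wedge (sgl f) (ins v g) : alt_forms V W n"
   proof (cases q)
    case 0
    then show ?thesis using g by (simp add: alt_forms_ins_0 alt_wedge_zero alt_forms_zero assms(2))
   next
    case (Suc q')
    then show ?thesis using Suc.hyps(1)[of p q' "sgl f" "ins v g"] Suc.hyps(2) alt_forms_ins[of g V W q' v] sf g v by auto
   qed
   ultimately show ?thesis unfolding ins_alt_wedge by (rule alt_forms_add[OF assms(2)])
  qed
  have "f [] = 0 | g [] = 0"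
   using Suc.hyps(2) alt_formsD(2)[OF f, of "[]"] alt_formsD(2)[OF g, of "[]"] by (cases p) auto
  then show "alt_wedge f g [] = 0" by (auto simp: alt_wedge_Nil)
  show "alt_wedge f g (v # us) = 0" if "v \<notin> V" for v us
   using that f g by (simp add: alt_wedge_Cons alt_forms_ins_outside alt_wedge_zero)
  show "alt_wedge f g ((c *\<^sub>R v + w) # us) = c *\<^sub>R alt_wedge f g (v # us) + alt_wedge f g (w # us)"
   if "v : V" "w : V" for v w us c
   using fun_cong[OF alt_wedge_linear_head[OF alt_forms_ins_linear[OF f that assms(1)] alt_forms_ins_linear[OF g that assms(1)]], of c us]
   by (simp add: ins_def scaleR_fun_def)
  show "alt_wedge f g (v # v # us) = 0" for v us
  proof -
   \<comment> \<open>Of the four Leibniz terms the two outer ones vanish, and the mixed ones cancel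
     because contraction anticommutes with \<open>sgl\<close>.\<close>
   have "ins v (ins v (alt_wedge f g)) = 0"
    by (simp add: ins_alt_wedge ins_add alt_forms_ins_ins[OF f] alt_forms_ins_ins[OF g] alt_wedge_zero
      ins_sgl alt_wedge_uminus_left)
   from fun_cong[OF this, of us] show ?thesis by (simp add: ins_def)
  qed
 qed
qed

section \<open>Forms with values in a vector bundle\<close>

definition ev :: "('m => 'e list => 'v) => ('m => 'e) list => 'm => 'v" where
 "ev al ss = (%x. al x (map (%s. s x) ss))"

definition iota :: "('m => 'e) => ('m => 'e list => 'v) => 'm => 'e list => 'v" where
 "iota Z al = (%x. ins (Z x) (al x))"

definition sg :: "('m => 'e list => 'v::real_vector) => 'm => 'e list => 'v" where
 "sg al = (%x. sgl (al x))"

lemma psign_simps [simp]: "psign 0 = 1" "psign 1 = - 1" "psign (- k) = psign k" "psign k * psign k = 1" "psign k * (psign k * r) = r"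
 "psign (- 1) = - 1"
 by (auto simp: psign_def)

lemma psign_add: "psign (j + k) = psign j * psign k"
 by (auto simp: psign_def)

lemma psign_diff: "psign (j - k) = psign j * psign k"
 by (auto simp: psign_def)

lemma psign_int: "psign (int n) = (- 1) ^ n"
 by (auto simp: psign_def)

lemma psign_scale_scale [simp]: "psign k *\<^sub>R psign k *\<^sub>R (v :: 'v::real_vector) = v"
 by (simp add: psign_def)

lemma ev_Nil: "ev al [] = (%x. al x [])"
 by (simp add: ev_def)

lemma ev_Cons: "ev al (Z # Zs) = ev (iota Z al) Zs"
 by (simp add: ev_def iota_def ins_def)

lemma ev_add: "ev (al + be) ss = ev al ss + ev be ss"
 and ev_diff: "ev (al' - be') ss = ev al' ss - (ev be' ss :: 'm => 'v::ab_group_add)"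
 and ev_uminus: "ev (- al') ss = - ev al' ss"
 and ev_scale: "ev (c *\<^sub>R ga) ss = c *\<^sub>R ev ga ss"
 and ev_sc: "ev (sc f ga) ss = sc f (ev ga ss)"
 and ev_zero: "ev 0 ss = (0 :: 'm => 'v)"
 by (auto simp: ev_def fun_eq_iff sc_def scaleR_fun_def)

lemma iota_add: "iota Z (al + be) = iota Z al + iota Z be"
 and iota_diff: "iota Z (al' - be') = iota Z al' - (iota Z be' :: 'm => 'e list => 'v::ab_group_add)"
 and iota_uminus: "iota Z (- al') = - iota Z al'"
 and iota_scale: "iota Z (c *\<^sub>R ga) = c *\<^sub>R iota Z ga"
 and iota_sc: "iota Z (sc f ga) = sc f (iota Z ga)"
 and iota_zero: "iota Z 0 = (0 :: 'm => 'e list => 'v)"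
 by (auto simp: iota_def ins_def fun_eq_iff sc_def scaleR_fun_def)

lemma wedge_add_left: "wedge (om + om') be = wedge om be + wedge om' be"
 and wedge_add_right: "wedge om (be + be') = wedge om be + wedge om be'"
 and wedge_zero_left: "wedge 0 be = 0" and wedge_zero_right: "wedge om 0 = 0"
 and wedge_uminus_left: "wedge (- om) be = - wedge om be"
 and wedge_uminus_right: "wedge om (- be) = - wedge om be"
 and wedge_assoc: "wedge (wedge om om') be = wedge om (wedge om' be)"
 by (simp_all add: wedge_def fun_eq_iff alt_wedge_add_left alt_wedge_add_right alt_wedge_zero alt_wedge_uminus_left alt_wedge_uminus_right alt_wedge_assoc)

lemma wedge_scale_left: "wedge (c *\<^sub>R om) be = c *\<^sub>R wedge om be"
 and wedge_scale_right: "wedge om (c *\<^sub>R be) = c *\<^sub>R wedge om be"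
 by (simp_all add: wedge_def fun_eq_iff alt_wedge_scale_left alt_wedge_scale_right scaleR_fun_apply)

lemma wedge_diff_left: "wedge (om - om') be = wedge om be - wedge om' be"
 and wedge_diff_right: "wedge om (be - be') = wedge om be - wedge om be'"
 using wedge_add_left[of om "- om'" be] wedge_add_right[of om be "- be'"]
 by (simp_all add: wedge_uminus_left wedge_uminus_right)

lemma iota_wedge: "iota Z (wedge om be) = wedge (iota Z om) be + wedge (sg om) (iota Z be)"
 by (simp add: iota_def wedge_def sg_def ins_alt_wedge fun_eq_iff)

lemma wedge_at: "wedge om be x = alt_wedge (om x) (be x)"
 by (simp add: wedge_def)

text \<open>A family of maps on lists of sections that comes from an alternating form of degree \<open>n\<close>,
 described by recursion along the first entry.\<close>

primrec tens :: "('m, 'b::euclidean_space) manifold => ('m, 'e::real_vector) vbundle => ('m, 'v::real_vector) vbundle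
  => nat => (('m => 'e) list => 'm => 'v) => bool" where
 "tens M A Lb 0 F \<longleftrightarrow> F [] : sections M Lb & (\<forall>Z Zs. set (Z # Zs) <= sections M A --> F (Z # Zs) = 0)"
| "tens M A Lb (Suc n) F \<longleftrightarrow> F [] = 0 & (ALL Z:sections M A. tens M A Lb n (%ss. F (Z # ss))) &
   (ALL Z:sections M A. ALL W:sections M A. ALL f:Cinf M. \<forall>ss. set ss <= sections M A -->
    F ((sc f Z + W) # ss) = sc f (F (Z # ss)) + F (W # ss)) &
   (ALL Z:sections M A. \<forall>ss. set ss <= sections M A --> F (Z # Z # ss) = 0)"

text \<open>Each vector is extended to an arbitrarily chosen global section. The choice is harmless
  exactly for tensorial \<open>F\<close>, which is the content of
  \<open>tens_pointwise\<close>.\<close>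

definition mkform :: "('m, 'b::euclidean_space) manifold => ('m, 'e::real_vector) vbundle
  => (('m => 'e) list => 'm => 'v::zero) => 'm => 'e list => 'v" where
 "mkform M A F = (%x vs. if set vs <= fib A x
   then F (map (%v. SOME s. s : sections M A & s x = v) vs) x else 0)"

text \<open>A module derivation with its symbol made explicit, graded by form degree. Regrading the
  module changes neither the degree of an operator nor the signs, so the same notion serves the
  shifts by 1 and by 2.\<close>

definition der :: "('m, 'b::euclidean_space) manifold => ('m, 'e::real_vector) vbundle => ('m, 'v::real_vector) vbundle
  => int => (('m => 'e list => real) => 'm => 'e list => real) => (('m => 'e list => 'v) => 'm => 'e list => 'v) => bool" where
 "der M A Lb d Y X \<longleftrightarrow> algebra_derivation (Omega_fun M A) wedge d Y &
   graded_linear (Omega M A Lb) (Omega M A Lb) d X &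
   (\<forall>p k. \<forall>om\<in>Omega_fun M A p. \<forall>al\<in>Omega M A Lb k.
    X (wedge om al) = wedge (Y om) al + psign (d * p) *\<^sub>R wedge om (X al))"

locale fbun = mfd M
 for M :: "('m::{t2_space,second_countable_topology}, 'b::euclidean_space) manifold" +
 fixes A :: "('m, 'e::real_vector) vbundle"
 assumes A: "vector_bundle M A"
begin

lemmas A_facts = subspace_fib[OF A] sections_fib[OF A] sections_add[OF A] sections_sc[OF A] sections_zero[OF A]
 sections_uminus[OF A] sections_diff[OF A] sections_scaleR[OF A]

lemma Omega_neg: "k < 0 ==> Omega M A Lb k = {0}"
 by (simp add: Omega_def)

lemma OmegaI:
 assumes "!!x. al x : alt_forms (fib A x) (fib Lb x) n"
  "!!ss. length ss = n ==> set ss <= sections M A ==> ev al ss : sections M Lb"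
 shows "al : Omega M A Lb (int n)"
 using assms by (simp add: Omega_def ev_def)

lemma OmegaD:
 assumes "al : Omega M A Lb (int n)"
 shows "al x : alt_forms (fib A x) (fib Lb x) n"
  "length ss = n ==> set ss <= sections M A ==> ev al ss : sections M Lb"
 using assms by (simp_all add: Omega_def ev_def)

lemma Omega_cases:
 assumes "al : Omega M A Lb k"
 obtains "k < 0" "al = 0" | n where "k = int n" "al : Omega M A Lb (int n)"
 using assms Omega_neg[of k Lb] by (cases "k < 0") (auto elim: nonneg_int_cases simp: not_less)

lemma sg_Omega: "al : Omega M A Lb k ==> sg al = psign k *\<^sub>R al"
proof (erule Omega_cases)
 fix n assume n: "k = int n" "al : Omega M A Lb (int n)"
 show ?thesis
  using sgl_of_degree[OF alt_forms_degree[OF OmegaD(1)[OF n(2)]]]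
  by (simp add: sg_def fun_eq_iff n(1) psign_int scaleR_fun_def)
qed (simp add: sg_def sgl_zero zero_fun_def[symmetric])

lemma Omega_outside: "al : Omega M A Lb k ==> int (length vs) ~= k | \<not> set vs <= fib A x ==> al x vs = 0"
 by (erule Omega_cases) (auto intro!: alt_formsD(2)[OF OmegaD(1)])

lemma fib_section: "v : fib A x ==> \<exists>s. s : sections M A & s x = v"
 using section_through[OF A] by metis

lemma sections_list: "set vs <= fib A x ==> \<exists>ss. set ss <= sections M A & map (%s. s x) ss = vs"
proof (induction vs)
 case (Cons v vs)
 then obtain ss s where "set ss <= sections M A" "map (%s. s x) ss = vs" "s : sections M A" "s x = v"
  using fib_section by force
 then show ?case by (intro exI[of _ "s # ss"]) auto
qed auto

lemma form_eqI:
 assumes "al : Omega M A Lb k" "be : Omega M A Lb k"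
  "!!ss. set ss <= sections M A ==> int (length ss) = k ==> ev al ss = ev be ss"
 shows "al = be"
proof (intro ext)
 fix x vs
 show "al x vs = be x vs"
 proof (cases "int (length vs) = k & set vs <= fib A x")
  case True
  with sections_list[of vs x] obtain ss where ss: "set ss <= sections M A" "map (%s. s x) ss = vs" by auto
  then have "length ss = length vs" by auto
  then show ?thesis using fun_cong[OF assms(3)[OF ss(1)], of x] True ss(2) by (simp add: ev_def)
 next
  case False
  then show ?thesis using Omega_outside assms(1,2) by metis
 qed
qed

lemma iota_Omega:
 assumes "al : Omega M A Lb k" "Z : sections M A"
 shows "iota Z al : Omega M A Lb (k - 1)"
 using assms(1)
proof (cases rule: Omega_cases)
 case (2 n)
 show ?thesis
 proof (cases n)
  case 0
  then have "iota Z al = 0" using 2 Omega_outside[OF assms(1)] by (auto simp: iota_def ins_def fun_eq_iff)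
  then show ?thesis using 0 2 by (simp add: Omega_neg)
 next
  case (Suc m)
  have "iota Z al : Omega M A Lb (int m)"
  proof (rule OmegaI)
   show "iota Z al x : alt_forms (fib A x) (fib Lb x) m" for x
    unfolding iota_def by (rule alt_forms_ins) (use OmegaD(1)[OF 2(2)] Suc sections_fib[OF A assms(2)] in auto)
   show "ev (iota Z al) ss : sections M Lb" if "length ss = m" "set ss <= sections M A" for ss
    using OmegaD(2)[OF 2(2), of "Z # ss"] that Suc assms(2) by (simp add: ev_Cons)
  qed
  then show ?thesis using Suc 2 by simp
 qed
qed (simp add: Omega_neg iota_zero)

text \<open>The induction principle for identities between forms: contractions lower the degree, and
  degree 0 is left as the base case.\<close>

lemma Omega_ext:
 assumes "al : Omega M A Lb k" "be : Omega M A Lb k" "k ~= 0"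
  "!!Z. Z : sections M A ==> iota Z al = iota Z be"
 shows "al = be"
proof (rule form_eqI[OF assms(1,2)])
 fix ss assume "set ss <= sections M A" "int (length ss) = k"
 then show "ev al ss = ev be ss" using assms(3,4) by (cases ss) (auto simp: ev_Cons)
qed

lemma Omega_0:
 assumes "al : Omega M A Lb 0"
 shows "al = form0 (ev al [])" "ev al [] : sections M Lb"
 using Omega_outside[OF assms] OmegaD(2)[of al Lb 0 "[]"] assms
 by (auto simp: form0_def ev_Nil fun_eq_iff)

lemma ev_form0: "ev (form0 s) [] = s"
 by (simp add: ev_Nil form0_def)

lemma iota_form0: "iota Z (form0 s) = 0"
 by (simp add: iota_def ins_def form0_def fun_eq_iff)

lemma form0_add: "form0 (s + t) = form0 s + (form0 t :: _ => _ => 'v::real_vector)"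
 and form0_scale: "form0 (c *\<^sub>R t) = c *\<^sub>R form0 (t :: _ => 'v)"
 and form0_uminus: "form0 (- t) = - form0 (t :: _ => 'v)"
 and form0_zero: "form0 0 = (0 :: _ => _ => 'v)"
 and form0_sc: "form0 (sc f t) = sc f (form0 (t :: _ => 'v))"
 by (auto simp: form0_def fun_eq_iff scaleR_fun_def sc_def)

lemma wedge_form0: "wedge (form0 f) be = sc f be" for be :: "'m => 'e list => 'v::real_vector"
proof -
 have "of_degree 0 (form0 f x :: 'e list => real)" for x by (auto simp: of_degree_def form0_def)
 from alt_wedge_degree_0[OF this] have "wedge (form0 f) be x = form0 f x ([] :: 'e list) *\<^sub>R be x" for x
  by (simp only: wedge_def)
 then show ?thesis by (intro ext) (simp add: sc_def form0_def)
qed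

context
 fixes Lb :: "('m, 'v::real_vector) vbundle"
 assumes Lb: "vector_bundle M Lb"
begin

lemma form0_Omega:
 assumes "s : sections M Lb"
 shows "form0 s : Omega M A Lb 0"
proof -
 have "form0 s : Omega M A Lb (int 0)"
 proof (rule OmegaI)
  show "form0 s x : alt_forms (fib A x) (fib Lb x) 0" for x
   by (rule alt_forms_0I) (use sections_fib[OF Lb assms] in \<open>auto simp: form0_def\<close>)
  show "ev (form0 s) ss : sections M Lb" if "length ss = 0" for ss
   using that assms by (simp add: ev_form0)
 qed
 then show ?thesis by simp
qed

lemma Omega_zero: "0 : Omega M A Lb k"
proof (cases "k < 0")
 case False
 then obtain n where "k = int n" by (auto elim: nonneg_int_cases simp: not_less)
 then show ?thesis using OmegaI[of 0 Lb n]
  by (auto simp: ev_zero alt_forms_zero subspace_fib[OF Lb] sections_zero[OF Lb] zero_fun_def[symmetric])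
qed (simp add: Omega_neg)

lemma Omega_add: "al : Omega M A Lb k ==> be : Omega M A Lb k ==> al + be : Omega M A Lb k"
proof (erule Omega_cases)
 fix n assume n: "be : Omega M A Lb k" "k = int n" "al : Omega M A Lb (int n)"
 show "al + be : Omega M A Lb k"
  unfolding n(2) by (rule OmegaI)
   (use n OmegaD[of al Lb n] OmegaD[of be Lb n] in \<open>auto simp: ev_add intro: alt_forms_add subspace_fib[OF Lb] sections_add[OF Lb]\<close>)
qed auto

lemma Omega_sc: "f : Cinf M ==> al : Omega M A Lb k ==> sc f al : Omega M A Lb k"
proof (erule Omega_cases)
 fix n assume n: "f : Cinf M" "k = int n" "al : Omega M A Lb (int n)"
 show "sc f al : Omega M A Lb k"
  unfolding n(2) ev_sc by (rule OmegaI)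
   (use n OmegaD[of al Lb n] in \<open>auto simp: ev_sc sc_apply intro: alt_forms_scale subspace_fib[OF Lb] sections_sc[OF Lb]\<close>)
qed (use Omega_zero in \<open>auto simp: sc_def zero_fun_def[symmetric]\<close>)

lemma Omega_scale: "al : Omega M A Lb k ==> c *\<^sub>R al : Omega M A Lb k"
 unfolding scaleR_conv_sc by (intro Omega_sc Cinf_const)

lemma Omega_uminus: "al : Omega M A Lb k ==> - al : Omega M A Lb k"
 using Omega_scale[of al k "- 1"] by simp

lemma Omega_diff: "al : Omega M A Lb k ==> be : Omega M A Lb k ==> al - be : Omega M A Lb k"
 using Omega_add[of al k "- be"] Omega_uminus by simp

lemma Omega_sum: "(!!i. i : I ==> al i : Omega M A Lb k) ==> (\<Sum>i\<in>I. al i) : Omega M A Lb k"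
 by (induction I rule: infinite_finite_induct) (auto intro: Omega_zero Omega_add)

lemma sg_in_Omega: "al : Omega M A Lb k ==> sg al : Omega M A Lb k"
 by (simp add: sg_Omega Omega_scale)

lemma subspace_Omega: "subspace (Omega M A Lb k)"
 by (auto simp: subspace_def Omega_zero Omega_add Omega_scale)

lemma Omega_local:
 assumes "!!x. \<exists>V \<eta>. open V & x : V & \<eta> : Omega M A Lb k & (ALL y:V. al y = \<eta> y)"
 shows "al : Omega M A Lb k"
proof (cases "k < 0")
 case True
 then have "al x = 0" for x using assms[of x] by (auto simp: Omega_neg)
 then show ?thesis using True by (auto simp: Omega_neg fun_eq_iff)
next
 case False
 then obtain n where k: "k = int n" by (auto elim: nonneg_int_cases simp: not_less)
 show ?thesis unfolding k
 proof (rule OmegaI)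
  show "al x : alt_forms (fib A x) (fib Lb x) n" for x
   using assms[of x] k OmegaD(1) by metis
  fix ss assume ss: "length ss = n" "set ss <= sections M A"
  show "ev al ss : sections M Lb"
  proof (rule sections_eq_local[OF Lb])
   fix x
   from assms[of x] obtain V \<eta> where "open V" "x : V" "\<eta> : Omega M A Lb k" "ALL y:V. al y = \<eta> y" by blast
   then show "\<exists>V t. open V & x : V & t : sections M Lb & (ALL y:V. ev al ss y = t y)"
    using OmegaD(2)[of \<eta> Lb n ss] ss k by (intro exI[of _ V] exI[of _ "ev \<eta> ss"]) (auto simp: ev_def)
  qed
 qed
qed

text \<open>Smoothness of a form is tested on sections. Recursion along the first section ends in
  degree 0, where the wedge is multiplication of a section by a function.\<close>

lemma wedge_ev:
 assumes "om : Omega_fun M A (int p)" "be : Omega M A Lb (int q)" "length ss = p + q" "set ss <= sections M A"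
 shows "ev (wedge om be) ss : sections M Lb"
 using assms
proof (induction ss arbitrary: om be p q)
 case Nil
 have "ev (wedge om be) [] = sc (ev om []) (ev be [])"
  by (simp add: ev_Nil wedge_def alt_wedge_Nil sc_def)
 then show ?case using OmegaD(2)[OF Nil(1), of "[]"] OmegaD(2)[OF Nil(2), of "[]"] Nil
  by (simp add: sections_trivial_line sections_sc[OF Lb])
next
 case (Cons Z ss)
 have Z: "Z : sections M A" "set ss <= sections M A" using Cons.prems by auto
 have "ev (wedge (iota Z om) be) ss : sections M Lb"
 proof (cases p)
  case 0
  then have "iota Z om = 0" using iota_Omega[OF Cons.prems(1) Z(1)] by (simp add: Omega_neg)
  then show ?thesis by (simp add: wedge_zero_left ev_zero sections_zero[OF Lb])
 next
  case (Suc p')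
  then show ?thesis using Cons.IH[of "iota Z om" p' be q] iota_Omega[OF Cons.prems(1) Z(1)] Cons.prems Z by simp
 qed
 moreover have "ev (wedge om (iota Z be)) ss : sections M Lb"
 proof (cases q)
  case 0
  then have "iota Z be = 0" using iota_Omega[OF Cons.prems(2) Z(1)] by (simp add: Omega_neg)
  then show ?thesis by (simp add: wedge_zero_right ev_zero sections_zero[OF Lb])
 next
  case (Suc q')
  then show ?thesis using Cons.IH[of om p "iota Z be" q'] iota_Omega[OF Cons.prems(2) Z(1)] Cons.prems Z by simp
 qed
 ultimately show ?case
  unfolding ev_Cons iota_wedge sg_Omega[OF Cons.prems(1)] wedge_scale_left ev_add ev_scale
  by (intro sections_add[OF Lb] sections_scaleR[OF Lb])
qed

lemma wedge_Omega:
 assumes "om : Omega_fun M A p" "be : Omega M A Lb k"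
 shows "wedge om be : Omega M A Lb (p + k)"
 using assms(1)
proof (cases rule: Omega_cases)
 case 1
 then show ?thesis by (simp add: wedge_zero_left Omega_zero)
next
 case (2 n)
 note n = this
 from assms(2) show ?thesis
 proof (cases rule: Omega_cases)
  case 1
  then show ?thesis by (simp add: wedge_zero_right Omega_zero)
 next
  case (2 m)
  have "wedge om be : Omega M A Lb (int (n + m))"
  proof (rule OmegaI)
   show "wedge om be x : alt_forms (fib A x) (fib Lb x) (n + m)" for x
    unfolding wedge_def
    by (rule alt_wedge_alt_forms[OF subspace_fib[OF A] subspace_fib[OF Lb]])
      (use OmegaD(1)[OF n(2), of x] OmegaD(1)[OF 2(2), of x] in \<open>auto simp: trivial_line_def\<close>)
  qed (use wedge_ev[OF n(2) 2(2)] in auto)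
  then show ?thesis using n 2 by simp
 qed
qed

end

lemma wedge_comm:
 assumes "om : Omega_fun M A p" "\<eta> : Omega_fun M A q"
 shows "wedge om \<eta> = psign (p * q) *\<^sub>R wedge \<eta> om"
 using assms(1)
proof (cases rule: Omega_cases)
 case 1
 then show ?thesis by (simp add: wedge_zero_left wedge_zero_right)
next
 case (2 n)
 note n = this
 from assms(2) show ?thesis
 proof (cases rule: Omega_cases)
  case 1
  then show ?thesis by (simp add: wedge_zero_left wedge_zero_right)
 next
  case (2 m)
  have "psign (p * q) = (- 1) ^ (n * m)" using n 2 by (simp add: psign_def)
  then show ?thesis
   using alt_wedge_comm[OF alt_forms_degree[OF OmegaD(1)[OF n(2)]] alt_forms_degree[OF OmegaD(1)[OF 2(2)]]]
   by (simp add: wedge_def fun_eq_iff scaleR_fun_def)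
 qed
qed

text \<open>A local frame and its dual coframe, both cut off so as to be global. The resulting
  decomposition of a multiple of the identity underlies tensoriality and local generation.\<close>

lemma partial_identity:
 obtains n :: nat and a eps chi where "\<forall>i<n. a i : sections M A & eps i : Omega_fun M A 1" "chi : Cinf M" "chi x = 1"
  "\<forall>y. ALL v:fib A y. chi y *\<^sub>R v = (\<Sum>i<n. eps i y [v] *\<^sub>R a i y)"
proof -
 obtain U ts where f: "(U, ts) : frames A" "x : U" using frame_at[OF A] .
 obtain h V K where b: "h : Cinf M" "open V" "x : V" "V <= K" "!!y. y : V ==> h y = 1" "closed K" "K <= U"
  "!!y. y \<notin> K ==> h y = 0"
  using bump[OF frameD(1)[OF A f(1)] f(2)] by blast
 define co where "co y v = (SOME c. v = (\<Sum>j<length ts. c j *\<^sub>R (ts ! j) y))" for y v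
 have co: "v = (\<Sum>j<length ts. co y v j *\<^sub>R (ts ! j) y)" if y: "y : U" and v: "v : fib A y" for y v
 proof -
  obtain d where "v = (\<Sum>j<length ts. d j *\<^sub>R (ts ! j) y)" using frame_span[OF A f(1) y v] .
  then show ?thesis unfolding co_def by (rule someI[of "%c. v = (\<Sum>j<length ts. c j *\<^sub>R (ts ! j) y)"])
 qed
 have co_eq: "co y v j = d j" if y: "y : U" and v: "v : fib A y" "v = (\<Sum>j<length ts. d j *\<^sub>R (ts ! j) y)" and j: "j < length ts" for y v d j
  using frame_unique[OF A f(1) y j, of "co y v" d] co[OF y v(1)] v(2) by simp
 define eps where "eps j y vs = (case vs of [v] => if y : U & v : fib A y then h y * co y v j else 0 | _ => 0)" for j y vs
 have eps1: "eps j y [v] = (if y : U & v : fib A y then h y * co y v j else 0)" for j y v by (simp add: eps_def)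
 have eps2: "eps j y vs = 0" if "length vs ~= 1" for j y vs using that by (auto simp: eps_def split: list.splits)
 have lin: "eps j y [c *\<^sub>R v + w] = c * eps j y [v] + eps j y [w]" if "v : fib A y" "w : fib A y" and j: "j < length ts" for j y c v w
 proof (cases "y : U")
  case True
  have vw: "c *\<^sub>R v + w : fib A y" using that by (intro subspace_add subspace_scale A_facts(1))
  have "c *\<^sub>R v + w = (\<Sum>j<length ts. (c * co y v j + co y w j) *\<^sub>R (ts ! j) y)"
   using arg_cong[OF co[OF True that(1)], of "scaleR c"] co[OF True that(2)]
   by (simp add: scaleR_add_left sum.distrib scaleR_sum_right)
  from co_eq[OF True vw this j] show ?thesis using that True vw by (simp add: eps1 algebra_simps)
 qed (simp add: eps1)
 have epsO: "eps j : Omega_fun M A 1" if j: "j < length ts" for j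
 proof -
  have "eps j : Omega M A trivial_line (int (Suc 0))"
  proof (rule OmegaI)
   fix y
   show "eps j y : alt_forms (fib A y) (fib trivial_line y) (Suc 0)"
   proof (rule alt_forms_SucI)
    show "ins v (eps j y) : alt_forms (fib A y) (fib trivial_line y) 0" for v
     by (rule alt_forms_0I) (auto simp: ins_def eps2 trivial_line_def)
    show "eps j y (v # us) = 0" if "v \<notin> fib A y" for v us
     using that by (cases us) (auto simp: eps_def)
    show "eps j y ((c *\<^sub>R v + w) # us) = c *\<^sub>R eps j y (v # us) + eps j y (w # us)" if "v : fib A y" "w : fib A y" for v w us c
     using lin[OF that j] by (cases us) (auto simp: eps2)
   qed (auto simp: eps2 A_facts)
  next
   fix ss assume "length ss = Suc 0" "set ss <= sections M A"
   then obtain s where ss: "ss = [s]" and s: "s : sections M A" by (auto simp: length_Suc_conv)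
   from sec_coeff[OF A sections_on[OF A s, of U] f(1)] obtain c where
    c: "!!j. j < length ts ==> smooth_fun_on M (U \<inter> U) (c j)" "!!x. x : U ==> x : U ==> s x = (\<Sum>j<length ts. c j x *\<^sub>R (ts ! j) x)" by blast
   have "smooth_fun_on M U (%y. h y * c j y)"
    using c(1)[OF j] by (intro smooth_fun_on_mult) (simp_all add: Cinf_smooth[OF b(1)])
   moreover have "h y * c j y = ev (eps j) ss y" if "y : U" for y
    using co_eq[OF that sections_fib[OF A s] c(2)[OF that that] j] that sections_fib[OF A s] by (simp add: ss ev_def eps1)
   ultimately have "smooth_fun_on M U (ev (eps j) ss)"
    using smooth_fun_on_cong[of U "%y. h y * c j y" "ev (eps j) ss"] by simp
   moreover have "smooth_fun_on M (- K) (ev (eps j) ss)"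
    using smooth_fun_on_const[of M "- K" 0] smooth_fun_on_cong[of "- K" "ev (eps j) ss" "%_. 0"] b(8) by (auto simp: ss ev_def eps1)
   ultimately show "ev (eps j) ss : sections M trivial_line"
    unfolding sections_trivial_line using frameD(1)[OF A f(1)] b by (intro CinfI_local) (metis ComplI open_Compl subsetD)
  qed
  then show ?thesis by simp
 qed
 define a where "a j = sc h (ts ! j)" for j
 have aO: "a j : sections M A" if j: "j < length ts" for j
 proof -
  have "smooth_section_on M A U (a j)"
   unfolding a_def using j by (intro sec_sc[OF A] Cinf_smooth b frameD(5)[OF A f(1)]) auto
  moreover have "smooth_section_on M A (- K) (a j)"
   by (rule sec_cong[OF A sec_zero[OF A]]) (use b(8) in \<open>auto simp: a_def sc_def\<close>)
  ultimately show ?thesis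
   using frameD(1)[OF A f(1)] b by (intro sectionsI_local[OF A]) (metis ComplI open_Compl subsetD)
 qed
 \<comment> \<open>The frame and the coframe carry one factor \<open>h\<close> each; therefore the
   cut-off function obtained is the square of \<open>h\<close>.\<close>
 have "(h y * h y) *\<^sub>R v = (\<Sum>i<length ts. eps i y [v] *\<^sub>R a i y)" if v: "v : fib A y" for y v
 proof (cases "y : U")
  case True
  then show ?thesis
   using arg_cong[OF co[OF True v], of "scaleR (h y * h y)"] v
   by (simp add: eps1 a_def sc_def scaleR_sum_right mult_ac)
 next
  case False
  then have "h y = 0" using b by auto
  then show ?thesis by (simp add: eps1 a_def sc_def)
 qed
 then show ?thesis
  by (intro that[of "length ts" a eps "h * h"]) (use epsO aO b Cinf_mult in auto)
qed

text \<open>Up to a function equal to 1 at \<open>x\<close>, the section \<open>Z\<close> is a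
  combination of fixed sections whose coefficients are values of one-forms on \<open>Z\<close>.
  Linearity over functions pulls these out of \<open>H\<close>, and at \<open>x\<close> they vanish
  together with \<open>Z\<close>.\<close>

lemma clin_vanish:
 fixes H :: "('m => 'e) => 'm => 'v::real_vector"
 assumes H: "!!Z W f. Z : sections M A ==> W : sections M A ==> f : Cinf M ==> H (sc f Z + W) = sc f (H Z) + H W"
  and Z: "Z : sections M A" "Z x = 0"
 shows "H Z x = 0"
proof -
 obtain n :: nat and a eps chi where *: "\<forall>i<n. a i : sections M A & eps i : Omega_fun M A 1" "chi : Cinf M" "chi x = 1"
  "\<forall>y. ALL v:fib A y. chi y *\<^sub>R v = (\<Sum>i<n. eps i y [v] *\<^sub>R a i y)" by (rule partial_identity)
 have e: "ev (eps i) [Z] : Cinf M" if "i < n" for i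
  using OmegaD(2)[of "eps i" trivial_line 1 "[Z]"] *(1) that Z(1) by (simp add: sections_trivial_line)
 have "sc (%_. 1) 0 + 0 = (0 :: 'm => 'e)" "sc (%_. 1) (H 0) = H 0" by (simp_all add: sc_def fun_eq_iff)
 then have H0: "H 0 = 0" using H[OF A_facts(5) A_facts(5) Cinf_const, of 1] by simp
 have sum: "H (\<Sum>i<m. sc (ev (eps i) [Z]) (a i)) = (\<Sum>i<m. sc (ev (eps i) [Z]) (H (a i)))
   & (\<Sum>i<m. sc (ev (eps i) [Z]) (a i)) : sections M A" if "m <= n" for m
  using that
 proof (induction m)
  case (Suc m)
  then have IH: "H (\<Sum>i<m. sc (ev (eps i) [Z]) (a i)) = (\<Sum>i<m. sc (ev (eps i) [Z]) (H (a i)))"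
   "(\<Sum>i<m. sc (ev (eps i) [Z]) (a i)) : sections M A" and m: "m < n" by auto
  note am = *(1)[rule_format, OF m, THEN conjunct1]
  show ?case
   unfolding sum.lessThan_Suc add.commute[of "\<Sum>i<m. _ i"] H[OF am IH(2) e[OF m]] IH(1)
   by (intro conjI refl A_facts am IH(2) e[OF m])
 qed (simp only: lessThan_0 sum.empty H0 A_facts simp_thms)
 have "sc chi Z + 0 = (\<Sum>i<n. sc (ev (eps i) [Z]) (a i))"
  using *(4) A_facts(2)[OF Z(1)] by (simp add: fun_eq_iff sc_def sum_fun_apply ev_def)
 then have "sc chi (H Z) + H 0 = (\<Sum>i<n. sc (ev (eps i) [Z]) (H (a i)))"
  using H[OF Z(1) A_facts(5) *(2)] sum[of n] by simp
 from fun_cong[OF this, of x] have "H Z x = (\<Sum>i<n. eps i x [0] *\<^sub>R H (a i) x)"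
  using *(3) H0 Z(2) by (simp add: sc_def sum_fun_apply ev_def)
 moreover have "eps i x [0] = 0" if "i < n" for i
 proof -
  have "eps i x : alt_forms (fib A x) (fib trivial_line x) 1" using OmegaD(1)[of "eps i" trivial_line 1] *(1) that by simp
  from alt_formsD(3)[OF this, of 0 0 "[]" 1] show ?thesis using subspace_0[OF A_facts(1)] by simp
 qed
 ultimately show ?thesis by simp
qed

end

context fbun
begin

context
 fixes Lb :: "('m, 'v::real_vector) vbundle"
 assumes Lb: "vector_bundle M Lb"
begin

text \<open>The head of the list is replaced by means of \<open>clin_vanish\<close> applied to the
  difference of the two sections; the tail is left to the induction.\<close>

lemma tens_pointwise:
 assumes "tens M A Lb n F" "set ss <= sections M A" "set ss' <= sections M A"
  "map (%s. s x) ss = map (%s. s x) ss'"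
 shows "F ss x = F ss' x"
 using assms
proof (induction ss arbitrary: F n ss')
 case (Cons Z Zs)
 then obtain Z' Zs' where ss': "ss' = Z' # Zs'" "Z x = Z' x" "map (%s. s x) Zs = map (%s. s x) Zs'"
  by (cases ss') auto
 have G: "Z : sections M A" "Z' : sections M A" "set Zs <= sections M A" "set Zs' <= sections M A"
  using Cons.prems ss' by auto
 show ?case
 proof (cases n)
  case 0
  then show ?thesis using Cons.prems(1) G by (simp add: ss')
 next
  case (Suc m)
  note T = Cons.prems(1)[unfolded Suc tens.simps]
  have lin: "F ((sc f Z + W) # Zs) = sc f (F (Z # Zs)) + F (W # Zs)"
   if "Z : sections M A" "W : sections M A" "f : Cinf M" for Z W f
   using T that G(3) by blast
  have 0: "F ((Z - Z') # Zs) x = 0"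
   by (rule clin_vanish[of "%Z. F (Z # Zs)"]) (use lin ss'(2) A_facts(7)[OF G(1,2)] in auto)
  have "sc (%_. 1) (Z - Z') + Z' = Z" by (simp add: sc_def fun_eq_iff)
  then have "F (Z # Zs) x = F (Z' # Zs) x"
   using fun_cong[OF lin[OF A_facts(7)[OF G(1,2)] G(2) Cinf_const[of 1]], of x] 0 by (simp add: sc_def)
  also have "\<dots> = F (Z' # Zs') x"
   by (rule Cons.IH[of m "%ss. F (Z' # ss)"]) (use T G ss' in auto)
  finally show ?thesis by (simp add: ss')
 qed
qed auto

lemma some_section: "v : fib A x ==> (SOME s. s : sections M A & s x = v) : sections M A"
 "v : fib A x ==> (SOME s. s : sections M A & s x = v) x = v"
 using someI_ex[OF fib_section, of v x] by auto

lemma ev_mkform: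
 assumes "tens M A Lb n F" "set ss <= sections M A"
 shows "ev (mkform M A F) ss = F ss"
proof
 fix x
 let ?vs = "map (%s. s x) ss"
 have vs: "set ?vs <= fib A x" using assms(2) A_facts(2) by auto
 have "F (map (%v. SOME s. s : sections M A & s x = v) ?vs) x = F ss x"
  by (rule tens_pointwise[OF assms(1) _ assms(2)]) (use vs some_section in \<open>auto simp: comp_def\<close>)
 then show "ev (mkform M A F) ss x = F ss x" using vs by (simp add: ev_def mkform_def)
qed

lemma mkform_alt: "tens M A Lb n F ==> mkform M A F x : alt_forms (fib A x) (fib Lb x) n"
proof (induction n arbitrary: F)
 case 0
 show ?case
 proof (rule alt_forms_0I)
  show "mkform M A F x [] : fib Lb x" using 0 sections_fib[OF Lb] by (simp add: mkform_def)
  show "mkform M A F x (v # us) = 0" for v us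
  proof (cases "set (v # us) <= fib A x")
   case True
   let ?e = "%v. SOME s. s : sections M A & s x = v"
   have "set (?e v # map ?e us) <= sections M A" using True some_section by auto
   then have "F (?e v # map ?e us) = 0" using 0 unfolding tens.simps by blast
   then show ?thesis using True by (simp add: mkform_def)
  qed (simp only: mkform_def if_False)
 qed
next
 case (Suc n)
 let ?e = "%v. SOME s. s : sections M A & s x = v"
 note T = Suc.prems[unfolded tens.simps]
 have e: "set (map ?e us) <= sections M A" if "set us <= fib A x" for us using that some_section by auto
 have ein: "ins v (mkform M A F x) = mkform M A (%ss. F (?e v # ss)) x" if "v : fib A x" for v
  using that by (auto simp: ins_def mkform_def fun_eq_iff)
 show ?case
 proof (rule alt_forms_SucI[OF A_facts(1)])
  show "ins v (mkform M A F x) : alt_forms (fib A x) (fib Lb x) n" if "v : fib A x" for v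
   unfolding ein[OF that] using T some_section(1)[OF that] by (intro Suc.IH) blast
  show "mkform M A F x [] = 0" using T by (simp add: mkform_def)
  show "mkform M A F x (v # us) = 0" if "v \<notin> fib A x" for v us using that by (simp add: mkform_def)
  show "mkform M A F x ((c *\<^sub>R v + w) # us) = c *\<^sub>R mkform M A F x (v # us) + mkform M A F x (w # us)"
   if vw: "v : fib A x" "w : fib A x" and us: "set us <= fib A x" for v w us c
  proof -
   have cvw: "c *\<^sub>R v + w : fib A x" using vw by (intro subspace_add subspace_scale A_facts(1))
   note s = some_section[OF vw(1)] some_section[OF vw(2)] some_section[OF cvw]
   have g: "sc (%_. c) (?e v) + ?e w : sections M A"
    using s A_facts(3,4) Cinf_const by blast
   have "F (?e (c *\<^sub>R v + w) # map ?e us) x = F ((sc (%_. c) (?e v) + ?e w) # map ?e us) x"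
    by (rule tens_pointwise[OF Suc.prems]) (use s e[OF us] g in \<open>auto simp: sc_def\<close>)
   also have "F ((sc (%_. c) (?e v) + ?e w) # map ?e us) = sc (%_. c) (F (?e v # map ?e us)) + F (?e w # map ?e us)"
    using T s(1,3) e[OF us] Cinf_const by blast
   finally show ?thesis using vw us cvw by (simp add: mkform_def sc_def)
  qed
  show "mkform M A F x (v # v # us) = 0" if "v : fib A x" "set us <= fib A x" for v us
  proof -
   have "F (?e v # ?e v # map ?e us) = 0" using T some_section(1)[OF that(1)] e[OF that(2)] by blast
   then show ?thesis using that by (simp add: mkform_def)
  qed
 qed
qed

lemma tens_sections: "tens M A Lb n F ==> set ss <= sections M A ==> length ss = n ==> F ss : sections M Lb"
proof (induction n arbitrary: F ss)
 case (Suc n)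
 then obtain Z Zs where "ss = Z # Zs" by (cases ss) auto
 then show ?case using Suc.IH[of "%ss. F (Z # ss)" Zs] Suc.prems by simp
qed simp

lemma mkform_Omega: "tens M A Lb n F ==> mkform M A F : Omega M A Lb (int n)"
 by (rule OmegaI) (simp_all add: mkform_alt ev_mkform tens_sections)

lemma tens_diff: "tens M A Lb n F ==> tens M A Lb n H ==> tens M A Lb n (%ss. F ss - H ss)"
proof (induction n arbitrary: F H)
 case (Suc n)
 note F = Suc.prems(1)[unfolded tens.simps] and H = Suc.prems(2)[unfolded tens.simps]
 have sc: "sc f a + a' - (sc f b + b') = sc f (a - b) + (a' - b')" for f and a b a' b' :: "'m => 'v"
  by (simp add: sc_def fun_eq_iff scaleR_diff_right)
 have "F ((sc f Z + W) # ss) - H ((sc f Z + W) # ss) = sc f (F (Z # ss) - H (Z # ss)) + (F (W # ss) - H (W # ss))"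
  if "Z : sections M A" "W : sections M A" "f : Cinf M" "set ss <= sections M A" for Z W f ss
 proof -
  have f: "F ((sc f Z + W) # ss) = sc f (F (Z # ss)) + F (W # ss)" using F that by blast
  have h: "H ((sc f Z + W) # ss) = sc f (H (Z # ss)) + H (W # ss)" using H that by blast
  show ?thesis unfolding f h sc ..
 qed
 moreover have "F (Z # Z # ss) - H (Z # Z # ss) = 0" if "Z : sections M A" "set ss <= sections M A" for Z ss
 proof -
  have f: "F (Z # Z # ss) = 0" using F that by blast
  have h: "H (Z # Z # ss) = 0" using H that by blast
  show ?thesis unfolding f h by (rule diff_self)
 qed
 moreover have "tens M A Lb n (%ss. F (Z # ss) - H (Z # ss))" if "Z : sections M A" for Z
  by (rule Suc.IH) (use F H that in blast)+
 moreover have "F [] - H [] = 0"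
 proof -
  have f: "F [] = 0" using F by blast
  have h: "H [] = 0" using H by blast
  show ?thesis unfolding f h by (rule diff_self)
 qed
 ultimately show ?case unfolding tens.simps by blast
qed (simp add: sections_diff[OF Lb])

lemma tens_ev: "al : Omega M A Lb (int n) ==> tens M A Lb n (ev al)"
proof (induction n arbitrary: al)
 case 0
 then show ?case using OmegaD(2)[OF 0, of "[]"] iota_Omega[OF 0] by (auto simp: ev_Cons Omega_neg ev_zero)
next
 case (Suc n)
 have "ev al [] = 0" using Omega_outside[OF Suc.prems] by (simp add: ev_Nil fun_eq_iff)
 moreover have "tens M A Lb n (%ss. ev al (Z # ss))" if "Z : sections M A" for Z
  unfolding ev_Cons using Suc.IH iota_Omega[OF Suc.prems that] by simp
 moreover have "ev al ((sc f Z + W) # ss) = sc f (ev al (Z # ss)) + ev al (W # ss)"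
  if "Z : sections M A" "W : sections M A" "set ss <= sections M A" for Z W f ss
 proof
  fix x
  have "set (map (%s. s x) ss) <= fib A x" using that A_facts(2) by auto
  from alt_formsD(3)[OF OmegaD(1)[OF Suc.prems] A_facts(2)[OF that(1)] A_facts(2)[OF that(2)] this]
  show "ev al ((sc f Z + W) # ss) x = (sc f (ev al (Z # ss)) + ev al (W # ss)) x"
   by (simp add: ev_def sc_def)
 qed
 moreover have "ev al (Z # Z # ss) = 0" for Z ss
  using alt_formsD(4)[OF OmegaD(1)[OF Suc.prems]] by (auto simp: ev_def fun_eq_iff)
 ultimately show ?case by simp
qed

lemma iota_clin:
 assumes "al : Omega M A Lb k" "Z : sections M A" "W : sections M A" "f : Cinf M"
 shows "iota (sc f Z + W) al = sc f (iota Z al) + iota W al"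
 using assms(1)
proof (cases rule: Omega_cases)
 case (2 n)
 have "ins (f x *\<^sub>R Z x + W x) (al x) = f x *\<^sub>R ins (Z x) (al x) + ins (W x) (al x)" for x
  by (rule alt_forms_ins_linear[OF OmegaD(1)[OF 2(2)]]) (auto intro: A_facts assms)
 then show ?thesis by (simp add: iota_def sc_def plus_fun_def)
next
 case 1
 show ?thesis unfolding 1(2) iota_zero by (simp add: sc_def fun_eq_iff)
qed

lemma iota_iota:
 assumes "al : Omega M A Lb k" "Z : sections M A" "W : sections M A"
 shows "iota Z (iota W al) = - iota W (iota Z al)" "iota Z (iota Z al) = 0"
proof -
 have *: "iota Z (iota Z al) = 0" if "Z : sections M A" for Z
  using assms(1)
 proof (cases rule: Omega_cases)
  case (2 n)
  then show ?thesis using alt_forms_ins_ins[OF OmegaD(1)[OF 2(2)]] by (simp add: iota_def fun_eq_iff)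
 qed (simp add: iota_zero)
 from this[OF assms(2)] show "iota Z (iota Z al) = 0" .
 have e: "sc (%_. 1) Z + W = Z + W" by (simp add: sc_def fun_eq_iff)
 have sc1: "sc (%_. 1) be = be" for be :: "'m => 'e list => 'v" by (simp add: sc_def)
 note L = iota_clin[OF _ assms(2,3) Cinf_const[of 1], unfolded e sc1]
 have "0 = iota (Z + W) (iota (Z + W) al)" using * A_facts(3)[OF assms(2,3)] by simp
 also have "\<dots> = iota Z (iota Z al) + iota Z (iota W al) + (iota W (iota Z al) + iota W (iota W al))"
  unfolding L[OF assms(1)] iota_add L[OF iota_Omega[OF assms(1,2)]] L[OF iota_Omega[OF assms(1,3)]]
  by (simp only: add_ac)
 finally show "iota Z (iota W al) = - iota W (iota Z al)"
  using *[OF assms(2)] *[OF assms(3)] by (simp add: eq_neg_iff_add_eq_0)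
qed

lemma iota_pointwise: "Z x = W x ==> iota Z al x = iota W al x"
 by (simp add: iota_def)

text \<open>Every form is, up to a cut-off function, a sum of products of one-forms with forms of lower degree.\<close>

lemma local_generation:
 assumes "al : Omega M A Lb (int (Suc k))"
 obtains n :: nat and eps be chi where "\<forall>i<n. eps i : Omega_fun M A 1 & be i : Omega M A Lb (int k)" "chi : Cinf M"
  "chi x = 1" "sc chi al = (\<Sum>i<n. wedge (eps i) (be i))"
proof -
 obtain n :: nat and a eps chi where *: "\<forall>i<n. a i : sections M A & eps i : Omega_fun M A 1" "chi : Cinf M" "chi x = 1"
  "\<forall>y. ALL v:fib A y. chi y *\<^sub>R v = (\<Sum>i<n. eps i y [v] *\<^sub>R a i y)" by (rule partial_identity)
 have eO: "eps i : Omega_fun M A 1" "a i : sections M A" if "i < n" for i using * that by auto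
 have contr: "sc chi (iota Z ga) = (\<Sum>i<n. sc (ev (eps i) [Z]) (iota (a i) ga))"
  if g: "ga : Omega M A Lb j" and Z: "Z : sections M A" for ga j Z
  using g
 proof (cases rule: Omega_cases)
  case 1
  show ?thesis unfolding 1(2) iota_zero by (simp add: sc_def fun_eq_iff sum_fun_apply)
 next
  case (2 m)
  show ?thesis
  proof
   fix y
   have lin: "ins (\<Sum>i<l. c i *\<^sub>R a i y) (ga y) = (\<Sum>i<l. c i *\<^sub>R ins (a i y) (ga y)) & (\<Sum>i<l. c i *\<^sub>R a i y) : fib A y"
    if "l <= n" for l c using that
   proof (induction l)
    case 0
    have "ins (1 *\<^sub>R 0 + 0) (ga y) = 1 *\<^sub>R ins 0 (ga y) + ins 0 (ga y)"
     by (rule alt_forms_ins_linear[OF OmegaD(1)[OF 2(2)]]) (auto intro: subspace_0 A_facts)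
    then show ?case by (simp add: subspace_0[OF A_facts(1)])
   next
    case (Suc l)
    then have IH: "ins (\<Sum>i<l. c i *\<^sub>R a i y) (ga y) = (\<Sum>i<l. c i *\<^sub>R ins (a i y) (ga y))"
     "(\<Sum>i<l. c i *\<^sub>R a i y) : fib A y" by auto
    have al: "a l y : fib A y" using A_facts(2) eO(2)[of l] Suc.prems by auto
    have "ins (c l *\<^sub>R a l y + (\<Sum>i<l. c i *\<^sub>R a i y)) (ga y) = c l *\<^sub>R ins (a l y) (ga y) + ins (\<Sum>i<l. c i *\<^sub>R a i y) (ga y)"
     by (rule alt_forms_ins_linear[OF OmegaD(1)[OF 2(2)] al IH(2) A_facts(1)])
    moreover have e: "(\<Sum>i<Suc l. c i *\<^sub>R a i y) = c l *\<^sub>R a l y + (\<Sum>i<l. c i *\<^sub>R a i y)"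
     by (simp add: add.commute)
    moreover have "c l *\<^sub>R a l y + (\<Sum>i<l. c i *\<^sub>R a i y) : fib A y"
     by (intro subspace_add[OF A_facts(1)] subspace_scale[OF A_facts(1)] al IH(2))
    moreover have "(\<Sum>i<Suc l. c i *\<^sub>R ins (a i y) (ga y)) = c l *\<^sub>R ins (a l y) (ga y) + (\<Sum>i<l. c i *\<^sub>R ins (a i y) (ga y))"
     by (simp only: sum.lessThan_Suc add.commute)
    ultimately show ?case using IH(1) by (simp only: simp_thms)
   qed
   have "chi y *\<^sub>R Z y + 0 = (\<Sum>i<n. ev (eps i) [Z] y *\<^sub>R a i y)"
    using *(4) A_facts(2)[OF Z] by (simp add: ev_def)
   moreover have "ins (chi y *\<^sub>R Z y + 0) (ga y) = chi y *\<^sub>R ins (Z y) (ga y) + ins 0 (ga y)"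
    by (rule alt_forms_ins_linear[OF OmegaD(1)[OF 2(2)]]) (auto intro: subspace_0 A_facts Z)
   moreover have "ins 0 (ga y) = 0" using lin[of 0] by simp
   ultimately show "sc chi (iota Z ga) y = (\<Sum>i<n. sc (ev (eps i) [Z]) (iota (a i) ga)) y"
    using lin[of n "%i. ev (eps i) [Z] y"] by (simp add: sc_def iota_def sum_fun_apply)
  qed
 qed
 \<comment> \<open>The Euler identity: contracting with the frame and wedging with the coframe
   multiplies a form by its degree, up to the cut-off. Division by the positive degree then yields
   the decomposition.\<close>
 have euler: "(\<Sum>i<n. wedge (eps i) (iota (a i) ga)) = sc chi (real j *\<^sub>R ga)" if "ga : Omega M A Lb (int j)" for ga j
  using that
 proof (induction j arbitrary: ga)
  case 0
  then have "iota (a i) ga = 0" if "i < n" for i using iota_Omega[OF 0 eO(2)[OF that]] by (simp add: Omega_neg)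
  then have "(\<Sum>i<n. wedge (eps i) (iota (a i) ga)) = (\<Sum>i<n. 0)"
   by (intro sum.cong) (auto simp: wedge_zero_right)
  then show ?case by (simp add: sc_def fun_eq_iff scaleR_fun_def)
 next
  case (Suc j)
  have wO: "wedge (eps i) (iota (a i) ga) : Omega M A Lb (int (Suc j))" if "i < n" for i
   using wedge_Omega[OF Lb eO(1)[OF that] iota_Omega[OF Suc.prems eO(2)[OF that]]] by simp
  show ?case
  proof (rule Omega_ext)
   show "(\<Sum>i<n. wedge (eps i) (iota (a i) ga)) : Omega M A Lb (int (Suc j))"
    by (intro Omega_sum[OF Lb] wO) auto
   show "sc chi (real (Suc j) *\<^sub>R ga) : Omega M A Lb (int (Suc j))"
    by (intro Omega_sc[OF Lb] Omega_scale[OF Lb] Suc.prems *)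
   fix Z assume Z: "Z : sections M A"
   have iO: "iota Z ga : Omega M A Lb (int j)" using iota_Omega[OF Suc.prems Z] by simp
   have isum: "iota Z (\<Sum>i<m. \<eta> i) = (\<Sum>i<m. iota Z (\<eta> i))" for m and \<eta> :: "nat => 'm => 'e list => 'v"
    by (simp add: iota_def ins_def fun_eq_iff sum_fun_apply)
   have t: "iota Z (wedge (eps i) (iota (a i) ga)) = sc (ev (eps i) [Z]) (iota (a i) ga) + wedge (eps i) (iota (a i) (iota Z ga))"
    if "i < n" for i
   proof -
    have "iota Z (eps i) : Omega_fun M A 0" using iota_Omega[OF eO(1)[OF that] Z] by simp
    from Omega_0(1)[OF this] have "iota Z (eps i) = form0 (ev (eps i) [Z])" by (simp add: ev_Cons)
    moreover have "iota Z (iota (a i) ga) = - iota (a i) (iota Z ga)" by (rule iota_iota(1)[OF Suc.prems Z eO(2)[OF that]])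
    ultimately show ?thesis
     by (simp add: iota_wedge wedge_form0 sg_Omega[OF eO(1)[OF that]] wedge_uminus_left wedge_uminus_right)
   qed
   have "iota Z (\<Sum>i<n. wedge (eps i) (iota (a i) ga))
     = (\<Sum>i<n. sc (ev (eps i) [Z]) (iota (a i) ga) + wedge (eps i) (iota (a i) (iota Z ga)))"
    unfolding isum by (rule sum.cong) (use t in auto)
   also have "\<dots> = sc chi (iota Z ga) + sc chi (real j *\<^sub>R iota Z ga)"
    unfolding sum.distrib contr[OF Suc.prems Z, symmetric] Suc.IH[OF iO] ..
   also have "\<dots> = iota Z (sc chi (real (Suc j) *\<^sub>R ga))"
    unfolding iota_sc iota_scale by (simp add: sc_def fun_eq_iff scaleR_fun_def algebra_simps)
   finally show "iota Z (\<Sum>i<n. wedge (eps i) (iota (a i) ga)) = iota Z (sc chi (real (Suc j) *\<^sub>R ga))" .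
  qed simp
 qed
 have "sc chi al = (1 / real (Suc k)) *\<^sub>R sc chi (real (Suc k) *\<^sub>R al)"
  by (simp add: sc_def fun_eq_iff scaleR_fun_def)
 also have "\<dots> = (\<Sum>i<n. wedge (eps i) ((1 / real (Suc k)) *\<^sub>R iota (a i) al))"
  unfolding euler[OF assms, symmetric] scaleR_sum_right wedge_scale_right ..
 finally have fin: "sc chi al = (\<Sum>i<n. wedge (eps i) ((1 / real (Suc k)) *\<^sub>R iota (a i) al))" .
 show ?thesis
 proof (rule that[OF _ *(2,3) fin])
  show "\<forall>i<n. eps i : Omega_fun M A 1 & (1 / real (Suc k)) *\<^sub>R iota (a i) al : Omega M A Lb (int k)"
   using eO iota_Omega[OF assms eO(2)] Omega_scale[OF Lb] by auto
 qed
qed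

end

end

section \<open>Graded derivations\<close>

text \<open>The Leibniz rule for an arbitrary target bundle, with no demand on \<open>Y\<close>.
  Taking the trivial line for the target turns it into the derivation property of the algebra, so
  every closure property is proved once and used for operator and symbol.\<close>

definition leib :: "('m, 'b::euclidean_space) manifold => ('m, 'e::real_vector) vbundle => ('m, 'v::real_vector) vbundle
  => int => (('m => 'e list => real) => 'm => 'e list => real) => (('m => 'e list => 'v) => 'm => 'e list => 'v) => bool" where
 "leib M A Lb d Y X \<longleftrightarrow> graded_linear (Omega M A Lb) (Omega M A Lb) d X &
   (\<forall>p k. \<forall>om\<in>Omega_fun M A p. \<forall>al\<in>Omega M A Lb k.
    X (wedge om al) = wedge (Y om) al + psign (d * p) *\<^sub>R wedge om (X al))"

lemma der_leib: "der M A Lb d Y X \<longleftrightarrow> leib M A trivial_line d Y Y & leib M A Lb d Y X"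
 unfolding der_def leib_def algebra_derivation_def ..

lemma leibD:
 assumes "leib M A Lb d Y X"
 shows "al : Omega M A Lb k ==> X al : Omega M A Lb (k + d)"
  "al : Omega M A Lb k ==> be : Omega M A Lb k ==> X (c *\<^sub>R al + be) = c *\<^sub>R X al + X be"
  "om : Omega_fun M A p ==> al : Omega M A Lb k ==>
   X (wedge om al) = wedge (Y om) al + psign (d * p) *\<^sub>R wedge om (X al)"
 using assms unfolding leib_def graded_linear_def by auto

lemma leibI:
 assumes "!!al k. al : Omega M A Lb k ==> X al : Omega M A Lb (k + d)"
  "!!al be k c. al : Omega M A Lb k ==> be : Omega M A Lb k ==> X (c *\<^sub>R al + be) = c *\<^sub>R X al + X be"
  "!!om p al k. om : Omega_fun M A p ==> al : Omega M A Lb k ==>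
   X (wedge om al) = wedge (Y om) al + psign (d * p) *\<^sub>R wedge om (X al)"
 shows "leib M A Lb d Y X"
 using assms unfolding leib_def graded_linear_def by auto

lemma der_module_derivation:
 assumes "der M A Lb d Y X"
 shows "module_derivation (Omega_fun M A) wedge (%k. Omega M A Lb (k + j)) wedge d X"
proof -
 have "graded_linear (%k. Omega M A Lb (k + j)) (%k. Omega M A Lb (k + j)) d X"
  unfolding graded_linear_def
 proof (intro allI ballI conjI)
  fix k v assume v: "v : Omega M A Lb (k + j)"
  have "k + j + d = k + d + j" by simp
  then show "X v : Omega M A Lb (k + d + j)"
   using assms v unfolding der_def graded_linear_def by metis
  show "X (c *\<^sub>R v + w) = c *\<^sub>R X v + X w" if "w : Omega M A Lb (k + j)" for w c
   using assms v that unfolding der_def graded_linear_def by blast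
 qed
 then show ?thesis using assms unfolding module_derivation_def der_def by blast
qed

lemma module_derivation_der:
 assumes "module_derivation (Omega_fun M A) wedge (%k. Omega M A Lb (k + j)) wedge d X"
 obtains Y where "der M A Lb d Y X"
proof -
 have s: "Omega M A Lb k = Omega M A Lb ((k - j) + j)" for k by simp
 from assms obtain Y where Y: "algebra_derivation (Omega_fun M A) wedge d Y"
  "!!p k a v. a : Omega_fun M A p ==> v : Omega M A Lb (k + j) ==> X (wedge a v) = wedge (Y a) v + psign (d * p) *\<^sub>R wedge a (X v)"
  and g: "graded_linear (%k. Omega M A Lb (k + j)) (%k. Omega M A Lb (k + j)) d X"
  unfolding module_derivation_def by blast
 have "X v : Omega M A Lb (k + d)" "ALL w:Omega M A Lb k. \<forall>c. X (c *\<^sub>R v + w) = c *\<^sub>R X v + X w"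
  if "v : Omega M A Lb k" for v k
  using g[unfolded graded_linear_def, rule_format, of v "k - j"] that by (simp_all add: algebra_simps)
 then have "graded_linear (Omega M A Lb) (Omega M A Lb) d X" unfolding graded_linear_def by blast
 moreover have "X (wedge a v) = wedge (Y a) v + psign (d * p) *\<^sub>R wedge a (X v)"
  if "a : Omega_fun M A p" "v : Omega M A Lb k" for a v p k
  using Y(2)[OF that(1), of v "k - j"] that(2) by simp
 ultimately show ?thesis using that[of Y] Y(1) unfolding der_def by blast
qed

lemma leib_additive:
 assumes "leib M A Lb d Y X" "al : Omega M A Lb k" "be : Omega M A Lb k"
 shows "X (al + be) = X al + X be"
 using leibD(2)[OF assms, of 1] by simp

context fbun
begin

lemmas tl = trivial_line_bundle

context
 fixes Lb :: "('m, 'v::real_vector) vbundle"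
 assumes Lb: "vector_bundle M Lb"
begin

lemma leib_zero:
 assumes "leib M A Lb d Y X"
 shows "X 0 = 0"
 using leibD(2)[OF assms Omega_zero[OF Lb, of 0] Omega_zero[OF Lb, of 0], of 1] by simp

lemma leib_scale:
 assumes "leib M A Lb d Y X" "al : Omega M A Lb k"
 shows "X (c *\<^sub>R al) = c *\<^sub>R X al"
 using leibD(2)[OF assms Omega_zero[OF Lb], of c] leib_zero[OF assms(1)] by simp

lemma leib_uminus:
 assumes "leib M A Lb d Y X" "al : Omega M A Lb k"
 shows "X (- al) = - X al"
 using leib_scale[OF assms, of "- 1"] by simp

lemma leib_sum:
 assumes "leib M A Lb d Y X" "!!i. i : I ==> al i : Omega M A Lb k"
 shows "X (\<Sum>i\<in>I. al i) = (\<Sum>i\<in>I. X (al i))"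
 using assms(2)
proof (induction I rule: infinite_finite_induct)
 case (insert i I)
 then have "X (al i + sum al I) = X (al i) + X (sum al I)"
  by (intro leib_additive[OF assms(1)] Omega_sum[OF Lb]) auto
 moreover have "X (sum al I) = (\<Sum>i\<in>I. X (al i))" using insert by auto
 ultimately show ?case unfolding sum.insert[OF insert.hyps] by (simp only: simp_thms)
qed (simp_all only: sum.infinite sum.empty leib_zero[OF assms(1)] not_False_eq_True)

lemma leib_const_zero: "leib M A Lb d (%_. 0) (%_. 0)"
 by (rule leibI) (simp_all add: Omega_zero[OF Lb] wedge_zero_left wedge_zero_right)

lemma leib_add:
 assumes "leib M A Lb d Y X" "leib M A Lb d Y' X'"
 shows "leib M A Lb d (%om. Y om + Y' om) (%al. X al + X' al)"
 using assms
 by (intro leibI) (auto simp: leibD(2,3)[OF assms(1)] leibD(2,3)[OF assms(2)] wedge_add_left wedge_add_right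
   scaleR_add_right intro: Omega_add[OF Lb] leibD(1))

lemma leib_smult:
 assumes "leib M A Lb d Y X"
 shows "leib M A Lb d (%om. c *\<^sub>R Y om) (%al. c *\<^sub>R X al)"
 using assms
 by (intro leibI) (auto simp: leibD(2,3)[OF assms(1)] wedge_scale_left wedge_scale_right
   scaleR_add_right mult.commute intro: Omega_scale[OF Lb] leibD(1))

lemma leib_wedge:
 assumes "leib M A trivial_line d Y Y" "leib M A Lb d Y X" "\<eta> : Omega_fun M A q"
 shows "leib M A Lb (q + d) (%om. wedge \<eta> (Y om)) (%al. wedge \<eta> (X al))"
proof (rule leibI)
 fix om p al k assume o: "om : Omega_fun M A p" and a: "al : Omega M A Lb k"
 have "wedge \<eta> (wedge om (X al)) = wedge (wedge \<eta> om) (X al)" by (simp only: wedge_assoc)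
 also have "\<dots> = psign (q * p) *\<^sub>R wedge om (wedge \<eta> (X al))"
  unfolding wedge_comm[OF assms(3) o] wedge_scale_left wedge_assoc ..
 finally show "wedge \<eta> (X (wedge om al)) = wedge (wedge \<eta> (Y om)) al + psign ((q + d) * p) *\<^sub>R wedge om (wedge \<eta> (X al))"
  unfolding leibD(3)[OF assms(2) o a] wedge_add_right wedge_scale_right
  by (simp add: wedge_assoc distrib_right distrib_left psign_add mult.commute)
next
 fix al k assume "al : Omega M A Lb k"
 from wedge_Omega[OF Lb assms(3) leibD(1)[OF assms(2) this]]
 show "wedge \<eta> (X al) : Omega M A Lb (k + (q + d))" by (simp add: algebra_simps)
qed (simp add: leibD(2)[OF assms(2)] wedge_add_right wedge_scale_right)

text \<open>The mixed terms, in which one operator has acted on each factor, arise in both orders of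
  composition and cancel thanks to the sign \<open>psign (d * e)\<close>.\<close>

lemma leib_commutator:
 assumes "leib M A trivial_line d Y Y" "leib M A Lb d Y X" "leib M A trivial_line e Y' Y'" "leib M A Lb e Y' X'"
 shows "leib M A Lb (d + e) (%om. Y (Y' om) - psign (d * e) *\<^sub>R Y' (Y om)) (%al. X (X' al) - psign (d * e) *\<^sub>R X' (X al))"
proof (rule leibI)
 fix al k assume "al : Omega M A Lb k"
 then show "X (X' al) - psign (d * e) *\<^sub>R X' (X al) : Omega M A Lb (k + (d + e))"
  using leibD(1)[OF assms(2) leibD(1)[OF assms(4)], of al k] leibD(1)[OF assms(4) leibD(1)[OF assms(2)], of al k]
  by (intro Omega_diff[OF Lb] Omega_scale[OF Lb]) (simp_all add: algebra_simps)
next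
 fix al be k c assume "al : Omega M A Lb k" "be : Omega M A Lb k"
 note ab = this
 show "X (X' (c *\<^sub>R al + be)) - psign (d * e) *\<^sub>R X' (X (c *\<^sub>R al + be))
   = c *\<^sub>R (X (X' al) - psign (d * e) *\<^sub>R X' (X al)) + (X (X' be) - psign (d * e) *\<^sub>R X' (X be))"
  unfolding leibD(2)[OF assms(2) ab] leibD(2)[OF assms(4) ab]
   leibD(2)[OF assms(2) leibD(1)[OF assms(4) ab(1)] leibD(1)[OF assms(4) ab(2)]]
   leibD(2)[OF assms(4) leibD(1)[OF assms(2) ab(1)] leibD(1)[OF assms(2) ab(2)]]
  by (simp add: fun_eq_iff scaleR_fun_apply algebra_simps)
next
 fix om p al k assume o: "om : Omega_fun M A p" and a: "al : Omega M A Lb k"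
 note Yo = leibD(1)[OF assms(1) o] and Y'o = leibD(1)[OF assms(3) o]
 note Xa = leibD(1)[OF assms(2) a] and X'a = leibD(1)[OF assms(4) a]
 have 1: "X (X' (wedge om al)) = wedge (Y (Y' om)) al + psign (d * (p + e)) *\<^sub>R wedge (Y' om) (X al)
   + psign (e * p) *\<^sub>R (wedge (Y om) (X' al) + psign (d * p) *\<^sub>R wedge om (X (X' al)))"
 proof -
  have "wedge om (X' al) : Omega M A Lb (p + k + e)" "wedge (Y' om) al : Omega M A Lb (p + k + e)"
   using wedge_Omega[OF Lb o X'a] wedge_Omega[OF Lb Y'o a] by (simp_all add: algebra_simps)
  then have "X (psign (e * p) *\<^sub>R wedge om (X' al) + wedge (Y' om) al)
    = psign (e * p) *\<^sub>R X (wedge om (X' al)) + X (wedge (Y' om) al)" by (rule leibD(2)[OF assms(2)])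
  then show ?thesis
   unfolding leibD(3)[OF assms(4) o a] leibD(3)[OF assms(2) o X'a] leibD(3)[OF assms(2) Y'o a] by (simp only: add_ac)
 qed
 have 2: "X' (X (wedge om al)) = wedge (Y' (Y om)) al + psign (e * (p + d)) *\<^sub>R wedge (Y om) (X' al)
   + psign (d * p) *\<^sub>R (wedge (Y' om) (X al) + psign (e * p) *\<^sub>R wedge om (X' (X al)))"
 proof -
  have "wedge om (X al) : Omega M A Lb (p + k + d)" "wedge (Y om) al : Omega M A Lb (p + k + d)"
   using wedge_Omega[OF Lb o Xa] wedge_Omega[OF Lb Yo a] by (simp_all add: algebra_simps)
  then have "X' (psign (d * p) *\<^sub>R wedge om (X al) + wedge (Y om) al)
    = psign (d * p) *\<^sub>R X' (wedge om (X al)) + X' (wedge (Y om) al)" by (rule leibD(2)[OF assms(4)])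
  then show ?thesis
   unfolding leibD(3)[OF assms(2) o a] leibD(3)[OF assms(4) o Xa] leibD(3)[OF assms(4) Yo a] by (simp only: add_ac)
 qed
 have s1: "psign (d * (p + e)) = psign (d * e) * psign (d * p)" "psign (e * (p + d)) = psign (d * e) * psign (e * p)"
  "psign ((d + e) * p) = psign (d * p) * psign (e * p)"
  by (simp_all add: distrib_left distrib_right psign_add mult.commute)
 show "X (X' (wedge om al)) - psign (d * e) *\<^sub>R X' (X (wedge om al))
   = wedge (Y (Y' om) - psign (d * e) *\<^sub>R Y' (Y om)) al
    + psign ((d + e) * p) *\<^sub>R wedge om (X (X' al) - psign (d * e) *\<^sub>R X' (X al))"
  unfolding 1 2 s1 wedge_diff_left wedge_diff_right wedge_scale_left wedge_scale_right
  by (simp add: psign_def fun_eq_iff scaleR_fun_apply algebra_simps)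
qed

end

text \<open>A derivation is local, and it is determined at a point by its values there on generators.\<close>

context
 fixes L :: "('m, 'l::real_vector) vbundle"
 assumes L: "line_bundle M L"
begin

lemma vbL: "vector_bundle M L"
 using L by (simp add: line_bundle_def)

lemma line_frame_obj:
 obtains lam nu V where "lam : sections M L" "open V" "x : V" "ALL y:V. nu y (lam y) = 1"
  "ALL y:V. ALL l:fib L y. nu y l *\<^sub>R lam y = l" "ALL s:sections M L. (%y. nu y (s y)) : Cinf M"
  "\<forall>y. ALL l:fib L y. \<forall>l'\<in>fib L y. \<forall>c. nu y (c *\<^sub>R l + l') = (c * nu y l + nu y l' :: real)"
proof (rule line_frame[OF L, of x])
 fix lam nu V
 assume "lam : sections M L" "open V" "x : V" "!!y. y : V ==> nu y (lam y) = 1"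
  "!!y l. y : V ==> l : fib L y ==> nu y l *\<^sub>R lam y = l"
  "!!s. s : sections M L ==> (%y. nu y (s y)) : Cinf M"
  "!!y l l' c. l : fib L y ==> l' : fib L y ==> nu y (c *\<^sub>R l + l') = (c * nu y l + nu y l' :: real)"
 then show thesis by (intro that[of lam V nu]) simp_all
qed

lemma nonzero_section: obtains s where "s : sections M L" "s x ~= 0"
proof -
 obtain lam nu V where *: "lam : sections M L" "open V" "x : V" "ALL y:V. nu y (lam y) = 1"
  "ALL y:V. ALL l:fib L y. nu y l *\<^sub>R lam y = l" "ALL s:sections M L. (%y. nu y (s y)) : Cinf M"
  "\<forall>y. ALL l:fib L y. \<forall>l'\<in>fib L y. \<forall>c. nu y (c *\<^sub>R l + l') = (c * nu y l + nu y l' :: real)"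
  by (rule line_frame_obj)
 have "0 : fib L x" using subspace_0[OF subspace_fib[OF vbL]] .
 then have "nu x (1 *\<^sub>R 0 + 0) = 1 * nu x 0 + nu x 0" using *(7) by blast
 then have "nu x 0 = 0" by simp
 then have "lam x ~= 0" using *(3,4) by auto
 then show ?thesis using that *(1) by blast
qed

lemma wedge_form0_right: "wedge om (form0 s) x vs = om x vs *\<^sub>R s x"
 for om :: "'m => 'e list => real" and s :: "'m => 'l"
proof -
 have "alt_wedge f (%vs. if vs = [] then s x else 0) us = f us *\<^sub>R s x" for f and us :: "'e list"
 proof (induction us arbitrary: f)
  case (Cons u us)
  have "ins u (%vs. if vs = [] then s x else 0) = 0" by (simp add: ins_def fun_eq_iff)
  then have "alt_wedge f (%vs. if vs = [] then s x else 0) (u # us) = alt_wedge (ins u f) (%vs. if vs = [] then s x else 0) us"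
   by (simp add: alt_wedge_Cons alt_wedge_zero)
  then show ?case unfolding Cons by (simp add: ins_def)
 qed (simp add: alt_wedge_Nil)
 from this[of "om x" vs] show ?thesis by (simp only: wedge_def form0_def)
qed

text \<open>A real form is recovered from its products with sections of \<open>L\<close>, one of
  which does not vanish at \<open>x\<close>. In this way the symbol is controlled by the module
  derivation.\<close>

lemma wedge_eq_zero_at:
 fixes om :: "'m => 'e list => real"
 assumes "!!s. s : sections M L ==> wedge om (form0 s) x = 0"
 shows "om x = 0"
proof -
 obtain s where s: "s : sections M L" "s x ~= 0" using nonzero_section .
 have "om x vs *\<^sub>R s x = 0" for vs using fun_cong[OF assms[OF s(1)], of vs] by (simp add: wedge_form0_right)
 then show ?thesis using s(2) by (simp add: fun_eq_iff)
qed

text \<open>The symbol is first shown to vanish at \<open>x\<close> on functions and one-forms, by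
  the Leibniz rule against sections of \<open>L\<close>. Then local generation gives the operator in
  all degrees, and the operator in turn gives the rest of the symbol.\<close>

lemma der_vanish:
 assumes d: "der M A L d Y X"
  and X0: "!!s. s : sections M L ==> X (form0 s) x = 0" and X1: "!!be. be : Omega M A L 1 ==> X be x = 0"
 shows "al : Omega M A L k ==> X al x = 0" "om : Omega_fun M A p ==> Y om x = 0"
proof -
 have lY: "leib M A trivial_line d Y Y" and lX: "leib M A L d Y X" using d by (auto simp: der_leib)
 have Ygen: "Y om x = 0" if o: "om : Omega_fun M A p" and z: "!!s. s : sections M L ==> X (wedge om (form0 s)) x = 0" for om p
 proof (rule wedge_eq_zero_at)
  fix s assume s: "s : sections M L"
  have "X (wedge om (form0 s)) x = wedge (Y om) (form0 s) x + psign (d * p) *\<^sub>R wedge om (X (form0 s)) x"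
   unfolding leibD(3)[OF lX o form0_Omega[OF vbL s]] by (simp add: scaleR_fun_apply)
  moreover have "wedge om (X (form0 s)) x = 0" by (simp add: wedge_at X0[OF s] alt_wedge_zero)
  ultimately show "wedge (Y om) (form0 s) x = 0" using z[OF s] by simp
 qed
 have Y0: "Y (form0 f) x = 0" if "f : Cinf M" for f
 proof (rule Ygen)
  show "form0 f : Omega_fun M A 0" using that form0_Omega[OF tl] by (simp add: sections_trivial_line)
  show "X (wedge (form0 f) (form0 s)) x = 0" if "s : sections M L" for s
   using X0[OF sections_sc[OF vbL \<open>f : Cinf M\<close> that]] by (simp add: wedge_form0 form0_sc)
 qed
 have Y1: "Y om x = 0" if "om : Omega_fun M A 1" for om
 proof (rule Ygen[OF that])
  show "X (wedge om (form0 s)) x = 0" if "s : sections M L" for s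
   using X1 wedge_Omega[OF vbL \<open>om : Omega_fun M A 1\<close> form0_Omega[OF vbL that]] by simp
 qed
 have main: "X al x = 0" if "al : Omega M A L (int n)" for n al
  using that
 proof (induction n arbitrary: al)
  case 0
  then show ?case using X0[of "ev al []"] Omega_0[of al L] by simp
 next
  case (Suc n)
  obtain m :: nat and eps be chi where g: "\<forall>i<m. eps i : Omega_fun M A 1 & be i : Omega M A L (int n)" "chi : Cinf M"
   "chi x = 1" "sc chi al = (\<Sum>i<m. wedge (eps i) (be i))" by (rule local_generation[OF vbL Suc.prems])
  have f0: "form0 chi : Omega_fun M A 0" using g(2) form0_Omega[OF tl] by (simp add: sections_trivial_line)
  \<comment> \<open>The cut-off may be inserted without changing the value at \<open>x\<close>: it
    equals 1 there, and the symbol annihilates it there.\<close>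
  have "X (sc chi al) = wedge (Y (form0 chi)) al + sc chi (X al)"
   using leibD(3)[OF lX f0 Suc.prems] by (simp add: wedge_form0)
  then have "X (sc chi al) x = X al x"
   using g(3) by (simp add: wedge_at Y0[OF g(2)] alt_wedge_zero sc_def)
  moreover have "X (sc chi al) = (\<Sum>i<m. X (wedge (eps i) (be i)))"
   unfolding g(4)
  proof (rule leib_sum[OF vbL lX])
   show "wedge (eps i) (be i) : Omega M A L (1 + int n)" if "i : {..<m}" for i
    using g(1) that by (intro wedge_Omega[OF vbL]) auto
  qed
  moreover have "X (wedge (eps i) (be i)) x = 0" if "i < m" for i
  proof -
   have e: "eps i : Omega_fun M A 1" and b: "be i : Omega M A L (int n)" using g(1) that by auto
   show ?thesis unfolding leibD(3)[OF lX e b]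
    by (simp add: wedge_at Y1[OF e] Suc.IH[OF b] alt_wedge_zero scaleR_fun_apply)
  qed
  ultimately show ?case by (simp add: sum_fun_apply)
 qed
 have XX: "X al x = 0" if "al : Omega M A L k" for al k
  using that by (cases rule: Omega_cases) (auto simp: leib_zero[OF vbL lX] main)
 then show "X al x = 0" if "al : Omega M A L k" using that .
 show "Y om x = 0" if "om : Omega_fun M A p"
  by (rule Ygen[OF that]) (use XX wedge_Omega[OF vbL that form0_Omega[OF vbL]] in blast)
qed

lemma der_sub:
 assumes "der M A L d Y X" "der M A L d Y' X'"
 shows "der M A L d (%om. Y om + (- 1) *\<^sub>R Y' om) (%al. X al + (- 1) *\<^sub>R X' al)"
 using assms unfolding der_leib by (intro conjI leib_add leib_smult tl vbL) auto

lemma der_agree: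
 assumes "der M A L d Y X" "der M A L d Y' X'"
  and X0: "!!s. s : sections M L ==> X (form0 s) x = X' (form0 s) x" and X1: "!!be. be : Omega M A L 1 ==> X be x = X' be x"
 shows "al : Omega M A L k ==> X al x = X' al x" "om : Omega_fun M A p ==> Y om x = Y' om x"
 using der_vanish[OF der_sub[OF assms(1,2)], of x] X0 X1 by (simp_all add: scaleR_fun_apply)

text \<open>Agreement on generators at a point propagates to all forms at that point. Hence near
  every \<open>x\<close> the diagonal family coincides with the single derivation
  \<open>X x\<close>, and smoothness and the Leibniz rule are inherited.\<close>

lemma der_glue:
 assumes d: "!!x. der M A L d (Y x) (X x)" and U: "!!x. open (U x)" "!!x. x : U x"
  and X0: "!!x y s. y : U x ==> s : sections M L ==> X x (form0 s) y = X y (form0 s) y"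
  and X1: "!!x y be. y : U x ==> be : Omega M A L 1 ==> X x be y = X y be y"
 shows "der M A L d (%om y. Y y om y) (%al y. X y al y)"
  "!!al k x y. y : U x ==> al : Omega M A L k ==> X x al y = X y al y"
proof -
 show XX: "X x al y = X y al y" if "y : U x" "al : Omega M A L k" for al k x y
  by (rule der_agree(1)[OF d[of x] d[of y] X0[OF that(1)] X1[OF that(1)] that(2)])
 have YY: "Y x om y = Y y om y" if "y : U x" "om : Omega_fun M A p" for om p x y
  by (rule der_agree(2)[OF d[of x] d[of y] X0[OF that(1)] X1[OF that(1)] that(2)])
 have lY: "leib M A trivial_line d (Y x) (Y x)" and lX: "leib M A L d (Y x) (X x)" for x using d[of x] by (auto simp: der_leib)
 show "der M A L d (%om y. Y y om y) (%al y. X y al y)"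
  unfolding der_leib
 proof (intro conjI leibI)
  fix al k assume a: "al : Omega M A L k"
  show "(%y. X y al y) : Omega M A L (k + d)"
  proof (rule Omega_local[OF vbL])
   show "\<exists>V \<eta>. open V & x : V & \<eta> : Omega M A L (k + d) & (ALL y:V. X y al y = \<eta> y)" for x
    by (rule exI[of _ "U x"], rule exI[of _ "X x al"])
      (intro conjI ballI U leibD(1)[OF lX a] XX[OF _ a, symmetric])
  qed
 next
  fix om k assume a: "om : Omega_fun M A k"
  show "(%y. Y y om y) : Omega_fun M A (k + d)"
  proof (rule Omega_local[OF tl])
   show "\<exists>V \<eta>. open V & x : V & \<eta> : Omega_fun M A (k + d) & (ALL y:V. Y y om y = \<eta> y)" for x
    by (rule exI[of _ "U x"], rule exI[of _ "Y x om"])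
      (intro conjI ballI U leibD(1)[OF lY a] YY[OF _ a, symmetric])
  qed
 qed (simp_all add: fun_eq_iff leibD(2,3)[OF lX] leibD(2,3)[OF lY] scaleR_fun_apply wedge_at)
qed

end

end

section \<open>Contractions, Lie derivatives and the de Rham differential\<close>

text \<open>A pair of operators \<open>K\<close> on the sections of \<open>A\<close> and \<open>D\<close> on the sections of a bundle \<open>Lb\<close>, both
 derivations along the same vector field \<open>v\<close>, induces a derivation of degree \<open>0\<close> on forms. Taking the
 trivial line for \<open>Lb\<close> gives its symbol.\<close>

definition lie_data :: "('m, 'b::euclidean_space) manifold => ('m, 'e::real_vector) vbundle => ('m, 'v::real_vector) vbundle
  => (('m => 'e) => 'm => 'e) => (('m => real) => 'm => real) => (('m => 'v) => 'm => 'v) => bool" where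
 "lie_data M A Lb K v D \<longleftrightarrow>
   (ALL Z:sections M A. K Z : sections M A) &
   (ALL Z:sections M A. ALL W:sections M A. ALL f:Cinf M. K (sc f Z + W) = sc f (K Z) + (sc (v f) Z + K W)) &
   (ALL s:sections M Lb. D s : sections M Lb) &
   (ALL s:sections M Lb. ALL t:sections M Lb. ALL f:Cinf M. D (sc f s + t) = sc f (D s) + (sc (v f) s + D t)) &
   (ALL f:Cinf M. v f : Cinf M) & (\<forall>c. v (%_. c) = 0)"

text \<open>The commutator \<open>[Lie, iota Z] = iota (K Z)\<close> read as a recursion along the
  list of sections. Existence of the Lie derivative is thereby reduced to tensoriality.\<close>

primrec LF :: "(('m => 'e) => 'm => 'e) => (('m => 'v::real_vector) => 'm => 'v) => ('m => 'e) list
  => ('m => 'e list => 'v) => 'm => 'v" where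
 "LF K D [] = (%al. D (ev al []))"
| "LF K D (Z # Zs) = (%al. LF K D Zs (iota Z al) - ev (iota (K Z) al) Zs)"

definition Lie where "Lie M A K D al = mkform M A (%ss. LF K D ss al)"

text \<open>The data of a Jacobi algebroid: a bracket and a representation of it by derivations along \<open>v\<close>.\<close>

definition rep_data :: "('m, 'b::euclidean_space) manifold => ('m, 'e::real_vector) vbundle => ('m, 'v::real_vector) vbundle
  => (('m => 'e) => ('m => 'e) => 'm => 'e) => (('m => 'e) => ('m => real) => 'm => real)
  => (('m => 'e) => ('m => 'v) => 'm => 'v) => bool" where
 "rep_data M A Lb br v D \<longleftrightarrow>
   (ALL Z:sections M A. lie_data M A Lb (br Z) (v Z) (D Z)) &
   (ALL Z:sections M A. ALL W:sections M A. br Z W = - br W Z) &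
   (ALL Z:sections M A. ALL W:sections M A. ALL f:Cinf M. ALL g:Cinf M. v (sc f Z + W) g = sc f (v Z g) + v W g) &
   (ALL Z:sections M A. ALL W:sections M A. ALL f:Cinf M. ALL s:sections M Lb. D (sc f Z + W) s = sc f (D Z s) + D W s)"

text \<open>Cartan's formula \<open>iota Z d = Lie Z - d iota Z\<close> read as a recursion; the
  familiar alternating sum is recovered from it only at the end.\<close>

primrec DF :: "('m, 'b::euclidean_space) manifold => ('m, 'e::real_vector) vbundle
  => (('m => 'e) => ('m => 'e) => 'm => 'e) => (('m => 'e) => ('m => 'v::real_vector) => 'm => 'v) => ('m => 'e) list
  => ('m => 'e list => 'v) => 'm => 'v" where
 "DF M A br D [] = (%al. 0)"
| "DF M A br D (Z # Zs) = (%al. ev (Lie M A (br Z) (D Z) al) Zs - DF M A br D Zs (iota Z al))"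

definition dop where "dop M A br D al = mkform M A (%ss. DF M A br D ss al)"

text \<open>The differential of a function. It enters as the defect of linearity over functions,
  both of the Lie derivative in its section and of the de Rham operator in its form.\<close>

definition dfun where "dfun M A v f = mkform M A (%ss. case ss of [Z] => v Z f | _ => (0 :: 'm => real))"

lemma sc_add: "sc f (s + t) = sc f s + sc f t" and sc_diff: "sc f (s - t) = sc f s - sc f t"
 and sc_uminus: "sc f (- s) = - sc f s" and sc_uminus_left: "sc (- f) s = - sc f s" and sc_zero: "sc f 0 = 0" and sc_one: "sc (%_. 1) s = s"
 and sc_zero_left: "sc 0 s = 0"
 by (auto simp: sc_def fun_eq_iff scaleR_add_right scaleR_diff_right)

context fbun
begin

context
 fixes Lb :: "('m, 'v::real_vector) vbundle"
 assumes Lb: "vector_bundle M Lb"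
begin

context
 fixes K v D
 assumes ld: "lie_data M A Lb K v D"
begin

lemma lie_dataD:
 "Z : sections M A ==> K Z : sections M A"
 "Z : sections M A ==> W : sections M A ==> f : Cinf M ==> K (sc f Z + W) = sc f (K Z) + (sc (v f) Z + K W)"
 "s : sections M Lb ==> D s : sections M Lb"
 "s : sections M Lb ==> t : sections M Lb ==> f : Cinf M ==> D (sc f s + t) = sc f (D s) + (sc (v f) s + D t)"
 "f : Cinf M ==> v f : Cinf M" "v (%_. c) = 0"
 using ld unfolding lie_data_def by auto

lemma lie_D_zero: "D 0 = 0"
 using lie_dataD(4)[OF sections_zero[OF Lb] sections_zero[OF Lb] Cinf_const[of 1]]
 by (simp add: sc_one lie_dataD(6) sc_zero)

lemma LF_zero: "LF K D ss 0 = 0"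
proof (induction ss)
 case (Cons Z ss)
 show ?case unfolding LF.simps iota_zero ev_zero Cons.IH by (rule diff_self)
qed (simp only: LF.simps ev_zero lie_D_zero)

lemma ev_Nil_section: "al : Omega M A Lb k ==> ev al [] : sections M Lb"
proof (cases "k = 0")
 case False
 assume "al : Omega M A Lb k"
 then have "ev al [] = 0" using Omega_outside[of al Lb k "[]"] False by (simp add: ev_Nil fun_eq_iff)
 then show ?thesis using sections_zero[OF Lb] by simp
qed (use Omega_0 in blast)

lemma LF_clin:
 assumes "al : Omega M A Lb k" "be : Omega M A Lb k" "f : Cinf M" "set ss <= sections M A"
 shows "LF K D ss (sc f al + be) = sc f (LF K D ss al) + (sc (v f) (ev al ss) + LF K D ss be)"
 using assms
proof (induction ss arbitrary: al be k)
 case Nil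
 then show ?case by (simp only: LF.simps ev_add ev_sc lie_dataD(4)[OF ev_Nil_section ev_Nil_section])
next
 case (Cons Z ss)
 then have Z: "Z : sections M A" "set ss <= sections M A" by auto
 have IH: "LF K D ss (sc f (iota Z al) + iota Z be) = sc f (LF K D ss (iota Z al)) + (sc (v f) (ev (iota Z al) ss) + LF K D ss (iota Z be))"
  by (rule Cons.IH[OF iota_Omega[OF Cons.prems(1) Z(1)] iota_Omega[OF Cons.prems(2) Z(1)] Cons.prems(3) Z(2)])
 show ?case
  unfolding LF.simps iota_add iota_sc IH ev_add ev_sc ev_Cons sc_diff by (simp add: fun_eq_iff)
qed

text \<open>Two terms containing \<open>v f\<close> occur when an entry is multiplied by
  \<open>f\<close>, one from differentiating the contracted form and one from \<open>K\<close>; they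
  have opposite signs. On a repeated entry the contractions anticommute.\<close>

lemma LF_tens: "al : Omega M A Lb (int n) ==> tens M A Lb n (%ss. LF K D ss al)"
proof (induction n arbitrary: al)
 case 0
 have "LF K D (Z # Zs) al = 0" if "Z : sections M A" for Z Zs
  using iota_Omega[OF 0 that] iota_Omega[OF 0 lie_dataD(1)[OF that]] by (simp add: Omega_neg LF_zero ev_zero)
 then show ?case using lie_dataD(3)[OF ev_Nil_section[OF 0]] by simp
next
 case (Suc n)
 have "LF K D [] al = 0"
 proof -
  have "ev al [] = 0" using Omega_outside[OF Suc.prems] by (simp add: ev_Nil fun_eq_iff)
  then show ?thesis by (simp add: lie_D_zero)
 qed
 moreover have "tens M A Lb n (%ss. LF K D (Z # ss) al)" if Z: "Z : sections M A" for Z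
 proof -
  have 1: "iota Z al : Omega M A Lb (int n)" "iota (K Z) al : Omega M A Lb (int n)"
   using iota_Omega[OF Suc.prems Z] iota_Omega[OF Suc.prems lie_dataD(1)[OF Z]] by simp_all
  show ?thesis unfolding LF.simps by (rule tens_diff[OF Lb Suc.IH[OF 1(1)] tens_ev[OF Lb 1(2)]])
 qed
 moreover have "LF K D ((sc f Z + W) # ss) al = sc f (LF K D (Z # ss) al) + LF K D (W # ss) al"
  if Z: "Z : sections M A" and W: "W : sections M A" and f: "f : Cinf M" and ss: "set ss <= sections M A" for Z W f ss
 proof -
  have k: "sc (v f) Z + K W : sections M A" using Z W f by (intro A_facts lie_dataD)
  show ?thesis
   unfolding LF.simps iota_clin[OF Lb Suc.prems Z W f] lie_dataD(2)[OF Z W f]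
    iota_clin[OF Lb Suc.prems lie_dataD(1)[OF Z] k f] iota_clin[OF Lb Suc.prems Z lie_dataD(1)[OF W] lie_dataD(5)[OF f]]
    LF_clin[OF iota_Omega[OF Suc.prems Z] iota_Omega[OF Suc.prems W] f ss] ev_add ev_sc sc_diff
   by (simp add: fun_eq_iff)
 qed
 moreover have "LF K D (Z # Z # ss) al = 0" if Z: "Z : sections M A" for Z ss
  unfolding LF.simps ev_Cons iota_iota(2)[OF Lb Suc.prems Z Z] LF_zero iota_iota(1)[OF Lb Suc.prems Z lie_dataD(1)[OF Z]] ev_uminus
  by (simp add: fun_eq_iff)
 ultimately show ?case unfolding tens.simps by blast
qed

lemma ev_Lie: "al : Omega M A Lb k ==> set ss <= sections M A ==> ev (Lie M A K D al) ss = LF K D ss al"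
proof (erule Omega_cases)
 assume "set ss <= sections M A" "al = 0"
 then show "ev (Lie M A K D al) ss = LF K D ss al"
  unfolding Lie_def using ev_mkform[OF Lb LF_tens[OF Omega_zero[OF Lb, of "int 0"]]] by simp
qed (simp add: Lie_def ev_mkform[OF Lb LF_tens])

lemma Lie_Omega: "al : Omega M A Lb k ==> Lie M A K D al : Omega M A Lb k"
proof (erule Omega_cases)
 assume k: "k < 0" "al = 0"
 have "Lie M A K D al = 0"
 proof (rule form_eqI)
  show "Lie M A K D al : Omega M A Lb (int 0)" unfolding Lie_def k by (rule mkform_Omega[OF Lb LF_tens[OF Omega_zero[OF Lb]]])
  show "0 : Omega M A Lb (int 0)" by (rule Omega_zero[OF Lb])
  show "ev (Lie M A K D al) ss = ev 0 ss" if "set ss <= sections M A" for ss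
   using ev_Lie[OF Omega_zero[OF Lb] that] by (simp only: k LF_zero ev_zero)
 qed
 then show ?thesis using Omega_zero[OF Lb] by simp
qed (simp add: Lie_def mkform_Omega[OF Lb LF_tens])

lemma Lie_form0:
 assumes "s : sections M Lb"
 shows "Lie M A K D (form0 s) = form0 (D s)"
 by (rule form_eqI[OF Lie_Omega[OF form0_Omega[OF Lb assms]] form0_Omega[OF Lb lie_dataD(3)[OF assms]]])
   (simp add: ev_Lie[OF form0_Omega[OF Lb assms]] ev_form0)

lemma iota_Lie:
 assumes "al : Omega M A Lb k" "Z : sections M A"
 shows "iota Z (Lie M A K D al) = Lie M A K D (iota Z al) - iota (K Z) al"
proof (rule form_eqI)
 show "iota Z (Lie M A K D al) : Omega M A Lb (k - 1)" by (intro iota_Omega Lie_Omega assms)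
 show "Lie M A K D (iota Z al) - iota (K Z) al : Omega M A Lb (k - 1)"
  by (intro Omega_diff[OF Lb] Lie_Omega iota_Omega lie_dataD assms)
 show "ev (iota Z (Lie M A K D al)) ss = ev (Lie M A K D (iota Z al) - iota (K Z) al) ss" if "set ss <= sections M A" for ss
  using ev_Lie[OF assms(1), of "Z # ss"] ev_Lie[OF iota_Omega[OF assms] that] that assms(2)
  by (simp add: ev_Cons ev_diff)
qed

lemma Lie_clin:
 assumes "al : Omega M A Lb k" "be : Omega M A Lb k" "f : Cinf M"
 shows "Lie M A K D (sc f al + be) = sc f (Lie M A K D al) + (sc (v f) al + Lie M A K D be)"
proof (rule form_eqI)
 have s: "sc f al + be : Omega M A Lb k" by (intro Omega_add[OF Lb] Omega_sc[OF Lb] assms)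
 then show "Lie M A K D (sc f al + be) : Omega M A Lb k" by (rule Lie_Omega)
 show "sc f (Lie M A K D al) + (sc (v f) al + Lie M A K D be) : Omega M A Lb k"
  by (intro Omega_add[OF Lb] Omega_sc[OF Lb] Lie_Omega lie_dataD assms)
 show "ev (Lie M A K D (sc f al + be)) ss = ev (sc f (Lie M A K D al) + (sc (v f) al + Lie M A K D be)) ss"
  if "set ss <= sections M A" for ss
  unfolding ev_add ev_sc ev_Lie[OF s that] ev_Lie[OF assms(1) that] ev_Lie[OF assms(2) that]
  by (rule LF_clin[OF assms that])
qed

lemma Lie_linear:
 assumes "al : Omega M A Lb k" "be : Omega M A Lb k"
 shows "Lie M A K D (c *\<^sub>R al + be) = c *\<^sub>R Lie M A K D al + Lie M A K D be"
 using Lie_clin[OF assms Cinf_const[of c]] by (simp add: scaleR_conv_sc lie_dataD(6) sc_zero_left)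

lemma Lie_zero: "Lie M A K D 0 = (0 :: 'm => 'e list => 'v)"
 using Lie_Omega[OF Omega_zero[OF Lb], of "- 1"] by (simp add: Omega_neg)

end

end

lemma lie_data_real:
 assumes "vector_bundle M Lb" "lie_data M A Lb K v D"
  and "!!f g. f : Cinf M ==> g : Cinf M ==> v (f * g) = v f * g + f * v g"
  and "!!f g. f : Cinf M ==> g : Cinf M ==> v (f + g) = v f + v g"
 shows "lie_data M A trivial_line K v v"
proof -
 have "v (sc f s + t) = sc f (v s) + (sc (v f) s + v t)" if "f : Cinf M" "s : Cinf M" "t : Cinf M" for f s t
  using assms(3)[OF that(1,2)] assms(4)[OF Cinf_mult[OF that(1,2)] that(3)] by (simp add: sc_real fun_eq_iff)
 then show ?thesis using assms(2) unfolding lie_data_def sections_trivial_line by auto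
qed

text \<open>Induction over the total degree by contraction; in degree 0 the claim is the Leibniz
  rule of \<open>D\<close> along \<open>v\<close>.\<close>

lemma Lie_wedge:
 assumes Lb: "vector_bundle M Lb" and r: "lie_data M A trivial_line K v v" and d: "lie_data M A Lb K v D"
  and "om : Omega_fun M A p" "al : Omega M A Lb k"
 shows "Lie M A K D (wedge om al) = wedge (Lie M A K v om) al + wedge om (Lie M A K D al)"
proof -
 have triv: "Lie M A K D (wedge om al) = wedge (Lie M A K v om) al + wedge om (Lie M A K D al)" if "om = 0 | al = 0" for om al
  using that Lie_zero[OF tl r] Lie_zero[OF Lb d] by (auto simp: wedge_zero_left wedge_zero_right)
 have "Lie M A K D (wedge om al) = wedge (Lie M A K v om) al + wedge om (Lie M A K D al)"
  if "p + k = int n" "om : Omega_fun M A p" "al : Omega M A Lb k" for n p k om al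
  using that
 proof (induction n arbitrary: p k om al)
  case 0
  show ?case
  proof (cases "p < 0 | k < 0")
   case True
   then show ?thesis using 0 by (intro triv) (auto simp: Omega_neg)
  next
   case False
   then have "p = 0" "k = 0" using 0(1) by linarith+
   then have pk: "om : Omega_fun M A 0" "al : Omega M A Lb 0" using 0 by simp_all
   define f s where "f = ev om []" and "s = ev al []"
   have fs: "om = form0 f" "al = form0 s" "f : Cinf M" "s : sections M Lb"
    using Omega_0[OF pk(1)] Omega_0[OF pk(2)] by (auto simp: f_def s_def sections_trivial_line)
   have "Lie M A K D (wedge om al) = form0 (D (sc f s))"
    unfolding fs wedge_form0 form0_sc[symmetric] by (rule Lie_form0[OF Lb d sections_sc[OF Lb fs(3,4)]])
   also have "D (sc f s) = sc (v f) s + sc f (D s)"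
    using lie_dataD(4)[OF Lb d fs(4) sections_zero[OF Lb] fs(3)] lie_D_zero[OF Lb d] by (simp add: add.commute)
   also have "form0 \<dots> = wedge (Lie M A K v om) al + wedge om (Lie M A K D al)"
    unfolding fs Lie_form0[OF Lb d fs(4)] Lie_form0[OF tl r fs(3)[folded sections_trivial_line]] wedge_form0 form0_add form0_sc ..
   finally show ?thesis .
  qed
 next
  case (Suc n)
  note o = Suc.prems(2) and a = Suc.prems(3)
  note Lo = Lie_Omega[OF tl r o] and La = Lie_Omega[OF Lb d a]
  show ?case
  proof (rule Omega_ext)
   show "Lie M A K D (wedge om al) : Omega M A Lb (p + k)" by (intro Lie_Omega[OF Lb d] wedge_Omega[OF Lb] o a)
   show "wedge (Lie M A K v om) al + wedge om (Lie M A K D al) : Omega M A Lb (p + k)"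
    by (intro Omega_add[OF Lb] wedge_Omega[OF Lb] o a Lo La)
   show "p + k ~= 0" using Suc.prems by simp
   fix Z assume Z: "Z : sections M A"
   note Zo = iota_Omega[OF o Z] and Za = iota_Omega[OF a Z] and KZ = lie_dataD(1)[OF Lb d Z]
   have w1: "wedge (iota Z om) al : Omega M A Lb (p + k - 1)" using wedge_Omega[OF Lb Zo a] by (simp add: algebra_simps)
   have w2: "wedge om (iota Z al) : Omega M A Lb (p + k - 1)" using wedge_Omega[OF Lb o Za] by (simp add: algebra_simps)
   have 1: "Lie M A K D (wedge (iota Z om) al) = wedge (Lie M A K v (iota Z om)) al + wedge (iota Z om) (Lie M A K D al)"
    by (rule Suc.IH[OF _ Zo a]) (use Suc.prems in simp)
   have 2: "Lie M A K D (wedge om (iota Z al)) = wedge (Lie M A K v om) (iota Z al) + wedge om (Lie M A K D (iota Z al))"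
    by (rule Suc.IH[OF _ o Za]) (use Suc.prems in simp)
   have 3: "iota Z (wedge om al) = psign p *\<^sub>R wedge om (iota Z al) + wedge (iota Z om) al"
    by (simp add: iota_wedge sg_Omega[OF o] wedge_scale_left add.commute)
   have 4: "iota (K Z) (wedge om al) = psign p *\<^sub>R wedge om (iota (K Z) al) + wedge (iota (K Z) om) al"
    by (simp add: iota_wedge sg_Omega[OF o] wedge_scale_left add.commute)
   have "iota Z (Lie M A K D (wedge om al)) = psign p *\<^sub>R Lie M A K D (wedge om (iota Z al)) + Lie M A K D (wedge (iota Z om) al)
     - (psign p *\<^sub>R wedge om (iota (K Z) al) + wedge (iota (K Z) om) al)"
    unfolding iota_Lie[OF Lb d wedge_Omega[OF Lb o a] Z] 3 4 Lie_linear[OF Lb d w2 w1] ..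
   also have "\<dots> = iota Z (wedge (Lie M A K v om) al + wedge om (Lie M A K D al))"
    unfolding 1 2 iota_add iota_wedge sg_Omega[OF Lo] sg_Omega[OF o] iota_Lie[OF Lb d a Z] iota_Lie[OF tl r o Z]
     wedge_diff_left wedge_diff_right wedge_scale_left
    by (simp add: fun_eq_iff scaleR_fun_apply algebra_simps)
   finally show "iota Z (Lie M A K D (wedge om al)) = iota Z (wedge (Lie M A K v om) al + wedge om (Lie M A K D al))" .
  qed
 qed
 note main = this
 show ?thesis
 proof (cases "p < 0 | k < 0")
  case True
  then show ?thesis using assms by (intro triv) (auto simp: Omega_neg)
 next
  case False
  then show ?thesis using main[of p k "nat (p + k)"] assms by auto
 qed
qed

lemma Lie_der:
 assumes "vector_bundle M Lb" "lie_data M A trivial_line K v v" "lie_data M A Lb K v D"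
 shows "der M A Lb 0 (Lie M A K v) (Lie M A K D)"
 unfolding der_leib
 by (intro conjI leibI)
   (simp_all add: Lie_Omega[OF assms(1,3)] Lie_Omega[OF tl assms(2)] Lie_linear[OF assms(1,3)] Lie_linear[OF tl assms(2)]
    Lie_wedge[OF assms] Lie_wedge[OF tl assms(2,2)])

lemma iota_der:
 assumes Lb: "vector_bundle M Lb" and Z: "Z : sections M A"
 shows "der M A Lb (- 1) (iota Z) (iota Z)"
proof -
 have "leib M A B (- 1) (iota Z) (iota Z)" if "vector_bundle M B" for B :: "('m, 'w::real_vector) vbundle"
 proof (rule leibI)
  show "iota Z (wedge om al) = wedge (iota Z om) al + psign (- 1 * p) *\<^sub>R wedge om (iota Z al)"
   if "om : Omega_fun M A p" for om p and al :: "'m => 'e list => 'w"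
   by (simp add: iota_wedge sg_Omega[OF that] wedge_scale_left)
  show "iota Z al : Omega M A B (k + - 1)" if "al : Omega M A B k" for al k using iota_Omega[OF that Z] by simp
 qed (simp add: iota_add iota_scale)
 note * = this
 show ?thesis unfolding der_leib using *[OF tl] *[OF Lb] by (rule conjI)
qed

lemma dfun_tens:
 assumes r: "rep_data M A Lb br v D" and f: "f : Cinf M"
 shows "tens M A trivial_line (Suc 0) (%ss. case ss of [Z] => v Z f | _ => (0 :: 'm => real))"
proof -
 have v: "v Z f : Cinf M" if "Z : sections M A" for Z
  using r that f unfolding rep_data_def lie_data_def by blast
 have lin: "v (sc g Z + W) f = sc g (v Z f) + v W f" if "Z : sections M A" "W : sections M A" "g : Cinf M" for Z W g
  using r that f unfolding rep_data_def by blast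
 show ?thesis
  using v lin by (auto simp: sections_trivial_line sc_zero zero_fun_def[symmetric] split: list.splits)
qed

lemma dfun_Omega:
 assumes "rep_data M A Lb br v D" "f : Cinf M"
 shows "dfun M A v f : Omega_fun M A 1" "Z : sections M A ==> iota Z (dfun M A v f) = form0 (v Z f)"
proof -
 note t = dfun_tens[OF assms]
 show o: "dfun M A v f : Omega_fun M A 1" unfolding dfun_def using mkform_Omega[OF tl t] by simp
 show "iota Z (dfun M A v f) = form0 (v Z f)" if Z: "Z : sections M A"
 proof -
  have "iota Z (dfun M A v f) : Omega_fun M A 0" using iota_Omega[OF o Z] by simp
  from Omega_0(1)[OF this] have "iota Z (dfun M A v f) = form0 (ev (dfun M A v f) [Z])" by (simp only: ev_Cons)
  moreover have "ev (dfun M A v f) [Z] = v Z f"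
   unfolding dfun_def using ev_mkform[OF tl t, of "[Z]"] Z by simp
  ultimately show ?thesis by (simp only:)
 qed
qed

context
 fixes Lb :: "('m, 'v::real_vector) vbundle" and br v D
 assumes Lb: "vector_bundle M Lb" and r: "rep_data M A Lb br v D"
begin

lemma rep_dataD:
 "Z : sections M A ==> lie_data M A Lb (br Z) (v Z) (D Z)"
 "Z : sections M A ==> W : sections M A ==> br Z W = - br W Z"
 "Z : sections M A ==> W : sections M A ==> f : Cinf M ==> g : Cinf M ==> v (sc f Z + W) g = sc f (v Z g) + v W g"
 "Z : sections M A ==> W : sections M A ==> f : Cinf M ==> s : sections M Lb ==> D (sc f Z + W) s = sc f (D Z s) + D W s"
proof -
 note r' = r[unfolded rep_data_def]
 show "Z : sections M A ==> lie_data M A Lb (br Z) (v Z) (D Z)" using r'[THEN conjunct1] by blast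
 show "Z : sections M A ==> W : sections M A ==> br Z W = - br W Z"
  by (rule r'[THEN conjunct2, THEN conjunct1, rule_format])
 show "Z : sections M A ==> W : sections M A ==> f : Cinf M ==> g : Cinf M ==> v (sc f Z + W) g = sc f (v Z g) + v W g"
  by (rule r'[THEN conjunct2, THEN conjunct2, THEN conjunct1, rule_format])
 show "Z : sections M A ==> W : sections M A ==> f : Cinf M ==> s : sections M Lb ==> D (sc f Z + W) s = sc f (D Z s) + D W s"
  by (rule r'[THEN conjunct2, THEN conjunct2, THEN conjunct2, rule_format])
qed

abbreviation LZ where "LZ Z \<equiv> Lie M A (br Z) (D Z)"

lemmas LZ_Omega = Lie_Omega[OF Lb rep_dataD(1)]
lemmas iota_LZ = iota_Lie[OF Lb rep_dataD(1)]
lemmas LZ_clin = Lie_clin[OF Lb rep_dataD(1)]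
lemmas LZ_zero = Lie_zero[OF Lb rep_dataD(1)]

text \<open>By contraction with \<open>X\<close>: the term with \<open>v X f\<close> coming from the
  bracket, which is a derivation in the other entry by skew-symmetry, is the one produced by
  contracting \<open>dfun\<close>. The correction term is what makes the Cartan recursion
  tensorial.\<close>

lemma LZ_section_clin:
 assumes Z: "Z : sections M A" and W: "W : sections M A" and f: "f : Cinf M"
 shows "al : Omega M A Lb k ==> LZ (sc f Z + W) al = sc f (LZ Z al) + (wedge (dfun M A v f) (iota Z al) + LZ W al)"
proof -
 have ZW: "sc f Z + W : sections M A" using Z W f by (intro A_facts)
 note df = dfun_Omega[OF r f]
 have triv: "LZ (sc f Z + W) 0 = sc f (LZ Z 0) + (wedge (dfun M A v f) (iota Z 0) + LZ W 0)"
  by (simp only: LZ_zero[OF Z] LZ_zero[OF W] LZ_zero[OF ZW] iota_zero wedge_zero_right sc_zero add_0)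
 have main: "LZ (sc f Z + W) al = sc f (LZ Z al) + (wedge (dfun M A v f) (iota Z al) + LZ W al)"
  if "al : Omega M A Lb (int n)" for al n
  using that
 proof (induction n arbitrary: al)
  case 0
  then have a: "al : Omega M A Lb 0" by simp
  define s where "s = ev al []"
  have s: "al = form0 s" "s : sections M Lb" using Omega_0[OF a] by (auto simp: s_def)
  show ?case unfolding s(1) Lie_form0[OF Lb rep_dataD(1)[OF Z] s(2)] Lie_form0[OF Lb rep_dataD(1)[OF W] s(2)]
   Lie_form0[OF Lb rep_dataD(1)[OF ZW] s(2)] rep_dataD(4)[OF Z W f s(2)] iota_form0 wedge_zero_right form0_add form0_sc
   by (simp only: add_0)
 next
  case (Suc n)
  note a = Suc.prems
  have wi: "wedge (dfun M A v f) (iota Z al) : Omega M A Lb (int (Suc n))"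
   using wedge_Omega[OF Lb df(1) iota_Omega[OF a Z]] by simp
  show ?case
  proof (rule Omega_ext)
   show "LZ (sc f Z + W) al : Omega M A Lb (int (Suc n))" by (rule LZ_Omega[OF ZW a])
   show "sc f (LZ Z al) + (wedge (dfun M A v f) (iota Z al) + LZ W al) : Omega M A Lb (int (Suc n))"
    by (intro Omega_add[OF Lb] Omega_sc[OF Lb] LZ_Omega wi Z W f a)
   fix X assume X: "X : sections M A"
   have Xa: "iota X al : Omega M A Lb (int n)" using iota_Omega[OF a X] by simp
   have vf: "v X f : Cinf M" "- v X f : Cinf M"
    using lie_dataD(5)[OF Lb rep_dataD(1)[OF X] f] Cinf_mult[OF Cinf_const[of "- 1"]] by (auto simp: times_fun_def fun_Compl_def)
   have brs: "br Z X : sections M A" "br W X : sections M A" "br X Z : sections M A"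
    using lie_dataD(1)[OF Lb rep_dataD(1)] Z W X by auto
   have "br (sc f Z + W) X = - br X (sc f Z + W)" by (rule rep_dataD(2)[OF ZW X])
   also have "\<dots> = sc f (- br X Z) + (sc (- v X f) Z + - br X W)"
    unfolding lie_dataD(2)[OF Lb rep_dataD(1)[OF X] Z W f] by (simp add: sc_def fun_eq_iff)
   also have "\<dots> = sc f (br Z X) + (sc (- v X f) Z + br W X)"
    by (simp only: rep_dataD(2)[OF Z X] rep_dataD(2)[OF W X])
   finally have br: "br (sc f Z + W) X = sc f (br Z X) + (sc (- v X f) Z + br W X)" .
   have 1: "iota (br (sc f Z + W) X) al = sc f (iota (br Z X) al) + (sc (- v X f) (iota Z al) + iota (br W X) al)"
    unfolding br iota_clin[OF Lb a brs(1) A_facts(3)[OF A_facts(4)[OF vf(2) Z] brs(2)] f] iota_clin[OF Lb a Z brs(2) vf(2)] ..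
   have 2: "iota X (wedge (dfun M A v f) (iota Z al)) = sc (v X f) (iota Z al) + wedge (dfun M A v f) (iota Z (iota X al))"
    unfolding iota_wedge sg_Omega[OF df(1)] df(2)[OF X] wedge_form0 iota_iota(1)[OF Lb a X Z] wedge_scale_left wedge_uminus_right
    by simp
   show "iota X (LZ (sc f Z + W) al) = iota X (sc f (LZ Z al) + (wedge (dfun M A v f) (iota Z al) + LZ W al))"
    unfolding iota_LZ[OF ZW a X] iota_add iota_sc iota_LZ[OF Z a X] iota_LZ[OF W a X] Suc.IH[OF Xa] 1 2
    by (simp add: fun_eq_iff sc_def algebra_simps)
  qed simp
 qed
 show "LZ (sc f Z + W) al = sc f (LZ Z al) + (wedge (dfun M A v f) (iota Z al) + LZ W al)" if "al : Omega M A Lb k"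
  using that by (cases rule: Omega_cases) (use main triv in blast)+
qed

lemma DF_clin:
 assumes "al : Omega M A Lb k" "be : Omega M A Lb k" and f: "f : Cinf M" and "set ss <= sections M A"
 shows "DF M A br D ss (sc f al + be) = sc f (DF M A br D ss al) + (ev (wedge (dfun M A v f) al) ss + DF M A br D ss be)"
 using assms(1,2,4)
proof (induction ss arbitrary: al be k)
 case Nil
 have "dfun M A v f x [] = 0" for x by (rule Omega_outside[OF dfun_Omega(1)[OF r f]]) simp
 then show ?case by (simp add: ev_Nil wedge_at alt_wedge_Nil fun_eq_iff sc_def)
next
 case (Cons Z ss)
 then have Z: "Z : sections M A" "set ss <= sections M A" by auto
 have IH: "DF M A br D ss (sc f (iota Z al) + iota Z be) = sc f (DF M A br D ss (iota Z al))
   + (ev (wedge (dfun M A v f) (iota Z al)) ss + DF M A br D ss (iota Z be))"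
  by (rule Cons.IH[OF iota_Omega[OF Cons.prems(1) Z(1)] iota_Omega[OF Cons.prems(2) Z(1)] Z(2)])
 show ?case
  unfolding DF.simps iota_add iota_sc IH LZ_clin[OF Z(1) Cons.prems(1,2) f] ev_Cons iota_wedge ev_add ev_sc
   sg_Omega[OF dfun_Omega(1)[OF r f]] dfun_Omega(2)[OF r f Z(1)] wedge_form0 wedge_scale_left ev_scale
  by (simp add: fun_eq_iff sc_def algebra_simps scaleR_fun_apply)
qed

lemma DF_zero: "set ss <= sections M A ==> DF M A br D ss 0 = 0"
proof (induction ss)
 case (Cons Z ss)
 then have *: "Z : sections M A" "set ss <= sections M A" by auto
 show ?case unfolding DF.simps iota_zero Cons.IH[OF *(2)] LZ_zero[OF *(1)] ev_zero by (rule diff_self)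
qed (simp only: DF.simps)

lemma DF_tens_step:
 assumes a: "al : Omega M A Lb (int n)" and T: "!!Z. Z : sections M A ==> tens M A Lb n (%ss. DF M A br D ss (iota Z al))"
 shows "tens M A Lb (Suc n) (%ss. DF M A br D ss al)"
proof -
 have "DF M A br D [] al = 0" by (simp only: DF.simps)
 moreover have "tens M A Lb n (%ss. DF M A br D (Z # ss) al)" if Z: "Z : sections M A" for Z
  unfolding DF.simps by (rule tens_diff[OF Lb tens_ev[OF Lb LZ_Omega[OF Z a]] T[OF Z]])
 moreover have "DF M A br D ((sc f Z + W) # ss) al = sc f (DF M A br D (Z # ss) al) + DF M A br D (W # ss) al"
  if Z: "Z : sections M A" and W: "W : sections M A" and f: "f : Cinf M" and ss: "set ss <= sections M A" for Z W f ss
  unfolding DF.simps LZ_section_clin[OF Z W f a] iota_clin[OF Lb a Z W f]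
   DF_clin[OF iota_Omega[OF a Z] iota_Omega[OF a W] f ss] ev_add ev_sc
  by (simp add: fun_eq_iff sc_def algebra_simps)
 moreover have "DF M A br D (Z # Z # ss) al = 0" if Z: "Z : sections M A" and ss: "set ss <= sections M A" for Z ss
 proof -
  have "br Z Z + br Z Z = 0" using rep_dataD(2)[OF Z Z] by (simp only: eq_neg_iff_add_eq_0)
  then have "2 *\<^sub>R br Z Z = 0" by (simp only: scaleR_2)
  then have b: "br Z Z = 0" by simp
  have "iota (sc (%_. 1) 0 + 0) al = sc (%_. 1) (iota 0 al) + iota 0 al"
   by (rule iota_clin[OF Lb a A_facts(5) A_facts(5) Cinf_const])
  then have i: "iota 0 al = 0" by (simp add: sc_one)
  show ?thesis
   unfolding DF.simps ev_Cons iota_LZ[OF Z a Z] b i iota_iota(2)[OF Lb a Z Z] DF_zero[OF ss]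
   by (simp add: fun_eq_iff)
 qed
 ultimately show ?thesis unfolding tens.simps by blast
qed

lemma DF_tens: "al : Omega M A Lb (int n) ==> tens M A Lb (Suc n) (%ss. DF M A br D ss al)"
proof (induction n arbitrary: al)
 case (Suc n)
 show ?case
 proof (rule DF_tens_step[OF Suc.prems])
  show "tens M A Lb (Suc n) (%ss. DF M A br D ss (iota Z al))" if "Z : sections M A" for Z
   using Suc.IH iota_Omega[OF Suc.prems that] by simp
 qed
next
 case 0
 show ?case
 proof (rule DF_tens_step[OF 0])
  fix Z assume Z: "Z : sections M A"
  have z: "iota Z al = 0" using iota_Omega[OF 0 Z] by (simp add: Omega_neg)
  have "DF M A br D [] 0 : sections M Lb" unfolding DF.simps by (rule sections_zero[OF Lb])
  then show "tens M A Lb 0 (%ss. DF M A br D ss (iota Z al))"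
   unfolding z tens.simps using DF_zero by blast
 qed
qed

abbreviation dd where "dd \<equiv> dop M A br D"

lemma ev_dd: "al : Omega M A Lb k ==> set ss <= sections M A ==> ev (dd al) ss = DF M A br D ss al"
proof (erule Omega_cases)
 assume "set ss <= sections M A" "al = 0"
 then show "ev (dd al) ss = DF M A br D ss al"
  unfolding dop_def using ev_mkform[OF Lb DF_tens[OF Omega_zero[OF Lb, of "int 0"]]] by simp
qed (simp add: dop_def ev_mkform[OF Lb DF_tens])

lemma dd_Omega: "al : Omega M A Lb k ==> dd al : Omega M A Lb (k + 1)"
proof (erule Omega_cases)
 assume k: "k < 0" "al = 0"
 have "dd al = 0"
 proof (rule form_eqI)
  show "dd al : Omega M A Lb (int (Suc 0))" unfolding dop_def k by (rule mkform_Omega[OF Lb DF_tens[OF Omega_zero[OF Lb]]])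
  show "0 : Omega M A Lb (int (Suc 0))" by (rule Omega_zero[OF Lb])
  show "ev (dd al) ss = ev 0 ss" if "set ss <= sections M A" for ss
   using ev_dd[OF Omega_zero[OF Lb] that] by (simp only: k DF_zero[OF that] ev_zero)
 qed
 then show ?thesis using Omega_zero[OF Lb] by simp
next
 fix n assume n: "k = int n" "al : Omega M A Lb (int n)"
 show ?thesis using mkform_Omega[OF Lb DF_tens[OF n(2)]] by (simp add: dop_def n(1) add.commute)
qed

lemma iota_dd:
 assumes "al : Omega M A Lb k" "Z : sections M A"
 shows "iota Z (dd al) = LZ Z al - dd (iota Z al)"
proof (rule form_eqI)
 show "iota Z (dd al) : Omega M A Lb k" using iota_Omega[OF dd_Omega assms(2)] assms(1) by fastforce
 show "LZ Z al - dd (iota Z al) : Omega M A Lb k"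
  using dd_Omega[OF iota_Omega[OF assms]] by (intro Omega_diff[OF Lb] LZ_Omega assms) simp
 show "ev (iota Z (dd al)) ss = ev (LZ Z al - dd (iota Z al)) ss" if "set ss <= sections M A" for ss
  using ev_dd[OF assms(1), of "Z # ss"] ev_dd[OF iota_Omega[OF assms] that] that assms(2)
  by (simp add: ev_Cons ev_diff)
qed

lemma dd_zero: "dd 0 = (0 :: 'm => 'e list => 'v)"
 using dd_Omega[OF Omega_zero[OF Lb], of "- 2"] by (simp add: Omega_neg)

lemma dd_linear:
 assumes "al : Omega M A Lb k" "be : Omega M A Lb k"
 shows "dd (c *\<^sub>R al + be) = c *\<^sub>R dd al + dd be"
proof -
 have "dfun M A v (%_. c) = 0"
 proof (rule Omega_ext)
  show "dfun M A v (%_. c) : Omega_fun M A 1" by (rule dfun_Omega[OF r Cinf_const])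
  show "0 : Omega_fun M A 1" by (rule Omega_zero[OF tl])
  show "iota Z (dfun M A v (%_. c)) = iota Z 0" if "Z : sections M A" for Z
   unfolding dfun_Omega(2)[OF r Cinf_const that] lie_dataD(6)[OF Lb rep_dataD(1)[OF that]] form0_zero iota_zero ..
 qed simp
 note z = this
 show ?thesis
 proof (rule form_eqI)
  show s: "dd (c *\<^sub>R al + be) : Omega M A Lb (k + 1)"
   by (intro dd_Omega Omega_add[OF Lb] Omega_scale[OF Lb] assms)
  show "c *\<^sub>R dd al + dd be : Omega M A Lb (k + 1)"
   by (intro dd_Omega Omega_add[OF Lb] Omega_scale[OF Lb] assms)
  fix ss assume ss: "set ss <= sections M A"
  have "c *\<^sub>R al + be : Omega M A Lb k" by (intro Omega_add[OF Lb] Omega_scale[OF Lb] assms)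
  from ev_dd[OF this ss] show "ev (dd (c *\<^sub>R al + be)) ss = ev (c *\<^sub>R dd al + dd be) ss"
   using DF_clin[OF assms Cinf_const[of c] ss]
   by (simp only: ev_add ev_scale ev_sc ev_dd[OF assms(1) ss] ev_dd[OF assms(2) ss] scaleR_conv_sc z wedge_zero_left ev_zero add_0)
 qed
qed

end

lemma dd_wedge:
 assumes Lb: "vector_bundle M Lb" and r: "rep_data M A trivial_line br v v" and d: "rep_data M A Lb br v D"
  and "om : Omega_fun M A p" "al : Omega M A Lb k"
 shows "dop M A br D (wedge om al) = wedge (dop M A br v om) al + psign p *\<^sub>R wedge om (dop M A br D al)"
proof -
 let ?d = "dop M A br D" and ?e = "dop M A br v"
 have triv: "?d (wedge om al) = wedge (?e om) al + psign p *\<^sub>R wedge om (?d al)" if "om = 0 | al = 0" for om al p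
  using that dd_zero[OF tl r] dd_zero[OF Lb d] by (auto simp: wedge_zero_left wedge_zero_right)
 have main: "?d (wedge om al) = wedge (?e om) al + psign p *\<^sub>R wedge om (?d al)"
  if "p + k + 1 = int n" "om : Omega_fun M A p" "al : Omega M A Lb k" for n p k om al
  using that
 proof (induction n arbitrary: p k om al)
  case 0
  then have "p < 0 | k < 0" by linarith
  then show ?case using 0 by (intro triv) (auto simp: Omega_neg)
 next
  case (Suc n)
  note o = Suc.prems(2) and a = Suc.prems(3)
  note do = dd_Omega[OF tl r o] and da = dd_Omega[OF Lb d a]
  show ?case
  proof (rule Omega_ext)
   show "?d (wedge om al) : Omega M A Lb (p + k + 1)" by (intro dd_Omega[OF Lb d] wedge_Omega[OF Lb] o a)
   have "wedge (?e om) al : Omega M A Lb (p + k + 1)" "wedge om (?d al) : Omega M A Lb (p + k + 1)"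
    using wedge_Omega[OF Lb do a] wedge_Omega[OF Lb o da] by (simp_all add: algebra_simps)
   then show "wedge (?e om) al + psign p *\<^sub>R wedge om (?d al) : Omega M A Lb (p + k + 1)"
    by (intro Omega_add[OF Lb] Omega_scale[OF Lb])
   show "p + k + 1 ~= 0" using Suc.prems by simp
   fix Z assume Z: "Z : sections M A"
   note Zo = iota_Omega[OF o Z] and Za = iota_Omega[OF a Z]
   have w1: "wedge (iota Z om) al : Omega M A Lb (p + k - 1)" using wedge_Omega[OF Lb Zo a] by (simp add: algebra_simps)
   have w2: "wedge om (iota Z al) : Omega M A Lb (p + k - 1)" using wedge_Omega[OF Lb o Za] by (simp add: algebra_simps)
   have 1: "?d (wedge (iota Z om) al) = wedge (?e (iota Z om)) al + psign (p - 1) *\<^sub>R wedge (iota Z om) (?d al)"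
    by (rule Suc.IH[OF _ Zo a]) (use Suc.prems in simp)
   have 2: "?d (wedge om (iota Z al)) = wedge (?e om) (iota Z al) + psign p *\<^sub>R wedge om (?d (iota Z al))"
    by (rule Suc.IH[OF _ o Za]) (use Suc.prems in simp)
   have 3: "iota Z (wedge om al) = psign p *\<^sub>R wedge om (iota Z al) + wedge (iota Z om) al"
    by (simp add: iota_wedge sg_Omega[OF o] wedge_scale_left add.commute)
   have "iota Z (?d (wedge om al)) = Lie M A (br Z) (D Z) (wedge om al) - (psign p *\<^sub>R ?d (wedge om (iota Z al)) + ?d (wedge (iota Z om) al))"
    unfolding iota_dd[OF Lb d wedge_Omega[OF Lb o a] Z] 3 dd_linear[OF Lb d w2 w1] ..
   also have "\<dots> = iota Z (wedge (?e om) al + psign p *\<^sub>R wedge om (?d al))"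
    unfolding 1 2 Lie_wedge[OF Lb rep_dataD(1)[OF tl r Z] rep_dataD(1)[OF Lb d Z] o a]
     iota_add iota_scale iota_wedge sg_Omega[OF do] sg_Omega[OF o] iota_dd[OF Lb d a Z] iota_dd[OF tl r o Z]
     wedge_diff_left wedge_diff_right wedge_scale_left
    by (simp add: fun_eq_iff scaleR_fun_apply algebra_simps psign_add psign_diff)
   finally show "iota Z (?d (wedge om al)) = iota Z (wedge (?e om) al + psign p *\<^sub>R wedge om (?d al))" .
  qed
 qed
 show ?thesis
 proof (cases "p < 0 | k < 0")
  case True
  then show ?thesis using assms by (intro triv) (auto simp: Omega_neg)
 next
  case False
  then show ?thesis using main[of p k "nat (p + k + 1)"] assms by auto
 qed
qed

lemma dd_der:
 assumes "vector_bundle M Lb" "rep_data M A trivial_line br v v" "rep_data M A Lb br v D"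
 shows "der M A Lb 1 (dop M A br v) (dop M A br D)"
 unfolding der_leib
 by (intro conjI leibI)
   (simp_all add: dd_Omega[OF assms(1,3)] dd_Omega[OF tl assms(2)] dd_linear[OF assms(1,3)] dd_linear[OF tl assms(2)]
    dd_wedge[OF assms] dd_wedge[OF tl assms(2,2)])

end

section \<open>Courant--Jacobi algebroids\<close>

lemma (in mfd) local_inverse:
 assumes f: "f : Cinf M" "f x ~= 0"
 obtains h V where "h : Cinf M" "open V" "x : V" "ALL y:V. h y * f y = 1"
proof -
 have "\<exists>U. open U & x : U & (ALL y:U. f y ~= 0)"
 proof -
  obtain U \<phi> where c: "(U, \<phi>) : charts M" "x : U" using chart_at .
  have "smooth_on (\<phi> ` (U \<inter> UNIV)) (f \<circ> inv_into U \<phi>)" using f(1) c(1) by (auto simp: Cinf_def smooth_fun_on_def)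
  from smooth_onE[OF this, of "\<phi> x"] c(2) obtain W g where W: "open W" "\<phi> x : W" "!!k. Ck_on k W g"
   "!!y. y : W ==> y : \<phi> ` (U \<inter> UNIV) ==> g y = (f \<circ> inv_into U \<phi>) y" by (metis Int_UNIV_right imageI)
  have cg: "continuous_on W g" using W(3)[of 0] by simp
  have oW: "open (W \<inter> g -` (- {0}))" by (rule continuous_open_preimage[OF cg W(1)]) auto
  have "openin (top_of_set U) (U \<inter> \<phi> -` (W \<inter> g -` (- {0})))"
   using chartD(3)[OF c(1)] oW by (intro continuous_openin_preimage_gen) (auto simp: homeomorphism_def)
  then have o: "open (U \<inter> \<phi> -` (W \<inter> g -` (- {0})))" using chartD(1)[OF c(1)] openin_open_trans by blast
  have ge: "g (\<phi> y) = f y" if "y : U" "\<phi> y : W" for y using W(4)[OF that(2)] that chartD(5)[OF c(1)] by simp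
  show ?thesis using o c(2) W(2) ge f(2) by (intro exI[of _ "U \<inter> \<phi> -` (W \<inter> g -` (- {0}))"]) auto
 qed
 then obtain U where U: "open U" "x : U" "!!y. y : U ==> f y ~= 0" by blast
 have "smooth_fun_on M U (%y. inverse (f y))" by (intro smooth_fun_on_inverse Cinf_smooth f U(3))
 from extend_fun[OF U(1,2) this] obtain g V where "g : Cinf M" "open V" "x : V" "V <= U" "!!y. y : V ==> g y = inverse (f y)" by blast
 then show ?thesis using U(3) by (intro that[of g V]) auto
qed

locale cjb = mfd M for M :: "('m::{t2_space,second_countable_topology}, 'b::euclidean_space) manifold" +
 fixes C :: "('m, 'e::real_vector, 'l::real_vector) cj_data"
 assumes CJ: "courant_jacobi M C"
begin

abbreviation "E \<equiv> bdl C"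
abbreviation "L \<equiv> lin C"
abbreviation "GE \<equiv> sections M (bdl C)"
abbreviation "GL \<equiv> sections M (lin C)"
abbreviation "sp \<equiv> spair C"
abbreviation "br \<equiv> bracket C"

definition nab where "nab e s = (%x. nabla C x (e x) s)"

text \<open>The anchor, that is the vector field \<open>\<sigma>(nabla e)\<close>. The number is the
  same for all sections of \<open>L\<close> and is unique because one of them is non-zero at the
  point.\<close>

definition sig where "sig e f = (%x. SOME r. ALL s:GL. nabla C x (e x) (sc f s) = r *\<^sub>R s x + f x *\<^sub>R nabla C x (e x) s)"

lemmas cj = CJ[unfolded courant_jacobi_def]
lemmas cj1 = cj[THEN conjunct1]
lemmas cj2 = cj[THEN conjunct2, THEN conjunct1]
lemmas cj3 = cj[THEN conjunct2, THEN conjunct2, THEN conjunct1]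
lemmas cj4 = cj[THEN conjunct2, THEN conjunct2, THEN conjunct2, THEN conjunct1]
lemmas cj5 = cj[THEN conjunct2, THEN conjunct2, THEN conjunct2, THEN conjunct2, THEN conjunct1]
lemmas cj6 = cj[THEN conjunct2, THEN conjunct2, THEN conjunct2, THEN conjunct2, THEN conjunct2, THEN conjunct1]
lemmas cj7 = cj[THEN conjunct2, THEN conjunct2, THEN conjunct2, THEN conjunct2, THEN conjunct2, THEN conjunct2, THEN conjunct1]
lemmas cj8 = cj[THEN conjunct2, THEN conjunct2, THEN conjunct2, THEN conjunct2, THEN conjunct2, THEN conjunct2, THEN conjunct2, THEN conjunct1]
lemmas cj9 = cj[THEN conjunct2, THEN conjunct2, THEN conjunct2, THEN conjunct2, THEN conjunct2, THEN conjunct2, THEN conjunct2, THEN conjunct2, THEN conjunct1]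
lemmas cj10 = cj[THEN conjunct2, THEN conjunct2, THEN conjunct2, THEN conjunct2, THEN conjunct2, THEN conjunct2, THEN conjunct2, THEN conjunct2, THEN conjunct2]

lemma vbE: "vector_bundle M E" and lineL: "line_bundle M L"
 by (rule cj1, rule cj2)

lemma vbL: "vector_bundle M L"
 using lineL by (simp add: line_bundle_def)

lemma pair_facts:
 assumes "u : fib E x" "v : fib E x"
 shows "pairing C x u v : fib L x" "pairing C x u v = pairing C x v u"
  "w : fib E x ==> pairing C x (c *\<^sub>R u + v) w = c *\<^sub>R pairing C x u w + pairing C x v w"
  "w : fib E x ==> pairing C x w (c *\<^sub>R u + v) = c *\<^sub>R pairing C x w u + pairing C x w v"
proof -
 have *: "\<forall>x. ALL u:fib (bdl C) x. ALL v:fib (bdl C) x.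
    pairing C x u v : fib (lin C) x & pairing C x u v = pairing C x v u &
    (ALL w:fib (bdl C) x. \<forall>c.
      pairing C x (c *\<^sub>R u + v) w = c *\<^sub>R pairing C x u w + pairing C x v w)"
  by (rule cj3)
 show "pairing C x u v : fib L x" "pairing C x u v = pairing C x v u" using * assms by blast+
 show 1: "pairing C x (c *\<^sub>R u + v) w = c *\<^sub>R pairing C x u w + pairing C x v w" if "w : fib E x"
  using * assms that by blast
 have s: "pairing C x u v = pairing C x v u" if "u : fib E x" "v : fib E x" for u v using * that by blast
 have "c *\<^sub>R u + v : fib E x" using assms by (intro subspace_add[OF subspace_fib[OF vbE]] subspace_scale[OF subspace_fib[OF vbE]])
 then show "pairing C x w (c *\<^sub>R u + v) = c *\<^sub>R pairing C x w u + pairing C x w v" if "w : fib E x"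
  using 1[OF that] s[OF that] assms by simp
qed

lemma pair_zero: "u : fib E x ==> pairing C x u 0 = 0" "u : fib E x ==> pairing C x 0 u = 0"
proof -
 have z: "0 : fib E x" using subspace_0[OF subspace_fib[OF vbE]] .
 show "u : fib E x ==> pairing C x u 0 = 0" using pair_facts(4)[OF z z, of u 1] by simp
 show "u : fib E x ==> pairing C x 0 u = 0" using pair_facts(3)[OF z z, of u 1] by simp
qed

lemma nondeg: "u : fib E x ==> (!!v. v : fib E x ==> pairing C x u v = 0) ==> u = 0"
proof -
 have "\<forall>x. ALL u:fib (bdl C) x. (ALL v:fib (bdl C) x. pairing C x u v = 0) --> u = 0" by (rule cj4)
 then show "u : fib E x ==> (!!v. v : fib E x ==> pairing C x u v = 0) ==> u = 0" by blast
qed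

lemma sp_sections: "s : GE ==> t : GE ==> sp s t : GL"
proof -
 have "ALL s:GE. ALL t:GE. sp s t : GL" by (rule cj5)
 then show "s : GE ==> t : GE ==> sp s t : GL" by blast
qed

lemma br_sections: "s : GE ==> t : GE ==> br s t : GE"
proof -
 have "ALL s:GE. ALL t:GE. br s t : GE" by (rule cj6)
 then show "s : GE ==> t : GE ==> br s t : GE" by blast
qed

lemma br_add:
 assumes "s : GE" "t : GE" "r : GE"
 shows "br (s + t) r = br s r + br t r" "br r (s + t) = br r s + br r t"
proof -
 have "ALL s:sections M (bdl C). ALL t:sections M (bdl C). ALL r:sections M (bdl C). \<forall>c.
    bracket C (c *\<^sub>R s + t) r = c *\<^sub>R bracket C s r + bracket C t r &
    bracket C r (c *\<^sub>R s + t) = c *\<^sub>R bracket C r s + bracket C r t" by (rule cj7)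
 then have "br (1 *\<^sub>R s + t) r = 1 *\<^sub>R br s r + br t r" "br r (1 *\<^sub>R s + t) = 1 *\<^sub>R br r s + br r t" using assms by blast+
 then show "br (s + t) r = br s r + br t r" "br r (s + t) = br r s + br r t" by simp_all
qed

lemma loday:
 assumes "s : GE" "t : GE" "r : GE"
 shows "br s (br t r) = br (br s t) r + br t (br s r)"
proof -
 have "ALL s:GE. ALL t:GE. ALL r:GE. br s (br t r) = br (br s t) r + br t (br s r)" by (rule cj8)
 then show ?thesis using assms by blast
qed

lemma cj_ax:
 assumes "s : GE" "t : GE"
 shows "sp (br s t) t = sp s (br t t)" "nab s (sp t t) = 2 *\<^sub>R sp (br s t) t"
proof -
 have "ALL s:sections M (bdl C). ALL t:sections M (bdl C).
    spair C (bracket C s t) t = spair C s (bracket C t t) &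
    (%x. nabla C x (s x) (spair C t t)) = 2 *\<^sub>R spair C (bracket C s t) t" by (rule cj10)
 then show "sp (br s t) t = sp s (br t t)" "nab s (sp t t) = 2 *\<^sub>R sp (br s t) t" unfolding nab_def using assms by blast+
qed

lemma gm: "gauge_morphism M E L (nabla C)"
 by (rule cj9)

lemma nabla_lin: "v : fib E x ==> w : fib E x ==> s : GL ==> nabla C x (c *\<^sub>R v + w) s = c *\<^sub>R nabla C x v s + nabla C x w s"
 using gm[unfolded gauge_morphism_def, THEN conjunct2, THEN conjunct1] by blast

lemma nab_sections: "e : GE ==> s : GL ==> nab e s : GL"
 unfolding nab_def using gm[unfolded gauge_morphism_def, THEN conjunct2, THEN conjunct2] by blast

lemma nabla_gauge: "v : fib E x ==> nabla C x v : gauge_fib M L x"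
 using gm[unfolded gauge_morphism_def, THEN conjunct1] by blast

lemma nab_add:
 assumes e: "e : GE" and s: "s : GL" "t : GL"
 shows "nab e (s + t) = nab e s + nab e t" "nab e (c *\<^sub>R s) = c *\<^sub>R nab e s" "nab e 0 = 0"
proof -
 have lin: "nab e (c *\<^sub>R s + t) = c *\<^sub>R nab e s + nab e t" if "s : GL" "t : GL" for s t c
 proof
  fix x
  have "c *\<^sub>R s + t = (%y. c *\<^sub>R s y + t y)" by (simp add: fun_eq_iff scaleR_fun_apply)
  then show "nab e (c *\<^sub>R s + t) x = (c *\<^sub>R nab e s + nab e t) x"
   using nabla_gauge[OF sections_fib[OF vbE e], of x] that unfolding gauge_fib_def nab_def
   by (simp add: scaleR_fun_apply)
 qed
 from lin[OF s, of 1] show "nab e (s + t) = nab e s + nab e t" by simp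
 from lin[OF sections_zero[OF vbL] sections_zero[OF vbL], of 1] show z: "nab e 0 = 0" by simp
 from lin[OF s(1) sections_zero[OF vbL], of c] show "nab e (c *\<^sub>R s) = c *\<^sub>R nab e s" by (simp add: z)
qed

lemma nab_sc:
 assumes "e : GE" "f : Cinf M" "s : GL"
 shows "nab e (sc f s) = sc (sig e f) s + sc f (nab e s)"
proof
 fix x
 have "\<exists>r. ALL s:GL. nabla C x (e x) (sc f s) = r *\<^sub>R s x + f x *\<^sub>R nabla C x (e x) s"
  using nabla_gauge[OF sections_fib[OF vbE assms(1)], of x] assms(2) unfolding gauge_fib_def sc_def by blast
 from someI_ex[OF this] have "ALL s:GL. nabla C x (e x) (sc f s) = sig e f x *\<^sub>R s x + f x *\<^sub>R nabla C x (e x) s"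
  unfolding sig_def .
 from bspec[OF this assms(3)] show "nab e (sc f s) x = (sc (sig e f) s + sc f (nab e s)) x"
  by (simp only: nab_def plus_fun_apply sc_apply)
qed

lemma nab_lin_left:
 assumes "e : GE" "e' : GE" "s : GL"
 shows "nab (sc f e + e') s = sc f (nab e s) + nab e' s"
 using nabla_lin[OF sections_fib[OF vbE assms(1)] sections_fib[OF vbE assms(2)] assms(3)]
 by (simp add: nab_def sc_def fun_eq_iff)

lemma nab_zero_at: "e x = 0 ==> s : GL ==> nab e s x = 0"
 using nabla_lin[OF subspace_0[OF subspace_fib[OF vbE]] subspace_0[OF subspace_fib[OF vbE]], of s x 1] by (simp add: nab_def)

lemma L_frame:
 obtains lam nu V where "lam : GL" "open V" "x : V" "ALL y:V. nu y (lam y) = 1"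
  "ALL y:V. ALL l:fib L y. nu y l *\<^sub>R lam y = l" "ALL s:GL. (%y. nu y (s y)) : Cinf M"
  "\<forall>y. ALL l:fib L y. \<forall>l'\<in>fib L y. \<forall>c. nu y (c *\<^sub>R l + l') = (c * nu y l + nu y l' :: real)"
proof -
 interpret fb: fbun M E by standard (rule vbE)
 show ?thesis by (rule fb.line_frame_obj[OF lineL, of x]) (rule that)
qed

lemma L_nonzero: obtains s where "s : GL" "s x ~= 0"
proof -
 interpret fb: fbun M E by standard (rule vbE)
 show ?thesis by (rule fb.nonzero_section[OF lineL, of x]) (rule that)
qed

lemma L_cancel: "(!!s. s : GL ==> sc f s = sc g s) ==> f = g"
proof
 fix x assume *: "!!s. s : GL ==> sc f s = sc g s"
 obtain s where s: "s : GL" "s x ~= 0" using L_nonzero .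
 show "f x = g x" using fun_cong[OF *[OF s(1)], of x] s(2) by (simp add: sc_def)
qed

text \<open>Nothing in the fibrewise definition of the gauge algebroid makes the symbol smooth. It
  is the coefficient, against a local generator of \<open>L\<close>, of the commutator of
  \<open>nab e\<close> with multiplication by \<open>f\<close>.\<close>

lemma sig_Cinf:
 assumes "e : GE" "f : Cinf M"
 shows "sig e f : Cinf M"
proof (rule CinfI_local)
 fix x
 obtain lam nu V where F: "lam : GL" "open V" "x : V" "ALL y:V. nu y (lam y) = 1"
  "ALL y:V. ALL l:fib L y. nu y l *\<^sub>R lam y = l" "ALL s:GL. (%y. nu y (s y)) : Cinf M"
  "\<forall>y. ALL l:fib L y. \<forall>l'\<in>fib L y. \<forall>c. nu y (c *\<^sub>R l + l') = (c * nu y l + nu y l' :: real)" by (rule L_frame)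
 define t where "t = nab e (sc f lam) - sc f (nab e lam)"
 have t: "t : GL" unfolding t_def
  by (intro sections_diff[OF vbL] nab_sections sections_sc[OF vbL] assms F)
 have te: "t y = sig e f y *\<^sub>R lam y" for y
  unfolding t_def nab_sc[OF assms F(1)] by (simp add: sc_def)
 have z: "nu y 0 = 0" for y
 proof -
  have "nu y (1 *\<^sub>R 0 + 0) = 1 * nu y 0 + nu y 0" using F(7) subspace_0[OF subspace_fib[OF vbL]] by blast
  then show ?thesis by simp
 qed
 have "nu y (t y) = sig e f y" if "y : V" for y
 proof -
  have "nu y (sig e f y *\<^sub>R lam y + 0) = sig e f y * nu y (lam y) + nu y 0"
   using F(7) sections_fib[OF vbL F(1)] subspace_0[OF subspace_fib[OF vbL]] by blast
  then show ?thesis using F(4) that by (simp add: te z)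
 qed
 moreover have "smooth_fun_on M V (%y. nu y (t y))" using F(6) t Cinf_smooth by blast
 ultimately have "smooth_fun_on M V (sig e f)"
  using smooth_fun_on_cong[of V "%y. nu y (t y)" "sig e f"] by blast
 then show "\<exists>V. open V & x : V & smooth_fun_on M V (sig e f)" using F by blast
qed

lemma sig_mult:
 assumes e: "e : GE" and f: "f : Cinf M" and g: "g : Cinf M"
 shows "sig e (f * g) = sig e f * g + f * sig e g"
proof (rule L_cancel)
 fix s assume s: "s : GL"
 have m: "sc (f * g) s = sc f (sc g s)" by (simp add: sc_def fun_eq_iff)
 have "sc (sig e (f * g)) s + sc (f * g) (nab e s) = sc (sig e f) (sc g s) + sc f (sc (sig e g) s + sc g (nab e s))"
  using nab_sc[OF e Cinf_mult[OF f g] s] nab_sc[OF e f sections_sc[OF vbL g s]] by (simp only: m nab_sc[OF e g s])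
 then show "sc (sig e (f * g)) s = sc (sig e f * g + f * sig e g) s"
  by (simp add: fun_eq_iff sc_def algebra_simps)
qed

lemma sig_add:
 assumes e: "e : GE" and f: "f : Cinf M" and g: "g : Cinf M"
 shows "sig e (f + g) = sig e f + sig e g"
proof (rule L_cancel)
 fix s assume s: "s : GL"
 have m: "sc (f + g) s = sc f s + sc g s" by (simp add: sc_def fun_eq_iff algebra_simps)
 have "sc (sig e (f + g)) s + sc (f + g) (nab e s) = sc (sig e f) s + sc f (nab e s) + (sc (sig e g) s + sc g (nab e s))"
  using nab_sc[OF e Cinf_add[OF f g] s] nab_add(1)[OF e sections_sc[OF vbL f s] sections_sc[OF vbL g s]]
  by (simp only: m nab_sc[OF e g s] nab_sc[OF e f s])
 then show "sc (sig e (f + g)) s = sc (sig e f + sig e g) s"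
  by (simp add: fun_eq_iff sc_def algebra_simps)
qed

lemma sig_const:
 assumes e: "e : GE"
 shows "sig e (%_. c) = 0"
proof (rule L_cancel)
 fix s assume s: "s : GL"
 have "sc (sig e (%_. c)) s + sc (%_. c) (nab e s) = sc (%_. c) (nab e s)"
  using nab_sc[OF e Cinf_const s, of c] nab_add(2)[OF e s s, of c] by (simp only: scaleR_conv_sc)
 then show "sc (sig e (%_. c)) s = sc 0 s" by (simp add: sc_zero_left)
qed

lemma sig_lin:
 assumes e: "e : GE" "e' : GE" and f: "f : Cinf M" and g: "g : Cinf M"
 shows "sig (sc f e + e') g = sc f (sig e g) + sig e' g"
proof (rule L_cancel)
 fix s assume s: "s : GL"
 have e'': "sc f e + e' : GE" by (intro sections_add[OF vbE] sections_sc[OF vbE] f e)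
 note gs = sections_sc[OF vbL g s]
 have "sc (sig (sc f e + e') g) s + sc g (sc f (nab e s) + nab e' s)
   = sc f (sc (sig e g) s + sc g (nab e s)) + (sc (sig e' g) s + sc g (nab e' s))"
  using nab_sc[OF e'' g s] nab_lin_left[OF e gs] by (simp only: nab_sc[OF e(1) g s] nab_sc[OF e(2) g s] nab_lin_left[OF e s])
 then show "sc (sig (sc f e + e') g) s = sc (sc f (sig e g) + sig e' g) s"
  by (simp add: fun_eq_iff sc_def algebra_simps)
qed

text \<open>The fibres of the gauge algebroid consist of functionals on global sections, so locality
  is not built in. It follows from the Leibniz rule for a bump function times the difference, a
  product that is identically zero.\<close>

lemma nab_local:
 assumes e: "e : GE" and s: "s : GL" "t : GL" and V: "open V" "x : V" "!!y. y : V ==> s y = t y"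
 shows "nab e s x = nab e t x"
proof -
 obtain h W K where b: "h : Cinf M" "open W" "x : W" "W <= K" "!!y. y : W ==> h y = 1" "closed K" "K <= V"
  "!!y. y \<notin> K ==> h y = 0"
  using bump[OF V(1,2)] by blast
 define u where "u = s - t"
 have u: "u : GL" unfolding u_def by (intro sections_diff[OF vbL] s)
 have "sc h u = 0" using b V(3) by (force simp: sc_def u_def fun_eq_iff)
 then have "0 = sc (sig e h) u + sc h (nab e u)" using nab_sc[OF e b(1) u] nab_add(3)[OF e s] by simp
 from fun_cong[OF this, of x] have "nab e u x = 0" using b(3,5) V(2,3) by (simp add: sc_def u_def)
 moreover have "nab e s = nab e u + nab e t" using nab_add(1)[OF e u s(2)] by (simp add: u_def)
 ultimately show ?thesis by simp
qed

lemma sp_sym: "s : GE ==> t : GE ==> sp s t = sp t s"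
 using pair_facts(2)[OF sections_fib[OF vbE] sections_fib[OF vbE]] by (simp add: spair_def fun_eq_iff)

lemma sp_lin:
 assumes "s : GE" "t : GE" "r : GE"
 shows "sp (sc f s + t) r = sc f (sp s r) + sp t r" "sp r (sc f s + t) = sc f (sp r s) + sp r t"
  "sp (s + t) r = sp s r + sp t r" "sp r (s + t) = sp r s + sp r t"
  "sp (sc f s) r = sc f (sp s r)" "sp r (sc f s) = sc f (sp r s)"
  "sp (s - t) r = sp s r - sp t r" "sp r (s - t) = sp r s - sp r t" "sp (- s) r = - sp s r" "sp r (- s) = - sp r s"
proof -
 note fibs = sections_fib[OF vbE assms(1)] sections_fib[OF vbE assms(2)] sections_fib[OF vbE assms(3)]
 have 0: "sp (sc f s + t) r = sc f (sp s r) + sp t r & sp r (sc f s + t) = sc f (sp r s) + sp r t"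
  if "s : GE" "t : GE" for f s t
  using pair_facts(3,4)[OF sections_fib[OF vbE that(1)] sections_fib[OF vbE that(2)] fibs(3)] by (simp add: spair_def sc_def fun_eq_iff)
 note st = assms(1,2)
 note z = sections_zero[OF vbE]
 have zz: "sp 0 r = 0" "sp r 0 = 0" using pair_zero[OF fibs(3)] by (simp_all add: spair_def fun_eq_iff)
 show "sp (sc f s + t) r = sc f (sp s r) + sp t r" "sp r (sc f s + t) = sc f (sp r s) + sp r t" using 0[OF st] by auto
 show add: "sp (s + t) r = sp s r + sp t r" "sp r (s + t) = sp r s + sp r t" using 0[OF st, of "%_. 1"] by (simp_all add: sc_one)
 show scale: "sp (sc f s) r = sc f (sp s r)" "sp r (sc f s) = sc f (sp r s)" for f using 0[OF assms(1) z, of f] by (simp_all add: zz)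
 have m: "sc (%_. - 1) a + c = c - a" for a c :: "'m => 'w::real_vector" by (simp add: sc_def fun_eq_iff)
 have m': "sc (%_. - 1) a = - a" for a :: "'m => 'w::real_vector" by (simp add: sc_def fun_eq_iff)
 show "sp (s - t) r = sp s r - sp t r" "sp r (s - t) = sp r s - sp r t" using 0[OF st(2,1), of "%_. - 1"] by (simp_all add: m)
 show "sp (- s) r = - sp s r" "sp r (- s) = - sp r s" using 0[OF st(1) z, of "%_. - 1"] by (simp_all only: m' zz add_0_right)
qed

lemma GE_eqI:
 assumes "e : GE" "e' : GE" "!!t. t : GE ==> sp e t = sp e' t"
 shows "e = e'"
proof
 fix x
 have "e x - e' x = 0"
 proof (rule nondeg)
  show "e x - e' x : fib E x" using sections_fib[OF vbE] assms(1,2) subspace_diff[OF subspace_fib[OF vbE]] by blast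
  fix v assume "v : fib E x"
  then obtain t where t: "t : GE" "t x = v" using section_through[OF vbE] by metis
  show "pairing C x (e x - e' x) v = 0"
   using fun_cong[OF sp_lin(7)[OF assms(1,2) t(1)], of x] fun_cong[OF assms(3)[OF t(1)], of x] t(2) by (simp add: spair_def)
 qed
 then show "e x = e' x" by simp
qed

text \<open>Polarisation of the axiom for \<open>nab s (sp t t)\<close>.\<close>

lemma C1:
 assumes e: "e1 : GE" "e2 : GE" "e3 : GE"
 shows "nab e1 (sp e2 e3) = sp (br e1 e2) e3 + sp e2 (br e1 e3)"
proof -
 note [simp] = e sp_sections br_sections sections_add[OF vbE] sections_add[OF vbL]
 have "nab e1 (sp (e2 + e3) (e2 + e3)) = 2 *\<^sub>R sp (br e1 (e2 + e3)) (e2 + e3)" by (rule cj_ax(2)) simp_all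
 then have "nab e1 (sp e2 e2 + sp e3 e2 + (sp e2 e3 + sp e3 e3)) = 2 *\<^sub>R (sp (br e1 e2) e2 + sp (br e1 e3) e2 + (sp (br e1 e2) e3 + sp (br e1 e3) e3))"
  by (simp only: sp_lin(3,4) br_add e br_sections sections_add[OF vbE])
 then have "nab e1 (sp e2 e2) + nab e1 (sp e3 e2) + (nab e1 (sp e2 e3) + nab e1 (sp e3 e3))
   = 2 *\<^sub>R (sp (br e1 e2) e2 + sp (br e1 e3) e2 + (sp (br e1 e2) e3 + sp (br e1 e3) e3))"
  by (simp only: nab_add(1) e sp_sections sections_add[OF vbL])
 then have "2 *\<^sub>R nab e1 (sp e2 e3) = 2 *\<^sub>R (sp (br e1 e2) e3 + sp e2 (br e1 e3))"
  unfolding cj_ax(2)[OF e(1,2)] cj_ax(2)[OF e(1,3)] sp_sym[OF e(3,2)] sp_sym[OF br_sections[OF e(1,3)] e(2)]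
  by (simp add: scaleR_2 algebra_simps fun_eq_iff)
 then show ?thesis by (simp only: scaleR_cancel_left) simp
qed

text \<open>Polarisation of the other axiom, combined with \<open>C1\<close>: the failure of
  skew-symmetry of the bracket is the gradient of the pairing.\<close>

lemma C2:
 assumes e: "e1 : GE" "e2 : GE" "e3 : GE"
 shows "sp e1 (br e2 e3) + sp e1 (br e3 e2) = nab e1 (sp e2 e3)"
proof -
 have "sp (br e1 (e2 + e3)) (e2 + e3) = sp e1 (br (e2 + e3) (e2 + e3))"
  by (rule cj_ax(1)[OF e(1) sections_add[OF vbE e(2,3)]])
 then have "sp (br e1 e2) e2 + sp (br e1 e3) e2 + (sp (br e1 e2) e3 + sp (br e1 e3) e3)
   = sp e1 (br e2 e2) + sp e1 (br e3 e2) + (sp e1 (br e2 e3) + sp e1 (br e3 e3))"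
  by (simp only: sp_lin(3,4) br_add e br_sections sections_add[OF vbE])
 then show ?thesis
  unfolding C1[OF e] cj_ax(1)[OF e(1,2)] cj_ax(1)[OF e(1,3)] sp_sym[OF br_sections[OF e(1,3)] e(2)]
  by (simp add: algebra_simps fun_eq_iff)
qed

text \<open>Pairing with an arbitrary section and using \<open>C1\<close> transports the Leibniz
  rule of \<open>nabla\<close> to the bracket; non-degeneracy concludes.\<close>

lemma br_sc:
 assumes e: "e1 : GE" "e2 : GE" and f: "f : Cinf M"
 shows "br e1 (sc f e2) = sc f (br e1 e2) + sc (sig e1 f) e2"
proof (rule GE_eqI)
 note fe = sections_sc[OF vbE f e(2)] and be = br_sections[OF e] and s = sig_Cinf[OF e(1) f]
 show "br e1 (sc f e2) : GE" by (intro br_sections e fe)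
 show "sc f (br e1 e2) + sc (sig e1 f) e2 : GE" by (intro sections_add[OF vbE] sections_sc[OF vbE] be f s e)
 fix t assume t: "t : GE"
 have "sp (br e1 (sc f e2)) t + sc f (sp e2 (br e1 t)) = sc (sig e1 f) (sp e2 t) + sc f (sp (br e1 e2) t + sp e2 (br e1 t))"
  using C1[OF e(1) fe t] unfolding sp_lin(5)[OF e(2) t t] sp_lin(5)[OF e(2) t br_sections[OF e(1) t]]
   nab_sc[OF e(1) f sp_sections[OF e(2) t]] C1[OF e t] by simp
 moreover have "sp (sc f (br e1 e2) + sc (sig e1 f) e2) t = sc f (sp (br e1 e2) t) + sc (sig e1 f) (sp e2 t)"
  unfolding sp_lin(1)[OF be sections_sc[OF vbE s e(2)] t] sp_lin(5)[OF e(2) t t] ..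
 ultimately show "sp (br e1 (sc f e2)) t = sp (sc f (br e1 e2) + sc (sig e1 f) e2) t"
  by (simp add: fun_eq_iff sc_def algebra_simps)
qed

text \<open>If the fibre is not zero, non-degeneracy provides two sections whose pairing is a
  generator of \<open>L\<close> near \<open>x\<close>; rescaling one of them reaches every section
  of \<open>L\<close> locally.\<close>

lemma local_pairing:
 assumes s: "s : GL" and ne: "fib E x ~= {0}"
 obtains e3 e4 V where "e3 : GE" "e4 : GE" "open V" "x : V" "ALL y:V. s y = sp e3 e4 y"
proof -
 obtain lam nu V where F: "lam : GL" "open V" "x : V" "ALL y:V. nu y (lam y) = 1"
  "ALL y:V. ALL l:fib L y. nu y l *\<^sub>R lam y = l" "ALL s:GL. (%y. nu y (s y)) : Cinf M"
  "\<forall>y. ALL l:fib L y. \<forall>l'\<in>fib L y. \<forall>c. nu y (c *\<^sub>R l + l') = (c * nu y l + nu y l' :: real)" by (rule L_frame)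
 obtain u where u: "u : fib E x" "u ~= 0" using ne subspace_0[OF subspace_fib[OF vbE], of x] by blast
 then obtain v where v: "v : fib E x" "pairing C x u v ~= 0" using nondeg by blast
 obtain e3 e4 where e: "e3 : GE" "e3 x = u" "e4 : GE" "e4 x = v" using section_through[OF vbE] u(1) v(1) by metis
 define f where "f = (%y. nu y (sp e3 e4 y))"
 have f: "f : Cinf M" unfolding f_def using F(6) sp_sections[OF e(1,3)] by blast
 have fe: "f y *\<^sub>R lam y = sp e3 e4 y" if "y : V" for y
  unfolding f_def using F(5) that sections_fib[OF vbL sp_sections[OF e(1,3)]] by blast
 have fx: "f x ~= 0" using fe[OF F(3)] v(2) e by (auto simp: spair_def)
 obtain h W where h: "h : Cinf M" "open W" "x : W" "ALL y:W. h y * f y = 1" by (rule local_inverse[where f=f and x=x, OF f fx])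
 define g where "g = (%y. nu y (s y)) * h"
 have g: "g : Cinf M" unfolding g_def using F(6) s h(1) Cinf_mult by blast
 show ?thesis
 proof (rule that[of "sc g e3" e4 "V \<inter> W"])
  show "sc g e3 : GE" by (rule sections_sc[OF vbE g e(1)])
  show "ALL y:V \<inter> W. s y = sp (sc g e3) e4 y"
  proof
   fix y assume y: "y : V \<inter> W"
   have "sp (sc g e3) e4 y = (nu y (s y) * (h y * f y)) *\<^sub>R lam y"
    using sp_lin(5)[OF e(1,3,3), of g] fe[of y] y by (simp add: sc_def g_def flip: fe)
   then show "s y = sp (sc g e3) e4 y" using h(4) y F(5) sections_fib[OF vbL s] by simp
  qed
 qed (use e F h in auto)
qed

text \<open>Flatness holds on pairings of two sections, by \<open>C1\<close> applied twice and the
  Loday identity in each entry. Locality of \<open>nabla\<close> then allows passing to all sections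
  of \<open>L\<close>.\<close>

lemma nab_br:
 assumes e: "e1 : GE" "e2 : GE" and s: "s : GL"
 shows "nab (br e1 e2) s = nab e1 (nab e2 s) - nab e2 (nab e1 s)"
proof
 fix x
 show "nab (br e1 e2) s x = (nab e1 (nab e2 s) - nab e2 (nab e1 s)) x"
 proof (cases "fib E x = {0}")
  \<comment> \<open>Over a zero fibre all sections of \<open>E\<close> vanish, and
    \<open>nabla\<close> vanishes there because it depends linearly on the vector.\<close>
  case True
  then have z: "e x = 0" if "e : GE" for e using sections_fib[OF vbE that, of x] by simp
  have zz: "nab e s x = 0" if "e : GE" "s : GL" for e s
   by (rule nab_zero_at) (rule z[OF that(1)], rule that(2))
  show ?thesis
   using zz[OF br_sections[OF e] s] zz[OF e(1) nab_sections[OF e(2) s]] zz[OF e(2) nab_sections[OF e(1) s]] by simp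
 next
  case False
  obtain e3 e4 V where V: "e3 : GE" "e4 : GE" "open V" "x : V" "ALL y:V. s y = sp e3 e4 y"
   by (rule local_pairing[OF s False])
  define t where "t = sp e3 e4"
  have t: "t : GL" unfolding t_def by (rule sp_sections[OF V(1,2)])
  have loc: "nab e s y = nab e t y" if "e : GE" "y : V" for e y
   by (rule nab_local[OF that(1) s t V(3) that(2)]) (use V(5) t_def in auto)
  have loc2: "nab e (nab e' s) x = nab e (nab e' t) x" if "e : GE" "e' : GE" for e e'
   by (rule nab_local[OF that(1) nab_sections[OF that(2) s] nab_sections[OF that(2) t] V(3,4) loc[OF that(2)]])
  note E = e V(1,2)
  have two: "nab e (nab e' t) = sp (br e (br e' e3)) e4 + sp (br e' e3) (br e e4) + (sp (br e e3) (br e' e4) + sp e3 (br e (br e' e4)))"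
   if "e : GE" "e' : GE" for e e'
   unfolding t_def C1[OF that(2) V(1,2)]
    nab_add(1)[OF that(1) sp_sections[OF br_sections[OF that(2) V(1)] V(2)] sp_sections[OF V(1) br_sections[OF that(2) V(2)]]]
    C1[OF that(1) br_sections[OF that(2) V(1)] V(2)] C1[OF that(1) V(1) br_sections[OF that(2) V(2)]] ..
  have "nab (br e1 e2) t = nab e1 (nab e2 t) - nab e2 (nab e1 t)"
   unfolding two[OF e] two[OF e(2,1)] loday[OF e V(1)] loday[OF e V(2)]
    sp_lin(3)[OF br_sections[OF br_sections[OF e] V(1)] br_sections[OF e(2) br_sections[OF e(1) V(1)]] V(2)]
    sp_lin(4)[OF br_sections[OF br_sections[OF e] V(2)] br_sections[OF e(2) br_sections[OF e(1) V(2)]] V(1)]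
   unfolding t_def C1[OF br_sections[OF e] V(1,2)] by (simp add: fun_eq_iff)
  then show ?thesis using loc[OF br_sections[OF e] V(4)] loc2[OF e] loc2[OF e(2,1)] by simp
 qed
qed

text \<open>A gradient acts trivially: writing \<open>s\<close> locally as a pairing,
  \<open>C2\<close> identifies the gradient at \<open>x\<close> with the symmetric part of a
  bracket, and by flatness the two orders of that bracket act with opposite signs.\<close>

lemma nab_exact:
 assumes w: "w : GE" and s: "s : GL" and t: "t : GL" and eq: "!!e. e : GE ==> sp w e x = nab e s x"
 shows "nab w t x = 0"
proof (cases "fib E x = {0}")
 case True
 then have "w x = 0" using sections_fib[OF vbE w, of x] by simp
 then show ?thesis using nab_zero_at t by blast
next
 case False
 obtain e3 e4 V where V: "e3 : GE" "e4 : GE" "open V" "x : V" "ALL y:V. s y = sp e3 e4 y"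
  by (rule local_pairing[OF s False])
 define w' where "w' = br e3 e4 + br e4 e3"
 note b = br_sections[OF V(1,2)] br_sections[OF V(2,1)]
 have w': "w' : GE" unfolding w'_def by (intro sections_add[OF vbE] b)
 have "w x - w' x = 0"
 proof (rule nondeg)
  show "w x - w' x : fib E x" using sections_fib[OF vbE] w w' subspace_diff[OF subspace_fib[OF vbE]] by blast
  fix v assume "v : fib E x"
  then obtain e where e: "e : GE" "e x = v" using section_through[OF vbE] by metis
  have "nab e s x = nab e (sp e3 e4) x"
   by (rule nab_local[OF e(1) s sp_sections[OF V(1,2)] V(3,4)]) (use V(5) in auto)
  also have "\<dots> = sp w' e x"
   unfolding C2[OF e(1) V(1,2), symmetric] w'_def sp_lin(3)[OF b e(1)] sp_sym[OF e(1) b(1)] sp_sym[OF e(1) b(2)] ..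
  finally have "sp w e x = sp w' e x" using eq[OF e(1)] by simp
  then show "pairing C x (w x - w' x) v = 0"
   using fun_cong[OF sp_lin(7)[OF w w' e(1)], of x] e(2) by (simp add: spair_def)
 qed
 then have "nab w t x = nab w' t x" by (simp add: nab_def)
 also have "nab w' t = nab (br e3 e4) t + nab (br e4 e3) t"
  unfolding w'_def using nab_lin_left[OF b t, of "%_. 1"] by (simp add: sc_one)
 also have "\<dots> = 0" unfolding nab_br[OF V(1,2) t] nab_br[OF V(2,1) t] by simp
 finally show ?thesis by simp
qed

end

section \<open>Dual frames of complementary Lagrangian subbundles\<close>

locale lag = cjb M C for M :: "('m::{t2_space,second_countable_topology}, 'b::euclidean_space) manifold"
  and C :: "('m, 'e::real_vector, 'l::real_vector) cj_data" +
 fixes A B :: "('m, 'e) vbundle"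
 assumes lagA: "almost_dirac_jacobi M C A" and lagB: "almost_dirac_jacobi M C B" and comp: "complementary (bdl C) A B"
begin

text \<open>The locale treats the two Lagrangian complements alike, so each statement about
  \<open>A\<close> is available for \<open>B\<close> by interchange.\<close>

lemma lag_swap: "lag M C B A"
proof -
 have "complementary (bdl C) B A"
  unfolding complementary_def
 proof (intro allI conjI)
  fix x
  note c = comp[unfolded complementary_def, THEN spec, of x]
  show "fib B x \<inter> fib A x = {0}" using c by (simp only: Int_commute)
  have "{a + b | a b. a : fib A x & b : fib B x} = {a + b | a b. a : fib B x & b : fib A x}"
   by (auto, metis add.commute, metis add.commute)
  then show "fib (bdl C) x = {a + b | a b. a : fib B x & b : fib A x}" using c by (simp only:)
 qed
 then show ?thesis using lagA lagB by unfold_locales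
qed

abbreviation "GA \<equiv> sections M A"
abbreviation "GB \<equiv> sections M B"

lemma vbA: "vector_bundle M A" and fibA: "fib A x <= fib E x"
 using lagA by (simp_all add: almost_dirac_jacobi_def subbundle_def)

lemma vbB: "vector_bundle M B" and fibB: "fib B x <= fib E x"
 using lagB by (simp_all add: almost_dirac_jacobi_def subbundle_def)

lemma perpA: "v : fib A x \<longleftrightarrow> v : fib E x & (ALL a:fib A x. pairing C x v a = 0)"
proof -
 have "fib A x = {v : fib E x. ALL a:fib A x. pairing C x v a = 0}"
  using lagA[unfolded almost_dirac_jacobi_def, THEN conjunct2] by (rule spec)
 then have "v : fib A x \<longleftrightarrow> v : {v : fib E x. ALL a:fib A x. pairing C x v a = 0}" by (rule arg_cong)
 then show ?thesis by (simp only: mem_Collect_eq)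
qed

lemma perpB: "v : fib B x \<longleftrightarrow> v : fib E x & (ALL a:fib B x. pairing C x v a = 0)"
proof -
 have "fib B x = {v : fib E x. ALL a:fib B x. pairing C x v a = 0}"
  using lagB[unfolded almost_dirac_jacobi_def, THEN conjunct2] by (rule spec)
 then have "v : fib B x \<longleftrightarrow> v : {v : fib E x. ALL a:fib B x. pairing C x v a = 0}" by (rule arg_cong)
 then show ?thesis by (simp only: mem_Collect_eq)
qed

lemma isoA: "v : fib A x ==> w : fib A x ==> pairing C x v w = 0"
 using perpA by blast

lemma isoB: "v : fib B x ==> w : fib B x ==> pairing C x v w = 0"
 using perpB by blast

lemma complementaryD: "fib A x \<inter> fib B x = {0}" "fib E x = {a + b | a b. a : fib A x & b : fib B x}"
 using comp[unfolded complementary_def, THEN spec, of x] by (rule conjunct1, rule conjunct2)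

lemma AB_zero: "v : fib A x ==> v : fib B x ==> v = 0"
 using complementaryD(1)[of x] by blast

lemma decompose:
 assumes "v : fib E x"
 obtains a b where "a : fib A x" "b : fib B x" "v = a + b"
 using assms[unfolded complementaryD(2)] that by blast

lemma GA_GE: "s : GA ==> s : GE"
proof (rule sectionsI_local[OF vbE])
 fix x assume s: "s : GA"
 obtain U ts where f: "(U, ts) : frames A" "x : U" using frame_at[OF vbA] .
 have ts: "smooth_section_on M E U t" if "t : set ts" for t
  using lagA f(1) that unfolding almost_dirac_jacobi_def subbundle_def by blast
 from sec_coeff[OF vbA sections_on[OF vbA s, of U] f(1)] obtain c where
  c: "!!j. j < length ts ==> smooth_fun_on M (U \<inter> U) (c j)" "!!x. x : U ==> x : U ==> s x = (\<Sum>j<length ts. c j x *\<^sub>R (ts ! j) x)" by blast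
 have "smooth_section_on M E U (\<Sum>j<length ts. sc (c j) (ts ! j))"
  by (intro sec_sum[OF vbE] sec_sc[OF vbE] ts) (use c(1) in auto)
 then have "smooth_section_on M E U s"
  by (rule sec_cong[OF vbE]) (simp add: c(2) sum_fun_apply sc_def)
 then show "\<exists>V. open V & x : V & smooth_section_on M E V s" using frameD(1)[OF vbA f(1)] f(2) by blast
qed

text \<open>The pairing is \<open>L\<close>-valued, so duality is understood relative to a generator
  \<open>lam\<close>, and \<open>nu\<close> extracts coefficients. All sections are global; the
  relations hold over \<open>U\<close> only.\<close>

definition frame :: "'m set => nat => (nat => 'm => 'e) => (nat => 'm => 'e) => ('m => 'l) => ('m => 'l => real) => bool" where
 "frame U n a b lam nu \<longleftrightarrow> open U & (\<forall>i<n. a i : GA & b i : GB) & lam : GL &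
   (ALL y:U. nu y (lam y) = 1 & (ALL l:fib L y. nu y l *\<^sub>R lam y = l)) &
   (ALL s:GL. (%y. nu y (s y)) : Cinf M) &
   (\<forall>y. ALL l:fib L y. \<forall>l'\<in>fib L y. \<forall>c. nu y (c *\<^sub>R l + l') = c * nu y l + nu y l') &
   (ALL y:U. \<forall>i<n. \<forall>j<n. pairing C y (a i y) (b j y) = (if i = j then lam y else 0)) &
   (ALL y:U. ALL v:fib A y. v = (\<Sum>i<n. nu y (pairing C y v (b i y)) *\<^sub>R a i y)) &
   (ALL y:U. ALL v:fib B y. v = (\<Sum>i<n. nu y (pairing C y (a i y) v) *\<^sub>R b i y))"

lemma pair_sum:
 fixes n :: nat
 assumes "!!i. i < n ==> v i : fib E y" "w : fib E y"
 shows "pairing C y (\<Sum>i<n. c i *\<^sub>R v i) w = (\<Sum>i<n. c i *\<^sub>R pairing C y (v i) w)"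
  "pairing C y w (\<Sum>i<n. c i *\<^sub>R v i) = (\<Sum>i<n. c i *\<^sub>R pairing C y w (v i))"
proof -
 have "pairing C y (\<Sum>i<m. c i *\<^sub>R v i) w = (\<Sum>i<m. c i *\<^sub>R pairing C y (v i) w) & (\<Sum>i<m. c i *\<^sub>R v i) : fib E y &
  pairing C y w (\<Sum>i<m. c i *\<^sub>R v i) = (\<Sum>i<m. c i *\<^sub>R pairing C y w (v i))"
  if "m <= n" for m
  using that
 proof (induction m)
  case 0
  then show ?case using pair_zero[OF assms(2)] subspace_0[OF subspace_fib[OF vbE]] by simp
 next
  case (Suc m)
  then have IH: "pairing C y (\<Sum>i<m. c i *\<^sub>R v i) w = (\<Sum>i<m. c i *\<^sub>R pairing C y (v i) w)" "(\<Sum>i<m. c i *\<^sub>R v i) : fib E y"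
   "pairing C y w (\<Sum>i<m. c i *\<^sub>R v i) = (\<Sum>i<m. c i *\<^sub>R pairing C y w (v i))"
   and vm: "v m : fib E y" using assms(1) by auto
  show ?case
   using pair_facts(3)[OF vm IH(2) assms(2), of "c m"] pair_facts(4)[OF vm IH(2) assms(2), of "c m"] IH
    subspace_add[OF subspace_fib[OF vbE] subspace_scale[OF subspace_fib[OF vbE] vm, of "c m"] IH(2)]
   by (simp add: add.commute)
 qed
 from this[of n] show "pairing C y (\<Sum>i<n. c i *\<^sub>R v i) w = (\<Sum>i<n. c i *\<^sub>R pairing C y (v i) w)"
  "pairing C y w (\<Sum>i<n. c i *\<^sub>R v i) = (\<Sum>i<n. c i *\<^sub>R pairing C y w (v i))" by auto
qed

lemma fib_sum: "vector_bundle M F ==> (!!i. i < (n::nat) ==> v i : fib F y) ==> (\<Sum>i<n. c i *\<^sub>R v i) : fib F y"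
 by (intro subspace_sum subspace_fib subspace_scale) auto

text \<open>Gram--Schmidt for the perfect pairing of \<open>A\<close> and \<open>B\<close>.\<close>

lemma dual_system:
 assumes lam: "lam : GL" "open V0" "x : V0" "ALL y:V0. nu y (lam y) = 1" "ALL y:V0. ALL l:fib L y. nu y l *\<^sub>R lam y = l"
  "ALL s:GL. (%y. nu y (s y)) : Cinf M"
  "\<forall>y. ALL l:fib L y. \<forall>l'\<in>fib L y. \<forall>c. nu y (c *\<^sub>R l + l') = (c * nu y l + nu y l' :: real)"
  and ts: "set ts <= GA" "distinct (map (%t. t x) ts)" "independent ((%t. t x) ` set ts)"
  and k: "k <= length ts"
 shows "\<exists>a b V. open V & x : V & V <= V0 & (\<forall>i<k. a i : GA & b i : GB) &
   (ALL y:V. \<forall>i<k. \<forall>j<k. pairing C y (a i y) (b j y) = (if i = j then lam y else 0)) &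
   (ALL y:V. \<forall>j<k. \<exists>c. (ts ! j) y = (\<Sum>i<k. c i *\<^sub>R a i y)) &
   (\<forall>i<k. a i x : span ((%j. (ts ! j) x) ` {..<k}))"
 using k
proof (induction k)
 case 0
 then show ?case using lam(2,3) by (intro exI[of _ "%_. 0"] exI[of _ "%_. 0"] exI[of _ V0]) auto
next
 case (Suc k)
 from Suc.IH[OF Suc_leD[OF Suc.prems]] obtain a b V where IH: "open V & x : V & V <= V0 & (\<forall>i<k. a i : GA & b i : GB) &
   (ALL y:V. \<forall>i<k. \<forall>j<k. pairing C y (a i y) (b j y) = (if i = j then lam y else 0)) &
   (ALL y:V. \<forall>j<k. \<exists>c. (ts ! j) y = (\<Sum>i<k. c i *\<^sub>R a i y)) &
   (\<forall>i<k. a i x : span ((%j. (ts ! j) x) ` {..<k}))" by (elim exE)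
 from IH have V: "open V" "x : V" "V <= V0" by simp_all
 from IH have G: "a i : GA" "b i : GB" if "i < k" for i using that by simp_all
 from IH have dual: "pairing C y (a i y) (b j y) = (if i = j then lam y else 0)" if "y : V" "i < k" "j < k" for y i j using that by simp
 from IH have spn: "\<exists>c. (ts ! j) y = (\<Sum>i<k. c i *\<^sub>R a i y)" if "y : V" "j < k" for y j using that by simp
 from IH have spx: "a i x : span ((%j. (ts ! j) x) ` {..<k})" if "i < k" for i using that by simp
 define t where "t = ts ! k"
 have tA: "t : GA" using ts(1) Suc.prems by (auto simp: t_def)
 have GE: "a i : GE" "b i : GE" if "i < k" for i
  using that G GA_GE lag.GA_GE[OF lag_swap] by auto
 have fE: "a i y : fib E y" "b i y : fib E y" if "i < k" for i y using GE[OF that] sections_fib[OF vbE] by auto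
 have tE: "t : GE" "t y : fib E y" for y using GA_GE[OF tA] sections_fib[OF vbE] by auto
 define c where "c i = (%y. nu y (sp t (b i) y))" for i
 have c: "c i : Cinf M" if "i < k" for i unfolding c_def using lam(6) sp_sections[OF tE(1) GE(2)[OF that]] by blast
 define a' where "a' = t - (\<Sum>i<k. sc (c i) (a i))"
 have a'A: "a' : GA" unfolding a'_def
  by (intro sections_diff[OF vbA] sections_sum[OF vbA] sections_sc[OF vbA] tA) (use G c in auto)
 have a'y: "a' y = t y - (\<Sum>i<k. c i y *\<^sub>R a i y)" for y by (simp add: a'_def sum_fun_apply sc_def)
 have a'E: "a' y : fib E y" for y using sections_fib[OF vbA a'A] fibA by blast
 have sumE: "(\<Sum>i<k. c i y *\<^sub>R a i y) : fib E y" for y by (rule fib_sum[OF vbE]) (rule fE)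
 have a'b: "pairing C y (a' y) (b j y) = 0" if y: "y : V" and j: "j < k" for y j
 proof -
  have "pairing C y (t y) (b j y) = pairing C y (1 *\<^sub>R a' y + (\<Sum>i<k. c i y *\<^sub>R a i y)) (b j y)" by (simp add: a'y)
  also have "\<dots> = pairing C y (a' y) (b j y) + (\<Sum>i<k. c i y *\<^sub>R pairing C y (a i y) (b j y))"
   using pair_sum(1)[of k "%i. a i y" y, OF fE(1) fE(2)[OF j], where c="%i. c i y"]
   unfolding pair_facts(3)[OF a'E sumE fE(2)[OF j]] by simp
  also have "(\<Sum>i<k. c i y *\<^sub>R pairing C y (a i y) (b j y)) = (\<Sum>i<k. if i = j then c i y *\<^sub>R lam y else 0)"
   by (intro sum.cong) (auto simp: dual[OF y _ j])
  also have "\<dots> = c j y *\<^sub>R lam y" using j by simp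
  also have "\<dots> = pairing C y (t y) (b j y)"
   using lam(5) y V(3) pair_facts(1)[OF tE(2) fE(2)[OF j], of y] by (auto simp: c_def spair_def)
  finally show ?thesis by simp
 qed
 \<comment> \<open>Here the span clause of the statement is needed: if \<open>a' x\<close> were
   zero, then \<open>t x\<close> would lie in the span of its predecessors, against independence at
   \<open>x\<close>.\<close>
 have ax: "a' x ~= 0"
 proof
  assume "a' x = 0"
  then have "t x = (\<Sum>i<k. c i x *\<^sub>R a i x)" by (simp add: a'y)
  then have "t x : span ((%j. (ts ! j) x) ` {..<k})"
   using spx by (auto intro!: span_sum span_scale)
  moreover have "(%j. (ts ! j) x) ` {..<k} <= (%t. t x) ` set ts - {t x}"
  proof
   fix v assume "v : (%j. (ts ! j) x) ` {..<k}"
   then obtain j where j: "j < k" "v = (ts ! j) x" by auto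
   have "map (%t. t x) ts ! j ~= map (%t. t x) ts ! k"
    using nth_eq_iff_index_eq[OF ts(2), of j k] j Suc.prems by auto
   then show "v : (%t. t x) ` set ts - {t x}" using j Suc.prems by (auto simp: t_def)
  qed
  ultimately have "t x : span ((%t. t x) ` set ts - {t x})" using span_mono by blast
  moreover have "t x : (%t. t x) ` set ts" using Suc.prems by (auto simp: t_def)
  ultimately show False using ts(3) unfolding dependent_def by blast
 qed
 obtain v where v: "v : fib E x" "pairing C x (a' x) v ~= 0" using nondeg[OF a'E] ax by blast
 \<comment> \<open>The partner found by non-degeneracy lies in \<open>E\<close>. Its component in
   \<open>A\<close> pairs to zero with \<open>a'\<close>, as \<open>A\<close> is isotropic, so the
   component in \<open>B\<close> already pairs non-trivially.\<close>
 obtain va vb where vab: "va : fib A x" "vb : fib B x" "v = va + vb" using decompose[OF v(1)] .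
 have "pairing C x (a' x) (1 *\<^sub>R va + vb) = 1 *\<^sub>R pairing C x (a' x) va + pairing C x (a' x) vb"
  by (rule pair_facts(4)) (use vab fibA fibB a'E in auto)
 then have vb: "pairing C x (a' x) vb ~= 0" using v(2) isoA[OF sections_fib[OF vbA a'A] vab(1)] vab(3) by auto
 obtain b0 where b0: "b0 : GB" "b0 x = vb" using section_through[OF vbB vab(2)] by metis
 have b0E: "b0 : GE" "b0 y : fib E y" for y using b0(1) lag.GA_GE[OF lag_swap] sections_fib[OF vbE] by auto
 define g where "g = (%y. nu y (sp a' b0 y))"
 have g: "g : Cinf M" unfolding g_def using lam(6) sp_sections[OF GA_GE[OF a'A] b0E(1)] by blast
 have glam: "g y *\<^sub>R lam y = pairing C y (a' y) (b0 y)" if "y : V0" for y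
  using lam(5) that pair_facts(1)[OF a'E b0E(2), of y] by (auto simp: g_def spair_def)
 have gx: "g x ~= 0" using glam[OF lam(3)] vb b0(2) by auto
 obtain h W where h: "h : Cinf M" "open W" "x : W" "ALL y:W. h y * g y = 1" by (rule local_inverse[where f=g and x=x, OF g gx])
 define d where "d i = (%y. nu y (sp (a i) b0 y))" for i
 have d: "d i : Cinf M" if "i < k" for i unfolding d_def using lam(6) sp_sections[OF GE(1)[OF that] b0E(1)] by blast
 define b1 where "b1 = b0 - (\<Sum>i<k. sc (d i) (b i))"
 have b1B: "b1 : GB" unfolding b1_def
  by (intro sections_diff[OF vbB] sections_sum[OF vbB] sections_sc[OF vbB] b0) (use G d in auto)
 define b' where "b' = sc h b1"
 have b'B: "b' : GB" unfolding b'_def by (rule sections_sc[OF vbB h(1) b1B])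
 have b1E: "b1 y : fib E y" for y using sections_fib[OF vbB b1B] fibB by blast
 have b0y: "b0 y = 1 *\<^sub>R b1 y + (\<Sum>i<k. d i y *\<^sub>R b i y)" for y by (simp add: b1_def sum_fun_apply sc_def)
 have sumE': "(\<Sum>i<k. d i y *\<^sub>R b i y) : fib E y" for y by (rule fib_sum[OF vbE]) (rule fE)
 have b'y: "pairing C y w (b' y) = h y *\<^sub>R pairing C y w (b1 y)" if "w : fib E y" for w y
  using pair_facts(4)[OF b1E subspace_0[OF subspace_fib[OF vbE]] that, of "h y"] pair_zero(1)[OF that] by (simp add: b'_def sc_def)
 have pb0: "pairing C y w (b0 y) = pairing C y w (b1 y) + (\<Sum>i<k. d i y *\<^sub>R pairing C y w (b i y))" if "w : fib E y" for w y
  using pair_sum(2)[of k "%i. b i y" y, OF fE(2) that, where c="%i. d i y"]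
  unfolding b0y pair_facts(4)[OF b1E sumE' that] by simp
 have ab': "pairing C y (a j y) (b' y) = 0" if y: "y : V" and j: "j < k" for y j
 proof -
  have "pairing C y (a j y) (b0 y) = pairing C y (a j y) (b1 y) + (\<Sum>i<k. if i = j then d i y *\<^sub>R lam y else 0)"
   unfolding pb0[OF fE(1)[OF j]] by (intro arg_cong2[of _ _ _ _ "(+)"] sum.cong) (auto simp: dual[OF y j])
  moreover have "pairing C y (a j y) (b0 y) = d j y *\<^sub>R lam y"
   using lam(5) y V(3) pair_facts(1)[OF fE(1)[OF j] b0E(2), of y] by (auto simp: d_def spair_def)
  ultimately have "pairing C y (a j y) (b1 y) = 0" using j by simp
  then show ?thesis by (simp add: b'y[OF fE(1)[OF j]])
 qed
 have a'b': "pairing C y (a' y) (b' y) = lam y" if y: "y : V \<inter> W" for y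
 proof -
  have "pairing C y (a' y) (b0 y) = pairing C y (a' y) (b1 y) + (\<Sum>i<k. 0)"
   unfolding pb0[OF a'E] by (intro arg_cong2[of _ _ _ _ "(+)"] sum.cong) (use a'b y in auto)
  moreover have "y : V0" using y V(3) by auto
  ultimately have "pairing C y (a' y) (b1 y) = g y *\<^sub>R lam y" using glam[of y] by simp
  then have "pairing C y (a' y) (b' y) = (h y * g y) *\<^sub>R lam y" by (simp add: b'y[OF a'E])
  then show ?thesis using h(4) y by simp
 qed
 let ?a = "a(k := a')" and ?b = "b(k := b')"
 show ?case
 proof (rule exI[of _ ?a], rule exI[of _ ?b], rule exI[of _ "V \<inter> W"], intro conjI ballI allI impI)
  show "open (V \<inter> W)" "x : V \<inter> W" "V \<inter> W <= V0" using V h by auto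
  show "?a i : GA" "?b i : GB" if "i < Suc k" for i using that G a'A b'B by (auto simp: less_Suc_eq)
  show "pairing C y (?a i y) (?b j y) = (if i = j then lam y else 0)" if "y : V \<inter> W" "i < Suc k" "j < Suc k" for y i j
   using that dual ab' a'b a'b' by (auto simp: less_Suc_eq)
  show "\<exists>c. (ts ! j) y = (\<Sum>i<Suc k. c i *\<^sub>R ?a i y)" if y: "y : V \<inter> W" and j: "j < Suc k" for y j
  proof (cases "j = k")
   case True
   have "t y = (\<Sum>i<Suc k. ((%i. c i y)(k := 1)) i *\<^sub>R ?a i y)" by (simp add: a'y)
   then show ?thesis using True t_def by (intro exI[of _ "(%i. c i y)(k := 1)"]) simp
  next
   case False
   then obtain c where "(ts ! j) y = (\<Sum>i<k. c i *\<^sub>R a i y)" using spn[of y j] y j by auto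
   then show ?thesis by (intro exI[of _ "c(k := 0)"]) simp
  qed
  have sub: "(%j. (ts ! j) x) ` {..<k} <= (%j. (ts ! j) x) ` {..<Suc k}" by auto
  have old: "a i x : span ((%j. (ts ! j) x) ` {..<Suc k})" if "i < k" for i using spx[OF that] span_mono[OF sub] by blast
  have "t x : span ((%j. (ts ! j) x) ` {..<Suc k})" unfolding t_def by (intro span_base) auto
  then have "a' x : span ((%j. (ts ! j) x) ` {..<Suc k})" unfolding a'y using old by (intro span_diff span_sum span_scale) auto
  then show "?a i x : span ((%j. (ts ! j) x) ` {..<Suc k})" if "i < Suc k" for i using that old by (auto simp: less_Suc_eq)
 qed
qed

lemma frame_exists: "\<exists>U n a b lam nu. x : U & frame U n a b lam nu"
proof -
 obtain lam nu V0 where F: "lam : GL" "open V0" "x : V0" "ALL y:V0. nu y (lam y) = 1"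
  "ALL y:V0. ALL l:fib L y. nu y l *\<^sub>R lam y = l" "ALL s:GL. (%y. nu y (s y)) : Cinf M"
  "\<forall>y. ALL l:fib L y. \<forall>l'\<in>fib L y. \<forall>c. nu y (c *\<^sub>R l + l') = (c * nu y l + nu y l' :: real)" by (rule L_frame)
 obtain ts W where ts: "set ts <= GA" "open W" "x : W" "!!y. y : W ==> fib A y = span ((%t. t y) ` set ts)"
  "distinct (map (%t. t x) ts)" "independent ((%t. t x) ` set ts)" using global_frame_at[OF vbA, of x] by blast
 define n where "n = length ts"
 from dual_system[OF F ts(1,5,6) order_refl] obtain a b V where IH: "open V & x : V & V <= V0 & (\<forall>i<n. a i : GA & b i : GB) &
   (ALL y:V. \<forall>i<n. \<forall>j<n. pairing C y (a i y) (b j y) = (if i = j then lam y else 0)) &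
   (ALL y:V. \<forall>j<n. \<exists>c. (ts ! j) y = (\<Sum>i<n. c i *\<^sub>R a i y)) &
   (\<forall>i<n. a i x : span ((%j. (ts ! j) x) ` {..<n}))" unfolding n_def[symmetric] by (elim exE)
 from IH have V: "open V" "x : V" "V <= V0" by simp_all
 from IH have G: "a i : GA" "b i : GB" if "i < n" for i using that by simp_all
 from IH have dual: "pairing C y (a i y) (b j y) = (if i = j then lam y else 0)" if "y : V" "i < n" "j < n" for y i j using that by simp
 from IH have spn: "\<exists>c. (ts ! j) y = (\<Sum>i<n. c i *\<^sub>R a i y)" if "y : V" "j < n" for y j using that by simp
 have GE: "a i : GE" "b i : GE" if "i < n" for i
  using that G GA_GE lag.GA_GE[OF lag_swap] by auto
 have fE: "a i y : fib E y" "b i y : fib E y" if "i < n" for i y using GE[OF that] sections_fib[OF vbE] by auto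
 have nul: "nu y (c *\<^sub>R lam y) = c" if "y : V" for y c
 proof -
  have z: "0 : fib L y" using subspace_0[OF subspace_fib[OF vbL]] .
  have "nu y (1 *\<^sub>R 0 + 0) = 1 * nu y 0 + nu y 0" "nu y (c *\<^sub>R lam y + 0) = c * nu y (lam y) + nu y 0"
   using F(7) z sections_fib[OF vbL F(1)] by blast+
  then show ?thesis using F(4) V(3) that by auto
 qed
 have expA: "v = (\<Sum>i<n. nu y (pairing C y v (b i y)) *\<^sub>R a i y)" if y: "y : V \<inter> W" and v: "v : fib A y" for y v
 proof -
  let ?S = "{v. \<exists>c. v = (\<Sum>i<n. c i *\<^sub>R a i y)}"
  have sub: "subspace ?S"
   unfolding subspace_def
  proof (intro conjI ballI allI)
   show "0 : ?S" by (auto intro!: exI[of _ "%_. 0"])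
   show "u + w : ?S" if uw: "u : ?S" "w : ?S" for u w
   proof -
    from uw obtain c d where "u = (\<Sum>i<n. c i *\<^sub>R a i y)" "w = (\<Sum>i<n. d i *\<^sub>R a i y)" by auto
    then show ?thesis by (auto intro!: exI[of _ "%i. c i + d i"] simp: scaleR_add_left sum.distrib)
   qed
   show "r *\<^sub>R u : ?S" if u: "u : ?S" for u r
   proof -
    from u obtain c where "u = (\<Sum>i<n. c i *\<^sub>R a i y)" by auto
    then show ?thesis by (auto intro!: exI[of _ "%i. r * c i"] simp: scaleR_sum_right)
   qed
  qed
  have "(%t. t y) ` set ts <= ?S" using spn[of y] y by (auto simp: in_set_conv_nth n_def)
  then have "span ((%t. t y) ` set ts) <= ?S" by (rule span_minimal[OF _ sub])
  then obtain c where c: "v = (\<Sum>i<n. c i *\<^sub>R a i y)" using ts(4)[of y] y v by auto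
  have "nu y (pairing C y v (b j y)) = c j" if j: "j < n" for j
  proof -
   have "pairing C y v (b j y) = (\<Sum>i<n. c i *\<^sub>R pairing C y (a i y) (b j y))"
    unfolding c by (rule pair_sum(1)[of n "%i. a i y" y, OF fE(1) fE(2)[OF j]])
   also have "\<dots> = (\<Sum>i<n. if i = j then c i *\<^sub>R lam y else 0)"
    by (intro sum.cong) (use dual y j in auto)
   also have "\<dots> = c j *\<^sub>R lam y" using j by simp
   finally show ?thesis using nul y by auto
  qed
  then show ?thesis using c by simp
 qed
 \<comment> \<open>No count of dimensions enters: the difference lies in \<open>B\<close> and is
   orthogonal to all of \<open>A\<close>, hence belongs to \<open>A\<close> as well, hence is
   zero.\<close>
 have expB: "v = (\<Sum>i<n. nu y (pairing C y (a i y) v) *\<^sub>R b i y)" if y: "y : V \<inter> W" and v: "v : fib B y" for y v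
 proof -
  let ?w = "(\<Sum>i<n. nu y (pairing C y (a i y) v) *\<^sub>R b i y)"
  have vE: "v : fib E y" using v fibB by auto
  have wB: "?w : fib B y" by (rule fib_sum[OF vbB]) (rule sections_fib[OF vbB G(2)])
  then have wE: "?w : fib E y" using fibB by auto
  have aw: "pairing C y (a j y) ?w = pairing C y (a j y) v" if j: "j < n" for j
  proof -
   have "pairing C y (a j y) ?w = (\<Sum>i<n. nu y (pairing C y (a i y) v) *\<^sub>R pairing C y (a j y) (b i y))"
    by (rule pair_sum(2)[of n "%i. b i y" y, OF fE(2) fE(1)[OF j]])
   also have "\<dots> = (\<Sum>i<n. if i = j then nu y (pairing C y (a i y) v) *\<^sub>R lam y else 0)"
    by (intro sum.cong) (use dual y j in auto)
   also have "\<dots> = nu y (pairing C y (a j y) v) *\<^sub>R lam y" using j by simp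
   also have "\<dots> = pairing C y (a j y) v" using F(5) y V(3) pair_facts(1)[OF fE(1)[OF j] vE] by blast
   finally show ?thesis .
  qed
  have d: "v - ?w : fib B y" by (rule subspace_diff[OF subspace_fib[OF vbB] v wB])
  have "v - ?w : fib A y"
   unfolding perpA
  proof (intro conjI ballI)
   show dE: "v - ?w : fib E y" using d fibB by auto
   fix u assume u: "u : fib A y"
   have "pairing C y (a j y) (v - ?w) = 0" if j: "j < n" for j
    using pair_facts(4)[OF wE vE fE(1)[OF j], of "- 1"] aw[OF j] by simp
   then have "(\<Sum>i<n. nu y (pairing C y u (b i y)) *\<^sub>R pairing C y (a i y) (v - ?w)) = 0" by simp
   then have "pairing C y u (v - ?w) = 0"
    using pair_sum(1)[of n "%i. a i y" y, OF fE(1) dE, where c="%i. nu y (pairing C y u (b i y))"] expA[OF y u] by simp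
   then show "pairing C y (v - ?w) u = 0" using pair_facts(2)[OF dE, of u] u fibA by auto
  qed
  from AB_zero[OF this d] show ?thesis by simp
 qed
 have "frame (V \<inter> W) n a b lam nu"
  unfolding frame_def using V ts(2) G F(1) dual expA expB F(4-7)
  by (intro conjI) (blast | simp add: open_Int subset_iff)+
 then show ?thesis using V(2) ts(3) by blast
qed

end

section \<open>Projections onto the two summands and the identification of B with the dual of
  A\<close>

context lag
begin

lemmas GB_GE = lag.GA_GE[OF lag_swap]

lemma GA_fib: "s : GA ==> s x : fib A x" "s : GA ==> s x : fib E x"
 using sections_fib[OF vbA] fibA by blast+

lemma GB_fib: "s : GB ==> s x : fib B x" "s : GB ==> s x : fib E x"
 using sections_fib[OF vbB] fibB by blast+

lemma GE_fib: "s : GE ==> s x : fib E x"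
 by (rule sections_fib[OF vbE])

lemma frameD:
 assumes "frame U n a b lam nu"
 shows "open U" "!!i. i < n ==> a i : GA" "!!i. i < n ==> b i : GB" "lam : GL"
  "!!y. y : U ==> nu y (lam y) = 1" "!!y l. y : U ==> l : fib L y ==> nu y l *\<^sub>R lam y = l"
  "!!s. s : GL ==> (%y. nu y (s y)) : Cinf M"
  "!!y l l' c. l : fib L y ==> l' : fib L y ==> nu y (c *\<^sub>R l + l') = c * nu y l + nu y l'"
  "!!y i j. y : U ==> i < n ==> j < n ==> pairing C y (a i y) (b j y) = (if i = j then lam y else 0)"
  "!!y v. y : U ==> v : fib A y ==> v = (\<Sum>i<n. nu y (pairing C y v (b i y)) *\<^sub>R a i y)"
  "!!y v. y : U ==> v : fib B y ==> v = (\<Sum>i<n. nu y (pairing C y (a i y) v) *\<^sub>R b i y)"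
proof -
 note f = assms[unfolded frame_def]
 show "open U" "!!i. i < n ==> a i : GA" "!!i. i < n ==> b i : GB" "lam : GL"
  "!!y. y : U ==> nu y (lam y) = 1" "!!y l. y : U ==> l : fib L y ==> nu y l *\<^sub>R lam y = l"
  "!!s. s : GL ==> (%y. nu y (s y)) : Cinf M"
  using f by blast+
 show "!!y l l' c. l : fib L y ==> l' : fib L y ==> nu y (c *\<^sub>R l + l') = c * nu y l + nu y l'"
  using f by blast
 show "!!y i j. y : U ==> i < n ==> j < n ==> pairing C y (a i y) (b j y) = (if i = j then lam y else 0)"
  using f by simp
 show "!!y v. y : U ==> v : fib A y ==> v = (\<Sum>i<n. nu y (pairing C y v (b i y)) *\<^sub>R a i y)"
  using f by blast
 show "!!y v. y : U ==> v : fib B y ==> v = (\<Sum>i<n. nu y (pairing C y (a i y) v) *\<^sub>R b i y)"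
  using f by blast
qed

lemma fibL_zero: "0 : fib L y"
 by (rule subspace_0[OF subspace_fib[OF vbL]])

lemma frame_nu:
 assumes "frame U n a b lam nu"
 shows "nu y 0 = 0" "l : fib L y ==> nu y (c *\<^sub>R l) = c * nu y l"
  "l : fib L y ==> l' : fib L y ==> nu y (l + l') = nu y l + nu y l'"
proof -
 show z: "nu y 0 = 0" using frameD(8)[OF assms fibL_zero fibL_zero, of y 1] by simp
 show "l : fib L y ==> nu y (c *\<^sub>R l) = c * nu y l" using frameD(8)[OF assms _ fibL_zero, of l y c] z by simp
 show "l : fib L y ==> l' : fib L y ==> nu y (l + l') = nu y l + nu y l'" using frameD(8)[OF assms, of l y l' 1] by simp
qed

text \<open>In a dual frame the coefficients of a section of \<open>A\<close> are its pairings with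
  sections of \<open>B\<close>, so their smoothness decides.\<close>

lemma sections_A_I:
 assumes "!!x. s x : fib A x" "!!b. b : GB ==> sp s b : GL"
 shows "s : GA"
proof (rule sections_eq_local[OF vbA])
 fix x
 obtain U n a b lam nu where F: "x : U" "frame U n a b lam nu" using frame_exists[of x] by blast
 define t where "t = (\<Sum>i<n. sc (%y. nu y (sp s (b i) y)) (a i))"
 have "t : GA" unfolding t_def
  by (intro sections_sum[OF vbA] sections_sc[OF vbA]) (use frameD[OF F(2)] assms(2) in auto)
 moreover have "s y = t y" if "y : U" for y
  using frameD(10)[OF F(2) that assms(1)] by (simp add: t_def sum_fun_apply sc_def spair_def)
 ultimately show "\<exists>V t. open V & x : V & t : GA & (ALL y:V. s y = t y)"
  using F(1) frameD(1)[OF F(2)] by blast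
qed

definition "prA e = proj B A e"
definition "prB e = proj A B e"

lemma proj_unique:
 assumes "e x = u + v" "u : fib A x" "v : fib B x"
 shows "prA e x = u" "prB e x = v"
proof -
 have uniq: "u' = u & v' = v" if "e x = u' + v'" "u' : fib A x" "v' : fib B x" for u' v'
 proof -
  have "u' - u : fib A x" "v - v' : fib B x"
   using that assms subspace_diff[OF subspace_fib[OF vbA]] subspace_diff[OF subspace_fib[OF vbB]] by auto
  moreover have "u' - u = v - v'" using that(1) assms(1) by (simp add: algebra_simps)
  ultimately have "u' - u = 0" using AB_zero by metis
  then show ?thesis using that(1) assms(1) by simp
 qed
 show "prA e x = u" unfolding prA_def proj_def
 proof (rule the_equality)
  show "u : fib A x & (EX a:fib B x. e x = a + u)"
   using assms(2) by (intro conjI bexI[of _ v] assms) (simp only: assms(1) add.commute[of u])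
  show "w = u" if "w : fib A x & (EX a:fib B x. e x = a + w)" for w
   using that uniq[of w] by (metis add.commute)
 qed
 show "prB e x = v" unfolding prB_def proj_def
 proof (rule the_equality)
  show "v : fib B x & (EX a:fib A x. e x = a + v)" using assms(2) by (intro conjI bexI[of _ u] assms)
  show "w = v" if "w : fib B x & (EX a:fib A x. e x = a + w)" for w
   using that uniq[of _ w] by metis
 qed
qed

lemma pr_fib:
 assumes "e x : fib E x"
 shows "prA e x : fib A x" "prB e x : fib B x" "e x = prA e x + prB e x"
proof -
 obtain u v where uv: "u : fib A x" "v : fib B x" "e x = u + v" using decompose[OF assms] .
 show "prA e x : fib A x" "prB e x : fib B x" "e x = prA e x + prB e x"
  unfolding proj_unique[where e=e and x=x and u=u and v=v, OF uv(3,1,2)] by (rule uv)+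
qed

lemma pair_add:
 assumes "u : fib E x" "v : fib E x" "w : fib E x"
 shows "pairing C x (u + v) w = pairing C x u w + pairing C x v w" "pairing C x w (u + v) = pairing C x w u + pairing C x w v"
 using pair_facts(3,4)[OF assms, of 1] by simp_all

lemma pair_pr:
 assumes "e x : fib E x"
 shows "v : fib B x ==> pairing C x (prA e x) v = pairing C x (e x) v"
  "u : fib A x ==> pairing C x (prB e x) u = pairing C x (e x) u"
proof -
 note p = pr_fib[where e=e and x=x, OF assms]
 have pE: "prA e x : fib E x" "prB e x : fib E x" using p fibA fibB by blast+
 show "pairing C x (prA e x) v = pairing C x (e x) v" if v: "v : fib B x"
 proof -
  have "pairing C x (e x) v = pairing C x (prA e x) v + pairing C x (prB e x) v"
   using pair_add(1)[OF pE, of v] v fibB p(3) by (metis subsetD)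
  then show ?thesis using isoB[OF p(2) v] by simp
 qed
 show "pairing C x (prB e x) u = pairing C x (e x) u" if u: "u : fib A x"
 proof -
  have "pairing C x (e x) u = pairing C x (prA e x) u + pairing C x (prB e x) u"
   using pair_add(1)[OF pE, of u] u fibA p(3) by (metis subsetD)
  then show ?thesis using isoA[OF p(1) u] by simp
 qed
qed

lemma sp_prA: "e : GE ==> b : GB ==> sp (prA e) b = sp e b"
 unfolding spair_def by (rule ext, rule pair_pr(1)) (rule GE_fib GB_fib, assumption)+

lemma sp_prB: "e : GE ==> Z : GA ==> sp (prB e) Z = sp e Z"
 unfolding spair_def by (rule ext, rule pair_pr(2)) (rule GE_fib GA_fib, assumption)+

lemma prA_GA: "e : GE ==> prA e : GA"
proof (rule sections_A_I)
 assume e: "e : GE"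
 show "prA e x : fib A x" for x by (rule pr_fib(1)[where e=e and x=x]) (rule GE_fib[OF e])
 show "sp (prA e) b : GL" if "b : GB" for b unfolding sp_prA[OF e that] by (rule sp_sections[OF e GB_GE[OF that]])
qed

end

lemma (in lag) prB_swap: "prB = lag.prA B A"
 unfolding prB_def lag.prA_def[OF lag_swap] by (simp add: fun_eq_iff)

context lag
begin

lemma prB_GB: "e : GE ==> prB e : GB"
 unfolding prB_swap by (rule lag.prA_GA[OF lag_swap])

lemma pr_sum: "e : GE ==> e = prA e + prB e"
proof
 fix x assume e: "e : GE"
 show "e x = (prA e + prB e) x" using pr_fib(3)[where e=e and x=x, OF GE_fib[OF e]] by simp
qed

lemma prA_GA_id: "Z : GA ==> prA Z = Z"
proof
 fix x assume Z: "Z : GA"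
 show "prA Z x = Z x" by (rule proj_unique(1)[where e=Z and u="Z x" and v=0]) (simp_all add: GA_fib[OF Z] subspace_0[OF subspace_fib[OF vbB]])
qed

lemma prA_lin:
 assumes "e : GE" "e' : GE"
 shows "prA (sc f e + e') = sc f (prA e) + prA e'"
proof
 fix x
 note p = pr_fib[where e=e and x=x, OF GE_fib[OF assms(1)]] and p' = pr_fib[where e=e' and x=x, OF GE_fib[OF assms(2)]]
 have "f x *\<^sub>R e x = f x *\<^sub>R prA e x + f x *\<^sub>R prB e x" using arg_cong[OF p(3), of "scaleR (f x)"] by (simp add: scaleR_add_right)
 then have eq: "(sc f e + e') x = (f x *\<^sub>R prA e x + prA e' x) + (f x *\<^sub>R prB e x + prB e' x)"
  using p'(3) by (simp add: sc_def)
 have "prA (sc f e + e') x = f x *\<^sub>R prA e x + prA e' x"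
  by (rule proj_unique(1)[where e="sc f e + e'" and x=x, OF eq])
    (intro subspace_add subspace_scale subspace_fib vbA vbB p p')+
 then show "prA (sc f e + e') x = (sc f (prA e) + prA e') x" by (simp add: sc_def)
qed

lemma GE_in_GB:
 assumes e: "e : GE" "!!x. e x : fib B x"
 shows "e : GB"
proof -
 have "prB e x = e x" for x
  by (rule proj_unique(2)[where e=e and u=0 and v="e x"]) (simp_all add: e subspace_0[OF subspace_fib[OF vbA]])
 then have "prB e = e" ..
 then show ?thesis using prB_GB[OF e(1)] by simp
qed

lemma spAA: "Z : GA ==> W : GA ==> sp Z W = 0"
 unfolding spair_def zero_fun_def by (rule ext, rule isoA) (rule GA_fib(1), assumption)+

lemma spBB: "Z : GB ==> W : GB ==> sp Z W = 0"
 unfolding spair_def zero_fun_def by (rule ext, rule isoB) (rule GB_fib(1), assumption)+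

end

sublocale lag \<subseteq> fb: fbun M A
 by standard (rule vbA)

context lag
begin

abbreviation "Om \<equiv> Omega M A (lin C)"
abbreviation "Om0 \<equiv> Omega M A trivial_line"

definition "td b = to_dual C A b"
definition "ofd al = of_dual C A B al"

lemma td_apply: "td b x [u] = (if u : fib A x then pairing C x (b x) u else 0)" "length us ~= 1 ==> td b x us = 0"
 by (auto simp: td_def to_dual_def split: list.splits)

lemma td_Omega:
 assumes b: "b : GE"
 shows "td b : Om 1"
proof -
 have "td b : Omega M A L (int (Suc 0))"
 proof (rule fb.OmegaI)
  fix x
  show "td b x : alt_forms (fib A x) (fib L x) (Suc 0)"
  proof (rule alt_forms_SucI)
   show "subspace (fib A x)" by (rule subspace_fib[OF vbA])
   show "ins v (td b x) : alt_forms (fib A x) (fib L x) 0" if "v : fib A x" for v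
    by (rule alt_forms_0I) (use that pair_facts(1)[OF GE_fib[OF b], of v x] fibA in \<open>auto simp: ins_def td_apply\<close>)
   show "td b x (v # us) = 0" if "v \<notin> fib A x" for v us
    using that by (cases us) (auto simp: td_apply)
   show "td b x ((c *\<^sub>R v + w) # us) = c *\<^sub>R td b x (v # us) + td b x (w # us)"
    if vw: "v : fib A x" "w : fib A x" for v w us c
   proof (cases us)
    case Nil
    have "c *\<^sub>R v + w : fib A x" using vw by (intro subspace_add subspace_scale subspace_fib vbA)
    then show ?thesis using pair_facts(4)[of v x w "b x" c] vw fibA GE_fib[OF b] Nil by (auto simp: td_apply)
   qed (simp add: td_apply)
  qed (simp_all add: td_apply)
 next
  fix ss assume ss: "length ss = Suc 0" "set ss <= GA"
  then obtain s where s: "ss = [s]" "s : GA" by (auto simp: length_Suc_conv)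
  have "ev (td b) ss = sp b s" using GA_fib[OF s(2)] by (simp add: ev_def s(1) td_apply spair_def fun_eq_iff)
  then show "ev (td b) ss : GL" using sp_sections[OF b GA_GE[OF s(2)]] by simp
 qed
 then show ?thesis by simp
qed

lemma ev_td: "Z : GA ==> ev (td b) [Z] = sp b Z"
 using GA_fib by (simp add: ev_def td_apply spair_def fun_eq_iff)

lemma iota_Om1:
 assumes "al : Omega M A Lb 1" "Z : GA"
 shows "iota Z al = form0 (ev al [Z])"
proof -
 have "iota Z al : Omega M A Lb 0" using fb.iota_Omega[OF assms] by simp
 from fb.Omega_0(1)[OF this] show ?thesis by (simp add: ev_Cons)
qed

lemma iota_td: "b : GE ==> Z : GA ==> iota Z (td b) = form0 (sp b Z)"
 using iota_Om1[OF td_Omega] ev_td by simp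

lemma Om1_eqI:
 assumes "al : Omega M A Lb 1" "be : Omega M A Lb 1" "!!Z. Z : GA ==> ev al [Z] x = ev be [Z] x"
 shows "al x = be x"
proof
 fix vs
 show "al x vs = be x vs"
 proof (cases "\<exists>v. vs = [v] & v : fib A x")
  case True
  then obtain v where v: "vs = [v]" "v : fib A x" by blast
  then obtain Z where "Z : GA" "Z x = v" using fb.fib_section by blast
  then show ?thesis using assms(3)[of Z] v by (simp add: ev_def)
 next
  case False
  then have "int (length vs) ~= 1 | \<not> set vs <= fib A x" by (auto simp: length_Suc_conv)
  then show ?thesis using fb.Omega_outside assms(1,2) by metis
 qed
qed

text \<open>The description in \<open>of_dual\<close> denotes: a dual frame exhibits a preimage, and
  two preimages differ by a vector of \<open>B\<close> orthogonal to \<open>A\<close>, which lies in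
  both and is zero.\<close>

lemma ofd_props:
 assumes "al : Om 1"
 shows "ofd al : GB" "td (ofd al) = al"
proof -
 have a: "al : Omega M A L (int 1)" using assms by simp
 have key: "ofd al x : fib B x & (ALL u:fib A x. pairing C x (ofd al x) u = al x [u])" for x
 proof -
  obtain U n a' b lam nu where F: "x : U" "frame U n a' b lam nu" using frame_exists[of x] by blast
  define v where "v = (\<Sum>i<n. nu x (ev al [a' i] x) *\<^sub>R b i x)"
  have vB: "v : fib B x" unfolding v_def by (rule fib_sum[OF vbB]) (rule GB_fib(1)[OF frameD(3)[OF F(2)]])
  have aL: "ev al [a' i] x : fib L x" if "i < n" for i
   using fb.OmegaD(2)[OF a, of "[a' i]"] frameD(2)[OF F(2) that] sections_fib[OF vbL] by auto
  have vp: "pairing C x v u = al x [u]" if u: "u : fib A x" for u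
  proof -
   have uE: "u : fib E x" using u fibA by auto
   have "pairing C x v u = (\<Sum>i<n. nu x (ev al [a' i] x) *\<^sub>R pairing C x (b i x) u)"
    unfolding v_def by (rule pair_sum(1)[OF GB_fib(2)[OF frameD(3)[OF F(2)]] uE])
   also have "\<dots> = (\<Sum>i<n. nu x (pairing C x u (b i x)) *\<^sub>R al x [a' i x])"
   proof (rule sum.cong[OF refl])
    fix i assume "i : {..<n}"
    then have i: "i < n" by simp
    have b: "b i x : fib E x" by (rule GB_fib(2)[OF frameD(3)[OF F(2) i]])
    have 1: "pairing C x (b i x) u = nu x (pairing C x u (b i x)) *\<^sub>R lam x"
     using frameD(6)[OF F(2,1) pair_facts(1)[OF uE b]] pair_facts(2)[OF uE b] by simp
    have 2: "al x [a' i x] = nu x (ev al [a' i] x) *\<^sub>R lam x"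
     using frameD(6)[OF F(2,1) aL[OF i]] by (simp add: ev_def)
    show "nu x (ev al [a' i] x) *\<^sub>R pairing C x (b i x) u = nu x (pairing C x u (b i x)) *\<^sub>R al x [a' i x]"
     unfolding 1 2 by (simp add: mult.commute)
   qed
   also have "\<dots> = al x [u]"
   proof -
    have lin: "al x [\<Sum>i<m. c i *\<^sub>R a' i x] = (\<Sum>i<m. c i *\<^sub>R al x [a' i x]) & (\<Sum>i<m. c i *\<^sub>R a' i x) : fib A x"
     if "m <= n" for m c using that
    proof (induction m)
     case 0
     have z: "0 : fib A x" by (rule subspace_0[OF subspace_fib[OF vbA]])
     from alt_formsD(3)[OF fb.OmegaD(1)[OF a] z z, of "[]" 1] show ?case using z by simp
    next
     case (Suc m)
     then have IH: "al x [\<Sum>i<m. c i *\<^sub>R a' i x] = (\<Sum>i<m. c i *\<^sub>R al x [a' i x])" "(\<Sum>i<m. c i *\<^sub>R a' i x) : fib A x" by auto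
     have am: "a' m x : fib A x" using GA_fib(1)[OF frameD(2)[OF F(2)]] Suc.prems by auto
     from alt_formsD(3)[OF fb.OmegaD(1)[OF a] am IH(2), of "[]" "c m"] show ?case
      using IH subspace_add[OF subspace_fib[OF vbA] subspace_scale[OF subspace_fib[OF vbA] am] IH(2)]
      by (simp add: add.commute)
    qed
    show ?thesis using lin[of n "%i. nu x (pairing C x u (b i x))"] frameD(10)[OF F(2,1) u] by simp
   qed
   finally show ?thesis .
  qed
  have uniq: "w = v" if "w : fib B x" "ALL u:fib A x. pairing C x w u = al x [u]" for w
  proof -
   have d: "w - v : fib B x" by (rule subspace_diff[OF subspace_fib[OF vbB] that(1) vB])
   have E: "w : fib E x" "v : fib E x" "w - v : fib E x" using that(1) vB d fibB by blast+
   have "w - v : fib A x"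
    unfolding perpA
   proof (intro conjI ballI E)
    fix u assume u: "u : fib A x"
    have "pairing C x ((- 1) *\<^sub>R v + w) u = (- 1) *\<^sub>R pairing C x v u + pairing C x w u"
     by (rule pair_facts(3)) (use E u fibA in auto)
    then show "pairing C x (w - v) u = 0" using that(2) vp u by simp
   qed
   from AB_zero[OF this d] show ?thesis by simp
  qed
  have "ofd al x = v" unfolding ofd_def of_dual_def
  proof (rule the_equality)
   show "v : fib B x & (ALL u:fib A x. pairing C x v u = al x [u])" using vB vp by blast
   show "w = v" if "w : fib B x & (ALL u:fib A x. pairing C x w u = al x [u])" for w
    using uniq[of w] that by blast
  qed
  then show ?thesis using vB vp by blast
 qed
 show "ofd al : GB"
 proof (rule lag.sections_A_I[OF lag_swap])
  show "ofd al x : fib B x" for x using key by blast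
  show "sp (ofd al) Z : GL" if Z: "Z : GA" for Z
  proof -
   have "sp (ofd al) Z = ev al [Z]" using key GA_fib(1)[OF Z] by (simp add: spair_def ev_def fun_eq_iff)
   then show ?thesis using fb.OmegaD(2)[OF a, of "[Z]"] Z by simp
  qed
 qed
 then have oG: "ofd al : GE" by (rule GB_GE)
 show "td (ofd al) = al"
  by (rule ext, rule Om1_eqI[OF td_Omega[OF oG] assms])
    (use key GA_fib(1) in \<open>simp add: ev_td spair_def ev_def td_apply\<close>)
qed

lemma ofd_td: "b : GB ==> ofd (td b) = b"
proof
 fix x assume b: "b : GB"
 note o = ofd_props[OF td_Omega[OF GB_GE[OF b]]]
 have d: "ofd (td b) x - b x : fib B x" by (rule subspace_diff[OF subspace_fib[OF vbB] GB_fib(1)[OF o(1)] GB_fib(1)[OF b]])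
 have "ofd (td b) x - b x : fib A x"
  unfolding perpA
 proof (intro conjI ballI)
  show "ofd (td b) x - b x : fib E x" using d fibB by auto
  fix u assume u: "u : fib A x"
  have "pairing C x ((- 1) *\<^sub>R b x + ofd (td b) x) u = (- 1) *\<^sub>R pairing C x (b x) u + pairing C x (ofd (td b) x) u"
   by (rule pair_facts(3)) (use GB_fib(2)[OF b] GB_fib(2)[OF o(1)] u fibA in auto)
  moreover have "pairing C x (ofd (td b) x) u = pairing C x (b x) u"
   using fun_cong[OF fun_cong[OF o(2), of x], of "[u]"] u by (simp add: td_apply)
  ultimately show "pairing C x (ofd (td b) x - b x) u = 0" by simp
 qed
 from AB_zero[OF this d] show "ofd (td b) x = b x" by simp
qed

text \<open>One operator for both summands. For \<open>e\<close> in an involutive \<open>A\<close>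
  it is the bracket of \<open>A\<close>; for \<open>e\<close> in \<open>B\<close> it is the
  coadjoint action, whose Lie derivative on one-forms realises the dual bracket.\<close>

definition "K e Z = prA (br e Z)"

lemma K_GA: "e : GE ==> Z : GA ==> K e Z : GA"
 unfolding K_def by (rule prA_GA[OF br_sections[OF _ GA_GE]])

lemma K_lie:
 assumes e: "e : GE"
 shows "lie_data M A L (K e) (sig e) (nab e)" "lie_data M A trivial_line (K e) (sig e) (sig e)"
proof -
 have K: "K e (sc f Z + W) = sc f (K e Z) + (sc (sig e f) Z + K e W)" if Z: "Z : GA" and W: "W : GA" and f: "f : Cinf M" for Z W f
 proof -
  note ZE = GA_GE[OF Z] and WE = GA_GE[OF W] and s = sig_Cinf[OF e f]
  have "br e (sc f Z + W) = sc f (br e Z) + (sc (sig e f) Z + br e W)"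
   unfolding br_add(2)[OF sections_sc[OF vbE f ZE] WE e] br_sc[OF e ZE f] by (simp only: add_ac)
  then show ?thesis
   unfolding K_def using prA_lin[OF br_sections[OF e ZE] sections_add[OF vbE sections_sc[OF vbE s ZE] br_sections[OF e WE]], of f]
    prA_lin[OF ZE br_sections[OF e WE], of "sig e f"] prA_GA_id[OF Z] by simp
 qed
 have D: "nab e (sc f s + t) = sc f (nab e s) + (sc (sig e f) s + nab e t)" if "s : GL" "t : GL" "f : Cinf M" for s t f
  unfolding nab_add(1)[OF e sections_sc[OF vbL that(3,1)] that(2)] nab_sc[OF e that(3,1)] by (simp only: add_ac)
 show *: "lie_data M A L (K e) (sig e) (nab e)"
  unfolding lie_data_def
  by (intro conjI ballI allI K D K_GA nab_sections sig_Cinf sig_const e)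
 show "lie_data M A trivial_line (K e) (sig e) (sig e)"
  by (rule fb.lie_data_real[OF vbL *]) (use sig_mult[OF e] sig_add[OF e] in auto)
qed

abbreviation "Lop e \<equiv> Lie M A (K e) (nab e)"
abbreviation "Lop0 e \<equiv> Lie M A (K e) (sig e)"

lemmas Lop_der = fb.Lie_der[OF vbL K_lie(2) K_lie(1)]
lemmas Lop_Om = fb.Lie_Omega[OF vbL K_lie(1)]
lemmas Lop_form0 = fb.Lie_form0[OF vbL K_lie(1)]
lemmas iota_Lop = fb.iota_Lie[OF vbL K_lie(1)]
lemmas iota_der = fb.iota_der[OF vbL]

lemma Lop_td:
 assumes e: "e : GE" and c: "c : GE" and Z: "Z : GA"
 shows "ev (Lop e (td c)) [Z] = nab e (sp c Z) - sp c (K e Z)"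
proof -
 note K = K_GA[OF e Z]
 have "iota Z (Lop e (td c)) = form0 (nab e (sp c Z)) - form0 (sp c (K e Z))"
  unfolding iota_Lop[OF e td_Omega[OF c] Z] iota_td[OF c Z] iota_td[OF c K] Lop_form0[OF e sp_sections[OF c GA_GE[OF Z]]] ..
 then show ?thesis by (simp add: ev_Cons ev_diff fb.ev_form0)
qed

text \<open>For sections of \<open>B\<close> the Lie derivative of one-forms is the dual bracket.\<close>

lemma Lop_td_GB:
 assumes b: "b : GB" and c: "c : GB"
 shows "Lop b (td c) = td (prB (br b c))"
proof -
 note bE = GB_GE[OF b] and cE = GB_GE[OF c]
 note p = prB_GB[OF br_sections[OF bE cE]]
 show ?thesis
 proof (rule ext, rule Om1_eqI[OF Lop_Om[OF bE td_Omega[OF cE]] td_Omega[OF GB_GE[OF p]]])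
  fix x Z assume Z: "Z : GA"
  note ZE = GA_GE[OF Z] and bz = br_sections[OF bE GA_GE[OF Z]]
  \<comment> \<open>The projection hidden in \<open>K\<close> is invisible to \<open>c\<close>,
    because \<open>B\<close> is isotropic; \<open>C1\<close> then transfers the bracket with
    \<open>b\<close> from \<open>Z\<close> to \<open>c\<close>.\<close>
  have "sp c (K b Z) = sp c (br b Z)"
   using sp_prA[OF bz c] sp_sym[OF cE GA_GE[OF prA_GA[OF bz]]] sp_sym[OF cE bz] by (simp add: K_def)
  then have "ev (Lop b (td c)) [Z] = sp (br b c) Z"
   unfolding Lop_td[OF bE cE Z] C1[OF bE cE ZE] by simp
  then show "ev (Lop b (td c)) [Z] x = ev (td (prB (br b c))) [Z] x"
   using sp_prB[OF br_sections[OF bE cE] Z] ev_td[OF Z] by simp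
 qed
qed

end

section \<open>The binary bracket: local formula, values on generators, gluing\<close>

definition nuf :: "('m => 'l => real) => ('m => 'e list => 'l) => 'm => 'e list => real" where
 "nuf nu al = (%x vs. nu x (al x vs))"

lemma ev_nuf: "ev (nuf nu al) ss x = nu x (ev al ss x)"
 by (simp add: ev_def nuf_def)

context lag
begin

text \<open>From here on only the existence of a symbol matters. Hiding it lets sums, products with
  forms and commutators be handled by operator alone.\<close>

abbreviation "dr d X \<equiv> \<exists>Y. der M A L d Y X"

lemma dr_add: "dr d X ==> dr d X' ==> dr d (%al. X al + X' al)"
 unfolding der_leib using fb.leib_add[OF fb.tl] fb.leib_add[OF vbL] by blast

lemma dr_zero: "dr d (%_. 0)"
 unfolding der_leib using fb.leib_const_zero[OF fb.tl] fb.leib_const_zero[OF vbL] by blast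

lemma dr_smult: "dr d X ==> dr d (%al. c *\<^sub>R X al)"
 unfolding der_leib using fb.leib_smult[OF fb.tl] fb.leib_smult[OF vbL] by blast

lemma dr_uminus: "dr d X ==> dr d (%al. - X al)"
 using dr_smult[of d X "- 1"] by simp

lemma dr_diff: "dr d X ==> dr d X' ==> dr d (%al. X al - X' al)"
 using dr_add[of d X "%al. - X' al"] dr_uminus[of d X'] by simp

lemma dr_wedge: "dr d X ==> \<eta> : Om0 q ==> dr (q + d) (%al. wedge \<eta> (X al))"
 unfolding der_leib using fb.leib_wedge[OF fb.tl] fb.leib_wedge[OF vbL] by blast

lemma dr_sum: "(!!i. i < (n::nat) ==> dr d (X i)) ==> dr d (%al. \<Sum>i<n. X i al)"
proof (induction n)
 case 0 show ?case unfolding lessThan_0 sum.empty by (rule dr_zero)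
next
 case (Suc n) then show ?case unfolding sum.lessThan_Suc by (intro dr_add) simp_all
qed

lemma dr_comm: "dr d X ==> dr e X' ==> dr (d + e) (%al. X (X' al) - psign (d * e) *\<^sub>R X' (X al))"
 unfolding der_leib using fb.leib_commutator[OF fb.tl] fb.leib_commutator[OF vbL] by blast

lemma drD:
 assumes "dr d X"
 shows "al : Om k ==> X al : Om (k + d)" "al : Om k ==> be : Om k ==> X (al + be) = X al + X be"
  "al : Om k ==> X (c *\<^sub>R al) = c *\<^sub>R X al" "al : Om k ==> X (- al) = - X al" "X 0 = 0"
proof -
 obtain Y where X: "leib M A L d Y X" using assms unfolding der_leib by blast
 show "al : Om k ==> X al : Om (k + d)" by (rule leibD(1)[OF X])
 show "al : Om k ==> be : Om k ==> X (al + be) = X al + X be" by (rule leib_additive[OF X])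
 show "al : Om k ==> X (c *\<^sub>R al) = c *\<^sub>R X al" by (rule fb.leib_scale[OF vbL X])
 show "al : Om k ==> X (- al) = - X al" by (rule fb.leib_uminus[OF vbL X])
 show "X 0 = 0" by (rule fb.leib_zero[OF vbL X])
qed

lemma form0_Om: "s : GL ==> form0 s : Om 0"
 by (rule fb.form0_Omega[OF vbL])

lemma GB_zero: "0 : GB"
 by (rule sections_zero[OF vbB])

lemma td_Om: "c : GB ==> td c : Om 1"
 by (rule td_Omega[OF GB_GE])

text \<open>Every one-form is \<open>td\<close> of a section of \<open>B\<close>, so the generators
  become sections of \<open>L\<close> and of \<open>B\<close>, where the Courant--Jacobi axioms
  apply.\<close>

lemma dr_agree:
 assumes "dr d X" "dr d X'" "!!s. s : GL ==> X (form0 s) x = X' (form0 s) x"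
  "!!c. c : GB ==> X (td c) x = X' (td c) x" "al : Om k"
 shows "X al x = X' al x"
proof -
 obtain Y Y' where "der M A L d Y X" "der M A L d Y' X'" using assms(1,2) by blast
 from fb.der_agree(1)[OF lineL this assms(3) _ assms(5)] show ?thesis
  using assms(4)[OF ofd_props(1)] ofd_props(2) by simp
qed

lemma dr_eqI:
 assumes "dr d X" "dr d X'" "!!s. s : GL ==> X (form0 s) = X' (form0 s)"
  "!!c. c : GB ==> X (td c) = X' (td c)" "al : Om k"
 shows "X al = X' al"
 by (rule ext, rule dr_agree[OF assms(1,2) _ _ assms(5)]) (simp_all add: assms(3,4))

lemma dr_iota: "Z : GA ==> dr (- 1) (iota Z)"
 using iota_der by blast

lemma dr_Lop: "e : GE ==> dr 0 (Lop e)"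
 using Lop_der by blast

lemma Om_val: "al : Om k ==> al x vs : fib L x"
proof (erule fb.Omega_cases)
 fix n assume a: "al : Om (int n)"
 show ?thesis using alt_formsD(1,2)[OF fb.OmegaD(1)[OF a]] fibL_zero by metis
qed (simp add: fibL_zero)

lemma nuf_Om:
 assumes F: "frame U n a b lam nu" and a: "al : Om k"
 shows "nuf nu al : Om0 k"
 using a
proof (cases rule: fb.Omega_cases)
 case 1
 then have "nuf nu al = 0" by (simp add: nuf_def fun_eq_iff frame_nu(1)[OF F])
 then show ?thesis using fb.Omega_zero[OF fb.tl] by simp
next
 case (2 m)
 note al = fb.OmegaD(1)[OF 2(2)]
 have "nuf nu al : Om0 (int m)"
 proof (rule fb.OmegaI)
  show "nuf nu al x : alt_forms (fib A x) (fib trivial_line x) m" for x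
   unfolding alt_forms_def mem_Collect_eq nuf_def
  proof (intro conjI allI impI)
   fix xs v w ys c assume "set xs <= fib A x & v : fib A x & w : fib A x & set ys <= fib A x"
   then show "nu x (al x (xs @ (c *\<^sub>R v + w) # ys)) = c *\<^sub>R nu x (al x (xs @ v # ys)) + nu x (al x (xs @ w # ys))"
    using alt_formsD(5)[OF al] frameD(8)[OF F Om_val[OF a] Om_val[OF a]] by simp
  qed (use alt_formsD(2,4)[OF al] frame_nu(1)[OF F] in \<open>auto simp: trivial_line_def\<close>)
  show "ev (nuf nu al) ss : sections M trivial_line" if "length ss = m" "set ss <= GA" for ss
   using frameD(7)[OF F fb.OmegaD(2)[OF 2(2) that]] unfolding sections_trivial_line ev_def nuf_def .
 qed
 then show ?thesis using 2 by simp
qed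

lemma nuf_scale: "frame U n a b lam nu ==> al : Om k ==> nuf nu (c *\<^sub>R al) = c *\<^sub>R nuf nu al"
 using frame_nu(2)[OF _ Om_val] by (simp add: nuf_def fun_eq_iff scaleR_fun_apply)

lemma nuf_uminus: "frame U n a b lam nu ==> al : Om k ==> nuf nu (- al) = - nuf nu al"
 using nuf_scale[of U n a b lam nu al k "- 1"] by simp

lemma nu_sum:
 assumes "frame U n a b lam nu" "finite I" "!!i. i : I ==> l i : fib L x"
 shows "nu x (\<Sum>i\<in>I. c i *\<^sub>R l i) = (\<Sum>i\<in>I. c i * nu x (l i)) & (\<Sum>i\<in>I. c i *\<^sub>R l i) : fib L x"
 using assms(2,3)
proof (induction I rule: finite_induct)
 case empty show ?case using frame_nu(1)[OF assms(1)] fibL_zero by simp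
next
 case (insert i I)
 then have s: "(\<Sum>i\<in>I. c i *\<^sub>R l i) : fib L x" and li: "l i : fib L x" by auto
 show ?case using insert frameD(8)[OF assms(1) li s]
   subspace_add[OF subspace_fib[OF vbL] subspace_scale[OF subspace_fib[OF vbL] li] s] by simp
qed

lemma nuf_wedge:
 assumes "frame U n a b lam nu" "al : Om k"
 shows "nuf nu (wedge om al) = wedge om (nuf nu al)"
proof (rule ext, rule ext)
 fix x vs
 show "nuf nu (wedge om al) x vs = wedge om (nuf nu al) x vs"
  using nu_sum[OF assms(1), of "Pow {..<length vs}" "%I. al x (nths vs (- I))" x "%I. shuffle_sign (length vs) I * om x (nths vs I)"]
   Om_val[OF assms(2)] by (simp add: nuf_def wedge_def alt_wedge_def)
qed

lemma nuf_form0: "frame U n a b lam nu ==> nuf nu (form0 s) = form0 (%x. nu x (s x))"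
 using frame_nu(1) by (fastforce simp: nuf_def form0_def)

lemma nu_swap: "frame U n a b lam nu ==> y : U ==> l : fib L y ==> l' : fib L y ==> nu y l *\<^sub>R l' = nu y l' *\<^sub>R l"
 using frameD(6) by (metis scaleR_left_commute)

text \<open>In a trivialisation the two factors of a product of \<open>L\<close>-valued forms can be exchanged.\<close>

lemma nuf_swap:
 assumes F: "frame U n a b lam nu" and y: "y : U" and al: "al : Om p" and be: "be : Om q"
 shows "wedge (nuf nu al) be y = psign (p * q) *\<^sub>R wedge (nuf nu be) al y"
proof
 fix vs
 have rep: "wedge om ga y vs = wedge om (nuf nu ga) y vs *\<^sub>R lam y" if "ga : Om k" for ga om k
  using frameD(6)[OF F y Om_val[OF that]] by (simp add: wedge_def alt_wedge_def nuf_def scaleR_sum_left scaleR_scaleR[symmetric] del: scaleR_scaleR)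
 show "wedge (nuf nu al) be y vs = (psign (p * q) *\<^sub>R wedge (nuf nu be) al y) vs"
  using fb.wedge_comm[OF nuf_Om[OF F al] nuf_Om[OF F be]] by (simp add: rep[OF al] rep[OF be] scaleR_fun_apply)
qed

text \<open>A first-order operator along the dual frame in each argument, with one factor
  trivialised. Either single sum alone already contains the brackets of frame elements; the double
  sum removes the copy counted twice.\<close>

definition m2F :: "nat => (nat => 'm => 'e) => (nat => 'm => 'e) => ('m => 'l => real) => ('m => 'e list => 'l) =>
  ('m => 'e list => 'l) => 'm => 'e list => 'l" where
 "m2F n a b nu al be = (\<Sum>i<n. \<Sum>j<n. wedge (wedge (nuf nu (iota (a i) al)) (nuf nu (Lop (b i) (td (b j))))) (iota (a j) be))
  - (\<Sum>i<n. wedge (nuf nu (iota (a i) al)) (Lop (b i) be)) - (\<Sum>i<n. wedge (nuf nu (Lop (b i) (sg al))) (iota (a i) be))"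

lemma br_skew:
 assumes "e : GE" "f : GE" "sp e f = 0"
 shows "br e f = - br f e"
proof (rule GE_eqI[OF br_sections[OF assms(1,2)] sections_uminus[OF vbE br_sections[OF assms(2,1)]]])
 fix t assume t: "t : GE"
 have "sp t (br e f) + sp t (br f e) = 0"
  unfolding C2[OF t assms(1,2)] assms(3) by (rule nab_add(3)[OF t]) (rule sections_zero[OF vbL])+
 then have "sp t (br e f) = - sp t (br f e)" by (rule eq_neg_iff_add_eq_0[THEN iffD2])
 then show "sp (br e f) t = sp (- br f e) t"
  unfolding sp_lin(9)[OF br_sections[OF assms(2,1)] t t]
   sp_sym[OF br_sections[OF assms(1,2)] t] sp_sym[OF br_sections[OF assms(2,1)] t] .
qed

lemma br_skew_B: "b : GB ==> c : GB ==> br b c = - br c b"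
 by (rule br_skew[OF GB_GE GB_GE spBB])

lemma ev_td_pr: "e : GE ==> Z : GA ==> ev (td (prB e)) [Z] = sp e Z"
 using ev_td sp_prB by simp

lemma td_eqI:
 assumes "e : GE" "f : GE" "!!Z. Z : GA ==> sp e Z x = sp f Z x"
 shows "td e x = td f x"
 by (rule Om1_eqI[OF td_Omega[OF assms(1)] td_Omega[OF assms(2)]]) (simp add: ev_td assms(3))

lemma td_prB: "e : GE ==> td (prB e) = td e"
 by (rule ext, rule td_eqI) (simp_all add: GB_GE prB_GB sp_prB)

lemma td_uminus: "e : GE ==> td (- e) = - td e"
proof
 fix x assume e: "e : GE"
 show "td (- e) x = (- td e) x"
 proof (rule Om1_eqI[OF td_Omega[OF sections_uminus[OF vbE e]] fb.Omega_uminus[OF vbL td_Omega[OF e]]])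
  fix Z assume Z: "Z : GA"
  show "ev (td (- e)) [Z] x = ev (- td e) [Z] x"
   unfolding ev_td[OF Z] ev_uminus sp_lin(9)[OF e e GA_GE[OF Z]] ..
 qed
qed

lemma Lop_td_B: "b : GB ==> c : GB ==> Lop b (td c) = td (br b c)"
 using Lop_td_GB td_prB[OF br_sections[OF GB_GE GB_GE]] by simp

lemma sum_at: "(!!i. i < (n::nat) ==> F i y = c *\<^sub>R G i y) ==> (\<Sum>i<n. F i) y = c *\<^sub>R (\<Sum>i<n. G i) y"
 for F G :: "nat => 'z => 'v::real_vector"
 by (simp add: sum_fun_apply scaleR_sum_right)

lemma m2F_dr:
 assumes F: "frame U n a b lam nu" and al: "al : Om k"
 shows "dr (k - 1) (m2F n a b nu al)"
proof -
 note aG = frameD(2)[OF F] and bG = GB_GE[OF frameD(3)[OF F]] and bB = frameD(3)[OF F]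
 have 1: "nuf nu (iota (a i) al) : Om0 (k - 1)" if "i < n" for i
  by (rule nuf_Om[OF F fb.iota_Omega[OF al aG[OF that]]])
 have 2: "nuf nu (Lop (b i) (sg al)) : Om0 k" if "i < n" for i
  by (rule nuf_Om[OF F Lop_Om[OF bG[OF that] fb.sg_in_Omega[OF vbL al]]])
 have 3: "wedge (nuf nu (iota (a i) al)) (nuf nu (Lop (b i) (td (b j)))) : Om0 (k - 1 + 1)" if "i < n" "j < n" for i j
  by (rule fb.wedge_Omega[OF fb.tl 1[OF that(1)] nuf_Om[OF F Lop_Om[OF bG[OF that(1)] td_Om[OF bB[OF that(2)]]]]])
 show ?thesis unfolding m2F_def
 proof (intro dr_diff dr_sum)
  fix i assume i: "i < n"
  show "dr (k - 1) (%be. wedge (nuf nu (iota (a i) al)) (Lop (b i) be))" using dr_wedge[OF dr_Lop[OF bG[OF i]] 1[OF i]] by simp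
  show "dr (k - 1) (%be. wedge (nuf nu (Lop (b i) (sg al))) (iota (a i) be))" using dr_wedge[OF dr_iota[OF aG[OF i]] 2[OF i]] by simp
  fix j assume j: "j < n"
  show "dr (k - 1) (%be. wedge (wedge (nuf nu (iota (a i) al)) (nuf nu (Lop (b i) (td (b j))))) (iota (a j) be))"
   using dr_wedge[OF dr_iota[OF aG[OF j]] 3[OF i j]] by simp
 qed
qed

text \<open>The two single sums are interchanged, and the double sum is symmetric because the
  brackets of frame elements of \<open>B\<close> are skew. Symmetry makes the derivation property in
  the second argument enough.\<close>

lemma m2F_sym:
 assumes F: "frame U n a b lam nu" and y: "y : U" and al: "al : Om p" and be: "be : Om q"
 shows "m2F n a b nu al be y = psign (p * q) *\<^sub>R m2F n a b nu be al y"
proof -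
 note aG = frameD(2)[OF F] and bG = GB_GE[OF frameD(3)[OF F]] and bB = frameD(3)[OF F]
 have T: "wedge (nuf nu (iota (a i) al)) (Lop (b i) be) y = psign (p * q) *\<^sub>R wedge (nuf nu (Lop (b i) (sg be))) (iota (a i) al) y"
  if "i < n" and al: "al : Om p" and be: "be : Om q" for i al be p q
 proof -
  note i = that(1)
  note L = Lop_Om[OF bG[OF i] be]
  have "Lop (b i) (sg be) = psign q *\<^sub>R Lop (b i) be"
   unfolding fb.sg_Omega[OF be] by (rule drD(3)[OF dr_Lop[OF bG[OF i]] be])
  then have e: "nuf nu (Lop (b i) (sg be)) = psign q *\<^sub>R nuf nu (Lop (b i) be)" using nuf_scale[OF F L] by simp
  have ps: "psign ((p - 1) * q) = psign (p * q) * psign q" by (simp add: left_diff_distrib psign_diff)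
  show ?thesis unfolding nuf_swap[OF F y fb.iota_Omega[OF al aG[OF i]] L] e wedge_scale_left ps
   by (simp add: scaleR_fun_apply)
 qed
 let ?c = "%i j. nuf nu (Lop (b i) (td (b j)))"
 have cS: "?c i j = - ?c j i" if ij: "i < n" "j < n" for i j
 proof -
  note g = br_sections[OF bG[OF ij(2)] bG[OF ij(1)]]
  show ?thesis unfolding Lop_td_B[OF bB[OF ij(1)] bB[OF ij(2)]] Lop_td_B[OF bB[OF ij(2)] bB[OF ij(1)]]
   unfolding br_skew_B[OF bB[OF ij(1)] bB[OF ij(2)]] td_uminus[OF g] nuf_uminus[OF F td_Omega[OF g]] ..
 qed
 have T3: "wedge (wedge (nuf nu (iota (a i) al)) (?c i j)) (iota (a j) be) y
   = psign (p * q) *\<^sub>R wedge (wedge (nuf nu (iota (a j) be)) (?c j i)) (iota (a i) al) y" if ij: "i < n" "j < n" for i j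
 proof -
  note c = nuf_Om[OF F Lop_Om[OF bG[OF ij(1)] td_Om[OF bB[OF ij(2)]]]]
  note ia = fb.iota_Omega[OF al aG[OF ij(1)]] and ib = fb.iota_Omega[OF be aG[OF ij(2)]]
  have w: "wedge (?c i j) (iota (a j) be) : Om q" using fb.wedge_Omega[OF vbL c ib] by simp
  have ps: "psign ((p - 1) * q) * - psign (q - 1) = psign (p * q)" by (simp add: left_diff_distrib psign_diff)
  have cm: "wedge (?c i j) (nuf nu (iota (a j) be)) = (- psign (q - 1)) *\<^sub>R wedge (nuf nu (iota (a j) be)) (?c j i)"
   using fb.wedge_comm[OF c nuf_Om[OF F ib]] unfolding cS[OF ij] by (simp add: wedge_uminus_right)
  show ?thesis
   unfolding wedge_assoc[of "nuf nu (iota (a i) al)"] nuf_swap[OF F y ia w] nuf_wedge[OF F ib] cm wedge_scale_left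
   by (simp only: scaleR_fun_apply scaleR_scaleR ps)
 qed
 let ?S = "psign (p * q)"
 have A: "(\<Sum>i<n. wedge (nuf nu (iota (a i) al)) (Lop (b i) be)) y = ?S *\<^sub>R (\<Sum>i<n. wedge (nuf nu (Lop (b i) (sg be))) (iota (a i) al)) y"
  by (rule sum_at) (rule T[OF _ al be])
 have "(\<Sum>i<n. wedge (nuf nu (iota (a i) be)) (Lop (b i) al)) y = ?S *\<^sub>R (\<Sum>i<n. wedge (nuf nu (Lop (b i) (sg al))) (iota (a i) be)) y"
  unfolding mult.commute[of p] by (rule sum_at) (rule T[OF _ be al])
 then have B: "(\<Sum>i<n. wedge (nuf nu (Lop (b i) (sg al))) (iota (a i) be)) y = ?S *\<^sub>R (\<Sum>i<n. wedge (nuf nu (iota (a i) be)) (Lop (b i) al)) y"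
  by simp
 have D: "(\<Sum>i<n. \<Sum>j<n. wedge (wedge (nuf nu (iota (a i) al)) (?c i j)) (iota (a j) be)) y
  = ?S *\<^sub>R (\<Sum>i<n. \<Sum>j<n. wedge (wedge (nuf nu (iota (a i) be)) (?c i j)) (iota (a j) al)) y"
  unfolding sum.swap[of "%i j. wedge (wedge (nuf nu (iota (a i) be)) (?c i j)) (iota (a j) al)"]
  by (rule sum_at, rule sum_at, rule T3)
 show ?thesis unfolding m2F_def by (simp only: minus_apply A B D scaleR_diff_right) (rule ext, simp)
qed

lemma nab_sum: "c : GE ==> (!!j. j < (n::nat) ==> f j : Cinf M & s j : GL) ==>
  nab c (\<Sum>j<n. sc (f j) (s j)) = (\<Sum>j<n. sc (sig c (f j)) (s j) + sc (f j) (nab c (s j)))"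
proof (induction n)
 case 0 show ?case using nab_add(3)[OF 0(1) sections_zero[OF vbL] sections_zero[OF vbL]] by (simp only: lessThan_0 sum.empty)
next
 case (Suc n)
 then have n: "f n : Cinf M" "s n : GL" by auto
 have S: "(\<Sum>j<n. sc (f j) (s j)) : GL" using Suc.prems by (intro sections_sum[OF vbL] sections_sc[OF vbL]) auto
 show ?case unfolding sum.lessThan_Suc nab_add(1)[OF Suc.prems(1) S sections_sc[OF vbL n]] nab_sc[OF Suc.prems(1) n]
  using Suc.IH[OF Suc.prems(1)] Suc.prems(2) by (simp only: less_SucI simp_thms)
qed

context
 fixes U n a b lam nu y
 assumes F: "frame U n a b lam nu" and y: "y : U"
begin

lemma sp_nu: "s : GE ==> t : GE ==> (%x. nu x (sp s t x)) : Cinf M"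
 by (rule frameD(7)[OF F sp_sections])

lemma spL: "s : GE ==> t : GE ==> sp s t x : fib L x"
 by (rule sections_fib[OF vbL sp_sections])

lemmas aG = frameD(2)[OF F] and bB = frameD(3)[OF F]
lemmas bG = GB_GE[OF bB] and aE = GA_GE[OF aG]

lemma nab_expand:
 assumes c: "c : GB" and s: "s : GL"
 shows "(\<Sum>i<n. nu y (sp c (a i) y) *\<^sub>R nab (b i) s y) = nab c s y"
proof -
 note f = sp_nu[OF GB_GE[OF c] aE]
 have e: "(\<Sum>i<m. sc (%x. nu x (sp c (a i) x)) (b i)) : GE &
   nab (\<Sum>i<m. sc (%x. nu x (sp c (a i) x)) (b i)) s = (\<Sum>i<m. sc (%x. nu x (sp c (a i) x)) (nab (b i) s))" if "m <= n" for m
  using that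
 proof (induction m)
  case 0
  have "nab 0 s = 0" by (rule ext) (simp add: nab_zero_at[OF _ s])
  then show ?case using sections_zero[OF vbE] by (simp only: lessThan_0 sum.empty simp_thms)
 next
  case (Suc m)
  then have m: "m < n" by simp
  have IH: "(\<Sum>i<m. sc (%x. nu x (sp c (a i) x)) (b i)) : GE" using Suc by simp
  show ?case unfolding sum.lessThan_Suc add.commute[of "\<Sum>i<m. _ i"] nab_lin_left[OF bG[OF m] IH s]
   using Suc sections_add[OF vbE sections_sc[OF vbE f[OF m] bG[OF m]] IH] by (simp only: Suc_leD simp_thms)
 qed
 \<comment> \<open>The expansion in the frame is valid over \<open>U\<close> only. The difference
   vanishes at \<open>y\<close>, which suffices since \<open>nabla\<close> is linear on
   fibres.\<close>
 let ?w = "sc (%_. - 1) (\<Sum>i<n. sc (%x. nu x (sp c (a i) x)) (b i)) + c"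
 have "?w y = 0"
  using frameD(11)[OF F y GB_fib(1)[OF c]] sp_sym[OF GB_GE[OF c] aE]
  by (simp add: sum_fun_apply sc_apply spair_def fun_eq_iff)
 from nab_zero_at[where e="?w" and x=y, OF this s] show ?thesis
  using e[of n] nab_lin_left[OF _ GB_GE[OF c] s, of "\<Sum>i<n. sc (%x. nu x (sp c (a i) x)) (b i)" "%_. - 1"]
  by (simp add: sum_fun_apply sc_apply)
qed

lemma sig_expand:
 assumes c: "c : GB" and f: "f : Cinf M"
 shows "(\<Sum>i<n. nu y (sp c (a i) y) * sig (b i) f y) = sig c f y"
proof -
 obtain s where s: "s : GL" "s y ~= 0" by (rule L_nonzero)
 have *: "sig e f y *\<^sub>R s y = nab e (sc f s) y - f y *\<^sub>R nab e s y" if "e : GE" for e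
  unfolding nab_sc[OF that f s(1)] by (simp add: sc_apply)
 have "sig c f y *\<^sub>R s y = (\<Sum>i<n. nu y (sp c (a i) y) *\<^sub>R nab (b i) (sc f s) y) - f y *\<^sub>R (\<Sum>i<n. nu y (sp c (a i) y) *\<^sub>R nab (b i) s y)"
  unfolding nab_expand[OF c s(1)] nab_expand[OF c sections_sc[OF vbL f s(1)]] by (rule *[OF GB_GE[OF c]])
 also have "\<dots> = (\<Sum>i<n. nu y (sp c (a i) y) *\<^sub>R (sig (b i) f y *\<^sub>R s y))"
  by (simp add: * bG scaleR_sum_right sum_subtractf scaleR_diff_right mult.commute)
 finally show ?thesis using s(2) by (simp add: scaleR_sum_left[symmetric])
qed

text \<open>The bracket is not tensorial. \<open>C1\<close> shifts the differentiation to the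
  function \<open>sp e Z\<close>, whose expansion holds in a neighbourhood and may therefore be
  differentiated.\<close>

lemma br_expand:
 assumes c: "c : GE" and e: "e : GB" and Z: "Z : GE"
 shows "sp (br c e) Z y = (\<Sum>j<n. nu y (sp e (a j) y) *\<^sub>R sp (br c (b j)) Z y)
   + (\<Sum>j<n. sig c (%x. nu x (sp e (a j) x)) y *\<^sub>R sp (b j) Z y)"
proof -
 let ?f = "%j x. nu x (sp e (a j) x)"
 note eE = GB_GE[OF e]
 have loc: "sp e t x = (\<Sum>j<n. sc (?f j) (sp (b j) t)) x" if x: "x : U" and t: "t : GE" for x t
 proof -
  have "e x = (\<Sum>j<n. ?f j x *\<^sub>R b j x)" using frameD(11)[OF F x GB_fib(1)[OF e]] sp_sym[OF eE aE] by (simp add: spair_def fun_eq_iff)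
  then have "sp e t x = pairing C x (\<Sum>j<n. ?f j x *\<^sub>R b j x) (t x)" by (simp add: spair_def)
  also have "\<dots> = (\<Sum>j<n. ?f j x *\<^sub>R pairing C x (b j x) (t x))" by (rule pair_sum(1)[OF GE_fib[OF bG] GE_fib[OF t]])
  finally show ?thesis by (simp add: sum_fun_apply sc_apply spair_def)
 qed
 have g: "!!j. j < n ==> ?f j : Cinf M & sp (b j) Z : GL" using sp_nu[OF eE aE] sp_sections[OF bG Z] by blast
 have S: "(\<Sum>j<n. sc (?f j) (sp (b j) Z)) : GL" using g by (intro sections_sum[OF vbL] sections_sc[OF vbL]) auto
 have "sp (br c e) Z y = nab c (sp e Z) y - sp e (br c Z) y" unfolding C1[OF c eE Z] by simp
 also have "nab c (sp e Z) y = nab c (\<Sum>j<n. sc (?f j) (sp (b j) Z)) y"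
  by (rule nab_local[OF c sp_sections[OF eE Z] S frameD(1)[OF F] y]) (rule loc[OF _ Z])
 also have "\<dots> = (\<Sum>j<n. sig c (?f j) y *\<^sub>R sp (b j) Z y + ?f j y *\<^sub>R (sp (br c (b j)) Z y + sp (b j) (br c Z) y))"
  by (subst nab_sum[OF c g], assumption) (simp add: sum_fun_apply sc_apply C1[OF c bG Z])
 finally show ?thesis unfolding loc[OF y br_sections[OF c Z]]
  by (simp add: sum_fun_apply sc_apply scaleR_add_right sum.distrib)
qed

lemma m2F_form0:
 assumes "al : Om k" "s : GL"
 shows "m2F n a b nu al (form0 s) y = - (\<Sum>i<n. wedge (nuf nu (iota (a i) al)) (form0 (nab (b i) s)) y)"
 by (simp add: m2F_def fb.iota_form0 wedge_zero_right sum_fun_apply Lop_form0[OF bG assms(2)])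

text \<open>The right-hand sides contain no frame; this is what permits gluing.\<close>

lemma m2F_gen:
 assumes s: "s : GL" "t : GL" and c: "c : GB" and e: "e : GB"
 shows "m2F n a b nu (form0 t) (form0 s) y = 0" "m2F n a b nu (td c) (form0 s) y = - form0 (nab c s) y"
  "m2F n a b nu (td c) (td e) y = - td (br c e) y"
proof -
 have n0: "nuf nu 0 = (0 :: 'm => 'e list => real)" by (simp add: nuf_def fun_eq_iff frame_nu(1)[OF F])
 show "m2F n a b nu (form0 t) (form0 s) y = 0"
  unfolding m2F_form0[OF form0_Om[OF s(2)] s(1)] by (simp add: fb.iota_form0 n0 wedge_zero_left)
 note cE = GB_GE[OF c] and eE = GB_GE[OF e]
 have ni: "nuf nu (iota (a i) (td c)) = form0 (%x. nu x (sp c (a i) x))" if "i < n" "c : GB" for i c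
  unfolding iota_td[OF GB_GE[OF that(2)] aG[OF that(1)]] nuf_form0[OF F] ..
 show "m2F n a b nu (td c) (form0 s) y = - form0 (nab c s) y"
 proof -
  have w: "wedge (nuf nu (iota (a i) (td c))) (form0 (nab (b i) s)) y = nu y (sp c (a i) y) *\<^sub>R form0 (nab (b i) s) y" if "i < n" for i
   by (simp only: ni[OF that c] fb.wedge_form0 sc_apply)
  have "(\<Sum>i<n. nu y (sp c (a i) y) *\<^sub>R form0 (nab (b i) s) y) vs = form0 (nab c s) y vs" for vs :: "'e list"
   by (cases "vs = []") (simp_all add: sum_fun_apply scaleR_fun_apply form0_def nab_expand[OF c s(1)])
  then have "(\<Sum>i<n. nu y (sp c (a i) y) *\<^sub>R form0 (nab (b i) s) y) = (form0 (nab c s) y :: 'e list => 'l)" ..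
  moreover have "(\<Sum>i<n. wedge (nuf nu (iota (a i) (td c))) (form0 (nab (b i) s)) y) = (\<Sum>i<n. nu y (sp c (a i) y) *\<^sub>R form0 (nab (b i) s) y)"
   by (rule sum.cong[OF refl]) (rule w, simp)
  ultimately show ?thesis unfolding m2F_form0[OF td_Om[OF c] s(1)] by (simp only:)
 qed
 note cE = GB_GE[OF c] and eE = GB_GE[OF e]
 let ?g = "%i x. nu x (sp c (a i) x)" and ?e = "%i x. nu x (sp e (a i) x)"
 show "m2F n a b nu (td c) (td e) y = - td (br c e) y"
 proof -
  have Om: "m2F n a b nu (td c) (td e) : Om 1" using drD(1)[OF m2F_dr[OF F td_Om[OF c]] td_Om[OF e]] by simp
  have "m2F n a b nu (td c) (td e) y = (- td (br c e)) y"
  proof (rule Om1_eqI[OF Om fb.Omega_uminus[OF vbL td_Omega[OF br_sections[OF cE eE]]]])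
   fix Z assume Z: "Z : GA"
   note ZE = GA_GE[OF Z]
   let ?B = "%i j. sp (br (b i) (b j)) Z y"
   have evw: "ev (wedge (form0 f) be) [Z] y = f y *\<^sub>R ev be [Z] y" for f and be :: "'m => 'e list => 'l"
    by (simp add: fb.wedge_form0 ev_sc sc_apply)
   have evr: "ev (wedge om (form0 t)) [Z] y = ev om [Z] y *\<^sub>R t y" for om :: "'m => 'e list => real" and t :: "'m => 'l"
    by (simp add: ev_def fb.wedge_form0_right[OF lineL])
   have eL: "ev (Lop b' (td c')) [Z] = sp (br b' c') Z" if "b' : GB" "c' : GB" for b' c'
    unfolding Lop_td_B[OF that] ev_td[OF Z] ..
   have T1: "ev (wedge (nuf nu (iota (a i) (td c))) (Lop (b i) (td e))) [Z] y
     = (\<Sum>j<n. (?g i y * ?e j y) *\<^sub>R ?B i j) + (\<Sum>j<n. (?g i y * sig (b i) (?e j) y) *\<^sub>R sp (b j) Z y)" if i: "i < n" for i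
    unfolding ni[OF i c] evw eL[OF bB[OF i] e] br_expand[OF bG[OF i] e ZE] by (simp add: scaleR_add_right scaleR_sum_right)
   have T2: "ev (wedge (nuf nu (Lop (b i) (sg (td c)))) (iota (a i) (td e))) [Z] y = ?e i y *\<^sub>R sp (br c (b i)) Z y" if i: "i < n" for i
   proof -
    have "Lop (b i) (sg (td c)) = td (br c (b i))"
     unfolding fb.sg_Omega[OF td_Om[OF c]] drD(3)[OF dr_Lop[OF bG[OF i]] td_Om[OF c]] Lop_td_B[OF bB[OF i] c]
      br_skew_B[OF bB[OF i] c] td_uminus[OF br_sections[OF cE bG[OF i]]] by simp
    then show ?thesis unfolding iota_td[OF eE aG[OF i]] evr ev_nuf
     using nu_swap[OF F y spL[OF br_sections[OF cE bG[OF i]] ZE] spL[OF eE aE[OF i]]] by (simp add: ev_td[OF Z])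
   qed
   have T3: "ev (wedge (wedge (nuf nu (iota (a i) (td c))) (nuf nu (Lop (b i) (td (b j))))) (iota (a j) (td e))) [Z] y
    = (?g i y * ?e j y) *\<^sub>R ?B i j" if i: "i < n" and j: "j < n" for i j
   proof -
    have "ev (nuf nu (Lop (b i) (td (b j)))) [Z] y *\<^sub>R sp e (a j) y = ?e j y *\<^sub>R ?B i j"
     unfolding ev_nuf eL[OF bB[OF i] bB[OF j]]
     by (rule nu_swap[OF F y spL[OF br_sections[OF bG[OF i] bG[OF j]] ZE] spL[OF eE aE[OF j]]])
    then show ?thesis unfolding wedge_assoc ni[OF i c] evw iota_td[OF eE aG[OF j]] evr by simp
   qed
   have S: "(\<Sum>i<n. \<Sum>j<n. (?g i y * sig (b i) (?e j) y) *\<^sub>R sp (b j) Z y) = (\<Sum>j<n. sig c (?e j) y *\<^sub>R sp (b j) Z y)"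
    unfolding sum.swap[of _ "{..<n}" "{..<n}"] scaleR_sum_left[symmetric]
    by (intro sum.cong refl) (simp add: sig_expand[OF c sp_nu[OF eE aE]])
   have es: "ev (\<Sum>i<n. F i) [Z] y = (\<Sum>i<n. ev (F i) [Z] y)" for F :: "nat => 'm => 'e list => 'l"
    by (simp add: ev_def sum_fun_apply)
   \<comment> \<open>The derivative-free part of \<open>T1\<close> equals the double sum
     \<open>T3\<close>, and the derivative part collapses by \<open>sig_expand\<close>; what remains
     is \<open>br_expand\<close> with a minus sign.\<close>
   have "ev (m2F n a b nu (td c) (td e)) [Z] y = - (\<Sum>j<n. sig c (?e j) y *\<^sub>R sp (b j) Z y) - (\<Sum>i<n. ?e i y *\<^sub>R sp (br c (b i)) Z y)"
    unfolding m2F_def ev_diff minus_apply es by (simp add: T1 T2 T3 sum.distrib S)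
   then show "ev (m2F n a b nu (td c) (td e)) [Z] y = ev (- td (br c e)) [Z] y"
    unfolding ev_uminus uminus_apply ev_td[OF Z] br_expand[OF cE e ZE] by simp
  qed
  then show ?thesis by simp
 qed
qed

end

text \<open>The section is the differential of \<open>s\<close> for the dual algebroid, a one-form
  on the dual of \<open>A\<close> twisted by \<open>L\<close>, hence a section of \<open>A\<close>.
  Fibrewise it is written in a dual frame; smoothness follows from its pairings.\<close>

lemma dual_exists:
 assumes s: "s : GL"
 shows "EX u:GA. ALL c:GB. sp u c = nab c s"
proof -
 have "\<exists>v. v : fib A x & (ALL c:GB. pairing C x v (c x) = nab c s x)" for x
 proof -
  obtain U n a b lam nu where x: "x : U" and F: "frame U n a b lam nu" using frame_exists[of x] by blast
  note aG = frameD(2)[OF F] and bB = frameD(3)[OF F]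
  have "pairing C x (\<Sum>i<n. nu x (nab (b i) s x) *\<^sub>R a i x) (c x) = nab c s x" if c: "c : GB" for c
  proof -
   have "pairing C x (\<Sum>i<n. nu x (nab (b i) s x) *\<^sub>R a i x) (c x) = (\<Sum>i<n. nu x (nab (b i) s x) *\<^sub>R sp c (a i) x)"
    by (subst pair_sum(1)[OF GA_fib(2)[OF aG] GB_fib(2)[OF c]], assumption)
      (simp add: spair_def pair_facts(2)[OF GA_fib(2)[OF aG] GB_fib(2)[OF c]])
   also have "\<dots> = (\<Sum>i<n. nu x (sp c (a i) x) *\<^sub>R nab (b i) s x)"
    by (rule sum.cong[OF refl], rule nu_swap[OF F x]) (simp_all add: sections_fib[OF vbL] nab_sections sp_sections GB_GE GA_GE bB aG s c)
   finally show ?thesis unfolding nab_expand[OF F x c s] .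
  qed
  then show ?thesis
   by (intro exI[of _ "\<Sum>i<n. nu x (nab (b i) s x) *\<^sub>R a i x"] conjI ballI fib_sum[OF vbA GA_fib(1)[OF aG]])
 qed
 then have "\<exists>u. \<forall>x. u x : fib A x & (ALL c:GB. pairing C x (u x) (c x) = nab c s x)" by (rule choice[OF allI])
 then obtain u where u: "!!x. u x : fib A x" "!!x c. c : GB ==> pairing C x (u x) (c x) = nab c s x" by blast
 have sp: "sp u c = nab c s" if "c : GB" for c using u(2)[OF that] by (simp add: spair_def fun_eq_iff)
 have "u : GA" by (rule sections_A_I[OF u(1)]) (simp add: sp nab_sections[OF GB_GE s])
 then show ?thesis using sp by blast
qed

definition "us s = (SOME u. u : GA & (ALL c:GB. sp u c = nab c s))"

lemma us: "s : GL ==> us s : GA" "s : GL ==> c : GB ==> sp (us s) c = nab c s"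
 using someI_ex[of "%u. u : GA & (ALL c:GB. sp u c = nab c s)"] dual_exists unfolding us_def by blast+

text \<open>Both sides are derivations in \<open>be\<close>, so generators suffice, and there
  symmetry leads back to the frame-free values. With a generator in front the bracket is thus a
  contraction or a Lie derivative.\<close>

lemma m2F_gen_left:
 assumes F: "frame U n a b lam nu" and y: "y : U" and be: "be : Om k"
 shows "t : GL ==> m2F n a b nu (form0 t) be y = - iota (us t) be y"
  "c : GB ==> m2F n a b nu (td c) be y = - Lop c be y"
proof -
 note gen = m2F_gen[OF F y]
 show "m2F n a b nu (form0 t) be y = - iota (us t) be y" if t: "t : GL"
 proof -
  have d: "dr (- 1) (m2F n a b nu (form0 t))" using m2F_dr[OF F form0_Om[OF t]] by simp
  have "m2F n a b nu (form0 t) be y = (- iota (us t) be) y"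
  proof (rule dr_agree[OF d dr_uminus[OF dr_iota[OF us(1)[OF t]]] _ _ be])
   fix c assume c: "c : GB"
   show "m2F n a b nu (form0 t) (td c) y = (- iota (us t) (td c)) y"
    unfolding m2F_sym[OF F y form0_Om[OF t] td_Om[OF c]] gen(2)[OF t t c c] iota_td[OF GB_GE[OF c] us(1)[OF t]]
     sp_sym[OF GB_GE[OF c] GA_GE[OF us(1)[OF t]]] us(2)[OF t c] by simp
  qed (simp add: gen(1)[OF _ t GB_zero GB_zero] fb.iota_form0)
  then show ?thesis by simp
 qed
 show "m2F n a b nu (td c) be y = - Lop c be y" if c: "c : GB"
 proof -
  have d: "dr 0 (m2F n a b nu (td c))" using m2F_dr[OF F td_Om[OF c]] by simp
  have "m2F n a b nu (td c) be y = (- Lop c be) y"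
   by (rule dr_agree[OF d dr_uminus[OF dr_Lop[OF GB_GE[OF c]]] _ _ be])
     (simp_all add: gen(2)[OF _ _ c c] gen(3)[OF sections_zero[OF vbL] sections_zero[OF vbL] c] Lop_form0[OF GB_GE[OF c]] Lop_td_B[OF c])
  then show ?thesis by simp
 qed
qed

lemma m2F_frame:
 assumes F: "frame U n a b lam nu" "frame U' n' a' b' lam' nu'" and y: "y : U" "y : U'" and al: "al : Om p" and be: "be : Om q"
 shows "m2F n a b nu al be y = m2F n' a' b' nu' al be y"
 by (rule dr_agree[OF m2F_dr[OF F(1) al] m2F_dr[OF F(2) al] _ _ be])
   (simp_all only: m2F_sym[OF F(1) y(1) al form0_Om] m2F_sym[OF F(2) y(2) al form0_Om] m2F_sym[OF F(1) y(1) al td_Om]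
    m2F_sym[OF F(2) y(2) al td_Om] m2F_gen_left[OF F(1) y(1) al] m2F_gen_left[OF F(2) y(2) al])

definition "FR = (SOME R. \<forall>x. case R x of (U, n, a, b, lam, nu) => x : U & frame U n a b lam nu)"

definition "mloc x al = (case FR x of (U, n, a, b, lam, nu) => m2F n a b nu al)"

text \<open>The value at \<open>y\<close> is computed in the frame chosen at \<open>y\<close>; by
  \<open>m2F_frame\<close> any other frame around \<open>y\<close> gives the same, and
  \<open>der_glue\<close> makes the family a derivation.\<close>

definition "M2 al be = (%y. mloc y al be y)"

lemma FR: "case FR x of (U, n, a, b, lam, nu) => x : U & frame U n a b lam nu"
proof -
 have "\<exists>r. case r of (U, n, a, b, lam, nu) => x : U & frame U n a b lam nu" for x
  using frame_exists[of x] by fast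
 then have "\<exists>R. \<forall>x. case R x of (U, n, a, b, lam, nu) => x : U & frame U n a b lam nu" by (rule choice[OF allI])
 from someI_ex[OF this] show ?thesis unfolding FR_def by (rule spec)
qed

lemma mloc:
 obtains U n a b lam nu where "x : U" "frame U n a b lam nu" "mloc x = m2F n a b nu"
proof -
 obtain U n a b lam nu where e: "FR x = (U, n, a, b, lam, nu)" by (cases "FR x")
 have "mloc x = m2F n a b nu" by (rule ext) (simp add: mloc_def e)
 then show thesis using that[of U n a b lam nu] FR[of x] by (simp add: e)
qed

lemma M2_at:
 assumes "frame U n a b lam nu" "y : U" "al : Om p" "be : Om q"
 shows "M2 al be y = m2F n a b nu al be y"
proof -
 obtain U' n' a' b' lam' nu' where F: "y : U'" "frame U' n' a' b' lam' nu'" "mloc y = m2F n' a' b' nu'" by (rule mloc)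
 show ?thesis unfolding M2_def F(3) by (rule m2F_frame[OF F(2) assms(1) F(1) assms(2,3,4)])
qed

lemma M2_dr:
 assumes al: "al : Om p"
 shows "dr (p - 1) (M2 al)"
proof -
 have "\<exists>Y. der M A L (p - 1) Y (mloc x al)" for x using m2F_dr[OF _ al] mloc[of x] by metis
 then obtain Y where Y: "!!x. der M A L (p - 1) (Y x) (mloc x al)" by metis
 define U where "U x = fst (FR x)" for x
 have U: "open (U x)" "x : U x" for x using FR[of x] frameD(1) by (auto simp: U_def split: prod.splits)
 have g: "mloc x al be y = mloc y al be y" if "y : U x" "be : Om q" for x y be q
  using that FR[of x] M2_at[OF _ _ al that(2), of _ _ _ _ _ _ y] by (auto simp: U_def M2_def mloc_def split: prod.splits)
 show ?thesis unfolding M2_def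
  by (rule exI, rule fb.der_glue(1)[OF lineL Y U]) (auto intro: g form0_Om)
qed

lemmas M2_Om = drD(1)[OF M2_dr]

lemma M2_sym:
 assumes "al : Om p" "be : Om q"
 shows "M2 al be = psign (p * q) *\<^sub>R M2 be al"
proof
 fix y
 obtain U n a b lam nu where F: "y : U" "frame U n a b lam nu" using frame_exists[of y] by blast
 show "M2 al be y = (psign (p * q) *\<^sub>R M2 be al) y"
  by (simp only: scaleR_fun_apply M2_at[OF F(2,1) assms] M2_at[OF F(2,1) assms(2,1)] m2F_sym[OF F(2,1) assms])
qed

lemma M2_gen:
 assumes be: "be : Om k"
 shows "t : GL ==> M2 (form0 t) be = - iota (us t) be" "c : GB ==> M2 (td c) be = - Lop c be"
proof -
 have "(t : GL --> M2 (form0 t) be y = - iota (us t) be y) & (c : GB --> M2 (td c) be y = - Lop c be y)" for y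
 proof -
  obtain U n a b lam nu where F: "y : U" "frame U n a b lam nu" using frame_exists[of y] by blast
  show ?thesis using M2_at[OF F(2,1) form0_Om be] M2_at[OF F(2,1) td_Om be] m2F_gen_left[OF F(2,1) be] by simp
 qed
 then show "t : GL ==> M2 (form0 t) be = - iota (us t) be" "c : GB ==> M2 (td c) be = - Lop c be" by (simp_all add: fun_eq_iff)
qed

end

section \<open>The ternary bracket\<close>

lemma sum_perm3:
 fixes F :: "nat => nat => nat => real"
 shows "(\<Sum>\<sigma> | \<sigma> permutes {..<3::nat}. of_int (sign \<sigma>) * F (\<sigma> 0) (\<sigma> 1) (\<sigma> 2)) =
  F 0 1 2 - F 0 2 1 - F 1 0 2 + F 1 2 0 + F 2 0 1 - F 2 1 0"
proof -
 have e: "{..<3::nat} = {0, 1, 2}" by auto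
 have f: "finite {1, 2::nat}" "0 \<notin> {1, 2::nat}" "finite {2::nat}" "1 \<notin> {2::nat}" by auto
 show ?thesis
  unfolding e sum_over_permutations_insert[OF f(1,2)] sum_over_permutations_insert[OF f(3,4)] permutes_sing
  by (simp add: sign_swap_id permutation_swap_id sign_compose sign_id transpose_def)
qed

lemma prod3: "(\<Prod>i<3. f i) = f 0 * f 1 * (f 2 :: real)" for f :: "nat => real"
 by (simp add: numeral_3_eq_3 numeral_2_eq_2)

lemma wedge_sc_left: "wedge (sc f om) be x = f x *\<^sub>R wedge om be x"
 by (rule ext) (simp add: wedge_def alt_wedge_def sc_def scaleR_fun_apply scaleR_sum_right mult_ac)

lemma sum_list_swap: "(\<Sum>t\<leftarrow>ts. \<Sum>i\<in>I. F i t) = (\<Sum>i\<in>I. \<Sum>t\<leftarrow>ts. F i t :: 'v::comm_monoid_add)"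
 by (induction ts) (simp_all add: sum.distrib)

context lag
begin

lemma dr_cong:
 assumes "dr d X" and e: "!!k ga. ga : Om k ==> X' ga = X ga"
 shows "dr d X'"
proof -
 obtain Y where Y: "leib M A trivial_line d Y Y" and X: "leib M A L d Y X" using assms(1) unfolding der_leib by blast
 have "leib M A L d Y X'"
 proof (rule leibI)
  show "X' al : Om (k + d)" if "al : Om k" for al k unfolding e[OF that] by (rule leibD(1)[OF X that])
  show "X' (c *\<^sub>R al + be) = c *\<^sub>R X' al + X' be" if "al : Om k" "be : Om k" for al be k c
   unfolding e[OF that(1)] e[OF that(2)] e[OF fb.Omega_add[OF vbL fb.Omega_scale[OF vbL that(1)] that(2)]] by (rule leibD(2)[OF X that])
  show "X' (wedge om al) = wedge (Y om) al + psign (d * p) *\<^sub>R wedge om (X' al)" if "om : Om0 p" "al : Om k" for om al p k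
   unfolding e[OF that(2)] e[OF fb.wedge_Omega[OF vbL that]] by (rule leibD(3)[OF X that])
 qed
 then show ?thesis using Y der_leib by blast
qed

lemma dr_sumS: "finite I ==> (!!i. i : I ==> dr d (X i)) ==> dr d (%al. \<Sum>i\<in>I. X i al)"
proof (induction I rule: finite_induct)
 case empty show ?case unfolding sum.empty by (rule dr_zero)
next
 case (insert i I) then show ?case unfolding sum.insert[OF insert(1,2)] by (intro dr_add) simp_all
qed

definition "yps b c e = sp (br b c) e"

lemma yps_GL: "b : GB ==> c : GB ==> e : GB ==> yps b c e : GL"
 unfolding yps_def by (intro sp_sections br_sections GB_GE)

text \<open>In the first two entries this is skew-symmetry of the bracket on the isotropic
  \<open>B\<close>; in the last two it is \<open>C1\<close> applied to a pairing that vanishes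
  identically.\<close>

lemma yps_skew:
 assumes "b : GB" "c : GB" "e : GB"
 shows "yps c b e = - yps b c e" "yps b e c = - yps b c e"
proof -
 note E = GB_GE[OF assms(1)] GB_GE[OF assms(2)] GB_GE[OF assms(3)]
 show "yps c b e = - yps b c e"
  unfolding yps_def br_skew_B[OF assms(2,1)] by (rule sp_lin(9)[OF br_sections[OF E(1,2)] E(3,3)])
 have "sp (br b c) e + sp c (br b e) = 0"
  unfolding C1[OF E, symmetric] spBB[OF assms(2,3)] by (rule nab_add(3)[OF E(1)]) (rule sections_zero[OF vbL])+
 then have "sp c (br b e) = - sp (br b c) e" by (metis add_eq_0_iff)
 then show "yps b e c = - yps b c e" unfolding yps_def sp_sym[OF br_sections[OF E(1,3)] E(2)] .
qed

lemma yps_cyc: "b : GB ==> c : GB ==> e : GB ==> yps c e b = yps b c e"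
 using yps_skew(1)[of b c e] yps_skew(2)[of c b e] by simp

definition I3 :: "nat => (nat \<times> nat \<times> nat) set" where "I3 n = {..<n} \<times> {..<n} \<times> {..<n}"

lemma finite_I3: "finite (I3 n)" by (simp add: I3_def)

lemma sum_I3: "(\<Sum>(p, q, r)\<in>I3 n. F p q r) = (\<Sum>p<n. \<Sum>q<n. \<Sum>r<n. F p q r)"
 by (simp add: I3_def sum.cartesian_product)

text \<open>The contraction with \<open>Upsilon\<close> written in a dual frame. The sum runs over
  ordered triples without a factor, since the permutation sum in the sharp notation absorbs the 1/6
  of the antisymmetric tensor.\<close>

definition m3F :: "nat => (nat => 'm => 'e) => (nat => 'm => 'e) => ('m => 'l => real) => ('m => 'e list => 'l) =>
  ('m => 'e list => 'l) => ('m => 'e list => 'l) => 'm => 'e list => 'l" where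
 "m3F n a b nu al be ga = (\<Sum>(p, q, r)\<in>I3 n. wedge (sc (%x. nu x (yps (b p) (b q) (b r) x))
   (wedge (nuf nu (iota (a p) al)) (nuf nu (iota (a q) be)))) (iota (a r) ga))"

context
 fixes U n a b lam nu y
 assumes F: "frame U n a b lam nu" and y: "y : U"
begin

lemmas fA3 = frameD(2)[OF F] and fB3 = frameD(3)[OF F]

definition "gam c p = nu y (sp c (a p) y)"

lemma yps_expand2:
 assumes "b' : GB" "c : GB" "e : GB"
 shows "yps b' c e y = (\<Sum>q<n. gam c q *\<^sub>R yps b' (b q) e y)"
 unfolding yps_def br_expand[OF F y GB_GE[OF assms(1)] assms(2) GB_GE[OF assms(3)]] gam_def
 using spBB[OF fB3 assms(3)] by simp

lemma yps_expand:
 assumes c: "c : GB" "c' : GB" "c'' : GB"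
 shows "yps c c' c'' y = (\<Sum>(p, q, r)\<in>I3 n. (gam c p * gam c' q * gam c'' r) *\<^sub>R yps (b p) (b q) (b r) y)"
proof -
 have 1: "yps c c' c'' y = (\<Sum>p<n. gam c p *\<^sub>R yps (b p) c' c'' y)" if c: "c : GB" "c' : GB" "c'' : GB" for c c' c''
 proof -
  have "yps c c' c'' y = yps c'' c c' y" using yps_cyc[OF c(3,1,2)] by simp
  also have "\<dots> = (\<Sum>p<n. gam c p *\<^sub>R yps c'' (b p) c' y)" by (rule yps_expand2[OF c(3,1,2)])
  also have "\<dots> = (\<Sum>p<n. gam c p *\<^sub>R yps (b p) c' c'' y)" using yps_cyc[OF c(3) fB3 c(2)] by simp
  finally show ?thesis .
 qed
 have 3: "yps (b p) (b q) c'' y = (\<Sum>r<n. gam c'' r *\<^sub>R yps (b p) (b q) (b r) y)" if "p < n" "q < n" for p q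
 proof -
  have "yps (b p) (b q) c'' y = yps c'' (b p) (b q) y" using yps_cyc[OF c(3) fB3[OF that(1)] fB3[OF that(2)]] by simp
  also have "\<dots> = (\<Sum>r<n. gam c'' r *\<^sub>R yps (b r) (b p) (b q) y)" by (rule 1[OF c(3) fB3[OF that(1)] fB3[OF that(2)]])
  also have "\<dots> = (\<Sum>r<n. gam c'' r *\<^sub>R yps (b p) (b q) (b r) y)" using yps_cyc[OF fB3 fB3[OF that(1)] fB3[OF that(2)]] by simp
  finally show ?thesis .
 qed
 show ?thesis unfolding sum_I3 1[OF c]
  by (intro sum.cong refl) (simp add: yps_expand2[OF fB3 c(2,3)] 3 scaleR_sum_right mult_ac)
qed

lemma ups_ofd: "al : Om 1 ==> be : Om 1 ==> ga : Om 1 ==> Upsilon C A B al be ga = yps (ofd al) (ofd be) (ofd ga)"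
 by (simp add: Upsilon_def yps_def ofd_def)

lemma represents_exists: "\<exists>ts. represents M A L (Upsilon C A B) y ts"
proof -
 \<comment> \<open>Ordered triples list every wedge of three frame elements six times, which the
   factor 1/6 undoes.\<close>
 define f where "f = (%(p, q, r). (%i::nat. (if i = 0 then a p y else if i = 1 then a q y else a r y, nu y),
  (1/6) *\<^sub>R yps (b p) (b q) (b r) y))"
 obtain xs where xs: "set xs = I3 n" "distinct xs" using finite_distinct_list[OF finite_I3] by blast
 define rep_list where "rep_list = map f xs"
 have "represents M A L (Upsilon C A B) y rep_list"
 unfolding represents_def
proof (intro conjI allI impI)
 show "\<forall>(t, l)\<in>set rep_list. (\<forall>i<3. t i : simple_tensors A L y) & l : fib L y"
  using GA_fib(1)[OF fA3] frameD(8)[OF F] sections_fib[OF vbL yps_GL[OF fB3 fB3 fB3]] subspace_scale[OF subspace_fib[OF vbL]]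
  by (auto simp: rep_list_def f_def xs I3_def simple_tensors_def)
 fix al :: "nat => 'm => 'e list => 'l" assume al: "\<forall>j<3. al j : Om 1"
 define c where "c j = ofd (al j)" for j
 have c: "c 0 : GB" "c 1 : GB" "c 2 : GB" unfolding c_def using al by (simp_all add: ofd_props(1))
 have val: "nu y (al j y [a p y]) = gam (c j) p" if "j < 3" "p < n" for j p
 proof -
  have "al j = td (c j)" unfolding c_def using ofd_props(2) al that by simp
  then show ?thesis using GA_fib(1)[OF fA3[OF that(2)]] by (simp add: td_apply gam_def spair_def)
 qed
 let ?T = "%i j k. \<Sum>(p, q, r)\<in>I3 n. (gam (c i) p * gam (c j) q * gam (c k) r) *\<^sub>R yps (b p) (b q) (b r) y"
 have "(\<Sum>(t, l)\<leftarrow>rep_list. (\<Sum>\<sigma> | \<sigma> permutes {..<3::nat}. of_int (sign \<sigma>) *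
       (\<Prod>i<3. snd (t i) (al (\<sigma> i) y [fst (t i)]))) *\<^sub>R l)
   = (\<Sum>(p, q, r)\<in>I3 n. (1/6 * (\<Sum>\<sigma> | \<sigma> permutes {..<3::nat}. of_int (sign \<sigma>) *
      (nu y (al (\<sigma> 0) y [a p y]) * nu y (al (\<sigma> 1) y [a q y]) * nu y (al (\<sigma> 2) y [a r y])))) *\<^sub>R yps (b p) (b q) (b r) y)"
  unfolding rep_list_def map_map sum.distinct_set_conv_list[OF xs(2), symmetric] xs(1)
  by (intro sum.cong refl) (auto simp: f_def prod3 mult.commute[of "1/6"])
 also have "\<dots> = (\<Sum>(p, q, r)\<in>I3 n. (1/6 * (gam (c 0) p * gam (c 1) q * gam (c 2) r - gam (c 0) p * gam (c 2) q * gam (c 1) r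
   - gam (c 1) p * gam (c 0) q * gam (c 2) r + gam (c 1) p * gam (c 2) q * gam (c 0) r
   + gam (c 2) p * gam (c 0) q * gam (c 1) r - gam (c 2) p * gam (c 1) q * gam (c 0) r)) *\<^sub>R yps (b p) (b q) (b r) y)"
  unfolding sum_perm3[of "%i j k. nu y (al i y [a _ y]) * nu y (al j y [a _ y]) * nu y (al k y [a _ y])"]
  by (intro sum.cong refl) (auto simp: I3_def val)
 also have "\<dots> = (1/6) *\<^sub>R (?T 0 1 2 - ?T 0 2 1 - ?T 1 0 2 + ?T 1 2 0 + ?T 2 0 1 - ?T 2 1 0)"
  by (simp add: scaleR_sum_right sum_subtractf[symmetric] sum.distrib[symmetric] split_def algebra_simps)
 also have "\<dots> = (1/6) *\<^sub>R (yps (c 0) (c 1) (c 2) y - yps (c 0) (c 2) (c 1) y - yps (c 1) (c 0) (c 2) y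
   + yps (c 1) (c 2) (c 0) y + yps (c 2) (c 0) (c 1) y - yps (c 2) (c 1) (c 0) y)"
  by (simp only: yps_expand[OF c(1,2,3)] yps_expand[OF c(1,3,2)] yps_expand[OF c(2,1,3)] yps_expand[OF c(2,3,1)] yps_expand[OF c(3,1,2)] yps_expand[OF c(3,2,1)])
 also have "\<dots> = yps (c 0) (c 1) (c 2) y"
  unfolding yps_skew(2)[OF c(1,2,3)] yps_skew(1)[OF c(1,2,3)] yps_skew(1)[OF c(2,3,1)] yps_cyc[OF c(1,2,3)]
   yps_cyc[OF c(3,1,2), symmetric] by (simp add: scaleR_2[symmetric] algebra_simps scaleR_add_left[symmetric])
 finally show "Upsilon C A B (al 0) (al 1) (al 2) y = (\<Sum>(t, l)\<leftarrow>rep_list. (\<Sum>\<sigma> | \<sigma> permutes {..<3::nat}. of_int (sign \<sigma>) *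
       (\<Prod>i<3. snd (t i) (al (\<sigma> i) y [fst (t i)]))) *\<^sub>R l)"
  using al by (simp add: ups_ofd c_def)
qed
 then show ?thesis by blast
qed

abbreviation "N p al \<equiv> nuf nu (iota (a p) al) y"

text \<open>The coefficients are the values of the simple tensor on the forms
  \<open>td (b p)\<close>. A representation of \<open>Upsilon\<close> is therefore seen only through
  its evaluation on one-forms, which \<open>represents\<close> fixes.\<close>

lemma sharp_expand:
 assumes al: "al : Om k" and t: "t : simple_tensors A L y"
 shows "sharp al y t = (%us. \<Sum>p<n. snd t (td (b p) y [fst t]) * N p al us)"
proof
 fix us
 obtain u f where t': "t = (u, f)" "u : fib A y" and f: "!!s s' c. s : fib L y ==> s' : fib L y ==> f (c *\<^sub>R s + s') = c * f s + f s'"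
  using t by (cases t) (auto simp: simple_tensors_def)
 have f0: "f 0 = 0" using f[OF fibL_zero fibL_zero, of 1] by simp
 have fl: "f l = nu y l * f (lam y)" if "l : fib L y" for l
  using frameD(6)[OF F y that] f[OF sections_fib[OF vbL frameD(4)[OF F], of y] fibL_zero, of "nu y l"] f0 by simp
 obtain Z where Z: "Z : GA" "Z y = u" using fb.fib_section[OF t'(2)] by blast
 let ?S = "%m. \<Sum>p<m. sc (%x. nu x (sp Z (b p) x)) (a p)"
 have io: "iota (?S m) al y = (\<Sum>p<m. nu y (sp Z (b p) y) *\<^sub>R iota (a p) al y) & ?S m : GA" if "m <= n" for m using that
 proof (induction m)
  case 0
  have "iota 0 al = 0" using fb.iota_clin[OF vbL al sections_zero[OF vbA] sections_zero[OF vbA], of "%_. 1"] Cinf_const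
   by (simp add: sc_zero sc_one)
  then have "iota 0 al y = 0" by simp
  then show ?case by (simp only: lessThan_0 sum.empty sections_zero[OF vbA] simp_thms)
 next
  case (Suc m)
  then have m: "m < n" by simp
  have IH: "?S m : GA" using Suc by simp
  have fC: "(%x. nu x (sp Z (b m) x)) : Cinf M" by (rule frameD(7)[OF F sp_sections[OF GA_GE[OF Z(1)] GB_GE[OF fB3[OF m]]]])
  have "iota (sc (%x. nu x (sp Z (b m) x)) (a m) + ?S m) al y = nu y (sp Z (b m) y) *\<^sub>R iota (a m) al y + iota (?S m) al y"
   unfolding fb.iota_clin[OF vbL al fA3[OF m] IH fC] by (simp add: sc_apply)
  moreover have "sc (%x. nu x (sp Z (b m) x)) (a m) + ?S m : GA"
   by (rule sections_add[OF vbA sections_sc[OF vbA fC fA3[OF m]] IH])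
  ultimately show ?case using Suc unfolding sum.lessThan_Suc by (simp only: Suc_leD add.commute simp_thms)
 qed
 have "Z y = ?S n y"
  using frameD(10)[OF F y, of u] t'(2) Z(2) by (simp add: sum_fun_apply sc_apply spair_def)
 then have "iota Z al y = iota (?S n) al y" by (rule fb.iota_pointwise[OF vbL])
 then have "iota Z al y us = (\<Sum>p<n. nu y (sp Z (b p) y) *\<^sub>R iota (a p) al y us)"
  using io[of n] by (simp add: sum_fun_apply scaleR_fun_apply)
 then have "al y (u # us) = (\<Sum>p<n. nu y (sp Z (b p) y) *\<^sub>R al y (a p y # us))"
  by (simp add: iota_def ins_def Z(2))
 note ex = this
 have "f (al y (u # us)) = (\<Sum>p<n. nu y (sp Z (b p) y) * nu y (al y (a p y # us))) * f (lam y)"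
  unfolding fl[OF Om_val[OF al], of "u # us"] unfolding ex using nu_sum[OF F, of "{..<n}" "%p. al y (a p y # us)" y] Om_val[OF al] by simp
 also have "\<dots> = (\<Sum>p<n. f (td (b p) y [u]) * N p al us)"
 proof -
  have "f (td (b p) y [u]) = nu y (sp Z (b p) y) * f (lam y)" if "p < n" for p
  proof -
   have "td (b p) y [u] = sp Z (b p) y"
    unfolding sp_sym[OF GA_GE[OF Z(1)] GB_GE[OF fB3[OF that]]] by (simp add: td_apply spair_def Z(2) t'(2))
   then show ?thesis using fl[OF Om_val[OF td_Om[OF fB3[OF that]]], of "[u]"] by (simp only:)
  qed
  then show ?thesis by (simp add: sum_distrib_left nuf_def iota_def ins_def mult_ac)
 qed
 finally show "sharp al y t us = (\<Sum>p<n. snd t (td (b p) y [fst t]) * N p al us)"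
  by (simp add: sharp_def t'(1))
qed

text \<open>Expanding all three sharps produces, for each triple of frame elements, the determinant
  through which the representation acts on the dual forms. Summed over the list it gives
  \<open>yps\<close>, whichever representation was chosen.\<close>

lemma sharp_apply_at:
 assumes al: "al : Om k" and be: "be : Om k'" and ga: "ga : Om k''"
 shows "sharp_apply M A L al be ga (Upsilon C A B) y = m3F n a b nu al be ga y"
proof
 fix us
 define ts where "ts = (SOME ts. represents M A L (Upsilon C A B) y ts)"
 have R: "represents M A L (Upsilon C A B) y ts" unfolding ts_def by (rule someI_ex[OF represents_exists])
 let ?W = "%p q r. alt_wedge (N p al) (alt_wedge (N q be) (N r ga)) us"
 define X where "X t i p = snd (t i) (td (b p) y [fst (t i)])" for t :: "nat => 'e \<times> ('l => real)" and i p
 define D where "D t p q r = X t 0 p * X t 1 q * X t 2 r - X t 0 p * X t 2 q * X t 1 r - X t 1 p * X t 0 q * X t 2 r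
   + X t 1 p * X t 2 q * X t 0 r + X t 2 p * X t 0 q * X t 1 r - X t 2 p * X t 1 q * X t 0 r" for t p q r
 have sw: "sharp_wedge3 al be ga y t us = (\<Sum>(p, q, r)\<in>I3 n. D t p q r * ?W p q r)" if "!!i. i < 3 ==> t i : simple_tensors A L y" for t
 proof -
  have lin: "alt_wedge (%us. \<Sum>p<n. x p * f p us) g = (%us. \<Sum>p<n. x p * alt_wedge (f p) g us)"
   "alt_wedge g (%us. \<Sum>p<n. x p * f p us) = (%us. \<Sum>p<n. x p * alt_wedge g (f p) us)" for x f and g :: "'e list => real"
   by (rule ext, simp add: alt_wedge_def sum_distrib_left sum_distrib_right sum.swap[of _ "{..<n}"] mult_ac)+
  have "alt_wedge (sharp al y (t i)) (alt_wedge (sharp be y (t j)) (sharp ga y (t k))) us = (\<Sum>(p, q, r)\<in>I3 n. (X t i p * X t j q * X t k r) * ?W p q r)"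
   if "i < 3" "j < 3" "k < 3" for i j k
   unfolding sharp_expand[OF al \<open>!!i. i < 3 ==> t i : _\<close>[OF that(1)]] sharp_expand[OF be \<open>!!i. i < 3 ==> t i : _\<close>[OF that(2)]]
    sharp_expand[OF ga \<open>!!i. i < 3 ==> t i : _\<close>[OF that(3)]] lin X_def[symmetric] sum_I3
   by (simp add: sum_distrib_left mult_ac)
  then show ?thesis
   unfolding sharp_wedge3_def sum_perm3[of "%i j k. alt_wedge (sharp al y (t i)) (alt_wedge (sharp be y (t j)) (sharp ga y (t k))) us"]
   by (simp add: sum_subtractf[symmetric] sum.distrib[symmetric] split_def D_def left_diff_distrib distrib_right)
 qed
 have up: "yps (b p) (b q) (b r) y = (\<Sum>(t, l)\<leftarrow>ts. D t p q r *\<^sub>R l)" if pq: "p < n" "q < n" "r < n" for p q r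
 proof -
  define c where "c j = (if j = 0 then b p else if j = 1 then b q else b r)" for j :: nat
  have c: "!!j. c j : GB" using fB3 pq by (simp add: c_def)
  have "Upsilon C A B (td (c 0)) (td (c 1)) (td (c 2)) y = (\<Sum>(t, l)\<leftarrow>ts. (\<Sum>\<sigma> | \<sigma> permutes {..<3::nat}. of_int (sign \<sigma>) *
       (\<Prod>i<3. snd (t i) (td (c (\<sigma> i)) y [fst (t i)]))) *\<^sub>R l)"
   using R td_Om[OF c] unfolding represents_def by (elim conjE allE[of _ "%j. td (c j)"]) simp
  also have "\<dots> = (\<Sum>(t, l)\<leftarrow>ts. D t p q r *\<^sub>R l)"
   unfolding prod3 sum_perm3[of "%i j k. snd (_ 0) (td (c i) y [fst (_ 0)]) * snd (_ 1) (td (c j) y [fst (_ 1)]) * snd (_ 2) (td (c k) y [fst (_ 2)])"]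
   by (rule arg_cong[of _ _ sum_list], rule map_cong[OF refl]) (auto simp: D_def X_def c_def algebra_simps)
  finally show ?thesis unfolding ups_ofd[OF td_Om[OF c] td_Om[OF c] td_Om[OF c]] ofd_td[OF c] by (simp add: c_def)
 qed
 have st: "t i : simple_tensors A L y" if "(t, l) : set ts" "i < 3" for t l i
  using R that unfolding represents_def by fast
 have "sharp_apply M A L al be ga (Upsilon C A B) y us = (\<Sum>(t, l)\<leftarrow>ts. sharp_wedge3 al be ga y t us *\<^sub>R l)"
  unfolding sharp_apply_def ts_def ..
 also have "\<dots> = (\<Sum>z\<leftarrow>ts. \<Sum>(p, q, r)\<in>I3 n. ?W p q r *\<^sub>R (D (fst z) p q r *\<^sub>R snd z))"
  by (rule arg_cong[of _ _ sum_list], rule map_cong[OF refl])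
    (auto simp: sw st scaleR_sum_left split_def mult.commute)
 also have "\<dots> = (\<Sum>(p, q, r)\<in>I3 n. ?W p q r *\<^sub>R yps (b p) (b q) (b r) y)"
  unfolding sum_list_swap split_def
 proof (rule sum.cong[OF refl])
  fix z assume "z : I3 n"
  then have z: "fst z < n" "fst (snd z) < n" "snd (snd z) < n" by (auto simp: I3_def)
  have s: "(\<Sum>t\<leftarrow>ts. c *\<^sub>R G t) = c *\<^sub>R (\<Sum>t\<leftarrow>ts. G t)" for c and G :: "_ => 'l" by (induction ts) (simp_all add: scaleR_add_right)
  show "(\<Sum>t\<leftarrow>ts. ?W (fst z) (fst (snd z)) (snd (snd z)) *\<^sub>R D (fst t) (fst z) (fst (snd z)) (snd (snd z)) *\<^sub>R snd t)
   = ?W (fst z) (fst (snd z)) (snd (snd z)) *\<^sub>R yps (b (fst z)) (b (fst (snd z))) (b (snd (snd z))) y"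
   unfolding s up[OF z] split_def ..
 qed
 also have "\<dots> = m3F n a b nu al be ga y us"
  unfolding m3F_def sum_fun_apply
 proof (rule sum.cong[OF refl])
  fix z assume "z : I3 n"
  then obtain p q r where z: "z = (p, q, r)" "p < n" "q < n" "r < n" by (auto simp: I3_def)
  note ig = fb.iota_Omega[OF ga fA3[OF z(4)]]
  let ?o = "wedge (nuf nu (iota (a p) al)) (nuf nu (iota (a q) be))" and ?Y = "yps (b p) (b q) (b r) y"
  have "nuf nu (wedge ?o (iota (a r) ga)) y us *\<^sub>R ?Y = nu y ?Y *\<^sub>R wedge ?o (iota (a r) ga) y us"
   by (subst nuf_def) (rule nu_swap[OF F y Om_val[OF fb.wedge_Omega[OF vbL fb.wedge_Omega[OF fb.tl nuf_Om[OF F fb.iota_Omega[OF al fA3[OF z(2)]]]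
     nuf_Om[OF F fb.iota_Omega[OF be fA3[OF z(3)]]]] ig]] sections_fib[OF vbL yps_GL[OF fB3[OF z(2)] fB3[OF z(3)] fB3[OF z(4)]]]])
  moreover have "nuf nu (wedge ?o (iota (a r) ga)) y us = ?W p q r"
   unfolding nuf_wedge[OF F ig] unfolding wedge_assoc by (simp add: wedge_at)
  ultimately show "(case z of (p, q, r) => ?W p q r *\<^sub>R yps (b p) (b q) (b r) y) =
   (case z of (p, q, r) => wedge (sc (%x. nu x (yps (b p) (b q) (b r) x)) (wedge (nuf nu (iota (a p) al)) (nuf nu (iota (a q) be)))) (iota (a r) ga)) y us"
   by (simp add: z(1) wedge_sc_left scaleR_fun_apply)
 qed
 finally show "sharp_apply M A L al be ga (Upsilon C A B) y us = m3F n a b nu al be ga y us" .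
qed

lemma m3F_dr:
 assumes al: "al : Om k" and be: "be : Om k'"
 shows "dr (k + k' - 3) (m3F n a b nu al be)"
proof -
 have w: "sc (%x. nu x (yps (b p) (b q) (b r) x)) (wedge (nuf nu (iota (a p) al)) (nuf nu (iota (a q) be))) : Om0 (k - 1 + (k' - 1))"
  if "p < n" "q < n" "r < n" for p q r
  by (intro fb.Omega_sc[OF fb.tl] frameD(7)[OF F] yps_GL fb.wedge_Omega[OF fb.tl] nuf_Om[OF F] fb.iota_Omega al be fA3 fB3 that)
 have e: "k - 1 + (k' - 1) + - 1 = k + k' - 3" by simp
 show ?thesis unfolding m3F_def
  by (rule dr_sumS[OF finite_I3]) (auto simp: I3_def intro!: dr_wedge[OF dr_iota[OF fA3] w, unfolded e])
qed

text \<open>Contraction lowers each degree by 1, and the skew-symmetry of \<open>yps\<close>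
  contributes one further sign; this explains the exponent.\<close>

lemma m3F_sym:
 assumes al: "al : Om k" and be: "be : Om k'" and ga: "ga : Om k''"
 shows "m3F n a b nu al be ga y = psign ((k - 1) * (k' - 1) + 1) *\<^sub>R m3F n a b nu be al ga y"
  "m3F n a b nu al be ga y = psign ((k' - 1) * (k'' - 1) + 1) *\<^sub>R m3F n a b nu al ga be y"
proof -
 let ?T = "%al be ga p q r. nu y (yps (b p) (b q) (b r) y) *\<^sub>R wedge (wedge (nuf nu (iota (a p) al)) (nuf nu (iota (a q) be))) (iota (a r) ga) y"
 have m: "m3F n a b nu al be ga y = (\<Sum>p<n. \<Sum>q<n. \<Sum>r<n. ?T al be ga p q r)" for al be ga
  unfolding m3F_def sum_I3[symmetric] by (simp add: sum_fun_apply split_def wedge_sc_left)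
 have nm: "nu y (- yps (b p) (b q) (b r) y) = - nu y (yps (b p) (b q) (b r) y)" if "p < n" "q < n" "r < n" for p q r
  using frame_nu(2)[OF F sections_fib[OF vbL yps_GL[OF fB3[OF that(1)] fB3[OF that(2)] fB3[OF that(3)]]], of y "- 1"] by simp
 have 1: "?T al be ga p q r = psign ((k - 1) * (k' - 1) + 1) *\<^sub>R ?T be al ga q p r" if pq: "p < n" "q < n" "r < n" for p q r
 proof -
  have "wedge (nuf nu (iota (a p) al)) (nuf nu (iota (a q) be)) = psign ((k - 1) * (k' - 1)) *\<^sub>R wedge (nuf nu (iota (a q) be)) (nuf nu (iota (a p) al))"
   by (rule fb.wedge_comm[OF nuf_Om[OF F fb.iota_Omega[OF al fA3[OF pq(1)]]] nuf_Om[OF F fb.iota_Omega[OF be fA3[OF pq(2)]]]])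
  then show ?thesis using yps_skew(1)[OF fB3[OF pq(1)] fB3[OF pq(2)] fB3[OF pq(3)]] nm[OF pq]
   by (simp only: wedge_scale_left scaleR_fun_apply psign_add psign_simps uminus_apply scaleR_scaleR) (simp only: mult_ac minus_minus minus_mult_minus mult_minus_left mult_minus_right mult_1_left mult_1_right)
 qed
 show "m3F n a b nu al be ga y = psign ((k - 1) * (k' - 1) + 1) *\<^sub>R m3F n a b nu be al ga y"
  unfolding m scaleR_sum_right sum.swap[of "%p q. \<Sum>r<n. psign _ *\<^sub>R ?T be al ga p q r"]
  by (intro sum.cong refl 1) simp_all
 have 2: "?T al be ga p q r = psign ((k' - 1) * (k'' - 1) + 1) *\<^sub>R ?T al ga be p r q" if pq: "p < n" "q < n" "r < n" for p q r
 proof -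
  have "wedge (nuf nu (iota (a q) be)) (iota (a r) ga) y = psign ((k' - 1) * (k'' - 1)) *\<^sub>R wedge (nuf nu (iota (a r) ga)) (iota (a q) be) y"
   by (rule nuf_swap[OF F y fb.iota_Omega[OF be fA3[OF pq(2)]] fb.iota_Omega[OF ga fA3[OF pq(3)]]])
  also have "\<dots> = (psign ((k' - 1) * (k'' - 1)) *\<^sub>R wedge (nuf nu (iota (a r) ga)) (iota (a q) be)) y" by (simp only: scaleR_fun_apply)
  finally have "wedge (nuf nu (iota (a p) al)) (wedge (nuf nu (iota (a q) be)) (iota (a r) ga)) y
   = wedge (nuf nu (iota (a p) al)) (psign ((k' - 1) * (k'' - 1)) *\<^sub>R wedge (nuf nu (iota (a r) ga)) (iota (a q) be)) y"
   by (simp only: wedge_at[of "nuf nu (iota (a p) al)"])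
  then show ?thesis using yps_skew(2)[OF fB3[OF pq(1)] fB3[OF pq(2)] fB3[OF pq(3)]] nm[OF pq]
   by (simp only: wedge_assoc wedge_scale_right scaleR_fun_apply psign_add psign_simps uminus_apply scaleR_scaleR) (simp only: mult_ac minus_minus minus_mult_minus mult_minus_left mult_minus_right mult_1_left mult_1_right)
 qed
 show "m3F n a b nu al be ga y = psign ((k' - 1) * (k'' - 1) + 1) *\<^sub>R m3F n a b nu al ga be y"
  unfolding m scaleR_sum_right
  by (rule sum.cong[OF refl], rule trans[OF _ sum.swap]) (intro sum.cong refl 2, simp_all)
qed

lemma m3F_gen:
 assumes c: "c : GB" "c' : GB" "c'' : GB"
 shows "m3F n a b nu (td c) (td c') (td c'') y = form0 (yps c c' c'') y"
proof
 fix vs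
 have N: "nuf nu (iota (a p) (td c)) = form0 (%x. nu x (sp c (a p) x))" if "p < n" "c : GB" for p c
  unfolding iota_td[OF GB_GE[OF that(2)] fA3[OF that(1)]] nuf_form0[OF F] ..
 have "m3F n a b nu (td c) (td c') (td c'') y vs = (\<Sum>z\<in>I3 n. if vs = [] then (case z of (p, q, r) => (gam c p * gam c' q * gam c'' r) *\<^sub>R yps (b p) (b q) (b r) y) else 0)"
  unfolding m3F_def sum_fun_apply
 proof (rule sum.cong[OF refl])
  fix z assume "z : I3 n"
  then obtain p q r where z: "z = (p, q, r)" "p < n" "q < n" "r < n" by (auto simp: I3_def)
  have "nu y (yps (b p) (b q) (b r) y) *\<^sub>R sp c'' (a r) y = gam c'' r *\<^sub>R yps (b p) (b q) (b r) y"
   unfolding gam_def by (rule nu_swap[OF F y sections_fib[OF vbL yps_GL[OF fB3[OF z(2)] fB3[OF z(3)] fB3[OF z(4)]]]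
    sections_fib[OF vbL sp_sections[OF GB_GE[OF c(3)] GA_GE[OF fA3[OF z(4)]]]]])
  then have "nu y (yps (b p) (b q) (b r) y) *\<^sub>R (gam c p *\<^sub>R (gam c' q *\<^sub>R sp c'' (a r) y)) = (gam c p * gam c' q * gam c'' r) *\<^sub>R yps (b p) (b q) (b r) y"
   by (metis scaleR_left_commute scaleR_scaleR)
  then show "(case z of (p, q, r) => wedge (sc (%x. nu x (yps (b p) (b q) (b r) x)) (wedge (nuf nu (iota (a p) (td c))) (nuf nu (iota (a q) (td c'))))) (iota (a r) (td c''))) y vs
   = (if vs = [] then (case z of (p, q, r) => (gam c p * gam c' q * gam c'' r) *\<^sub>R yps (b p) (b q) (b r) y) else 0)"
   by (simp only: z(1) prod.case wedge_sc_left scaleR_fun_apply wedge_assoc N[OF z(2) c(1)] N[OF z(3) c(2)] fb.wedge_form0 sc_apply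
    iota_td[OF GB_GE[OF c(3)] fA3[OF z(4)]]) (cases "vs = []"; simp add: form0_def gam_def del: scaleR_scaleR)
 qed
 then show "m3F n a b nu (td c) (td c') (td c'') y vs = form0 (yps c c' c'') y vs"
  unfolding yps_expand[OF c] form0_def by (cases "vs = []") simp_all
qed

end

text \<open>The operator \<open>sg\<close> inserts the sign given by the degree of \<open>be\<close>
  without naming that degree, so that the bracket is a function of the forms alone.\<close>

definition "M3 al be ga = - sharp_apply M A L al (sg be) ga (Upsilon C A B)"

lemma m3F_scale: "m3F n a b nu al (c *\<^sub>R be) ga = c *\<^sub>R m3F n a b nu al be ga" if F: "frame U n a b lam nu" and be: "be : Om k"
proof -
 have N: "nuf nu (iota (a q) (c *\<^sub>R be)) = c *\<^sub>R nuf nu (iota (a q) be)" if "q < n" for q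
  unfolding iota_scale by (rule nuf_scale[OF F fb.iota_Omega[OF be frameD(2)[OF F that]]])
 have sc: "sc f (c *\<^sub>R om) = c *\<^sub>R sc f om" for f and om :: "'m => 'e list => real"
  by (rule ext) (simp only: sc_apply scaleR_fun_apply scaleR_left_commute)
 show ?thesis unfolding m3F_def scaleR_sum_right
 proof (rule sum.cong[OF refl])
  fix z assume "z : I3 n"
  then obtain p q r where z: "z = (p, q, r)" "q < n" by (auto simp: I3_def)
  show "(case z of (p, q, r) => wedge (sc (%x. nu x (yps (b p) (b q) (b r) x)) (wedge (nuf nu (iota (a p) al)) (nuf nu (iota (a q) (c *\<^sub>R be))))) (iota (a r) ga))
   = c *\<^sub>R (case z of (p, q, r) => wedge (sc (%x. nu x (yps (b p) (b q) (b r) x)) (wedge (nuf nu (iota (a p) al)) (nuf nu (iota (a q) be)))) (iota (a r) ga))"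
   by (simp only: z(1) prod.case N[OF z(2)] wedge_scale_right sc wedge_scale_left)
 qed
qed

lemma M3_at:
 assumes F: "frame U n a b lam nu" "y : U" and al: "al : Om k" and be: "be : Om k'" and ga: "ga : Om k''"
 shows "M3 al be ga y = - psign k' *\<^sub>R m3F n a b nu al be ga y"
 unfolding M3_def by (simp only: uminus_apply fb.sg_Omega[OF be] sharp_apply_at[OF F al fb.Omega_scale[OF vbL be] ga]
  m3F_scale[OF F(1) be] scaleR_fun_apply scaleR_minus_left)

lemma M3_sharp:
 assumes al: "al : Om k" and be: "be : Om k'" and ga: "ga : Om k''"
 shows "M3 al be ga = - (psign k' *\<^sub>R sharp_apply M A L al be ga (Upsilon C A B))"
proof
 fix y
 obtain U n a b lam nu where F: "y : U" "frame U n a b lam nu" using frame_exists[of y] by blast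
 show "M3 al be ga y = (- (psign k' *\<^sub>R sharp_apply M A L al be ga (Upsilon C A B))) y"
  by (simp only: M3_at[OF F(2,1) assms] uminus_apply scaleR_fun_apply sharp_apply_at[OF F(2,1) assms] scaleR_minus_left)
qed

lemma M3_sym:
 assumes al: "al : Om k" and be: "be : Om k'" and ga: "ga : Om k''"
 shows "M3 al be ga = psign (k * k') *\<^sub>R M3 be al ga" "M3 al be ga = psign (k' * k'') *\<^sub>R M3 al ga be"
proof -
 have "M3 al be ga y = (psign (k * k') *\<^sub>R M3 be al ga) y & M3 al be ga y = (psign (k' * k'') *\<^sub>R M3 al ga be) y" for y
 proof -
  obtain U n a b lam nu where F: "y : U" "frame U n a b lam nu" using frame_exists[of y] by blast
  \<comment> \<open>The sign in the definition of \<open>M3\<close> is exactly the one that turns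
    the shifted skew-symmetry of \<open>m3F\<close> into graded symmetry in form degrees.\<close>
  have e: "- psign k' * psign ((k - 1) * (k' - 1) + 1) = psign (k * k') * - psign k"
   "- psign k' * psign ((k' - 1) * (k'' - 1) + 1) = psign (k' * k'') * - psign k''"
   by (auto simp: psign_def)
  have "M3 al be ga y = (psign (k * k') *\<^sub>R M3 be al ga) y"
   by (simp only: scaleR_fun_apply M3_at[OF F(2,1) al be ga] M3_at[OF F(2,1) be al ga] m3F_sym(1)[OF F(2,1) al be ga] scaleR_scaleR e)
  moreover have "M3 al be ga y = (psign (k' * k'') *\<^sub>R M3 al ga be) y"
   by (simp only: scaleR_fun_apply M3_at[OF F(2,1) al be ga] M3_at[OF F(2,1) al ga be] m3F_sym(2)[OF F(2,1) al be ga] scaleR_scaleR e)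
  ultimately show ?thesis ..
 qed
 then show "M3 al be ga = psign (k * k') *\<^sub>R M3 be al ga" "M3 al be ga = psign (k' * k'') *\<^sub>R M3 al ga be" by blast+
qed

lemma M3_form0: "al : Om k ==> be : Om k' ==> s : GL ==> M3 al be (form0 s) = 0"
proof
 fix y assume a: "al : Om k" "be : Om k'" "s : GL"
 obtain U n a b lam nu where F: "y : U" "frame U n a b lam nu" using frame_exists[of y] by blast
 have "m3F n a b nu al be (form0 s) = 0" unfolding m3F_def by (rule sum.neutral) (auto simp: fb.iota_form0 wedge_zero_right)
 then show "M3 al be (form0 s) y = 0 y" by (simp only: M3_at[OF F(2,1) a(1,2) form0_Om[OF a(3)]] zero_fun_apply scaleR_zero_right)
qed

lemma M3_td: "b : GB ==> c : GB ==> e : GB ==> M3 (td b) (td c) (td e) = form0 (yps b c e)"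
proof
 fix y assume a: "b : GB" "c : GB" "e : GB"
 obtain U n a b' lam nu where F: "y : U" "frame U n a b' lam nu" using frame_exists[of y] by blast
 show "M3 (td b) (td c) (td e) y = form0 (yps b c e) y"
  by (simp only: M3_at[OF F(2,1) td_Om[OF a(1)] td_Om[OF a(2)] td_Om[OF a(3)]] m3F_gen[OF F(2,1) a] psign_simps minus_minus scaleR_one)
qed

lemma M3_dr:
 assumes al: "al : Om k" and be: "be : Om k'"
 shows "dr (k + k' - 3) (M3 al be)"
proof -
 \<comment> \<open>\<open>M3\<close> is globally defined from the start, but its derivation property
   is visible only in frames; the local formulas are glued to recover it.\<close>
 let ?X = "%x ga. - psign k' *\<^sub>R (case FR x of (U, n, a, b, lam, nu) => m3F n a b nu al be) ga"
 have "dr (k + k' - 3) (?X x)" for x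
 proof -
  obtain V n a b lam nu where e: "FR x = (V, n, a, b, lam, nu)" by (cases "FR x")
  then have F: "frame V n a b lam nu" "x : V" using FR[of x] by simp_all
  show ?thesis unfolding e prod.case by (rule dr_smult[OF m3F_dr[OF F al be]])
 qed
 then obtain Y where Y: "!!x. der M A L (k + k' - 3) (Y x) (?X x)" by metis
 define U where "U x = fst (FR x)" for x
 have U: "open (U x)" "x : U x" for x using FR[of x] frameD(1) by (auto simp: U_def split: prod.splits)
 have g: "?X x ga y = M3 al be ga y" if yx: "y : U x" and ga: "ga : Om q" for x y ga q
 proof -
  obtain V n a b lam nu where e: "FR x = (V, n, a, b, lam, nu)" by (cases "FR x")
  then have F: "frame V n a b lam nu" "y : V" using FR[of x] yx by (simp_all add: U_def)
  show ?thesis by (simp only: e prod.case scaleR_fun_apply M3_at[OF F al be ga])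
 qed
 have "der M A L (k + k' - 3) (%om y. Y y om y) (%ga y. ?X y ga y)"
  by (rule fb.der_glue(1)[OF lineL Y U]) (simp_all only: g[OF _ form0_Om] g U)
 then have "dr (k + k' - 3) (%ga y. ?X y ga y)" by blast
 then show ?thesis by (rule dr_cong) (rule ext, simp only: g U)
qed

end

section \<open>The Jacobi relations on generators\<close>

locale dj = lag M C A B for M :: "('m::{t2_space,second_countable_topology}, 'b::euclidean_space) manifold"
  and C :: "('m, 'e::real_vector, 'l::real_vector) cj_data" and A B :: "('m, 'e) vbundle" +
 assumes inv: "involutive M C A"
begin

lemma br_GA: "Z : GA ==> W : GA ==> br Z W : GA"
 using inv unfolding involutive_def by blast

lemma K_A: "Z : GA ==> W : GA ==> K Z W = br Z W"
 unfolding K_def by (rule prA_GA_id[OF br_GA])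

lemma rep: "rep_data M A L K sig nab" "rep_data M A trivial_line K sig sig"
proof -
 have sk: "K Z W = - K W Z" if "Z : GA" "W : GA" for Z W
  unfolding K_A[OF that] K_A[OF that(2,1)] by (rule br_skew[OF GA_GE[OF that(1)] GA_GE[OF that(2)] spAA[OF that]])
 show "rep_data M A L K sig nab" unfolding rep_data_def
  by (intro conjI ballI K_lie sk sig_lin nab_lin_left GA_GE)
 show "rep_data M A trivial_line K sig sig" unfolding rep_data_def sections_trivial_line
  by (intro conjI ballI K_lie sk sig_lin GA_GE)
qed

abbreviation "dL \<equiv> dop M A K nab"

lemma dL_dr: "dr 1 dL"
 using fb.dd_der[OF vbL rep(2,1)] by blast

lemmas dL_Om = drD(1)[OF dL_dr] and iota_dL = fb.iota_dd[OF vbL rep(1)]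

lemma C1p: "e1 : GE ==> e2 : GE ==> e3 : GE ==> nab e1 (sp e2 e3) x = sp (br e1 e2) e3 x + sp e2 (br e1 e3) x"
 using fun_cong[OF C1[of e1 e2 e3], of x] by simp

lemma C2p: "e1 : GE ==> e2 : GE ==> e3 : GE ==> sp e1 (br e2 e3) x + sp e1 (br e3 e2) x = nab e1 (sp e2 e3) x"
 using fun_cong[OF C2[of e1 e2 e3], of x] by simp

lemma lodp: "e1 : GE ==> e2 : GE ==> e3 : GE ==> t : GE ==>
  sp (br e1 (br e2 e3)) t x = sp (br (br e1 e2) e3) t x + sp (br e2 (br e1 e3)) t x"
proof -
 assume a: "e1 : GE" "e2 : GE" "e3 : GE" "t : GE"
 show ?thesis
  unfolding loday[OF a(1,2,3)] sp_lin(3)[OF br_sections[OF br_sections[OF a(1,2)] a(3)] br_sections[OF a(2) br_sections[OF a(1,3)]] a(4)]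
  by simp
qed

lemma prE: "e : GE ==> prA e : GE" "e : GE ==> prB e : GE"
 by (simp_all add: GA_GE GB_GE prA_GA prB_GB)

lemma sp_split:
 assumes "e : GE" "t : GE"
 shows "sp t e x = sp t (prA e) x + sp t (prB e) x"
proof -
 have "sp t e = sp t (prA e + prB e)" using pr_sum[OF assms(1)] by simp
 then show ?thesis unfolding sp_lin(4)[OF prE(1)[OF assms(1)] prE(2)[OF assms(1)] assms(2)] by simp
qed

lemma br_split:
 assumes "c : GE" "e : GE" "t : GE"
 shows "sp (br c e) t x = sp (br c (prA e)) t x + sp (br c (prB e)) t x"
proof -
 note p = prE[OF assms(2)]
 have "br c e = br c (prA e) + br c (prB e)" unfolding br_add(2)[OF p assms(1), symmetric] using pr_sum[OF assms(2)] by simp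
 then show ?thesis using sp_lin(3)[OF br_sections[OF assms(1) p(1)] br_sections[OF assms(1) p(2)] assms(3)] by simp
qed

lemma nab_split: "e : GE ==> s : GL ==> nab e s x = nab (prA e) s x + nab (prB e) s x"
 using nab_lin_left[OF prE(1) prE(2), of e e s "%_. 1"] pr_sum[of e] by (simp add: sc_one)

lemma iota_d0: "Z : GA ==> s : GL ==> iota Z (dL (form0 s)) = form0 (nab Z s)"
 unfolding iota_dL[OF form0_Om] fb.iota_form0 Lop_form0[OF GA_GE] drD(5)[OF dL_dr] by simp

lemma Lop_td_A:
 assumes "Z : GA" "e : GE"
 shows "Lop Z (td e) = td (br Z e)"
proof (rule ext, rule Om1_eqI[OF Lop_Om[OF GA_GE[OF assms(1)] td_Omega[OF assms(2)]] td_Omega[OF br_sections[OF GA_GE[OF assms(1)] assms(2)]]])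
 fix x W assume W: "W : GA"
 show "ev (Lop Z (td e)) [W] x = ev (td (br Z e)) [W] x"
  unfolding Lop_td[OF GA_GE[OF assms(1)] assms(2) W] ev_td[OF W] K_A[OF assms(1) W]
  using C1p[OF GA_GE[OF assms(1)] assms(2) GA_GE[OF W]] by simp
qed

text \<open>By Cartan's formula this is \<open>td (br Z e)\<close> minus the differential of
  \<open>sp e Z\<close>, and \<open>C2\<close> says that subtracting that gradient reverses the
  order of the bracket with a minus sign.\<close>

lemma iota_dtd:
 assumes "e : GE" "Z : GA"
 shows "iota Z (dL (td e)) = - td (br e Z)"
proof -
 note Z = GA_GE[OF assms(2)] and t = td_Omega[OF assms(1)]
 have 1: "iota Z (dL (td e)) : Om 1" using fb.iota_Omega[OF dL_Om[OF t] assms(2)] by simp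
 show ?thesis
 proof (rule ext, rule Om1_eqI[OF 1 fb.Omega_uminus[OF vbL td_Omega[OF br_sections[OF assms(1) Z]]]])
  fix x W assume W: "W : GA"
  have "ev (dL (form0 (sp e Z))) [W] = nab W (sp e Z)"
   unfolding ev_Cons iota_d0[OF W sp_sections[OF assms(1) Z]] by (rule fb.ev_form0)
  then show "ev (iota Z (dL (td e))) [W] x = ev (- td (br e Z)) [W] x"
   unfolding iota_dL[OF t assms(2)] iota_td[OF assms] Lop_td_A[OF assms(2,1)] ev_diff ev_uminus ev_td[OF W]
   using C2p[OF GA_GE[OF W] assms(1) Z, of x] sp_sym[OF GA_GE[OF W] br_sections[OF assms(1) Z]] sp_sym[OF GA_GE[OF W] br_sections[OF Z assms(1)]]
   by (simp add: algebra_simps)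
 qed
qed

lemma ev_dtd: "e : GE ==> Z : GA ==> W : GA ==> ev (dL (td e)) [Z, W] x = - sp (br e Z) W x"
 unfolding ev_Cons[of _ Z] iota_dtd ev_uminus ev_td by simp

lemma form_zeroI:
 assumes "al : Om (int n)" "!!ss x. length ss = n ==> set ss <= GA ==> ev al ss x = 0"
 shows "al = 0"
 by (rule fb.form_eqI[OF assms(1) fb.Omega_zero[OF vbL]]) (use assms(2) in \<open>simp add: ev_zero fun_eq_iff\<close>)

lemma form1_zeroI: "al : Om 1 ==> (!!Z x. Z : GA ==> ev al [Z] x = 0) ==> al = 0"
 by (rule form_zeroI[of _ 1]) (auto simp: length_Suc_conv)

lemma form2_zeroI: "al : Om 2 ==> (!!Z W x. Z : GA ==> W : GA ==> ev al [Z, W] x = 0) ==> al = 0"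
 by (rule form_zeroI[of _ 2]) (auto simp: length_Suc_conv numeral_2_eq_2)

lemma form3_zeroI: "al : Om 3 ==> (!!Z W X x. Z : GA ==> W : GA ==> X : GA ==> ev al [Z, W, X] x = 0) ==> al = 0"
 by (rule form_zeroI[of _ 3]) (auto simp: length_Suc_conv numeral_3_eq_3)

text \<open>Evaluated on two sections of \<open>A\<close> this is flatness of
  \<open>nabla\<close>.\<close>

lemma J1s:
 assumes s: "s : GL"
 shows "dL (dL (form0 s)) = 0"
proof (rule form2_zeroI)
 note d = dL_Om[OF form0_Om[OF s], simplified]
 show "dL (dL (form0 s)) : Om 2" using dL_Om[OF d] by simp
 fix Z W x assume Z: "Z : GA" and W: "W : GA"
 note ZE = GA_GE[OF Z] and WE = GA_GE[OF W]
 have "ev (dL (dL (form0 s))) [Z, W] = nab Z (nab W s) - nab (br Z W) s - nab W (nab Z s)"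
  unfolding ev_Cons iota_dL[OF d Z] iota_d0[OF Z s] iota_diff iota_Lop[OF ZE d W] iota_d0[OF W s] K_A[OF Z W]
   iota_d0[OF br_GA[OF Z W] s] iota_d0[OF W nab_sections[OF ZE s]] Lop_form0[OF ZE nab_sections[OF WE s]] ev_diff fb.ev_form0 ..
 then show "ev (dL (dL (form0 s))) [Z, W] x = 0" unfolding nab_br[OF ZE WE s] by simp
qed

text \<open>Evaluated on three sections of \<open>A\<close>, the three iterated brackets of
  \<open>e\<close>, \<open>Z\<close>, \<open>W\<close> combine to the Loday identity paired with
  \<open>X\<close>.\<close>

lemma J1b:
 assumes e: "e : GE"
 shows "dL (dL (td e)) = 0"
proof (rule form3_zeroI)
 note d = dL_Om[OF td_Omega[OF e], simplified]
 show "dL (dL (td e)) : Om 3" using dL_Om[OF d] by simp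
 fix Z W X x assume Z: "Z : GA" and W: "W : GA" and X: "X : GA"
 note ZE = GA_GE[OF Z] and WE = GA_GE[OF W]
 note eZ = br_sections[OF e ZE] and eW = br_sections[OF e WE]
 have "iota W (Lop Z (dL (td e))) = - td (br Z (br e W)) + td (br e (br Z W))"
  unfolding iota_Lop[OF ZE d W] iota_dtd[OF e W] K_A[OF Z W] iota_dtd[OF e br_GA[OF Z W]] drD(4)[OF dr_Lop[OF ZE] td_Omega[OF eW]]
   Lop_td_A[OF Z eW] by simp
 then have "ev (dL (dL (td e))) [Z, W, X] = - sp (br Z (br e W)) X + sp (br e (br Z W)) X - sp (br (br e Z) W) X"
  unfolding ev_Cons[of _ Z] ev_Cons[of _ W] iota_dL[OF d Z] iota_dtd[OF e Z] drD(4)[OF dL_dr td_Omega[OF eZ]] iota_diff iota_uminus iota_dtd[OF eZ W]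
  by (simp only: ev_diff ev_add ev_uminus ev_td[OF X] minus_minus)
 then show "ev (dL (dL (td e))) [Z, W, X] x = 0"
  using lodp[OF e ZE WE GA_GE[OF X], of x] by simp
qed

definition "vB s = ofd (dL (form0 s))"

lemma vB:
 assumes s: "s : GL"
 shows "vB s : GB" "td (vB s) = dL (form0 s)" "Z : GA ==> sp (vB s) Z = nab Z s"
proof -
 note o = ofd_props[OF dL_Om[OF form0_Om[OF s], simplified]]
 show "vB s : GB" "td (vB s) = dL (form0 s)" unfolding vB_def by (rule o)+
 then show "Z : GA ==> sp (vB s) Z = nab Z s" using ev_td[of Z "vB s"] iota_d0[OF _ s] by (simp add: ev_Cons fb.ev_form0)
qed

text \<open>\<open>us s\<close> and \<open>vB s\<close> are the components in \<open>A\<close> and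
  in \<open>B\<close> of the gradient of \<open>s\<close>, the section of \<open>E\<close> dual to
  \<open>e \<mapsto> nab e s\<close>.\<close>

lemma Ds:
 assumes s: "s : GL" and e: "e : GE"
 shows "sp e (us s) x + sp e (vB s) x = nab e s x"
proof -
 note uG = us(1)[OF s] and vG = vB(1)[OF s]
 note uE = GA_GE[OF uG] and vE = GB_GE[OF vG] and p = prE[OF e]
 have "sp (us s) e x = nab (prB e) s x"
  unfolding sp_split[OF e uE] us(2)[OF s prB_GB[OF e]] spAA[OF uG prA_GA[OF e]] by simp
 moreover have "sp (vB s) e x = nab (prA e) s x"
  unfolding sp_split[OF e vE] vB(3)[OF s prA_GA[OF e]] spBB[OF vG prB_GB[OF e]] by simp
 ultimately show ?thesis unfolding nab_split[OF e s] sp_sym[OF e uE] sp_sym[OF e vE] by (simp add: add.commute)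
qed

lemma M2_ss: "s : GL ==> t : GL ==> M2 (form0 s) (form0 t) = 0"
 using M2_gen(1)[OF form0_Om] by (simp add: fb.iota_form0)

lemma M2_bs: "b : GB ==> s : GL ==> M2 (td b) (form0 s) = - form0 (nab b s)"
 using M2_gen(2)[OF form0_Om] Lop_form0[OF GB_GE] by simp

lemma M2_sb: "b : GB ==> s : GL ==> M2 (form0 s) (td b) = - form0 (nab b s)"
 unfolding M2_gen(1)[OF td_Om] iota_td[OF GB_GE us(1)] using us(2) sp_sym[OF GB_GE GA_GE[OF us(1)]] by simp

lemma M2_bb: "b : GB ==> c : GB ==> M2 (td b) (td c) = - td (prB (br b c))"
 unfolding M2_gen(2)[OF td_Om] Lop_td_GB by simp

lemma M2_left:
 assumes "al : Om p" "be : Om q"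
 shows "M2 (c *\<^sub>R al) be = c *\<^sub>R M2 al be" "M2 (- al) be = - M2 al be"
proof -
 have "M2 (c *\<^sub>R al) be = c *\<^sub>R M2 al be" for c
  unfolding M2_sym[OF fb.Omega_scale[OF vbL assms(1)] assms(2)] drD(3)[OF M2_dr[OF assms(2)] assms(1)] M2_sym[OF assms]
  by (rule scaleR_left_commute)
 from this this[of "- 1"] show "M2 (c *\<^sub>R al) be = c *\<^sub>R M2 al be" "M2 (- al) be = - M2 al be" by simp_all
qed

text \<open>The relation states that the gradient of \<open>s\<close> acts trivially on
  \<open>t\<close>, which is \<open>nab_exact\<close>.\<close>

lemma J2ss:
 assumes s: "s : GL" and t: "t : GL"
 shows "dL (M2 (form0 s) (form0 t)) + M2 (dL (form0 s)) (form0 t) + M2 (form0 s) (dL (form0 t)) = 0"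
proof -
 note uE = GA_GE[OF us(1)[OF s]] and vE = GB_GE[OF vB(1)[OF s]]
 have "nab (us s + vB s) t x = 0" for x
 proof (rule nab_exact[OF sections_add[OF vbE uE vE] s t])
  fix e assume e: "e : GE"
  show "sp (us s + vB s) e x = nab e s x" unfolding sp_lin(3)[OF uE vE e] using Ds[OF s e, of x] sp_sym[OF e uE] sp_sym[OF e vE] by simp
 qed
 then have "nab (us s) t x + nab (vB s) t x = 0" for x using nab_lin_left[OF uE vE t, of "%_. 1"] by (simp add: sc_one)
 then have E: "nab (vB s) t = - nab (us s) t" by (intro ext) (simp add: eq_neg_iff_add_eq_0 add.commute)
 moreover have "M2 (form0 s) (dL (form0 t)) = - form0 (nab (us s) t)"
  unfolding M2_gen(1)[OF dL_Om[OF form0_Om[OF t]] s] iota_d0[OF us(1)[OF s] t] ..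
 ultimately show ?thesis
  unfolding M2_ss[OF s t] drD(5)[OF dL_dr] vB(2)[OF s, symmetric] M2_bs[OF vB(1)[OF s] t] E fb.form0_uminus
  by (simp only: vB(2)[OF t] minus_minus add_0_left add.right_inverse)
qed

text \<open>\<open>C1\<close> for the gradient of \<open>s\<close> and \<open>Z\<close> computes
  \<open>nab b (nab Z s)\<close>; flatness removes the term with the bracket of \<open>b\<close> and
  \<open>Z\<close>, leaving the three summands.\<close>

lemma J2sb:
 assumes s: "s : GL" and b: "b : GB"
 shows "dL (M2 (form0 s) (td b)) + M2 (dL (form0 s)) (td b) + M2 (form0 s) (dL (td b)) = 0"
proof (rule form1_zeroI)
 note bE = GB_GE[OF b] and u = us(1)[OF s] and v = vB(1)[OF s]
 note uE = GA_GE[OF u] and vE = GB_GE[OF v] and n = nab_sections[OF bE s]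
 note m = form0_Om[OF s] and mb = td_Om[OF b]
 show "dL (M2 (form0 s) (td b)) + M2 (dL (form0 s)) (td b) + M2 (form0 s) (dL (td b)) : Om 1"
  using dL_Om[OF M2_Om[OF m mb]] M2_Om[OF dL_Om[OF m] mb] M2_Om[OF m dL_Om[OF mb]] by (intro fb.Omega_add[OF vbL]) simp_all
 fix Z x assume Z: "Z : GA"
 note ZE = GA_GE[OF Z]
 have 1: "ev (dL (M2 (form0 s) (td b))) [Z] x = - nab Z (nab b s) x"
  unfolding M2_sb[OF b s] drD(4)[OF dL_dr form0_Om[OF n]] ev_Cons iota_uminus iota_d0[OF Z n] ev_uminus fb.ev_form0 by simp
 have 2: "ev (M2 (dL (form0 s)) (td b)) [Z] x = sp (br b (vB s)) Z x"
  unfolding vB(2)[OF s, symmetric] M2_bb[OF v b] ev_uminus ev_td_pr[OF br_sections[OF vE bE] Z] unfolding br_skew_B[OF v b]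
   sp_lin(9)[OF br_sections[OF bE vE] ZE ZE] by simp
 have 3: "ev (M2 (form0 s) (dL (td b))) [Z] x = sp (br b (us s)) Z x"
  unfolding M2_gen(1)[OF dL_Om[OF mb] s] iota_dtd[OF bE u] minus_minus ev_td[OF Z] ..
 have D: "sp (us s + vB s) e = nab e s" if "e : GE" for e
  by (rule ext) (use Ds[OF s that] sp_lin(3)[OF uE vE that] sp_sym[OF that uE] sp_sym[OF that vE] in simp)
 have E: "us s + vB s : GE" by (rule sections_add[OF vbE uE vE])
 have "nab b (nab Z s) x = sp (br b (us s + vB s)) Z x + nab (br b Z) s x"
  using C1p[OF bE E ZE, of x] unfolding D[OF ZE] D[OF br_sections[OF bE ZE]] .
 moreover have "sp (br b (us s + vB s)) Z x = sp (br b (us s)) Z x + sp (br b (vB s)) Z x"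
  unfolding br_add(2)[OF uE vE bE] sp_lin(3)[OF br_sections[OF bE uE] br_sections[OF bE vE] ZE] by simp
 ultimately show "ev (dL (M2 (form0 s) (td b)) + M2 (dL (form0 s)) (td b) + M2 (form0 s) (dL (td b))) [Z] x = 0"
  unfolding nab_br[OF bE ZE s] ev_add by (simp add: 1 2 3 algebra_simps)
qed

text \<open>Compatibility of the differential with the dual bracket. After \<open>C1\<close> the
  iterated brackets form the Loday identity for \<open>b\<close>, \<open>c\<close>,
  \<open>Z\<close>; the terms with projections are symmetric in \<open>b\<close> and
  \<open>c\<close> and drop out of the difference.\<close>

lemma J2bb:
 assumes b: "b : GB" and c: "c : GB"
 shows "dL (M2 (td b) (td c)) + M2 (dL (td b)) (td c) - M2 (td b) (dL (td c)) = 0"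
proof (rule form2_zeroI)
 note bE = GB_GE[OF b] and cE = GB_GE[OF c]
 note mb = td_Om[OF b] and mc = td_Om[OF c] and bc = br_sections[OF bE cE]
 note db = dL_Om[OF mb, simplified] and dc = dL_Om[OF mc, simplified]
 show "dL (M2 (td b) (td c)) + M2 (dL (td b)) (td c) - M2 (td b) (dL (td c)) : Om 2"
  using dL_Om[OF M2_Om[OF mb mc]] M2_Om[OF dL_Om[OF mb] mc] M2_Om[OF mb dL_Om[OF mc]]
  by (intro fb.Omega_add[OF vbL] fb.Omega_diff[OF vbL]) simp_all
 fix Z W x assume Z: "Z : GA" and W: "W : GA"
 note ZE = GA_GE[OF Z] and WE = GA_GE[OF W]
 have 1: "ev (dL (M2 (td b) (td c))) [Z, W] x = sp (br (br b c) Z) W x"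
  unfolding M2_bb[OF b c] td_prB[OF bc] drD(4)[OF dL_dr td_Omega[OF bc]] ev_uminus uminus_apply ev_dtd[OF bc Z W] by simp
 have L: "ev (Lop b (dL (td c))) [Z, W] x = - nab b (sp (br c Z) W) x + sp (br c Z) (K b W) x + sp (br c (K b Z)) W x"
  if "b : GB" "c : GB" for b c
 proof -
  note bE = GB_GE[OF that(1)] and cE = GB_GE[OF that(2)]
  note cZ = br_sections[OF cE ZE] and KZ = K_GA[OF bE Z]
  have "ev (Lop b (dL (td c))) [Z, W] = - (nab b (sp (br c Z) W) - sp (br c Z) (K b W)) + sp (br c (K b Z)) W"
   unfolding ev_Cons[of _ Z] iota_Lop[OF bE dL_Om[OF td_Om[OF that(2)]] Z] iota_dtd[OF cE Z] iota_dtd[OF cE KZ]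
    drD(4)[OF dr_Lop[OF bE] td_Omega[OF cZ]] ev_diff ev_uminus Lop_td[OF bE cZ W] ev_td[OF W] by (simp only: diff_minus_eq_add)
  then show ?thesis by simp
 qed
 have 2: "M2 (dL (td b)) (td c) = - Lop c (dL (td b))"
  unfolding M2_sym[OF db mc] M2_gen(2)[OF db c] by (simp add: psign_def)
 have 3: "M2 (td b) (dL (td c)) = - Lop b (dL (td c))" by (rule M2_gen(2)[OF dc b])
 \<comment> \<open>\<open>f4\<close> and \<open>f6\<close> bring all projection terms to one shape,
   in which the symmetry between \<open>b\<close> and \<open>c\<close> is apparent.\<close>
 have f4: "sp (br c Z) (br b W) x = sp (br c Z) (K b W) x + sp (K c Z) (prB (br b W)) x" if "b : GB" "c : GB" for b c
 proof -
  note cz = br_sections[OF GB_GE[OF that(2)] ZE] and bw = br_sections[OF GB_GE[OF that(1)] WE]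
  show ?thesis unfolding sp_split[OF bw cz] K_def sp_prA[OF cz prB_GB[OF bw]] ..
 qed
 have f6: "sp (br c (K b Z)) W x = - sp (K b Z) (prB (br c W)) x" if "b : GB" "c : GB" for b c
 proof -
  note KZ = K_GA[OF GB_GE[OF that(1)] Z] and cE = GB_GE[OF that(2)]
  note cw = br_sections[OF cE WE]
  have "nab c (sp (K b Z) W) = 0" unfolding spAA[OF KZ W] by (rule nab_add(3)[OF cE]) (rule sections_zero[OF vbL])+
  then have "sp (br c (K b Z)) W x + sp (K b Z) (br c W) x = 0" unfolding C1p[OF cE GA_GE[OF KZ] WE, symmetric] by simp
  moreover have "sp (K b Z) (br c W) x = sp (K b Z) (prB (br c W)) x"
   unfolding sp_split[OF cw GA_GE[OF KZ]] spAA[OF KZ prA_GA[OF cw]] by simp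
  ultimately show ?thesis by (simp add: eq_neg_iff_add_eq_0)
 qed
 show "ev (dL (M2 (td b) (td c)) + M2 (dL (td b)) (td c) - M2 (td b) (dL (td c))) [Z, W] x = 0"
  unfolding 2 3 ev_diff ev_add ev_uminus plus_fun_apply minus_apply uminus_apply 1 L[OF b c] L[OF c b] f6[OF b c] f6[OF c b]
   C1p[OF bE br_sections[OF cE ZE] WE] C1p[OF cE br_sections[OF bE ZE] WE] lodp[OF bE cE ZE WE] f4[OF b c] f4[OF c b]
  by (simp add: algebra_simps)
qed

text \<open>Both sides are derivations of degree -1 that annihilate sections of \<open>L\<close> and
  give \<open>yps\<close> on a further section of \<open>B\<close>. In the relations below the
  ternary bracket thus becomes a contraction with the component in \<open>A\<close> of a
  bracket.\<close>

lemma M3_bb: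
 assumes c: "c : GB" "e : GB" and be: "be : Om k"
 shows "M3 (td c) (td e) be = iota (prA (br c e)) be"
proof (rule dr_eqI[OF _ dr_iota _ _ be])
 note g = br_sections[OF GB_GE[OF c(1)] GB_GE[OF c(2)]]
 show "dr (- 1) (M3 (td c) (td e))" using M3_dr[OF td_Om[OF c(1)] td_Om[OF c(2)]] by simp
 show "prA (br c e) : GA" by (rule prA_GA[OF g])
 show "M3 (td c) (td e) (form0 s) = iota (prA (br c e)) (form0 s)" if "s : GL" for s
  unfolding M3_form0[OF td_Om[OF c(1)] td_Om[OF c(2)] that] fb.iota_form0 ..
 show "M3 (td c) (td e) (td b) = iota (prA (br c e)) (td b)" if b: "b : GB" for b
  unfolding M3_td[OF c b] iota_td[OF GB_GE[OF b] prA_GA[OF g]] yps_def sp_sym[OF GB_GE[OF b] GA_GE[OF prA_GA[OF g]]] sp_prA[OF g b] ..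
qed

lemma M3_left:
 assumes c: "c : GB" "e : GB" and be: "be : Om k"
 shows "M3 be (td c) (td e) = iota (prA (br c e)) be"
 unfolding M3_sym(1)[OF be td_Om[OF c(1)] td_Om[OF c(2)]] M3_sym(2)[OF td_Om[OF c(1)] be td_Om[OF c(2)]] M3_bb[OF assms] by simp

text \<open>\<open>nabla\<close> is flat on \<open>E\<close>; its restriction to \<open>B\<close>
  with the projected bracket fails to be so by the action of the component in \<open>A\<close>,
  which is the pairing of the bracket with \<open>vB s\<close>, that is, the ternary term.\<close>

lemma J3bbs:
 assumes b: "b : GB" and c: "c : GB" and s: "s : GL"
 shows "M2 (M2 (td b) (td c)) (form0 s) + M2 (M2 (td b) (form0 s)) (td c) - M2 (M2 (td c) (form0 s)) (td b)
  + M3 (dL (form0 s)) (td b) (td c) = 0"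
proof -
 note bE = GB_GE[OF b] and cE = GB_GE[OF c] and v = vB(1)[OF s]
 note bc = br_sections[OF bE cE]
 note P = prB_GB[OF bc] and nb = nab_sections[OF bE s] and nc = nab_sections[OF cE s]
 have "nab (br b c) s x = sp (vB s) (br b c) x + nab (prB (br b c)) s x" for x
  unfolding nab_split[OF bc s] sp_split[OF bc GB_GE[OF v]] vB(3)[OF s prA_GA[OF bc]] spBB[OF v P] by simp
 then have "nab (prB (br b c)) s x + nab c (nab b s) x - nab b (nab c s) x + yps (vB s) b c x = 0" for x
  unfolding nab_br[OF bE cE s] yps_cyc[OF v b c, symmetric] unfolding yps_def sp_sym[OF bc GB_GE[OF v]] by (simp add: algebra_simps)
 then have "nab (prB (br b c)) s + nab c (nab b s) - nab b (nab c s) + yps (vB s) b c = 0" by (simp add: fun_eq_iff)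
 then show ?thesis
  unfolding M2_bb[OF b c] M2_left(2)[OF td_Om[OF P] form0_Om[OF s]] M2_bs[OF P s] M2_bs[OF b s] M2_bs[OF c s]
   M2_left(2)[OF form0_Om[OF nb] td_Om[OF c]] M2_left(2)[OF form0_Om[OF nc] td_Om[OF b]] M2_sb[OF c nb] M2_sb[OF b nc]
   vB(2)[OF s, symmetric] M3_td[OF v b c] minus_minus by (simp add: form0_def fun_eq_iff)
qed

text \<open>Each projection to \<open>B\<close> is the identity minus the projection to
  \<open>A\<close>. The latter cancel the three ternary terms with a differential, and the rest is
  the Loday identity, the missing order of one bracket being supplied by the differential of
  \<open>yps\<close> through \<open>C2\<close>.\<close>

lemma J3bbb:
 assumes b: "b : GB" and c: "c : GB" and e: "e : GB"
 shows "dL (M3 (td b) (td c) (td e)) + M2 (M2 (td b) (td c)) (td e) - M2 (M2 (td b) (td e)) (td c) + M2 (M2 (td c) (td e)) (td b)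
  + M3 (dL (td b)) (td c) (td e) - M3 (dL (td c)) (td b) (td e) + M3 (dL (td e)) (td b) (td c) = 0"
proof (rule form1_zeroI)
 note db = dL_Om[OF td_Om, simplified]
 have t1: "dL (M3 (td b) (td c) (td e)) : Om 1"
  unfolding M3_td[OF b c e] using dL_Om[OF form0_Om[OF yps_GL[OF b c e]]] by simp
 have P: "prB (br b c) : GB" if "b : GB" "c : GB" for b c by (rule prB_GB[OF br_sections[OF GB_GE[OF that(1)] GB_GE[OF that(2)]]])
 have t2: "M2 (M2 (td b) (td c)) (td e) = td (prB (br (prB (br b c)) e))" if "b : GB" "c : GB" "e : GB" for b c e
  unfolding M2_bb[OF that(1,2)] M2_left(2)[OF td_Om[OF P[OF that(1,2)]] td_Om[OF that(3)]] M2_bb[OF P[OF that(1,2)] that(3)] minus_minus ..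
 have Q: "prA (br b c) : GA" if "b : GB" "c : GB" for b c by (rule prA_GA[OF br_sections[OF GB_GE[OF that(1)] GB_GE[OF that(2)]]])
 have t3: "M3 (dL (td b)) (td c) (td e) = iota (prA (br c e)) (dL (td b))" "M3 (dL (td b)) (td c) (td e) : Om 1"
  if "b : GB" "c : GB" "e : GB" for b c e
  unfolding M3_left[OF that(2,3) db[OF that(1)]] using fb.iota_Omega[OF db[OF that(1)] Q[OF that(2,3)]] by simp_all
 show "dL (M3 (td b) (td c) (td e)) + M2 (M2 (td b) (td c)) (td e) - M2 (M2 (td b) (td e)) (td c) + M2 (M2 (td c) (td e)) (td b)
  + M3 (dL (td b)) (td c) (td e) - M3 (dL (td c)) (td b) (td e) + M3 (dL (td e)) (td b) (td c) : Om 1"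
  by (intro fb.Omega_add[OF vbL] fb.Omega_diff[OF vbL] t1 t3(2) b c e; unfold t2[OF b c e] t2[OF b e c] t2[OF c e b]; intro td_Om P b c e)
 fix Z x assume Z: "Z : GA"
 note ZE = GA_GE[OF Z]
 have s1: "ev (dL (M3 (td b) (td c) (td e))) [Z] x = nab Z (yps b c e) x"
  unfolding M3_td[OF b c e] ev_Cons iota_d0[OF Z yps_GL[OF b c e]] fb.ev_form0 ..
 have s2: "ev (M2 (M2 (td b) (td c)) (td e)) [Z] x = - sp (br e (prB (br b c))) Z x" if "b : GB" "c : GB" "e : GB" for b c e
  unfolding t2[OF that] ev_td_pr[OF br_sections[OF GB_GE[OF P[OF that(1,2)]] GB_GE[OF that(3)]] Z]
  unfolding br_skew_B[OF P[OF that(1,2)] that(3)]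
   sp_lin(9)[OF br_sections[OF GB_GE[OF that(3)] GB_GE[OF P[OF that(1,2)]]] ZE ZE] by simp
 have s3: "ev (M3 (dL (td b)) (td c) (td e)) [Z] x = - sp (br b (prA (br c e))) Z x" if "b : GB" "c : GB" "e : GB" for b c e
  unfolding t3(1)[OF that] ev_Cons[symmetric] by (rule ev_dtd[OF GB_GE[OF that(1)] Q[OF that(2,3)] Z])
 note E = GB_GE[OF b] GB_GE[OF c] GB_GE[OF e]
 note bc = br_sections[OF E(1,2)] and be = br_sections[OF E(1,3)] and ce = br_sections[OF E(2,3)]
 show "ev (dL (M3 (td b) (td c) (td e)) + M2 (M2 (td b) (td c)) (td e) - M2 (M2 (td b) (td e)) (td c) + M2 (M2 (td c) (td e)) (td b)
  + M3 (dL (td b)) (td c) (td e) - M3 (dL (td c)) (td b) (td e) + M3 (dL (td e)) (td b) (td c)) [Z] x = 0"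
 proof -
  have k: "sp (br e (prB e')) Z x = sp (br e e') Z x - sp (br e (prA e')) Z x" if "e : GE" "e' : GE" for e e'
   unfolding br_split[OF that ZE] by simp
  have n: "nab Z (yps b c e) x = sp (br (br b c) e) Z x + sp (br e (br b c)) Z x"
   unfolding yps_def C2p[OF ZE bc E(3), symmetric] sp_sym[OF ZE br_sections[OF bc E(3)]] sp_sym[OF ZE br_sections[OF E(3) bc]] ..
  show ?thesis
   unfolding ev_diff ev_add plus_fun_apply minus_apply s1 s2[OF b c e] s2[OF b e c] s2[OF c e b] s3[OF b c e] s3[OF c b e] s3[OF e b c]
    k[OF E(3) bc] k[OF E(2) be] k[OF E(1) ce] n lodp[OF E ZE] by (simp add: algebra_simps)
 qed
qed

text \<open>An identity between sections of \<open>L\<close>: derivatives of \<open>yps\<close>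
  against pairings of two brackets. \<open>C1\<close> and \<open>C2\<close> expand the derivatives,
  and the Loday identity for \<open>b\<close>, \<open>c\<close>, \<open>e\<close> paired with
  \<open>f\<close> remains.\<close>

lemma J4bbbb:
 assumes b: "b : GB" and c: "c : GB" and e: "e : GB" and f: "f : GB"
 shows "M2 (M3 (td b) (td c) (td e)) (td f) - M2 (M3 (td b) (td c) (td f)) (td e) + M2 (M3 (td b) (td e) (td f)) (td c) - M2 (M3 (td c) (td e) (td f)) (td b)
  + M3 (M2 (td b) (td c)) (td e) (td f) - M3 (M2 (td b) (td e)) (td c) (td f) + M3 (M2 (td b) (td f)) (td c) (td e)
  + M3 (M2 (td c) (td e)) (td b) (td f) - M3 (M2 (td c) (td f)) (td b) (td e) + M3 (M2 (td e) (td f)) (td b) (td c) = 0"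
proof -
 have a: "M2 (M3 (td b) (td c) (td e)) (td f) = - form0 (nab f (yps b c e))" if "b : GB" "c : GB" "e : GB" "f : GB" for b c e f
  unfolding M3_td[OF that(1,2,3)] by (rule M2_sb[OF that(4) yps_GL[OF that(1,2,3)]])
 have d: "M3 (M2 (td b) (td c)) (td e) (td f) = - form0 (sp (br b c) (prA (br e f)))" if "b : GB" "c : GB" "e : GB" "f : GB" for b c e f
 proof -
  note bc = br_sections[OF GB_GE[OF that(1)] GB_GE[OF that(2)]] and ef = br_sections[OF GB_GE[OF that(3)] GB_GE[OF that(4)]]
  show ?thesis unfolding M2_bb[OF that(1,2)] M3_left[OF that(3,4) fb.Omega_uminus[OF vbL td_Om[OF prB_GB[OF bc]]]]
   iota_uminus iota_td[OF prE(2)[OF bc] prA_GA[OF ef]] sp_prB[OF bc prA_GA[OF ef]] ..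
 qed
 note E = GB_GE[OF b] GB_GE[OF c] GB_GE[OF e] GB_GE[OF f]
 \<comment> \<open>Both summands are isotropic, so the pairing of two brackets consists of its two
   mixed components only.\<close>
 have w: "sp (br b c) (prA (br e f)) x + sp (br e f) (prA (br b c)) x = sp (br b c) (br e f) x" if "b : GB" "c : GB" "e : GB" "f : GB" for b c e f x
 proof -
  note bc = br_sections[OF GB_GE[OF that(1)] GB_GE[OF that(2)]] and ef = br_sections[OF GB_GE[OF that(3)] GB_GE[OF that(4)]]
  have "sp (br e f) (prA (br b c)) x = sp (br b c) (prB (br e f)) x"
   unfolding sp_split[OF ef bc] sp_prA[OF bc prB_GB[OF ef], symmetric] sp_split[OF ef prE(1)[OF bc]] sp_sym[OF ef prE(1)[OF bc]]
    spAA[OF prA_GA[OF bc] prA_GA[OF ef]] by simp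
  then show ?thesis unfolding sp_split[OF ef bc] by simp
 qed
 note bc = br_sections[OF E(1,2)] and be = br_sections[OF E(1,3)] and ce = br_sections[OF E(2,3)]
 have "- nab f (yps b c e) x + nab e (yps b c f) x - nab c (yps b e f) x + nab b (yps c e f) x
  - sp (br b c) (prA (br e f)) x + sp (br b e) (prA (br c f)) x - sp (br b f) (prA (br c e)) x
  - sp (br c e) (prA (br b f)) x + sp (br c f) (prA (br b e)) x - sp (br e f) (prA (br b c)) x = 0" for x
 proof -
  have w': "sp (br e f) (prA (br b c)) x = sp (br b c) (br e f) x - sp (br b c) (prA (br e f)) x" if "b : GB" "c : GB" "e : GB" "f : GB" for b c e f
   using w[OF that, of x] by (simp add: algebra_simps)
  have n: "nab f (sp (br b c) e) x = sp (br (br b c) e) f x + sp (br e (br b c)) f x"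
   unfolding C2p[OF E(4) bc E(3), symmetric] sp_sym[OF E(4) br_sections[OF bc E(3)]] sp_sym[OF E(4) br_sections[OF E(3) bc]] ..
  show ?thesis
   unfolding yps_def n w'[OF b c e f] w'[OF b e c f] w'[OF b f c e]
    C1p[OF E(1) ce E(4)] C1p[OF E(2) be E(4)] C1p[OF E(3) bc E(4)] lodp[OF E(1,2,3,4)] sp_sym[OF br_sections[OF E(1,4)] ce]
   by (simp add: algebra_simps)
 qed
 then show ?thesis
  by (simp add: a d b c e f fun_eq_iff form0_def)
qed

end

section \<open>From generators to arbitrary forms\<close>

context dj
begin

definition "gen p u \<longleftrightarrow> (p = 0 & (EX s:GL. u = form0 s)) | (p = (1::int) & (EX c:GB. u = td c))"

lemma gen_Om: "gen p u ==> u : Om p"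
 unfolding gen_def using form0_Om td_Om by blast

lemma gen_le: "gen p u ==> p <= 1"
 unfolding gen_def by auto

lemma gen_cases:
 assumes "gen p u"
 obtains s where "p = 0" "s : GL" "u = form0 s" | c where "p = 1" "c : GB" "u = td c"
 using assms unfolding gen_def by blast

lemma dr_gen:
 assumes "dr d X" "!!p u. gen p u ==> X u = 0" "al : Om k"
 shows "X al = 0"
 by (rule dr_eqI[OF assms(1) dr_zero _ _ assms(3)]) (rule assms(2), force simp: gen_def)+

text \<open>A graded commutator with free coefficients, shaped to match the pairs of summands in the
  Jacobi expressions; \<open>r\<close> is the coefficient that the commutator forces.\<close>

lemma dr_comm':
 assumes "dr d X" "dr e X'" "r = - c * psign (d * e)" "D = d + e"
 shows "dr D (%al. c *\<^sub>R X (X' al) + r *\<^sub>R X' (X al))"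
 unfolding assms(3,4)
 by (rule dr_cong[OF dr_smult[OF dr_comm[OF assms(1,2)], of c]]) (intro ext, simp add: algebra_simps)

lemma dr_deg: "dr d X ==> d = D ==> dr D X"
 by simp

lemma M3_Om: "al : Om k ==> be : Om k' ==> ga : Om k'' ==> M3 al be ga : Om (k + k' + k'' - 3)"
 using drD(1)[OF M3_dr, of al k be k' ga k''] by (simp add: algebra_simps)

lemma M2_Om': "al : Om k ==> be : Om k' ==> M2 al be : Om (k + k' - 1)"
 using M2_Om[of al k be k'] by (simp add: algebra_simps)

lemma M3_rot:
 assumes "al : Om k" "be : Om k'" "ga : Om k''"
 shows "M3 be ga al = psign (k * (k' + k'')) *\<^sub>R M3 al be ga"
 unfolding M3_sym(2)[OF assms(2,3,1)] M3_sym(1)[OF assms(2,1,3)]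
 by (simp only: scaleR_scaleR psign_add[symmetric] distrib_left mult.commute[of _ k] add.commute)

lemma M3_rev:
 assumes "al : Om k" "be : Om k'" "ga : Om k''"
 shows "M3 al be ga = psign (k * k' + k * k'' + k' * k'') *\<^sub>R M3 ga be al"
 unfolding M3_sym(1)[OF assms] M3_rot[OF assms(3,2,1)]
 by (simp only: scaleR_scaleR psign_add[symmetric]) (simp add: algebra_simps)

lemmas sc2 = drD(3)[OF M2_dr] and sc3 = drD(3)[OF M3_dr] and sc1 = drD(3)[OF dL_dr]

text \<open>The Jacobi expressions as operators on their last entry. Summands with that entry in the
  inner bracket pair off into graded commutators; the others have it in the outer bracket and are
  derivations already. Signs are written in form degrees, which differ from the degrees of the
  module by 2 and so have the same parity.\<close>

definition "J2 p u = (%v. (1 *\<^sub>R dL (M2 u v) + psign p *\<^sub>R M2 u (dL v)) + M2 (dL u) v)"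
definition "J3 p q u v = (%w. (1 *\<^sub>R dL (M3 u v w) + psign (p + q) *\<^sub>R M3 u v (dL w))
 + (psign p *\<^sub>R M2 u (M2 v w) + psign (p * q + q) *\<^sub>R M2 v (M2 u w)) + M2 (M2 u v) w + M3 (dL u) v w + psign (p * q) *\<^sub>R M3 (dL v) u w)"
definition "J4 p q r u v w = (%x. (psign p *\<^sub>R M2 u (M3 v w x) + psign ((p + 1) * (q + r)) *\<^sub>R M3 v w (M2 u x))
 + (psign (q * (p + 1)) *\<^sub>R M2 v (M3 u w x) + psign (q * r + p + r) *\<^sub>R M3 u w (M2 v x))
 + (psign (r * (p + q + 1)) *\<^sub>R M2 w (M3 u v x) + psign (p + q) *\<^sub>R M3 u v (M2 w x))
 + M2 (M3 u v w) x + M3 (M2 u v) w x + psign (q * r) *\<^sub>R M3 (M2 u w) v x + psign (p * (q + r)) *\<^sub>R M3 (M2 v w) u x)"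
definition "J5 p q r t u v w x = (%z. (psign (p + q) *\<^sub>R M3 u v (M3 w x z) + psign ((r + t) * (p + q + 1)) *\<^sub>R M3 w x (M3 u v z))
 + (psign (p * (q + t) + t * r + (p + r) * (q + t + 1)) *\<^sub>R M3 u w (M3 v x z) + psign (q * r + (q + t) * (p + r + 1)) *\<^sub>R M3 v x (M3 u w z))
 + (psign (p * (q + r) + (p + t) * (q + r + 1)) *\<^sub>R M3 u x (M3 v w z) + psign ((q + r) * (p + 1)) *\<^sub>R M3 v w (M3 u x z))
 + M3 (M3 u v w) x z + psign (t * r) *\<^sub>R M3 (M3 u v x) w z + psign (q * (r + t)) *\<^sub>R M3 (M3 u w x) v z + psign (p * (q + r + t)) *\<^sub>R M3 (M3 v w x) u z)"

lemma J2_dr: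
 assumes u: "u : Om p"
 shows "dr p (J2 p u)"
proof -
 have 1: "dr p (%v. 1 *\<^sub>R dL (M2 u v) + psign p *\<^sub>R M2 u (dL v))"
  by (rule dr_comm'[OF dL_dr M2_dr[OF u]]) (auto simp: psign_def)
 have 2: "dr p (M2 (dL u))" by (rule dr_deg[OF M2_dr[OF dL_Om[OF u]]]) simp
 show ?thesis using dr_add[OF 1 2] unfolding J2_def .
qed

lemma J3_dr:
 assumes u: "u : Om p" and v: "v : Om q"
 shows "dr (p + q - 2) (J3 p q u v)"
proof -
 let ?d = "p + q - 2"
 have 1: "dr ?d (%w. 1 *\<^sub>R dL (M3 u v w) + psign (p + q) *\<^sub>R M3 u v (dL w))"
  by (rule dr_comm'[OF dL_dr M3_dr[OF u v]]) (auto simp: psign_def)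
 have 2: "dr ?d (%w. psign p *\<^sub>R M2 u (M2 v w) + psign (p * q + q) *\<^sub>R M2 v (M2 u w))"
  by (rule dr_comm'[OF M2_dr[OF u] M2_dr[OF v]]) (auto simp: psign_def)
 have 3: "dr ?d (M2 (M2 u v))" by (rule dr_deg[OF M2_dr[OF M2_Om'[OF u v]]]) simp
 have 4: "dr ?d (M3 (dL u) v)" by (rule dr_deg[OF M3_dr[OF dL_Om[OF u] v]]) simp
 have 5: "dr ?d (M3 (dL v) u)" by (rule dr_deg[OF M3_dr[OF dL_Om[OF v] u]]) simp
 show ?thesis using dr_add[OF dr_add[OF dr_add[OF dr_add[OF 1 2] 3] 4] dr_smult[OF 5, of "psign (p * q)"]] unfolding J3_def .
qed

lemma J4_dr:
 assumes u: "u : Om p" and v: "v : Om q" and w: "w : Om r"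
 shows "dr (p + q + r - 4) (J4 p q r u v w)"
proof -
 let ?d = "p + q + r - 4"
 have 1: "dr ?d (%x. psign p *\<^sub>R M2 u (M3 v w x) + psign ((p + 1) * (q + r)) *\<^sub>R M3 v w (M2 u x))"
  by (rule dr_comm'[OF M2_dr[OF u] M3_dr[OF v w]]) (auto simp: psign_def)
 have 2: "dr ?d (%x. psign (q * (p + 1)) *\<^sub>R M2 v (M3 u w x) + psign (q * r + p + r) *\<^sub>R M3 u w (M2 v x))"
  by (rule dr_comm'[OF M2_dr[OF v] M3_dr[OF u w]]) (auto simp: psign_def)
 have 3: "dr ?d (%x. psign (r * (p + q + 1)) *\<^sub>R M2 w (M3 u v x) + psign (p + q) *\<^sub>R M3 u v (M2 w x))"
  by (rule dr_comm'[OF M2_dr[OF w] M3_dr[OF u v]]) (auto simp: psign_def)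
 have 4: "dr ?d (M2 (M3 u v w))" by (rule dr_deg[OF M2_dr[OF M3_Om[OF u v w]]]) simp
 have 5: "dr ?d (M3 (M2 u v) w)" by (rule dr_deg[OF M3_dr[OF M2_Om'[OF u v] w]]) simp
 have 6: "dr ?d (M3 (M2 u w) v)" by (rule dr_deg[OF M3_dr[OF M2_Om'[OF u w] v]]) simp
 have 7: "dr ?d (M3 (M2 v w) u)" by (rule dr_deg[OF M3_dr[OF M2_Om'[OF v w] u]]) simp
 show ?thesis using dr_add[OF dr_add[OF dr_add[OF dr_add[OF dr_add[OF dr_add[OF 1 2] 3] 4] 5] dr_smult[OF 6, of "psign (q * r)"]] dr_smult[OF 7, of "psign (p * (q + r))"]]
  unfolding J4_def .
qed

lemma J5_dr:
 assumes u: "u : Om p" and v: "v : Om q" and w: "w : Om r" and x: "x : Om t"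
 shows "dr (p + q + r + t - 6) (J5 p q r t u v w x)"
proof -
 let ?d = "p + q + r + t - 6"
 have 1: "dr ?d (%z. psign (p + q) *\<^sub>R M3 u v (M3 w x z) + psign ((r + t) * (p + q + 1)) *\<^sub>R M3 w x (M3 u v z))"
  by (rule dr_comm'[OF M3_dr[OF u v] M3_dr[OF w x]]) (auto simp: psign_def)
 have 2: "dr ?d (%z. psign (p * (q + t) + t * r + (p + r) * (q + t + 1)) *\<^sub>R M3 u w (M3 v x z) + psign (q * r + (q + t) * (p + r + 1)) *\<^sub>R M3 v x (M3 u w z))"
  by (rule dr_comm'[OF M3_dr[OF u w] M3_dr[OF v x]]) (auto simp: psign_def)
 have 3: "dr ?d (%z. psign (p * (q + r) + (p + t) * (q + r + 1)) *\<^sub>R M3 u x (M3 v w z) + psign ((q + r) * (p + 1)) *\<^sub>R M3 v w (M3 u x z))"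
  by (rule dr_comm'[OF M3_dr[OF u x] M3_dr[OF v w]]) (auto simp: psign_def)
 have 4: "dr ?d (M3 (M3 u v w) x)" by (rule dr_deg[OF M3_dr[OF M3_Om[OF u v w] x]]) simp
 have 5: "dr ?d (M3 (M3 u v x) w)" by (rule dr_deg[OF M3_dr[OF M3_Om[OF u v x] w]]) simp
 have 6: "dr ?d (M3 (M3 u w x) v)" by (rule dr_deg[OF M3_dr[OF M3_Om[OF u w x] v]]) simp
 have 7: "dr ?d (M3 (M3 v w x) u)" by (rule dr_deg[OF M3_dr[OF M3_Om[OF v w x] u]]) simp
 show ?thesis using dr_add[OF dr_add[OF dr_add[OF dr_add[OF dr_add[OF dr_add[OF 1 2] 3] 4] dr_smult[OF 5, of "psign (t * r)"]] dr_smult[OF 6, of "psign (q * (r + t))"]]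
   dr_smult[OF 7, of "psign (p * (q + r + t))"]] unfolding J5_def .
qed

text \<open>A shadow of the graded symmetry of the whole expression. Rotation suffices, as it
  carries every entry to the last place. Only the parities of the degrees enter, so a finite case
  distinction settles the signs, here and for the longer expressions.\<close>

lemma J2_rot:
 assumes u: "u : Om p" and v: "v : Om q"
 shows "J2 q v u = psign (p * q) *\<^sub>R J2 p u v"
proof -
 note du = dL_Om[OF u] and dv = dL_Om[OF v]
 have 1: "dL (M2 v u) = psign (q * p) *\<^sub>R dL (M2 u v)" unfolding M2_sym[OF v u] sc1[OF M2_Om[OF u v]] ..
 have 2: "M2 (dL v) u = psign ((q + 1) * p) *\<^sub>R M2 u (dL v)" by (rule M2_sym[OF dv u])
 have 3: "M2 v (dL u) = psign (q * (p + 1)) *\<^sub>R M2 (dL u) v" by (rule M2_sym[OF v du])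
 show ?thesis unfolding J2_def 1 2 3
  by (intro ext; cases "even p"; cases "even q"; simp add: psign_def)
qed

lemma J3_rot:
 assumes u: "u : Om p" and v: "v : Om q" and w: "w : Om r"
 shows "J3 q r v w u = psign (p * (q + r)) *\<^sub>R J3 p q u v w"
proof -
 note du = dL_Om[OF u] and dv = dL_Om[OF v] and dw = dL_Om[OF w]
 have 1: "dL (M3 v w u) = psign (p * (q + r)) *\<^sub>R dL (M3 u v w)" unfolding M3_rot[OF u v w] sc1[OF M3_Om[OF u v w]] ..
 have 2: "M3 v w (dL u) = psign ((p + 1) * (q + r)) *\<^sub>R M3 (dL u) v w" by (rule M3_rot[OF du v w])
 have 3: "M2 v (M2 w u) = psign (r * p) *\<^sub>R M2 v (M2 u w)" unfolding M2_sym[OF w u] sc2[OF v M2_Om[OF u w]] ..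
 have 4: "M2 w (M2 v u) = psign (q * p) *\<^sub>R psign (r * (p + q - 1)) *\<^sub>R M2 (M2 u v) w"
  unfolding M2_sym[OF v u] sc2[OF w M2_Om[OF u v]] M2_sym[OF w M2_Om'[OF u v]] ..
 have 5: "M2 (M2 v w) u = psign ((q + r - 1) * p) *\<^sub>R M2 u (M2 v w)" by (rule M2_sym[OF M2_Om'[OF v w] u])
 have 6: "M3 (dL v) w u = psign (r * p) *\<^sub>R M3 (dL v) u w" by (rule M3_sym(2)[OF dv w u])
 have 7: "M3 (dL w) v u = psign ((r + 1) * q + (r + 1) * p + q * p) *\<^sub>R M3 u v (dL w)" by (rule M3_rev[OF dw v u])
 show ?thesis unfolding J3_def 1 2 3 4 5 6 7
  by (intro ext; cases "even p"; cases "even q"; cases "even r"; simp add: psign_def)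
qed

lemma J4_rot:
 assumes u: "u : Om p" and v: "v : Om q" and w: "w : Om r" and x: "x : Om t"
 shows "J4 q r t v w x u = psign (p * (q + r + t)) *\<^sub>R J4 p q r u v w x"
proof -
 have 1: "M2 (M3 v w x) u = psign ((q + r + t - 3) * p) *\<^sub>R M2 u (M3 v w x)" by (rule M2_sym[OF M3_Om[OF v w x] u])
 have 2: "M2 x (M3 v w u) = psign (p * (q + r)) *\<^sub>R psign (t * (p + q + r - 3)) *\<^sub>R M2 (M3 u v w) x"
  unfolding M3_rot[OF u v w] sc2[OF x M3_Om[OF u v w]] M2_sym[OF x M3_Om[OF u v w]] ..
 have 3: "M2 w (M3 v x u) = psign (p * (q + t)) *\<^sub>R M2 w (M3 u v x)" unfolding M3_rot[OF u v x] sc2[OF w M3_Om[OF u v x]] ..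
 have 4: "M2 v (M3 w x u) = psign (p * (r + t)) *\<^sub>R M2 v (M3 u w x)" unfolding M3_rot[OF u w x] sc2[OF v M3_Om[OF u w x]] ..
 have 5: "M3 (M2 v w) x u = psign (t * p) *\<^sub>R M3 (M2 v w) u x" by (rule M3_sym(2)[OF M2_Om'[OF v w] x u])
 have 6: "M3 (M2 v x) w u = psign ((q + t - 1) * r + (q + t - 1) * p + r * p) *\<^sub>R M3 u w (M2 v x)" by (rule M3_rev[OF M2_Om'[OF v x] w u])
 have 7: "M3 (M2 w x) v u = psign ((r + t - 1) * q + (r + t - 1) * p + q * p) *\<^sub>R M3 u v (M2 w x)" by (rule M3_rev[OF M2_Om'[OF w x] v u])
 have 8: "M3 w x (M2 v u) = psign (q * p) *\<^sub>R psign ((p + q - 1) * (r + t)) *\<^sub>R M3 (M2 u v) w x"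
  unfolding M2_sym[OF v u] sc3[OF w x M2_Om'[OF u v]] M3_rot[OF M2_Om'[OF u v] w x] ..
 have 9: "M3 v x (M2 w u) = psign (r * p) *\<^sub>R psign ((p + r - 1) * (q + t)) *\<^sub>R M3 (M2 u w) v x"
  unfolding M2_sym[OF w u] sc3[OF v x M2_Om'[OF u w]] M3_rot[OF M2_Om'[OF u w] v x] ..
 have 10: "M3 v w (M2 x u) = psign (t * p) *\<^sub>R M3 v w (M2 u x)" unfolding M2_sym[OF x u] sc3[OF v w M2_Om'[OF u x]] ..
 show ?thesis unfolding J4_def 1 2 3 4 5 6 7 8 9 10
  by (intro ext; cases "even p"; cases "even q"; cases "even r"; cases "even t"; simp add: psign_def)
qed

lemma J5_rot:
 assumes u: "u : Om p" and v: "v : Om q" and w: "w : Om r" and x: "x : Om t" and z: "z : Om l"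
 shows "J5 q r t l v w x z u = psign (p * (q + r + t + l)) *\<^sub>R J5 p q r t u v w x z"
proof -

 have 1: "M3 (M3 v w x) z u = psign (l * p) *\<^sub>R M3 (M3 v w x) u z" by (rule M3_sym(2)[OF M3_Om[OF v w x] z u])
 have 2: "M3 (M3 v w z) x u = psign ((q + r + l - 3) * t + (q + r + l - 3) * p + t * p) *\<^sub>R M3 u x (M3 v w z)" by (rule M3_rev[OF M3_Om[OF v w z] x u])
 have 3: "M3 (M3 v x z) w u = psign ((q + t + l - 3) * r + (q + t + l - 3) * p + r * p) *\<^sub>R M3 u w (M3 v x z)" by (rule M3_rev[OF M3_Om[OF v x z] w u])
 have 4: "M3 (M3 w x z) v u = psign ((r + t + l - 3) * q + (r + t + l - 3) * p + q * p) *\<^sub>R M3 u v (M3 w x z)" by (rule M3_rev[OF M3_Om[OF w x z] v u])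
 have 5: "M3 x z (M3 v w u) = psign (p * (q + r)) *\<^sub>R psign ((p + q + r - 3) * (t + l)) *\<^sub>R M3 (M3 u v w) x z"
  unfolding M3_rot[OF u v w] sc3[OF x z M3_Om[OF u v w]] M3_rot[OF M3_Om[OF u v w] x z] ..
 have 6: "M3 w z (M3 v x u) = psign (p * (q + t)) *\<^sub>R psign ((p + q + t - 3) * (r + l)) *\<^sub>R M3 (M3 u v x) w z"
  unfolding M3_rot[OF u v x] sc3[OF w z M3_Om[OF u v x]] M3_rot[OF M3_Om[OF u v x] w z] ..
 have 7: "M3 v z (M3 w x u) = psign (p * (r + t)) *\<^sub>R psign ((p + r + t - 3) * (q + l)) *\<^sub>R M3 (M3 u w x) v z"
  unfolding M3_rot[OF u w x] sc3[OF v z M3_Om[OF u w x]] M3_rot[OF M3_Om[OF u w x] v z] ..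
 have 8: "M3 w x (M3 v z u) = psign (p * (q + l)) *\<^sub>R M3 w x (M3 u v z)"
  unfolding M3_rot[OF u v z] sc3[OF w x M3_Om[OF u v z]] ..
 have 9: "M3 v x (M3 w z u) = psign (p * (r + l)) *\<^sub>R M3 v x (M3 u w z)"
  unfolding M3_rot[OF u w z] sc3[OF v x M3_Om[OF u w z]] ..
 have 10: "M3 v w (M3 x z u) = psign (p * (t + l)) *\<^sub>R M3 v w (M3 u x z)"
  unfolding M3_rot[OF u x z] sc3[OF v w M3_Om[OF u x z]] ..
 show ?thesis unfolding J5_def 1 2 3 4 5 6 7 8 9 10
  by (intro ext; cases "even p"; cases "even q"; cases "even r"; cases "even t"; cases "even l"; simp add: psign_def)
qed

text \<open>\<open>dL\<close> is odd, so its graded commutator with itself is twice its square; that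
  commutator is a derivation and can be tested on generators.\<close>

lemma dL_dL: "al : Om k ==> dL (dL al) = 0"
proof -
 assume a: "al : Om k"
 have d: "dr 2 (%al. 1 *\<^sub>R dL (dL al) + 1 *\<^sub>R dL (dL al))" by (rule dr_comm'[OF dL_dr dL_dr]) simp_all
 have "1 *\<^sub>R dL (dL al) + 1 *\<^sub>R dL (dL al) = 0"
  by (rule dr_gen[OF d _ a]) (erule gen_cases; simp only: J1s J1b[OF GB_GE] scaleR_zero_right add_0_left)
 then have "dL (dL al) y vs + dL (dL al) y vs = 0" for y vs by (simp add: fun_eq_iff)
 then show ?thesis by (simp add: fun_eq_iff scaleR_2[symmetric])
qed

lemma J2_zero:
 assumes u: "u : Om p" and v: "v : Om q"
 shows "J2 p u v = 0"
proof -
 have sb: "J2 0 (form0 s) (td b) = 0" if "s : GL" "b : GB" for s b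
  using J2sb[OF that] unfolding J2_def by (simp only: psign_simps scaleR_one add_ac)
 have g: "J2 p g h = 0" if g: "gen p g" and h: "gen q h" for p q g h
  using g
 proof (cases rule: gen_cases)
  case (1 s)
  from h show ?thesis
  proof (cases rule: gen_cases)
   case (1 t)
   show ?thesis using J2ss[OF \<open>s : GL\<close> 1(2)] unfolding J2_def 1 \<open>p = 0\<close> \<open>g = form0 s\<close> by (simp only: psign_simps scaleR_one add_ac)
  next
   case (2 c) then show ?thesis using sb 1 by simp
  qed
 next
  case (2 b)
  from h show ?thesis
  proof (cases rule: gen_cases)
   case (1 t)
   show ?thesis unfolding 1 2 J2_rot[OF form0_Om[OF 1(2)] td_Om[OF 2(2)]] sb[OF 1(2) 2(2)] by (rule scaleR_zero_right)
  next
   case (2 c)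
   show ?thesis using J2bb[OF \<open>b : GB\<close> 2(2)] unfolding J2_def 2 \<open>p = 1\<close> \<open>g = td b\<close>
    by (simp only: psign_simps scaleR_one scaleR_minus_left diff_conv_add_uminus add_ac)
  qed
 qed
 have 1: "J2 p g v = 0" if "gen p g" "v : Om q" for p g v q by (rule dr_gen[OF J2_dr[OF gen_Om[OF that(1)]] _ that(2)]) (rule g[OF that(1)])
 show ?thesis
 proof (rule dr_gen[OF J2_dr[OF u] _ v])
  fix q g assume g: "gen q g"
  show "J2 p u g = 0" unfolding J2_rot[OF gen_Om[OF g] u] 1[OF g u] by (rule scaleR_zero_right)
 qed
qed

text \<open>On generators the value has degree \<open>p + q + r - 2\<close>, so at most one of the
  three can be a section of \<open>L\<close>; rotation puts it last.\<close>

lemma J3_zero: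
 assumes u: "u : Om p" and v: "v : Om q" and w: "w : Om r"
 shows "J3 p q u v w = 0"
proof -
 have bbs: "J3 1 1 (td b) (td c) (form0 s) = 0" if b: "b : GB" and c: "c : GB" and s: "s : GL" for b c s
 proof -
  note mb = td_Om[OF b] and mc = td_Om[OF c] and ms = form0_Om[OF s]
  note M3_form0[OF mb mc s] M3_form0[OF dL_Om[OF mb] mc s] M3_form0[OF dL_Om[OF mc] mb s] drD(5)[OF dL_dr]
  moreover have "M2 (td c) (M2 (td b) (form0 s)) = M2 (M2 (td b) (form0 s)) (td c)"
   using M2_sym[OF mc M2_Om[OF mb ms]] by simp
  moreover have "M2 (td b) (M2 (td c) (form0 s)) = M2 (M2 (td c) (form0 s)) (td b)"
   using M2_sym[OF mb M2_Om[OF mc ms]] by simp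
  moreover have "M3 (td b) (td c) (dL (form0 s)) = M3 (dL (form0 s)) (td b) (td c)"
   using M3_rot[OF dL_Om[OF ms] mb mc] by (simp add: psign_def)
  ultimately show ?thesis using J3bbs[OF b c s] unfolding J3_def
   by (simp only: psign_def) (simp add: fun_eq_iff algebra_simps)
 qed
 have bbb: "J3 1 1 (td b) (td c) (td e) = 0" if b: "b : GB" and c: "c : GB" and e: "e : GB" for b c e
 proof -
  note mb = td_Om[OF b] and mc = td_Om[OF c] and me = td_Om[OF e]
  have "M2 (td c) (M2 (td b) (td e)) = - M2 (M2 (td b) (td e)) (td c)" using M2_sym[OF mc M2_Om[OF mb me]] by simp
  moreover have "M2 (td b) (M2 (td c) (td e)) = - M2 (M2 (td c) (td e)) (td b)" using M2_sym[OF mb M2_Om[OF mc me]] by simp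
  moreover have "M3 (td b) (td c) (dL (td e)) = M3 (dL (td e)) (td b) (td c)" using M3_rot[OF dL_Om[OF me] mb mc] by (simp add: psign_def)
  ultimately show ?thesis using J3bbb[OF b c e] unfolding J3_def
   by (simp only: psign_def) (simp add: fun_eq_iff algebra_simps)
 qed
 have g: "J3 p q f g h = 0" if f: "gen p f" and g: "gen q g" and h: "gen r h" for p q r f g h
 proof (cases "p + q + r < 2")
  case True
  then show ?thesis using drD(1)[OF J3_dr[OF gen_Om[OF f] gen_Om[OF g]] gen_Om[OF h]] fb.Omega_neg[of "r + (p + q - 2)" L] by simp
 next
  case False
  note le = gen_le[OF f] gen_le[OF g] gen_le[OF h]
  show ?thesis
  proof (cases "r = 0")
   case True
   with False le have "p = 1" "q = 1" by auto
   then show ?thesis using f g h True bbs by (auto simp: gen_def)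
  next
   case r: False
   show ?thesis
   proof (cases "p = 0")
    case True
    with False le have "q = 1" "r = 1" by auto
    then have "J3 q r g h f = 0" using f g h True bbs by (auto simp: gen_def)
    then show ?thesis unfolding J3_rot[OF gen_Om[OF f] gen_Om[OF g] gen_Om[OF h]] by (simp add: psign_def split: if_splits)
   next
    case p: False
    show ?thesis
    proof (cases "q = 0")
     case True
     with False le have "p = 1" "r = 1" by auto
     then have "J3 r p h f g = 0" using f g h True bbs by (auto simp: gen_def)
     then show ?thesis using J3_rot[OF gen_Om[OF h] gen_Om[OF f] gen_Om[OF g]] J3_rot[OF gen_Om[OF g] gen_Om[OF h] gen_Om[OF f]]
      by (simp add: psign_def split: if_splits)
    next
     case False
     then show ?thesis using f g h p r bbb by (auto simp: gen_def)
    qed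
   qed
  qed
 qed
 \<comment> \<open>Testing the last entry on a generator and rotating it to the front gives an
   instance with one more generator in front, which is settled already. Each such pass frees one
   further entry.\<close>
 have rz: "J3 q r v w u = 0" if "J3 p q u v w = 0" "u : Om p" "v : Om q" "w : Om r" for u v w p q r
  unfolding J3_rot[OF that(2,3,4)] that(1) by (rule scaleR_zero_right)
 have 1: "J3 p q f g w = 0" if "gen p f" "gen q g" "w : Om r" for p q r f g w
  by (rule dr_gen[OF J3_dr[OF gen_Om[OF that(1)] gen_Om[OF that(2)]] _ that(3)]) (rule g[OF that(1,2)])
 have 2: "J3 p q f v w = 0" if f: "gen p f" and "v : Om q" "w : Om r" for p q r f v w
  by (rule dr_gen[OF J3_dr[OF gen_Om[OF f] that(2)] _ that(3)]) (rule rz[OF 1 gen_Om gen_Om[OF f] that(2)]; (assumption | rule f that(2)))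
 show ?thesis
  by (rule dr_gen[OF J3_dr[OF u v] _ w]) (rule rz[OF 2 gen_Om u v]; (assumption | rule u v))
qed

lemma J4_zero:
 assumes u: "u : Om p" and v: "v : Om q" and w: "w : Om r" and x: "x : Om t"
 shows "J4 p q r u v w x = 0"
proof -
 have bbbb: "J4 1 1 1 (td b) (td c) (td e) (td f) = 0" if b: "b : GB" and c: "c : GB" and e: "e : GB" and f: "f : GB" for b c e f
 proof -
  note m = td_Om[OF b] td_Om[OF c] td_Om[OF e] td_Om[OF f]
  have 1: "M2 (td b') (M3 (td c') (td e') (td f')) = M2 (M3 (td c') (td e') (td f')) (td b')" if "b' : GB" "c' : GB" "e' : GB" "f' : GB" for b' c' e' f'
   using M2_sym[OF td_Om[OF that(1)] M3_Om[OF td_Om[OF that(2)] td_Om[OF that(3)] td_Om[OF that(4)]]] by simp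
  have 2: "M3 (td b') (td c') (M2 (td e') (td f')) = M3 (M2 (td e') (td f')) (td b') (td c')" if "b' : GB" "c' : GB" "e' : GB" "f' : GB" for b' c' e' f'
   using M3_rot[OF M2_Om'[OF td_Om[OF that(3)] td_Om[OF that(4)]] td_Om[OF that(1)] td_Om[OF that(2)]] by (simp add: psign_def)
  show ?thesis using J4bbbb[OF b c e f] unfolding J4_def
   by (simp only: 1 2 b c e f psign_def) (simp add: fun_eq_iff algebra_simps)
 qed
 have g: "J4 p q r f g h k = 0" if f: "gen p f" and g: "gen q g" and h: "gen r h" and k: "gen t k" for p q r t f g h k
 proof (cases "p + q + r + t < 4")
  case True
  then show ?thesis using drD(1)[OF J4_dr[OF gen_Om[OF f] gen_Om[OF g] gen_Om[OF h]] gen_Om[OF k]] fb.Omega_neg[of "t + (p + q + r - 4)" L] by simp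
 next
  case False
  then have "p = 1" "q = 1" "r = 1" "t = 1" using gen_le[OF f] gen_le[OF g] gen_le[OF h] gen_le[OF k] by auto
  then show ?thesis using f g h k bbbb by (auto simp: gen_def)
 qed
 have rz: "J4 q r t v w x u = 0" if "J4 p q r u v w x = 0" "u : Om p" "v : Om q" "w : Om r" "x : Om t" for u v w x p q r t
  unfolding J4_rot[OF that(2,3,4,5)] that(1) by (rule scaleR_zero_right)
 have 1: "J4 p q r f g h x = 0" if "gen p f" "gen q g" "gen r h" "x : Om t" for p q r t f g h x
  by (rule dr_gen[OF J4_dr[OF that(1-3)[THEN gen_Om]] _ that(4)]) (rule g[OF that(1-3)])
 have 2: "J4 p q r f g w x = 0" if "gen p f" "gen q g" "w : Om r" "x : Om t" for p q r t f g w x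
  by (rule dr_gen[OF J4_dr[OF that(1)[THEN gen_Om] that(2)[THEN gen_Om] that(3)] _ that(4)])
    (rule rz[OF 1 gen_Om that(1)[THEN gen_Om] that(2)[THEN gen_Om] that(3)]; (assumption | rule that))
 have 3: "J4 p q r f v w x = 0" if "gen p f" "v : Om q" "w : Om r" "x : Om t" for p q r t f v w x
  by (rule dr_gen[OF J4_dr[OF that(1)[THEN gen_Om] that(2) that(3)] _ that(4)])
    (rule rz[OF 2 gen_Om that(1)[THEN gen_Om] that(2) that(3)]; (assumption | rule that))
 show ?thesis by (rule dr_gen[OF J4_dr[OF u v w] _ x]) (rule rz[OF 3 gen_Om u v w]; (assumption | rule u v w))
qed

text \<open>Five generators have total degree at most 5 and the expression lowers the degree by 6,
  so on generators there is nothing to compute.\<close>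

lemma J5_zero:
 assumes u: "u : Om p" and v: "v : Om q" and w: "w : Om r" and x: "x : Om t" and z: "z : Om l"
 shows "J5 p q r t u v w x z = 0"
proof -
 have g: "J5 p q r t f g h k m = 0" if f: "gen p f" and g: "gen q g" and h: "gen r h" and k: "gen t k" and m: "gen l m" for p q r t l f g h k m
  using drD(1)[OF J5_dr[OF gen_Om[OF f] gen_Om[OF g] gen_Om[OF h] gen_Om[OF k]] gen_Om[OF m]]
   fb.Omega_neg[of "l + (p + q + r + t - 6)" L] gen_le[OF f] gen_le[OF g] gen_le[OF h] gen_le[OF k] gen_le[OF m] by simp
 have rz: "J5 q r t l v w x z u = 0" if "J5 p q r t u v w x z = 0" "u : Om p" "v : Om q" "w : Om r" "x : Om t" "z : Om l" for u v w x z p q r t l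
  unfolding J5_rot[OF that(2,3,4,5,6)] that(1) by (rule scaleR_zero_right)
 have 1: "J5 p q r t f g h k z = 0" if "gen p f" "gen q g" "gen r h" "gen t k" "z : Om l" for p q r t l f g h k z
  by (rule dr_gen[OF J5_dr[OF that(1-4)[THEN gen_Om]] _ that(5)]) (rule g[OF that(1-4)])
 have 2: "J5 p q r t f g h x z = 0" if "gen p f" "gen q g" "gen r h" "x : Om t" "z : Om l" for p q r t l f g h x z
  by (rule dr_gen[OF J5_dr[OF that(1-3)[THEN gen_Om] that(4)] _ that(5)])
    (rule rz[OF 1 gen_Om that(1-3)[THEN gen_Om] that(4)]; (assumption | rule that))
 have 3: "J5 p q r t f g w x z = 0" if "gen p f" "gen q g" "w : Om r" "x : Om t" "z : Om l" for p q r t l f g w x z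
  by (rule dr_gen[OF J5_dr[OF that(1,2)[THEN gen_Om] that(3,4)] _ that(5)])
    (rule rz[OF 2 gen_Om that(1,2)[THEN gen_Om] that(3,4)]; (assumption | rule that))
 have 4: "J5 p q r t f v w x z = 0" if "gen p f" "v : Om q" "w : Om r" "x : Om t" "z : Om l" for p q r t l f v w x z
  by (rule dr_gen[OF J5_dr[OF that(1)[THEN gen_Om] that(2-4)] _ that(5)])
    (rule rz[OF 3 gen_Om that(1)[THEN gen_Om] that(2-4)]; (assumption | rule that))
 show ?thesis by (rule dr_gen[OF J5_dr[OF u v w x] _ z]) (rule rz[OF 4 gen_Om u v w x]; (assumption | rule u v w x))
qed

end

section \<open>Unshuffles as subsets and explicit Jacobi sums\<close>

definition ush_list :: "nat => nat set => nat list" where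
 "ush_list n S = sorted_list_of_set S @ sorted_list_of_set ({..<n} - S)"

lemma map_strict_mono_sorted:
 fixes \<sigma> :: "nat => nat"
 assumes "strict_mono_on {i..<n} \<sigma>"
 shows "map \<sigma> [i..<n] = sorted_list_of_set (\<sigma> ` {i..<n})"
proof (rule sorted_distinct_set_unique)
 show "sorted (map \<sigma> [i..<n])"
  unfolding sorted_iff_nth_mono using assms by (auto simp: strict_mono_on_leD)
 show "distinct (map \<sigma> [i..<n])" using strict_mono_on_imp_inj_on[OF assms] by (simp add: distinct_map)
qed simp_all

lemma unshuffle_list:
 assumes s: "\<sigma> : unshuffles i n" and i: "i <= n"
 shows "map \<sigma> [0..<n] = ush_list n (\<sigma> ` {..<i})" "\<sigma> ` {..<i} <= {..<n}" "card (\<sigma> ` {..<i}) = i"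
proof -
 have p: "\<sigma> permutes {..<n}" and m: "strict_mono_on {..<i} \<sigma>" "strict_mono_on {i..<n} \<sigma>" using s by (auto simp: unshuffles_def)
 note inj = permutes_inj[OF p]
 show "\<sigma> ` {..<i} <= {..<n}"
 proof (rule image_subsetI)
  fix a assume "a : {..<i}"
  then show "\<sigma> a : {..<n}" using i permutes_in_image[OF p, of a] by simp
 qed
 show "card (\<sigma> ` {..<i}) = i" using card_image[OF inj_on_subset[OF inj]] by simp
 have "\<sigma> ` {i..<n} = \<sigma> ` ({..<n} - {..<i})" by (rule arg_cong[of _ _ "image \<sigma>"]) (use i in auto)
 also have "\<dots> = {..<n} - \<sigma> ` {..<i}" unfolding image_set_diff[OF inj] permutes_image[OF p] ..
 finally have e: "\<sigma> ` {i..<n} = {..<n} - \<sigma> ` {..<i}" .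
 have "[0..<n] = [0..<i] @ [i..<n]" using upt_add_eq_append[of 0 i "n - i"] i by simp
 then show "map \<sigma> [0..<n] = ush_list n (\<sigma> ` {..<i})"
  unfolding ush_list_def e[symmetric] map_strict_mono_sorted[OF m(2), symmetric]
  using map_strict_mono_sorted[of 0 i \<sigma>] m(1) by (simp add: lessThan_atLeast0)
qed

lemma unshuffle_exists:
 assumes S: "S <= {..<n}" "card S = i"
 shows "\<exists>\<sigma>\<in>unshuffles i n. \<sigma> ` {..<i} = S"
proof -
 have fin: "finite S" "finite ({..<n} - S)" using finite_subset[OF S(1)] by auto
 let ?l = "ush_list n S"
 have len: "length ?l = n" using card_mono[OF _ S(1)] by (simp add: ush_list_def card_Diff_subset[OF fin(1) S(1)])
 have d: "distinct ?l" "set ?l = {..<n}" using fin S(1) by (auto simp: ush_list_def)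
 define \<sigma> where "\<sigma> p = (if p < n then ?l ! p else p)" for p
 have "bij_betw ((!) ?l) {..<n} {..<n}" by (rule bij_betw_nth[OF d(1)]) (simp_all only: len d(2))
 moreover have "bij_betw ((!) ?l) {..<n} {..<n} = bij_betw \<sigma> {..<n} {..<n}" by (rule bij_betw_cong) (simp add: \<sigma>_def)
 ultimately have "bij_betw \<sigma> {..<n} {..<n}" by (simp only:)
 then have p: "\<sigma> permutes {..<n}" by (rule bij_imp_permutes) (simp add: \<sigma>_def)
 have i: "i <= n" using card_mono[OF _ S(1)] S(2) by simp
 have sm: "sorted_list_of_set T ! a < sorted_list_of_set T ! b" if "a < b" "b < card T" for a b and T :: "nat set"
  using sorted_wrt_nth_less[OF strict_sorted_list_of_set, of a b T] that by simp
 have 1: "\<sigma> a = sorted_list_of_set S ! a" if "a < i" for a using that i S(2) by (simp add: \<sigma>_def ush_list_def nth_append)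
 have 2: "\<sigma> a = sorted_list_of_set ({..<n} - S) ! (a - i)" if "i <= a" "a < n" for a using that S(2) by (simp add: \<sigma>_def ush_list_def nth_append)
 have c: "card ({..<n} - S) = n - i" using S(2) by (simp add: card_Diff_subset[OF fin(1) S(1)])
 have "strict_mono_on {..<i} \<sigma>" by (rule strict_mono_onI) (simp add: 1 sm S(2))
 moreover have "strict_mono_on {i..<n} \<sigma>" by (rule strict_mono_onI) (simp add: 2 sm c)
 ultimately have u: "\<sigma> : unshuffles i n" using p by (simp add: unshuffles_def)
 have "\<sigma> ` {..<i} = (!) (sorted_list_of_set S) ` {..<i}" by (rule image_cong[OF refl]) (simp add: 1)
 also have "\<dots> = set (sorted_list_of_set S)" using S(2) by (auto simp: set_conv_nth)
 also have "\<dots> = S" using fin(1) by simp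
 finally show ?thesis using u by (rule bexI)
qed

text \<open>An unshuffle is determined by the image of its first block, and each subset of the right
  size occurs. Sums over subsets of an explicit set can be evaluated by splitting off one element at
  a time.\<close>

lemma sum_unshuffles:
 assumes i: "i <= n"
 shows "(\<Sum>\<sigma>\<in>unshuffles i n. F (map \<sigma> [0..<n])) = (\<Sum>S\<in>Pow {..<n}. if card S = i then F (ush_list n S) else 0)"
proof -
 have inj: "inj_on (%\<sigma>. \<sigma> ` {..<i}) (unshuffles i n)"
 proof (rule inj_onI)
  fix \<sigma> \<tau> assume s: "\<sigma> : unshuffles i n" "\<tau> : unshuffles i n" and e: "\<sigma> ` {..<i} = \<tau> ` {..<i}"
  have "map \<sigma> [0..<n] = map \<tau> [0..<n]" unfolding unshuffle_list(1)[OF s(1) i] unshuffle_list(1)[OF s(2) i] e ..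
  then have m: "\<sigma> a = \<tau> a" if "a < n" for a using that by (simp only: map_eq_conv) simp
  have p: "\<sigma> permutes {..<n}" "\<tau> permutes {..<n}" using s by (simp_all add: unshuffles_def)
  show "\<sigma> = \<tau>"
  proof
   fix a show "\<sigma> a = \<tau> a" using m permutes_not_in[OF p(1), of a] permutes_not_in[OF p(2), of a] by (cases "a < n") auto
  qed
 qed
 have im: "(%\<sigma>. \<sigma> ` {..<i}) ` unshuffles i n = {S : Pow {..<n}. card S = i}"
 proof (intro equalityI subsetI)
  show "S : {S : Pow {..<n}. card S = i}" if "S : (%\<sigma>. \<sigma> ` {..<i}) ` unshuffles i n" for S
   using that unshuffle_list(2,3)[OF _ i] by (elim imageE) simp
  show "S : (%\<sigma>. \<sigma> ` {..<i}) ` unshuffles i n" if "S : {S : Pow {..<n}. card S = i}" for S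
  proof -
   have "S <= {..<n}" "card S = i" using that by simp_all
   from unshuffle_exists[OF this] show ?thesis by (elim bexE) (rule rev_image_eqI, assumption, erule sym)
  qed
 qed
 have "(\<Sum>\<sigma>\<in>unshuffles i n. F (map \<sigma> [0..<n])) = (\<Sum>\<sigma>\<in>unshuffles i n. (%S. F (ush_list n S)) (\<sigma> ` {..<i}))"
  by (intro sum.cong refl) (simp add: unshuffle_list(1)[OF _ i])
 also have "\<dots> = (\<Sum>S\<in>{S : Pow {..<n}. card S = i}. F (ush_list n S))"
  unfolding im[symmetric] sum.reindex[OF inj] comp_def ..
 finally show ?thesis by (simp only: sum.inter_filter[OF finite_Pow_iff[THEN iffD2, OF finite_lessThan]])
qed

text \<open>The exponent of the Koszul sign in terms of the permuted list of positions;
  \<open>kos_Cons\<close> makes it computable by recursion.\<close>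

definition kos :: "int list => nat list => int" where
 "kos ds l = (\<Sum>p<length l. \<Sum>q<length l. if p < q & l ! q < l ! p then ds ! (l ! p) * ds ! (l ! q) else 0)"

lemma koszul_sign_list: "length ds = n ==> koszul_sign ds \<sigma> = psign (kos ds (map \<sigma> [0..<n]))"
proof -
 assume n: "length ds = n"
 have "(\<Sum>(p, q)\<in>{(p, q). p < q & q < length ds & \<sigma> q < \<sigma> p}. ds ! \<sigma> p * ds ! \<sigma> q)
  = (\<Sum>(p, q)\<in>{..<n} \<times> {..<n}. if p < q & \<sigma> q < \<sigma> p then ds ! \<sigma> p * ds ! \<sigma> q else 0)"
  by (rule sum.mono_neutral_cong_left) (auto simp: n split: if_splits)
 moreover have "kos ds (map \<sigma> [0..<n]) = (\<Sum>p<n. \<Sum>q<n. if p < q & \<sigma> q < \<sigma> p then ds ! \<sigma> p * ds ! \<sigma> q else 0)"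
  unfolding kos_def by (intro sum.cong) auto
 ultimately show ?thesis unfolding koszul_sign_def by (simp only: sum.cartesian_product)
qed

lemma kos_Nil: "kos ds [] = 0"
 by (simp add: kos_def)

lemma kos_Cons: "kos ds (a # l) = (\<Sum>b\<leftarrow>l. if b < a then ds ! a * ds ! b else 0) + kos ds l"
 unfolding kos_def by (simp only: length_Cons sum.lessThan_Suc_shift) (simp add: sum_list_sum_nth lessThan_atLeast0 cong: if_cong)

lemma sum_Pow_insert:
 assumes "finite T" "x \<notin> T"
 shows "(\<Sum>S\<in>Pow (insert x T). f S) = (\<Sum>S\<in>Pow T. f S) + (\<Sum>S\<in>Pow T. f (insert x S))"
proof -
 have inj: "inj_on (insert x) (Pow T)" using assms(2) by (auto simp: inj_on_def)
 have "Pow T \<inter> insert x ` Pow T = {}" using assms(2) by auto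
 then show ?thesis unfolding Pow_insert using assms(1) sum.reindex[OF inj, of f] by (simp add: sum.union_disjoint comp_def)
qed

text \<open>The \<open>i\<close>-th part of the \<open>n\<close>-th \<open>L\<^sub>\<infinity>\<close> relation as a sum over subsets.\<close>

definition jac :: "('v list => 'v::real_vector) => nat => int list => 'v list => nat => 'v" where
 "jac m n ds vs i = (\<Sum>S\<in>Pow {..<n}. if card S = i then psign (kos ds (ush_list n S)) *\<^sub>R
   m (m (map ((!) vs) (take i (ush_list n S))) # map ((!) vs) (drop i (ush_list n S))) else 0)"

lemma jac_unshuffles:
 assumes "length ds = length vs" "i <= length vs"
 shows "(\<Sum>\<sigma>\<in>unshuffles i (length vs). koszul_sign ds \<sigma> *\<^sub>R
       m (m (map (%p. vs ! \<sigma> p) [0..<i]) # map (%p. vs ! \<sigma> p) [i..<length vs])) = jac m (length vs) ds vs i"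
 unfolding jac_def sum_unshuffles[OF assms(2), of "%l. psign (kos ds l) *\<^sub>R m (m (map ((!) vs) (take i l)) # map ((!) vs) (drop i l))", symmetric]
 by (intro sum.cong refl) (use assms in \<open>simp add: koszul_sign_list take_map drop_map comp_def\<close>)

lemma lessThan_5: "{..<1::nat} = {0}" "{..<Suc 0} = {0}" "{..<2::nat} = {0, 1}" "{..<3::nat} = {0, 1, 2}" "{..<4::nat} = {0, 1, 2, 3}" "{..<5::nat} = {0, 1, 2, 3, 4}"
 by auto

lemmas kos_simps = kos_Nil kos_Cons ush_list_def lessThan_5 insert_Diff_if

lemma jac1: "jac m 1 [d] [u] 1 = m [m [u]]"
 unfolding jac_def lessThan_5 by (simp add: kos_simps sum_Pow_insert algebra_simps)

lemma jac2: "jac m 2 [d, e] [u, v] 1 = m [m [u], v] + psign (d * e) *\<^sub>R m [m [v], u]"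
  "jac m 2 [d, e] [u, v] 2 = m [m [u, v]]"
 unfolding jac_def lessThan_5 by (simp_all add: kos_simps sum_Pow_insert algebra_simps)

lemma jac3: "jac m 3 [d, e, f] [u, v, w] 1 = m [m [u], v, w] + psign (d * e) *\<^sub>R m [m [v], u, w] + psign (d * f + e * f) *\<^sub>R m [m [w], u, v]"
  "jac m 3 [d, e, f] [u, v, w] 2 = m [m [u, v], w] + psign (e * f) *\<^sub>R m [m [u, w], v] + psign (d * e + d * f) *\<^sub>R m [m [v, w], u]"
  "jac m 3 [d, e, f] [u, v, w] 3 = m [m [u, v, w]]"
 unfolding jac_def lessThan_5 by (simp_all add: kos_simps sum_Pow_insert algebra_simps)

text \<open>The parts with \<open>i = 1\<close> and \<open>i = 4\<close> are omitted: they involve a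
  bracket with four entries and vanish by \<open>jac_zero\<close>.\<close>

lemma jac4: "jac m 4 [d, e, f, g] [u, v, w, x] 2 = m [m [u, v], w, x] + psign (e * f) *\<^sub>R m [m [u, w], v, x] + psign (d * e + d * f) *\<^sub>R m [m [v, w], u, x]
   + psign (e * g + f * g) *\<^sub>R m [m [u, x], v, w] + psign (d * e + d * g + f * g) *\<^sub>R m [m [v, x], u, w] + psign (d * f + d * g + e * f + e * g) *\<^sub>R m [m [w, x], u, v]"
  "jac m 4 [d, e, f, g] [u, v, w, x] 3 = m [m [u, v, w], x] + psign (f * g) *\<^sub>R m [m [u, v, x], w] + psign (e * f + e * g) *\<^sub>R m [m [u, w, x], v]
   + psign (d * e + d * f + d * g) *\<^sub>R m [m [v, w, x], u]"
 unfolding jac_def lessThan_5 by (simp_all add: kos_simps sum_Pow_insert algebra_simps)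

lemma jac5: "jac m 5 [d, e, f, g, h] [u, v, w, x, z] 3 = m [m [u, v, w], x, z]
   + psign (f * g) *\<^sub>R m [m [u, v, x], w, z]
   + psign (f * h + g * h) *\<^sub>R m [m [u, v, z], w, x]
   + psign (e * f + e * g) *\<^sub>R m [m [u, w, x], v, z]
   + psign (e * f + e * h + g * h) *\<^sub>R m [m [u, w, z], v, x]
   + psign (e * g + e * h + f * g + f * h) *\<^sub>R m [m [u, x, z], v, w]
   + psign (d * e + d * f + d * g) *\<^sub>R m [m [v, w, x], u, z]
   + psign (d * e + d * f + d * h + g * h) *\<^sub>R m [m [v, w, z], u, x]
   + psign (d * e + d * g + d * h + f * g + f * h) *\<^sub>R m [m [v, x, z], u, w]
   + psign (d * f + d * g + d * h + e * f + e * g + e * h) *\<^sub>R m [m [w, x, z], u, v]"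
 unfolding jac_def lessThan_5 by (simp add: kos_simps sum_Pow_insert algebra_simps)

lemma ush_props: "S <= {..<n} ==> length (ush_list n S) = n & set (ush_list n S) = {..<n}"
proof -
 assume S: "S <= {..<n}"
 then have f: "finite S" by (rule finite_subset) simp
 have "card S <= n" using card_mono[OF _ S] by simp
 then show ?thesis using f S by (auto simp: ush_list_def card_Diff_subset[OF f S])
qed

lemma list4: "vs = [] | (\<exists>a. vs = [a]) | (\<exists>a b. vs = [a, b]) | (\<exists>a b c. vs = [a, b, c]) | length vs > 3"
 by (induction vs) auto

lemma psign_shift: "psign ((a + 2) * (b + 2)) = psign (a * b)"
 by (auto simp: psign_def)

lemma nths_compl:
 "nths (W # Zs) (- {0}) = Zs" "nths (W # Zs) (- {Suc j}) = W # nths Zs (- {j})"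
 "nths (W # Zs) (- {0, Suc j}) = nths Zs (- {j})" "nths (W # Zs) (- {Suc i, Suc j}) = W # nths Zs (- {i, j})"
proof -
 have "{a. Suc a : - {0}} = UNIV" "{a. Suc a : - {Suc j}} = - {j}" "{a. Suc a : - {0, Suc j}} = - {j}" "{a. Suc a : - {Suc i, Suc j}} = - {i, j}"
  by auto
 then show "nths (W # Zs) (- {0}) = Zs" "nths (W # Zs) (- {Suc j}) = W # nths Zs (- {j})"
  "nths (W # Zs) (- {0, Suc j}) = nths Zs (- {j})" "nths (W # Zs) (- {Suc i, Suc j}) = W # nths Zs (- {i, j})"
  unfolding nths_Cons by (simp_all add: nths_all)
qed

section \<open>The three brackets as one family and its structure\<close>

context dj
begin

definition "mm vs = (case vs of [a] => dL a | [a, b] => M2 a b | [a, b, c] => M3 a b c | _ => 0)"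

lemma mm_simps: "mm [] = 0" "mm [a] = dL a" "mm [a, b] = M2 a b" "mm [a, b, c] = M3 a b c"
 by (simp_all add: mm_def)

lemma mm_long: "length vs > 3 ==> mm vs = 0"
 unfolding mm_def by (auto split: list.split)

abbreviation "V \<equiv> %k::int. Om (k + 2)"

lemma Om_eq: "al : Om k ==> k = k' ==> al : Om k'"
 by simp

lemma drL:
 assumes "dr d X" "v : Om k" "w : Om k"
 shows "X (c *\<^sub>R v + w) = c *\<^sub>R X v + X w"
 unfolding drD(2)[OF assms(1) fb.Omega_scale[OF vbL assms(2)] assms(3)] drD(3)[OF assms(1,2)] ..

lemma Om_lin: "v : Om k ==> w : Om k ==> c *\<^sub>R v + w : Om k"
 by (intro fb.Omega_add[OF vbL] fb.Omega_scale[OF vbL])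

lemma M2_lin_left:
 assumes "v : Om k" "w : Om k" "be : Om q"
 shows "M2 (c *\<^sub>R v + w) be = c *\<^sub>R M2 v be + M2 w be"
 unfolding M2_sym[OF Om_lin[OF assms(1,2)] assms(3)] M2_sym[OF assms(1,3)] M2_sym[OF assms(2,3)] drL[OF M2_dr[OF assms(3)] assms(1,2)]
 by (simp only: scaleR_add_right scaleR_left_commute[of c])

lemma M3_lin_mid:
 assumes "v : Om k" "w : Om k" "be : Om q" "ga : Om r"
 shows "M3 be (c *\<^sub>R v + w) ga = c *\<^sub>R M3 be v ga + M3 be w ga"
 unfolding M3_sym(2)[OF assms(3) Om_lin[OF assms(1,2)] assms(4)] M3_sym(2)[OF assms(3,1,4)] M3_sym(2)[OF assms(3,2,4)]
  drL[OF M3_dr[OF assms(3,4)] assms(1,2)]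
 by (simp only: scaleR_add_right scaleR_left_commute[of c])

lemma M3_lin_left:
 assumes "v : Om k" "w : Om k" "be : Om q" "ga : Om r"
 shows "M3 (c *\<^sub>R v + w) be ga = c *\<^sub>R M3 v be ga + M3 w be ga"
 unfolding M3_sym(1)[OF Om_lin[OF assms(1,2)] assms(3,4)] M3_sym(1)[OF assms(1,3,4)] M3_sym(1)[OF assms(2,3,4)] M3_lin_mid[OF assms]
 by (simp only: scaleR_add_right scaleR_left_commute[of c])

lemma hom_simps: "homogeneous V ds [] \<longleftrightarrow> ds = []"
 "homogeneous V ds (v # vs) \<longleftrightarrow> (\<exists>d ds'. ds = d # ds' & v : Om (d + 2) & homogeneous V ds' vs)"
 by (simp_all add: homogeneous_def list_all2_Cons2)

lemma hom_length: "homogeneous V ds vs ==> length ds = length vs"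
 unfolding homogeneous_def by (rule list_all2_lengthD)

lemma hom_set: "homogeneous V ds vs ==> v : set vs ==> \<exists>k. v : Om k"
 by (induction vs arbitrary: ds) (auto simp: hom_simps)

text \<open>An inner bracket with more than three entries is 0, and the outer bracket must then
  vanish too. Symmetry carries the zero to the last entry, where linearity is known.\<close>

lemma mm_zero_head:
 assumes "!!v. v : set r ==> \<exists>k. v : Om k"
 shows "mm (0 # r) = 0"
proof -
 have z: "0 : Om 0" by (rule fb.Omega_zero[OF vbL])
 consider "r = []" | b where "r = [b]" | b c where "r = [b, c]" | "length r > 2" using list4[of r] by force
 then show ?thesis
 proof cases
  case 1 show ?thesis unfolding 1 mm_simps by (rule drD(5)[OF dL_dr])
 next
  case (2 b)
  obtain k where b: "b : Om k" using assms[of b] 2 by auto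
  show ?thesis unfolding 2 mm_simps M2_sym[OF z b] drD(5)[OF M2_dr[OF b]] by (rule scaleR_zero_right)
 next
  case (3 b c)
  obtain k k' where b: "b : Om k" "c : Om k'" using assms[of b] assms[of c] 3 by auto
  show ?thesis using M3_rot[OF z b] drD(5)[OF M3_dr[OF b]] unfolding 3 mm_simps by (simp only: mult_zero_left psign_simps scaleR_one)
 next
  case 4 show ?thesis by (rule mm_long) (use 4 in simp)
 qed
qed

text \<open>Either the inner bracket has \<open>i > 3\<close> entries, or the outer one has
  \<open>length vs - i + 1 > 3\<close>.\<close>

lemma jac_zero:
 assumes h: "homogeneous V ds vs" and i: "i <= length vs" and c: "i > 3 | length vs - i > 2"
 shows "jac mm (length vs) ds vs i = 0"
 unfolding jac_def
proof (rule sum.neutral, rule ballI)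
 fix S assume "S : Pow {..<length vs}"
 then have l: "length (ush_list (length vs) S) = length vs" "set (ush_list (length vs) S) = {..<length vs}" using ush_props by auto
 let ?l = "ush_list (length vs) S"
 have "mm (mm (map ((!) vs) (take i ?l)) # map ((!) vs) (drop i ?l)) = 0"
 proof (cases "i > 3")
  case True
  have "mm (map ((!) vs) (take i ?l)) = 0" by (rule mm_long) (use True i l in simp)
  moreover have "mm (0 # map ((!) vs) (drop i ?l)) = 0"
  proof (rule mm_zero_head)
   fix v assume "v : set (map ((!) vs) (drop i ?l))"
   then obtain p where p: "v = vs ! p" "p : set (drop i ?l)" by auto
   then have "p : set ?l" using set_drop_subset by fast
   then have "v : set vs" using l(2) p(1) by simp
   then show "\<exists>k. v : Om k" by (rule hom_set[OF h])
  qed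
  ultimately show ?thesis by (simp only:)
 next
  case False
  show ?thesis by (rule mm_long) (use False c l in simp)
 qed
 then show "(if card S = i then psign (kos ds ?l) *\<^sub>R mm (mm (map ((!) vs) (take i ?l)) # map ((!) vs) (drop i ?l)) else 0) = 0"
  by simp
qed

text \<open>The unshuffle sum keeps the inner bracket in front, whereas \<open>J2\<close> keeps the
  last argument last. Symmetry translates between the two, and the shift of degrees by 2 leaves all
  parities alone.\<close>

lemma id2:
 assumes u: "u : Om (d + 2)" and v: "v : Om (e + 2)"
 shows "M2 (dL u) v + psign (d * e) *\<^sub>R M2 (dL v) u + dL (M2 u v) = 0"
proof -
 have 1: "M2 u (dL v) = psign ((d + 2) * (e + 2 + 1)) *\<^sub>R M2 (dL v) u" by (rule M2_sym[OF u dL_Om[OF v]])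
 have "M2 (dL u) v + psign (d * e) *\<^sub>R M2 (dL v) u + dL (M2 u v) = J2 (d + 2) u v" unfolding J2_def 1
  by (intro ext; cases "even d"; cases "even e"; simp add: psign_def)
 then show ?thesis unfolding J2_zero[OF u v] .
qed

lemma id3:
 assumes u: "u : Om (d + 2)" and v: "v : Om (e + 2)" and w: "w : Om (f + 2)"
 shows "(M3 (dL u) v w + psign (d * e) *\<^sub>R M3 (dL v) u w + psign (d * f + e * f) *\<^sub>R M3 (dL w) u v)
  + (M2 (M2 u v) w + psign (e * f) *\<^sub>R M2 (M2 u w) v + psign (d * e + d * f) *\<^sub>R M2 (M2 v w) u) + dL (M3 u v w) = 0"
 (is "?l = 0")
proof -
 note 1 = M3_rot[OF dL_Om[OF w] u v] and 2 = M2_sym[OF u M2_Om'[OF v w]] and 3 = M2_sym[OF v M2_Om'[OF u w]]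
 have "?l = J3 (d + 2) (e + 2) u v w" unfolding J3_def 1 2 3
  by (intro ext; cases "even d"; cases "even e"; cases "even f"; simp add: psign_def)
 then show ?thesis unfolding J3_zero[OF u v w] .
qed

lemma id4:
 assumes u: "u : Om (d + 2)" and v: "v : Om (e + 2)" and w: "w : Om (f + 2)" and x: "x : Om (g + 2)"
 shows "jac mm 4 [d, e, f, g] [u, v, w, x] 2 + jac mm 4 [d, e, f, g] [u, v, w, x] 3 = 0"
proof -
 note r = M2_sym[OF u M3_Om[OF v w x]] M2_sym[OF v M3_Om[OF u w x]] M2_sym[OF w M3_Om[OF u v x]]
  M3_rot[OF M2_Om'[OF u x] v w] M3_rot[OF M2_Om'[OF v x] u w] M3_rot[OF M2_Om'[OF w x] u v]
 have "jac mm 4 [d, e, f, g] [u, v, w, x] 2 + jac mm 4 [d, e, f, g] [u, v, w, x] 3 = J4 (d + 2) (e + 2) (f + 2) u v w x"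
  unfolding jac4 mm_simps J4_def r
  by (intro ext; cases "even d"; cases "even e"; cases "even f"; cases "even g"; simp add: psign_def)
 then show ?thesis unfolding J4_zero[OF u v w x] .
qed

lemma id5:
 assumes u: "u : Om (d + 2)" and v: "v : Om (e + 2)" and w: "w : Om (f + 2)" and x: "x : Om (g + 2)" and z: "z : Om (h + 2)"
 shows "jac mm 5 [d, e, f, g, h] [u, v, w, x, z] 3 = 0"
proof -
 note r = M3_rot[OF M3_Om[OF w x z] u v] M3_rot[OF M3_Om[OF u v z] w x] M3_rot[OF M3_Om[OF v x z] u w]
  M3_rot[OF M3_Om[OF u w z] v x] M3_rot[OF M3_Om[OF v w z] u x] M3_rot[OF M3_Om[OF u x z] v w]
 have "jac mm 5 [d, e, f, g, h] [u, v, w, x, z] 3 = J5 (d + 2) (e + 2) (f + 2) (g + 2) u v w x z"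
  unfolding jac5 mm_simps J5_def r
  by (intro ext; cases "even d"; cases "even e"; cases "even f"; cases "even g"; cases "even h"; simp add: psign_def)
 then show ?thesis unfolding J5_zero[OF u v w x z] .
qed

lemma jacobi:
 assumes h: "homogeneous V ds vs"
 shows "(\<Sum>i = 1..length vs. jac mm (length vs) ds vs i) = 0"
proof -
 note z = jac_zero[OF h]
 consider "length vs = 0" | "length vs = 1" | "length vs = 2" | "length vs = 3" | "length vs = 4" | "length vs = 5" | "length vs > 5" by linarith
 then show ?thesis
 proof cases
  case 2
  then obtain u where vs: "vs = [u]" by (auto simp: length_Suc_conv)
  obtain d where ds: "ds = [d]" "u : Om (d + 2)" using h unfolding vs hom_simps by blast
  show ?thesis unfolding vs ds(1) using jac1[of mm d u] dL_dL[OF ds(2)] by (simp add: mm_simps)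
 next
  case 3
  then obtain u v where vs: "vs = [u, v]" by (auto simp: length_Suc_conv numeral_2_eq_2)
  obtain d e where ds: "ds = [d, e]" "u : Om (d + 2)" "v : Om (e + 2)" using h unfolding vs hom_simps by blast
  have i: "(\<Sum>i = 1..2::nat. F i) = F 1 + F 2" for F :: "nat => 'm => 'e list => 'l" by (simp add: numeral_2_eq_2)
  show ?thesis unfolding 3 i unfolding vs ds(1) jac2 mm_simps by (rule id2[OF ds(2,3)])
 next
  case 4
  then obtain u v w where vs: "vs = [u, v, w]" by (auto simp: length_Suc_conv numeral_3_eq_3)
  obtain d e f where ds: "ds = [d, e, f]" "u : Om (d + 2)" "v : Om (e + 2)" "w : Om (f + 2)" using h unfolding vs hom_simps by blast
  have i: "(\<Sum>i = 1..3::nat. F i) = F 1 + F 2 + F 3" for F :: "nat => 'm => 'e list => 'l" by (simp add: numeral_3_eq_3 numeral_2_eq_2)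
  show ?thesis unfolding 4 i unfolding vs ds(1) jac3 mm_simps by (rule id3[OF ds(2,3,4)])
 next
  case 5
  then obtain u v w x where vs: "vs = [u, v, w, x]" by (auto simp: length_Suc_conv eval_nat_numeral)
  obtain d e f g where ds: "ds = [d, e, f, g]" "u : Om (d + 2)" "v : Om (e + 2)" "w : Om (f + 2)" "x : Om (g + 2)" using h unfolding vs hom_simps by blast
  have i: "(\<Sum>i = 1..4::nat. F i) = F 1 + (F 2 + F 3) + F 4" for F :: "nat => 'm => 'e list => 'l" by (simp add: eval_nat_numeral add.assoc)
  have j: "jac mm 4 ds vs 1 = 0" "jac mm 4 ds vs 4 = 0" using z[of 1] z[of 4] unfolding 5 by simp_all
  show ?thesis unfolding 5 i j unfolding vs ds(1) id4[OF ds(2,3,4,5)] by simp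
 next
  case 6
  then obtain u v w x y where vs: "vs = [u, v, w, x, y]" by (auto simp: length_Suc_conv eval_nat_numeral)
  obtain d e f g k where ds: "ds = [d, e, f, g, k]" "u : Om (d + 2)" "v : Om (e + 2)" "w : Om (f + 2)" "x : Om (g + 2)" "y : Om (k + 2)"
   using h unfolding vs hom_simps by blast
  have i: "(\<Sum>i = 1..5::nat. F i) = F 1 + F 2 + F 3 + F 4 + F 5" for F :: "nat => 'm => 'e list => 'l" by (simp add: eval_nat_numeral add.assoc)
  have j: "jac mm 5 ds vs 1 = 0" "jac mm 5 ds vs 2 = 0" "jac mm 5 ds vs 4 = 0" "jac mm 5 ds vs 5 = 0" using z[of 1] z[of 2] z[of 4] z[of 5] unfolding 6 by simp_all
  show ?thesis unfolding 6 i j unfolding vs ds(1) id5[OF ds(2-6)] by simp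
 next
  \<comment> \<open>Non-zero parts need \<open>i \<le> 3\<close> and at most two remaining entries,
    which bounds the number of arguments by 5.\<close>
  case 7
  show ?thesis by (rule sum.neutral, rule ballI, rule z) (use 7 in auto)
 qed simp
qed

lemma L_infinity_mm: "L_infinity_1 V mm"
 unfolding L_infinity_1_def
proof (intro conjI allI impI; (elim conjE)?)
 show "subspace (Om (k + 2))" for k by (rule fb.subspace_Omega[OF vbL])
 show "mm vs : Om (sum_list ds + 1 + 2)" if ne: "vs ~= []" and h: "homogeneous V ds vs" for ds vs
 proof -
  from list4[of vs] ne consider a where "vs = [a]" | a b where "vs = [a, b]" | a b c where "vs = [a, b, c]" | "length vs > 3" by blast
  then show ?thesis
  proof cases
   case (1 a)
   obtain d where d: "ds = [d]" "a : Om (d + 2)" using h unfolding 1 hom_simps by blast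
   show ?thesis unfolding 1 d(1) mm_simps by (rule Om_eq[OF dL_Om[OF d(2)]]) simp
  next
   case (2 a b)
   obtain d e where d: "ds = [d, e]" "a : Om (d + 2)" "b : Om (e + 2)" using h unfolding 2 hom_simps by blast
   show ?thesis unfolding 2 d(1) mm_simps by (rule Om_eq[OF M2_Om'[OF d(2,3)]]) simp
  next
   case (3 a b c)
   obtain d e f where d: "ds = [d, e, f]" "a : Om (d + 2)" "b : Om (e + 2)" "c : Om (f + 2)" using h unfolding 3 hom_simps by blast
   show ?thesis unfolding 3 d(1) mm_simps by (rule Om_eq[OF M3_Om[OF d(2,3,4)]]) simp
  next
   case 4 show ?thesis unfolding mm_long[OF 4] by (rule fb.Omega_zero[OF vbL])
  qed
 qed
 show "mm (xs @ (c *\<^sub>R v + w) # ys) = c *\<^sub>R mm (xs @ v # ys) + mm (xs @ w # ys)"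
  if h: "homogeneous V ds (xs @ v # ys)" "homogeneous V ds (xs @ w # ys)" for ds xs v w ys c
 proof (cases "length xs + length ys > 2")
  case True
  then have "mm (xs @ u # ys) = 0" for u by (intro mm_long) simp
  then show ?thesis by (simp only: scaleR_zero_right add_0_left)
 next
  case False
  then consider "xs = []" "ys = []" | a where "xs = []" "ys = [a]" | a b where "xs = []" "ys = [a, b]"
   | a where "xs = [a]" "ys = []" | a b where "xs = [a]" "ys = [b]" | a b where "xs = [a, b]" "ys = []"
   using list4[of xs] list4[of ys] by force
  then show ?thesis
  proof cases
   case 1
   from h obtain d where "v : Om (d + 2)" "w : Om (d + 2)" unfolding 1 append_Nil hom_simps by blast
   from drL[OF dL_dr this] show ?thesis unfolding 1 append_Nil mm_simps .
  next
   case (2 a)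
   from h obtain d e where "v : Om (d + 2)" "w : Om (d + 2)" "a : Om (e + 2)" unfolding 2 append_Nil hom_simps by blast
   from M2_lin_left[OF this] show ?thesis unfolding 2 append_Nil mm_simps .
  next
   case (3 a b)
   from h obtain d e f where "v : Om (d + 2)" "w : Om (d + 2)" "a : Om (e + 2)" "b : Om (f + 2)" unfolding 3 append_Nil hom_simps by blast
   from M3_lin_left[OF this] show ?thesis unfolding 3 append_Nil mm_simps .
  next
   case (4 a)
   from h obtain d e where d: "v : Om (d + 2)" "w : Om (d + 2)" "a : Om (e + 2)" unfolding 4 append_Nil append_Cons hom_simps by blast
   from drL[OF M2_dr[OF d(3)] d(1,2)] show ?thesis unfolding 4 append_Nil append_Cons mm_simps .
  next
   case (5 a b)
   from h obtain d e f where d: "v : Om (d + 2)" "w : Om (d + 2)" "a : Om (e + 2)" "b : Om (f + 2)" unfolding 5 append_Nil append_Cons hom_simps by blast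
   from M3_lin_mid[OF d] show ?thesis unfolding 5 append_Nil append_Cons mm_simps .
  next
   case (6 a b)
   from h obtain d e f where d: "v : Om (d + 2)" "w : Om (d + 2)" "a : Om (e + 2)" "b : Om (f + 2)" unfolding 6 append_Nil append_Cons hom_simps by blast
   from drL[OF M3_dr[OF d(3,4)] d(1,2)] show ?thesis unfolding 6 append_Nil append_Cons mm_simps .
  qed
 qed
 show "mm (xs @ v # w # ys) = psign (ds ! length xs * ds ! Suc (length xs)) *\<^sub>R mm (xs @ w # v # ys)"
  if h: "homogeneous V ds (xs @ v # w # ys)" for ds xs v w ys
 proof (cases "length xs + length ys > 1")
  case True
  then have "mm (xs @ u # u' # ys) = 0" for u u' by (intro mm_long) simp
  then show ?thesis by (simp only: scaleR_zero_right)
 next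
  case False
  then consider "xs = []" "ys = []" | a where "xs = []" "ys = [a]" | a where "xs = [a]" "ys = []"
   using list4[of xs] list4[of ys] by force
  then show ?thesis
  proof cases
   case 1
   from h obtain d e where d: "ds = [d, e]" "v : Om (d + 2)" "w : Om (e + 2)" unfolding 1 append_Nil hom_simps by blast
   show ?thesis unfolding 1 d(1) append_Nil mm_simps using M2_sym[OF d(2,3)] by (simp only: psign_shift list.size nth_Cons_0 nth_Cons_Suc)
  next
   case (2 a)
   from h obtain d e f where d: "ds = [d, e, f]" "v : Om (d + 2)" "w : Om (e + 2)" "a : Om (f + 2)" unfolding 2 append_Nil hom_simps by blast
   show ?thesis unfolding 2 d(1) append_Nil mm_simps using M3_sym(1)[OF d(2,3,4)] by (simp only: psign_shift list.size nth_Cons_0 nth_Cons_Suc)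
  next
   case (3 a)
   from h obtain d e f where d: "ds = [f, d, e]" "a : Om (f + 2)" "v : Om (d + 2)" "w : Om (e + 2)" unfolding 3 append_Nil append_Cons hom_simps by blast
   show ?thesis unfolding 3 d(1) append_Nil append_Cons mm_simps using M3_sym(2)[OF d(2,3,4)]
    by (simp only: psign_shift list.size nth_Cons_0 nth_Cons_Suc add_0_right add_Suc_right)
  qed
 qed
 show "(\<Sum>i = 1..length vs. \<Sum>\<sigma>\<in>unshuffles i (length vs). koszul_sign ds \<sigma> *\<^sub>R
       mm (mm (map (%p. vs ! \<sigma> p) [0..<i]) # map (%p. vs ! \<sigma> p) [i..<length vs])) = 0"
  if h: "homogeneous V ds vs" for ds vs
  by (rule trans[OF sum.cong[OF refl] jacobi[OF h]], rule jac_unshuffles[OF hom_length[OF h]]) simp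
qed

lemma LR_infinity_mm: "LR_infinity_1 Om0 wedge V wedge mm"
 unfolding LR_infinity_1_def
proof (intro conjI allI impI L_infinity_mm)
 fix ds vs assume h: "homogeneous V ds vs"
 have "dr (sum_list ds + 1) (%v. mm (vs @ [v]))"
 proof -
  consider "vs = []" | a where "vs = [a]" | a b where "vs = [a, b]" | "length vs > 2" using list4[of vs] by force
  then show ?thesis
  proof cases
   case 1
   then show ?thesis using h dL_dr by (simp add: hom_simps mm_simps)
  next
   case (2 a)
   obtain d where d: "ds = [d]" "a : Om (d + 2)" using h unfolding 2 hom_simps by blast
   show ?thesis unfolding 2 d(1) append_Cons append_Nil mm_simps by (rule dr_deg[OF M2_dr[OF d(2)]]) simp
  next
   case (3 a b)
   obtain d e where d: "ds = [d, e]" "a : Om (d + 2)" "b : Om (e + 2)" using h unfolding 3 hom_simps by blast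
   show ?thesis unfolding 3 d(1) append_Cons append_Nil mm_simps by (rule dr_deg[OF M3_dr[OF d(2,3)]]) simp
  next
   case 4
   then have z: "mm (vs @ [v]) = 0" for v by (intro mm_long) simp
   show ?thesis unfolding z by (rule dr_zero)
  qed
 qed
 then show "module_derivation Om0 wedge V wedge (sum_list ds + 1) (%v. mm (vs @ [v]))"
  by (elim exE) (rule der_module_derivation)
qed

section \<open>Comparison with the de Rham differential, the Gerstenhaber--Jacobi bracket and
  involutivity\<close>

lemma ev_swap:
 assumes "al : Om k" "Z : GA" "W : GA"
 shows "ev al (Z # W # r) = - ev al (W # Z # r)"
 unfolding ev_Cons fb.iota_iota(1)[OF vbL assms(1,3,2)] ev_uminus ..

text \<open>The commutator of Lie derivative and contraction, iterated along the list. Moving the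
  bracketed entry back to the front past its predecessors accounts for the alternating
  signs.\<close>

lemma ev_Lop:
 assumes "Z : GA" "al : Om k" "set Zs <= GA"
 shows "ev (Lop Z al) Zs x = nab Z (ev al Zs) x - (\<Sum>j<length Zs. (- 1) ^ j *\<^sub>R ev al (br Z (Zs ! j) # nths Zs (- {j})) x)"
 using assms(2,3)
proof (induction Zs arbitrary: al k)
 case Nil
 show ?case unfolding fb.ev_Lie[OF vbL K_lie(1)[OF GA_GE[OF assms(1)]] Nil(1,2)] by simp
next
 case (Cons W Zs)
 then have W: "W : GA" and Zs: "set Zs <= GA" by auto
 have s: "ev (iota W al) (br Z (Zs ! j) # nths Zs (- {j})) x = - ev al (br Z (Zs ! j) # W # nths Zs (- {j})) x" if "j < length Zs" for j
  unfolding ev_Cons[of al W, symmetric] ev_swap[OF Cons(2) W br_GA[OF assms(1) subsetD[OF Zs nth_mem[OF that]]]] by simp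
 show ?case
  unfolding ev_Cons[of "Lop Z al"] iota_Lop[OF GA_GE[OF assms(1)] Cons(2) W] K_A[OF assms(1) W] ev_diff minus_apply
   Cons.IH[OF fb.iota_Omega[OF Cons(2) W] Zs] ev_Cons[of al W] length_Cons sum.lessThan_Suc_shift nth_Cons_0 nth_Cons_Suc nths_compl
  by (simp add: s sum_negf ev_Cons[of al "br Z W"])
qed

text \<open>Cartan's recursion unrolled: the Lie derivative along the head yields the summands in
  which the head takes part, and the differential of the contracted form yields the others, its
  minus sign matching the shift of indices.\<close>

lemma ev_dL:
 assumes "al : Om k" "set Xs <= GA"
 shows "ev (dL al) Xs x = (\<Sum>i<length Xs. (- 1) ^ i *\<^sub>R nab (Xs ! i) (ev al (nths Xs (- {i}))) x)
  + (\<Sum>j<length Xs. \<Sum>i<j. (- 1) ^ (i + j) *\<^sub>R ev al (br (Xs ! i) (Xs ! j) # nths Xs (- {i, j})) x)"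
 using assms
proof (induction Xs arbitrary: al k)
 case Nil
 show ?case unfolding fb.ev_dd[OF vbL rep(1) Nil] by simp
next
 case (Cons Z Zs)
 then have Z: "Z : GA" and Zs: "set Zs <= GA" by auto
 have s: "ev (iota Z al) (br (Zs ! i) (Zs ! j) # r) x = - ev al (br (Zs ! i) (Zs ! j) # Z # r) x" if "j < length Zs" "i < j" for i j r
 proof -
  have b: "br (Zs ! i) (Zs ! j) : GA" using that by (intro br_GA subsetD[OF Zs nth_mem]) simp_all
  show ?thesis unfolding ev_Cons[of al Z, symmetric] ev_swap[OF Cons(2) Z b] by simp
 qed
 show ?case
  unfolding ev_Cons[of "dL al"] iota_dL[OF Cons(2) Z] ev_diff minus_apply ev_Lop[OF Z Cons(2) Zs] Cons.IH[OF fb.iota_Omega[OF Cons(2) Z] Zs]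
   length_Cons sum.lessThan_Suc_shift nth_Cons_0 nth_Cons_Suc nths_compl
  by (simp add: s sum_negf sum.distrib sum_subtractf ev_Cons[of al Z])
qed

lemma dAL_eq:
 assumes a: "al : Om (int k)"
 shows "dAL M A L br (nabla C) k al = dL al"
 unfolding dAL_def
proof (rule the_equality)
 have sw: "(\<Sum>j<Suc k. \<Sum>i<j. F i j) = (\<Sum>(i, j)\<in>{(i, j). i < j & j <= k}. F i j)" for F :: "nat => nat => 'l"
  unfolding sum.Sigma[OF finite_lessThan ballI[OF finite_lessThan]]
  by (rule sum.reindex_bij_witness[of _ "%(i, j). (j, i)" "%(i, j). (j, i)"]) auto
 have f: "dL al x (map (%X. X x) Xs) =
     (\<Sum>i\<le>k. (- 1) ^ i *\<^sub>R nabla C x ((Xs ! i) x) (%y. al y (map (%X. X y) (nths Xs (- {i}))))) +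
     (\<Sum>(i, j)\<in>{(i, j). i < j & j <= k}. (- 1) ^ (i + j) *\<^sub>R
       al x (br (Xs ! i) (Xs ! j) x # map (%X. X x) (nths Xs (- {i, j}))))" if "length Xs = Suc k" "set Xs <= GA" for Xs x
  using ev_dL[OF a that(2), of x] unfolding that(1) sw unfolding lessThan_Suc_atMost by (simp add: ev_def nab_def)
 then show "dL al : Om (int k + 1) & (\<forall>Xs x. length Xs = Suc k & set Xs <= GA --> dL al x (map (%X. X x) Xs) =
     (\<Sum>i\<le>k. (- 1) ^ i *\<^sub>R nabla C x ((Xs ! i) x) (%y. al y (map (%X. X y) (nths Xs (- {i}))))) +
     (\<Sum>(i, j)\<in>{(i, j). i < j & j <= k}. (- 1) ^ (i + j) *\<^sub>R
       al x (br (Xs ! i) (Xs ! j) x # map (%X. X x) (nths Xs (- {i, j})))))"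
  using dL_Om[OF a] by blast
 fix \<eta> assume \<eta>: "\<eta> : Om (int k + 1) & (\<forall>Xs x. length Xs = Suc k & set Xs <= GA --> \<eta> x (map (%X. X x) Xs) =
     (\<Sum>i\<le>k. (- 1) ^ i *\<^sub>R nabla C x ((Xs ! i) x) (%y. al y (map (%X. X y) (nths Xs (- {i}))))) +
     (\<Sum>(i, j)\<in>{(i, j). i < j & j <= k}. (- 1) ^ (i + j) *\<^sub>R
       al x (br (Xs ! i) (Xs ! j) x # map (%X. X x) (nths Xs (- {i, j})))))"
 show "\<eta> = dL al"
 proof (rule fb.form_eqI[OF conjunct1[OF \<eta>] dL_Om[OF a]])
  fix ss assume ss: "set ss <= GA" "int (length ss) = int k + 1"
  then have l: "length ss = Suc k" by linarith
  show "ev \<eta> ss = ev (dL al) ss"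
   by (rule ext) (simp only: ev_def f[OF l ss(1)] conjunct2[OF \<eta>, rule_format, OF conjI[OF l ss(1)]])
 qed
qed

text \<open>As for \<open>M3\<close>, the sign comes from \<open>sg\<close> and needs no degree. The
  value 0 off homogeneous forms agrees with the normalisation that makes \<open>GJ_bracket\<close> a
  unique function.\<close>

definition "GJ al be = (if (\<exists>a. al : Om a) & (\<exists>b. be : Om b) then M2 (sg al) be else 0)"

lemma GJ_M2: "al : Om a ==> be : Om b ==> GJ al be = psign a *\<^sub>R M2 al be"
proof -
 assume a: "al : Om a" and b: "be : Om b"
 then have "GJ al be = M2 (sg al) be" unfolding GJ_def by (intro if_P conjI exI)
 then show ?thesis unfolding fb.sg_Omega[OF a] M2_left(1)[OF a b] .
qed

lemma GJ_axioms: "GJ_bracket_axioms M A L (dual_bracket C A B) (dual_nabla C A B) GJ"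
 unfolding GJ_bracket_axioms_def
proof (intro conjI allI ballI)
 fix a b al be assume a: "al : Om a" and b: "be : Om b"
 show "GJ al be : Om (a + b - 1)" unfolding GJ_M2[OF a b] by (rule fb.Omega_scale[OF vbL M2_Om'[OF a b]])
 have "psign a * psign (a * b) = - (psign ((a - 1) * (b - 1)) * psign b)" by (auto simp: psign_def)
 then show "GJ al be = - (psign ((a - 1) * (b - 1)) *\<^sub>R GJ be al)"
  unfolding GJ_M2[OF a b] GJ_M2[OF b a] M2_sym[OF a b] by (simp only: scaleR_scaleR scaleR_minus_left)
next
 fix a al assume a: "al : Om a"
 have "dr (a - 1) (GJ al)" by (rule dr_cong[OF dr_smult[OF M2_dr[OF a], of "psign a"]]) (rule GJ_M2[OF a])
 then show "module_derivation Om0 wedge (%k. Om (k + 1)) wedge (a - 1) (GJ al)"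
  by (elim exE) (rule der_module_derivation)
next
 fix al be assume a: "al : Om 1" and b: "be : Om 1"
 note oa = ofd_props[OF a] and ob = ofd_props[OF b]
 have "M2 al be = - dual_bracket C A B al be"
  using M2_bb[OF oa(1) ob(1)] unfolding oa(2) ob(2) unfolding dual_bracket_def td_def prB_def ofd_def .
 then show "GJ al be = dual_bracket C A B al be" unfolding GJ_M2[OF a b] by (simp only: psign_simps scaleR_minus_left scaleR_one minus_minus)
next
 fix al s assume a: "al : Om 1" and s: "s : GL"
 note oa = ofd_props[OF a]
 have "M2 al (form0 s) = - form0 (dual_nabla C A B al s)"
  using M2_bs[OF oa(1) s] unfolding oa(2) unfolding dual_nabla_def nab_def ofd_def .
 then show "GJ al (form0 s) = form0 (dual_nabla C A B al s)"
  unfolding GJ_M2[OF a form0_Om[OF s]] by (simp only: psign_simps scaleR_minus_left scaleR_one minus_minus)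
qed

text \<open>The derivation property is given in the second entry, and skew-symmetry transports it to
  the first. Two sections of \<open>L\<close> need no prescription, since their bracket has form
  degree -1.\<close>

lemma GJ_unique:
 assumes G: "GJ_bracket_axioms M A L (dual_bracket C A B) (dual_nabla C A B) G" and a: "al : Om a" and b: "be : Om b"
 shows "G al be = GJ al be"
proof -
 let ?ax = "%G. GJ_bracket_axioms M A L (dual_bracket C A B) (dual_nabla C A B) G"
 have d: "dr (a - 1) (G al)" if "?ax G" "al : Om a" for G al a
  using that unfolding GJ_bracket_axioms_def by (elim conjE) (blast elim: module_derivation_der)
 have s: "G al be = - (psign ((a - 1) * (b - 1)) *\<^sub>R G be al)" if "?ax G" "al : Om a" "be : Om b" for G al be a b
  using that unfolding GJ_bracket_axioms_def by (elim conjE) blast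
 have ss: "G (form0 t) (form0 s) = 0" if "?ax G" "s : GL" "t : GL" for G s t
  using drD(1)[OF d[OF that(1) form0_Om[OF that(3)]] form0_Om[OF that(2)]] fb.Omega_neg[of "0 + (0 - 1)" L] by simp
 have bs: "G al (form0 s) = form0 (dual_nabla C A B al s)" if "?ax G" "al : Om 1" "s : GL" for G al s
  using that unfolding GJ_bracket_axioms_def by (elim conjE) blast
 have bb: "G al be = dual_bracket C A B al be" if "?ax G" "al : Om 1" "be : Om 1" for G al be
  using that unfolding GJ_bracket_axioms_def by (elim conjE) blast
 note H = GJ_axioms
 have 1: "G (form0 t) be = GJ (form0 t) be" if t: "t : GL" and b: "be : Om b" for t be b
 proof (rule dr_eqI[OF d[OF G form0_Om[OF t]] d[OF H form0_Om[OF t]] _ _ b])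
  show "G (form0 t) (form0 s) = GJ (form0 t) (form0 s)" if "s : GL" for s unfolding ss[OF G that t] ss[OF H that t] ..
  show "G (form0 t) (td c) = GJ (form0 t) (td c)" if "c : GB" for c
   unfolding s[OF G form0_Om[OF t] td_Om[OF that]] s[OF H form0_Om[OF t] td_Om[OF that]] bs[OF G td_Om[OF that] t] bs[OF H td_Om[OF that] t] ..
 qed
 have 2: "G (td c) be = GJ (td c) be" if c: "c : GB" and b: "be : Om b" for c be b
  by (rule dr_eqI[OF d[OF G td_Om[OF c]] d[OF H td_Om[OF c]] _ _ b])
    (simp_all only: bs[OF G td_Om[OF c]] bs[OF H td_Om[OF c]] bb[OF G td_Om[OF c] td_Om] bb[OF H td_Om[OF c] td_Om])
 show ?thesis
 proof (rule dr_eqI[OF d[OF G a] d[OF H a] _ _ b])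
  show "G al (form0 t) = GJ al (form0 t)" if "t : GL" for t
   unfolding s[OF G a form0_Om[OF that]] s[OF H a form0_Om[OF that]] 1[OF that a] ..
  show "G al (td c) = GJ al (td c)" if "c : GB" for c
   unfolding s[OF G a td_Om[OF that]] s[OF H a td_Om[OF that]] 2[OF that a] ..
 qed
qed

lemma GJ_bracket_eq: "GJ_bracket M A L (dual_bracket C A B) (dual_nabla C A B) = GJ"
 unfolding GJ_bracket_def
proof (rule the_equality)
 show "GJ_bracket_axioms M A L (dual_bracket C A B) (dual_nabla C A B) GJ &
   (\<forall>al be. al \<notin> (\<Union>a. Om a) | be \<notin> (\<Union>b. Om b) --> GJ al be = 0)"
  using GJ_axioms by (auto simp: GJ_def)
 fix G assume G: "GJ_bracket_axioms M A L (dual_bracket C A B) (dual_nabla C A B) G &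
   (\<forall>al be. al \<notin> (\<Union>a. Om a) | be \<notin> (\<Union>b. Om b) --> G al be = 0)"
 show "G = GJ"
 proof (rule ext, rule ext)
  fix al be
  show "G al be = GJ al be"
  proof (cases "(\<exists>a. al : Om a) & (\<exists>b. be : Om b)")
   case True
   then obtain a b where "al : Om a" "be : Om b" by blast
   then show ?thesis by (rule GJ_unique[OF conjunct1[OF G]])
  next
   case False
   then have "G al be = 0" using conjunct2[OF G] by blast
   then show ?thesis unfolding GJ_def if_not_P[OF False] .
  qed
 qed
qed

lemma M3_zero_iff: "(\<forall>a b c. \<forall>al\<in>Om a. \<forall>be\<in>Om b. \<forall>ga\<in>Om c. M3 al be ga = 0) \<longleftrightarrow> involutive M C B"
proof
 assume z: "\<forall>a b c. \<forall>al\<in>Om a. \<forall>be\<in>Om b. \<forall>ga\<in>Om c. M3 al be ga = 0"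
 show "involutive M C B" unfolding involutive_def
 proof (intro ballI)
  fix b c assume b: "b : GB" and c: "c : GB"
  note bc = br_sections[OF GB_GE[OF b] GB_GE[OF c]]
  \<comment> \<open>Vanishing of the ternary bracket on three sections of \<open>B\<close> says that
    the bracket of two of them is orthogonal to \<open>B\<close>, and \<open>B\<close> is its own
    orthogonal.\<close>
  show "br b c : GB"
  proof (rule GE_in_GB[OF bc])
   fix x
   have "pairing C x (br b c x) v = 0" if v: "v : fib B x" for v
   proof -
    interpret fB: fbun M B by unfold_locales (rule vbB)
    obtain e where e: "e : GB" "e x = v" using fB.fib_section[OF v] by blast
    have "M3 (td b) (td c) (td e) = 0" by (rule z[rule_format, OF td_Om[OF b] td_Om[OF c] td_Om[OF e(1)]])
    then have "form0 (yps b c e) x ([] :: 'e list) = 0" unfolding M3_td[OF b c e(1)] by simp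
    then show ?thesis by (simp add: form0_def yps_def spair_def e(2))
   qed
   then show "br b c x : fib B x" unfolding perpB[of "br b c x"] using GE_fib[OF bc] by blast
  qed
 qed
next
 assume i: "involutive M C B"
 have y: "M3 (td b) (td c) (td e) = 0" if "b : GB" "c : GB" "e : GB" for b c e
 proof -
  have "br b c : GB" using i that unfolding involutive_def by blast
  then have "yps b c e = 0" unfolding yps_def by (rule spBB[OF _ that(3)])
  then show ?thesis unfolding M3_td[OF that] by (simp add: fb.form0_zero)
 qed
 \<comment> \<open>Conversely \<open>M3\<close> vanishes on all generators, and its entries are
   freed one at a time by the derivation property and symmetry.\<close>
 have s0: "M3 al be (form0 s) = 0" if "al : Om p" "be : Om q" "s : GL" for al be s p q by (rule M3_form0[OF that])
 have 1: "M3 (td b) (td c) ga = 0" if "b : GB" "c : GB" "ga : Om r" for b c ga r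
  by (rule dr_eqI[OF M3_dr[OF td_Om[OF that(1)] td_Om[OF that(2)]] dr_zero _ _ that(3)])
    (simp_all only: s0[OF td_Om[OF that(1)] td_Om[OF that(2)]] y[OF that(1,2)])
 have 2: "M3 (td b) be ga = 0" if b: "b : GB" and be: "be : Om q" and ga: "ga : Om r" for b be ga q r
 proof (rule dr_eqI[OF M3_dr[OF td_Om[OF b] be] dr_zero _ _ ga])
  show "M3 (td b) be (form0 s) = 0" if "s : GL" for s by (rule s0[OF td_Om[OF b] be that])
  show "M3 (td b) be (td c) = 0" if "c : GB" for c unfolding M3_sym(2)[OF td_Om[OF b] be td_Om[OF that]] 1[OF b that be] by (rule scaleR_zero_right)
 qed
 have "M3 al be ga = 0" if al: "al : Om p" and be: "be : Om q" and ga: "ga : Om r" for al be ga p q r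
 proof (rule dr_eqI[OF M3_dr[OF al be] dr_zero _ _ ga])
  show "M3 al be (form0 s) = 0" if "s : GL" for s by (rule s0[OF al be that])
  show "M3 al be (td c) = 0" if "c : GB" for c unfolding M3_rot[OF td_Om[OF that] al be] 2[OF that al be] by (rule scaleR_zero_right)
 qed
 then show "\<forall>a b c. \<forall>al\<in>Om a. \<forall>be\<in>Om b. \<forall>ga\<in>Om c. M3 al be ga = 0" by blast
qed

lemma dgL1a_iff: "dgL1a V mm \<longleftrightarrow> (\<forall>a b c. \<forall>al\<in>Om a. \<forall>be\<in>Om b. \<forall>ga\<in>Om c. M3 al be ga = 0)"
proof
 assume d: "dgL1a V mm"
 show "\<forall>a b c. \<forall>al\<in>Om a. \<forall>be\<in>Om b. \<forall>ga\<in>Om c. M3 al be ga = 0"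
 proof (intro allI ballI)
  fix a b c al be ga assume "al : Om a" "be : Om b" "ga : Om c"
  then have "homogeneous V [a - 2, b - 2, c - 2] [al, be, ga]" by (simp add: homogeneous_def)
  moreover have "length [al, be, ga] > 2" by simp
  ultimately have "mm [al, be, ga] = 0" using conjunct2[OF d[unfolded dgL1a_def], rule_format, OF conjI] by blast
  then show "M3 al be ga = 0" unfolding mm_simps .
 qed
next
 assume z: "\<forall>a b c. \<forall>al\<in>Om a. \<forall>be\<in>Om b. \<forall>ga\<in>Om c. M3 al be ga = 0"
 show "dgL1a V mm" unfolding dgL1a_def
 proof (intro conjI L_infinity_mm allI impI; elim conjE)
  fix ds vs assume h: "homogeneous V ds vs" and l: "length vs > 2"
  show "mm vs = 0"
  proof (cases "length vs > 3")
   case True then show ?thesis by (rule mm_long)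
  next
   case False
   then obtain a b c where vs: "vs = [a, b, c]" using list4[of vs] l by auto
   obtain d e f where "a : Om (d + 2)" "b : Om (e + 2)" "c : Om (f + 2)" using h unfolding vs hom_simps by blast
   then show ?thesis unfolding vs mm_simps using z by blast
  qed
 qed
qed

end

theorem mainTheorem2:
  fixes M :: "('m::{t2_space,second_countable_topology}, 'b::euclidean_space) manifold"
    and C :: "('m, 'e::real_vector, 'l::real_vector) cj_data"
    and A B :: "('m, 'e) vbundle"
  defines "L \<equiv> lin C"
    and "V \<equiv> (\<lambda>k. Omega M A (lin C) (k + 2))"
  assumes "smooth_manifold M"
    and "courant_jacobi M C"
    and "dirac_jacobi M C A"
    and "almost_dirac_jacobi M C B"
    and "complementary (bdl C) A B"
  shows "\<exists>m.
    LR_infinity_1 (Omega_fun M A) wedge V wedge m \<and>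
    (\<forall>ds vs. homogeneous V ds vs \<and> length vs > 3 \<longrightarrow> m vs = 0) \<and>
    (\<forall>k. \<forall>\<alpha>\<in>Omega M A L (int k). m [\<alpha>] = dAL M A L (bracket C) (nabla C) k \<alpha>) \<and>
    (\<forall>a b. \<forall>\<alpha>\<in>Omega M A L a. \<forall>\<beta>\<in>Omega M A L b.
       m [\<alpha>, \<beta>] = psign a *\<^sub>R GJ_bracket M A L (dual_bracket C A B) (dual_nabla C A B) \<alpha> \<beta>) \<and>
    (\<forall>a b c. \<forall>\<alpha>\<in>Omega M A L a. \<forall>\<beta>\<in>Omega M A L b. \<forall>\<gamma>\<in>Omega M A L c.
       m [\<alpha>, \<beta>, \<gamma>] = - (psign b *\<^sub>R sharp_apply M A L \<alpha> \<beta> \<gamma> (Upsilon C A B))) \<and>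
    (dgL1a V m \<longleftrightarrow> involutive M C B) \<and>
    ((\<forall>a b c. \<forall>\<alpha>\<in>Omega M A L a. \<forall>\<beta>\<in>Omega M A L b. \<forall>\<gamma>\<in>Omega M A L c. m [\<alpha>, \<beta>, \<gamma>] = 0)
       \<longleftrightarrow> involutive M C B)"
proof -
 interpret dj M C A B
  by unfold_locales (use assms(3-) in \<open>simp_all add: dirac_jacobi_def\<close>)
 show ?thesis unfolding L_def V_def
 proof (intro exI[of _ mm] conjI)
  show "LR_infinity_1 (Omega_fun M A) wedge (%k. Omega M A (lin C) (k + 2)) wedge mm" by (rule LR_infinity_mm)
  show "\<forall>ds vs. homogeneous (%k. Omega M A (lin C) (k + 2)) ds vs & length vs > 3 --> mm vs = 0" using mm_long by blast
  show "\<forall>k. \<forall>al\<in>Omega M A (lin C) (int k). mm [al] = dAL M A (lin C) (bracket C) (nabla C) k al"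
   unfolding mm_simps by (intro allI ballI dAL_eq[symmetric])
  \<comment> \<open>\<open>GJ\<close> differs from the binary bracket by a sign whose square is 1,
    so the sign may be moved to the other side.\<close>
  show "\<forall>a b. \<forall>al\<in>Omega M A (lin C) a. \<forall>be\<in>Omega M A (lin C) b.
    mm [al, be] = psign a *\<^sub>R GJ_bracket M A (lin C) (dual_bracket C A B) (dual_nabla C A B) al be"
   unfolding mm_simps GJ_bracket_eq by (intro allI ballI) (simp only: GJ_M2 psign_scale_scale)
  show "\<forall>a b c. \<forall>al\<in>Omega M A (lin C) a. \<forall>be\<in>Omega M A (lin C) b. \<forall>ga\<in>Omega M A (lin C) c.
    mm [al, be, ga] = - (psign b *\<^sub>R sharp_apply M A (lin C) al be ga (Upsilon C A B))"
   unfolding mm_simps by (intro allI ballI M3_sharp)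
  show "dgL1a (%k. Omega M A (lin C) (k + 2)) mm \<longleftrightarrow> involutive M C B" unfolding dgL1a_iff by (rule M3_zero_iff)
  show "(\<forall>a b c. \<forall>al\<in>Omega M A (lin C) a. \<forall>be\<in>Omega M A (lin C) b. \<forall>ga\<in>Omega M A (lin C) c. mm [al, be, ga] = 0)
    \<longleftrightarrow> involutive M C B" unfolding mm_simps by (rule M3_zero_iff)
 qed
qed

end
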